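(* Under the assumptions of the context, let $K:S^m\times S^m\to\mathbb{R}$ be a continuous, symmetric, positive definite kernel which is $(\mu_t,B,\rho)$-Hölder for some $\rho\in(0,2]$ and nonnegative $B\in L^\infty(S^m)$. Let $\mathcal{H}(K)$ be the reproducing kernel Hilbert space of $K$ and $S$ its unit sphere, regarded as a subset of $L^2(S^m)$. Then $$d_n(S;L^2(S^m))=O\big((n+1)^{-1/2-\rho/(2m)}\big),\qquad n\to\infty.$$
   Context: Let $m\ge 2$, $S^m$ the unit sphere of $\mathbb{R}^{m+1}$, $\sigma_m$ its surface measure, $\omega_m=\sigma_m(S^m)$, $L^p(S^m)=L^p(S^m,\sigma_m)$. Fix a pole $\xi\in S^m$; $\mathcal{M}_\xi(S^m)$ is the space of finite regular signed Borel measures on $S^m$ invariant under rotations fixing $\xi$, normed by $|\mu|=|\mu|(S^m)/\omega_m$. For $x\in S^m$ let $\mathcal{O}_x$ be a rotation with $\mathcal{O}_x(x)=\xi$, and $(f*\mu)(x)=\frac{1}{\omega_m}\int_{S^m}f(y)\,d(\mu\circ\mathcal{O}_x)(y)$. $P_k^{\lambda}$ is the Gegenbauer polynomial of degree $k$ and index $\lambda$ normalized by $P_k^\lambda(1)=1$; the multiplier of $\mu$ is $\mu^k=\frac{1}{\omega_m}\int_{S^m}P_k^{(m-1)/2}(\xi\cdot y)\,d\mu(y)$. Standing assumptions: $\{\mu_t:t\in(0,\pi)\}\subset\mathcal{M}_\xi(S^m)$ is uniformly bounded; for each $t$ its multiplier is $\mu_t^k=c_{k,m}(v_m(t))^{-1}P^\beta_{\alpha(k)}(\cos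 t)(\sin t)^\gamma$ with nonzero reals $c_{k,m}$, $\alpha:\mathbb{Z}_+\to\mathbb{Z}_+$ strictly increasing, $\gamma>0$, $2\beta$ an integer $\ge\gamma$; the normalizing function $v_m:(0,\pi)\to(0,\infty)$ (either $v_m\equiv1$, or the $\sigma_m$-measure of the support of the density of $\mu_t$ when $\mu_t$ is given by an isotropic kernel) satisfies $v_m(t)\asymp t^{c(m)}$ on $(0,\pi)$ for some constant $c(m)$; and for each positive integer $l$ there is $q=q(l,m)>0$ with $ln\le\alpha(qn)$ for all $n\ge1$. A kernel $K$ is $(\mu_t,B,\rho)$-Hölder if $|(K(x,\cdot)*\mu_t)(y)-K(x,y)|\le B(x)t^\rho$ for all $t\in(0,\pi)$, $x,y\in S^m$. The Kolmogorov $n$-width of a subset $A$ of a Hilbert space $H$ is $d_n(A;H)=\inf_{V_n}\sup_{f\in A}\inf_{g\in V_n}\|f-g\|_H$, the first infimum over all $n$-dimensional subspaces $V_n\subset H$. *)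

theory Defs
  imports "HOL-Analysis.Analysis" "HOL-Library.Landau_Symbols"
begin

(* ---------- The sphere S^m in R^(m+1), points are real^'n with CARD('n) = m+1 ---------- *)

abbreviation Sph :: "(real^'n::finite) set" where
  "Sph \<equiv> sphere 0 1"

text \<open>Surface measure sigma_m via the cone construction:
  sigma_m(A) = (m+1) * Lebesgue measure of {r x : 0 < r <= 1, x in A}.
  Realised as (m+1) times the push-forward of Lebesgue measure on the punctured unit
  ball under radial projection x / |x|.\<close>
definition surf :: "(real^'n::finite) measure" where
  "surf = scale_measure (ennreal (real CARD('n)))
     (distr (restrict_space lborel (cball 0 1 - {0})) borel (\<lambda>x. (1 / norm x) *\<^sub>R x))"

definition omega :: "'n::finite itself \<Rightarrow> real" where
  "omega _ = measure (surf :: (real^'n::finite) measure) Sph"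

definition rotation :: "(real^'n::finite \<Rightarrow> real^'n) \<Rightarrow> bool" where
  "rotation R \<longleftrightarrow> orthogonal_transformation R \<and> det (matrix R) = 1"

definition Orot :: "real^'n::finite \<Rightarrow> real^'n \<Rightarrow> (real^'n \<Rightarrow> real^'n)" where
  "Orot xi x = (SOME R. rotation R \<and> R x = xi)"

text \<open>A finite signed Borel measure on the sphere is represented by its Jordan
  decomposition (P, N): two finite Borel measures concentrated on the sphere that are
  mutually singular. (On the compact metric space S^m every finite Borel measure is regular.)\<close>
type_synonym 'n smeasure = "(real^'n::finite) measure \<times> (real^'n) measure"

definition signed_meas :: "'n::finite smeasure \<Rightarrow> bool" where
  "signed_meas mu \<longleftrightarrow>
     sets (fst mu) = sets (borel :: (real^'n::finite) measure) \<and> sets (snd mu) = sets (borel :: (real^'n) measure) \<and>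
     finite_measure (fst mu) \<and> finite_measure (snd mu) \<and>
     emeasure (fst mu) (- Sph) = 0 \<and> emeasure (snd mu) (- Sph) = 0 \<and>
     (\<exists>A\<in>sets (borel :: (real^'n::finite) measure). emeasure (fst mu) A = 0 \<and> emeasure (snd mu) (- A) = 0)"

definition sval :: "'n::finite smeasure \<Rightarrow> (real^'n::finite) set \<Rightarrow> real" where
  "sval mu A = measure (fst mu) A - measure (snd mu) A"

definition sint :: "'n::finite smeasure \<Rightarrow> (real^'n \<Rightarrow> real) \<Rightarrow> real" where
  "sint mu f = integral\<^sup>L (fst mu) f - integral\<^sup>L (snd mu) f"

text \<open>Total variation |mu|(S^m) (= P(S^m) + N(S^m) for the Jordan decomposition),
  and the norm |mu| = |mu|(S^m) / omega_m.\<close>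
definition snorm :: "'n::finite smeasure \<Rightarrow> real" where
  "snorm mu = (measure (fst mu) Sph + measure (snd mu) Sph) / omega TYPE('n)"

definition Mxi :: "real^'n::finite \<Rightarrow> 'n smeasure set" where
  "Mxi xi = {mu. signed_meas mu \<and>
     (\<forall>R. rotation R \<and> R xi = xi \<longrightarrow>
        (\<forall>A\<in>sets (borel :: (real^'n::finite) measure). sval mu (R ` A) = sval mu A))}"

text \<open>(f * mu)(x) = (1/omega_m) int f d(mu o O_x); since (mu o O_x)(A) = mu(O_x(A)) is the
  push-forward of mu under O_x^{-1}, this equals (1/omega_m) int f(O_x^{-1} z) dmu(z).\<close>
definition sconv :: "real^'n::finite \<Rightarrow> (real^'n \<Rightarrow> real) \<Rightarrow> 'n smeasure \<Rightarrow> real^'n \<Rightarrow> real" where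
  "sconv xi f mu x = (1 / omega TYPE('n)) * sint mu (\<lambda>z. f (inv (Orot xi x) z))"

fun gegenC :: "real \<Rightarrow> nat \<Rightarrow> real \<Rightarrow> real" where
  "gegenC lam 0 x = 1"
| "gegenC lam (Suc 0) x = 2 * lam * x"
| "gegenC lam (Suc (Suc k)) x =
     (2 * (real k + 1 + lam) * x * gegenC lam (Suc k) x - (real k + 2 * lam) * gegenC lam k x)
     / (real k + 2)"

text \<open>Normalised so that P_k^lam(1) = 1 (lam > 0).\<close>
definition gegenP :: "real \<Rightarrow> nat \<Rightarrow> real \<Rightarrow> real" where
  "gegenP lam k x = gegenC lam k x / gegenC lam k 1"

text \<open>Multiplier mu^k = (1/omega_m) int P_k^{(m-1)/2}(xi . y) dmu(y), with m = CARD('n) - 1.\<close>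
definition multiplier :: "real^'n::finite \<Rightarrow> 'n smeasure \<Rightarrow> nat \<Rightarrow> real" where
  "multiplier xi mu k = (1 / omega TYPE('n)) *
     sint mu (\<lambda>y. gegenP ((real CARD('n) - 2) / 2) k (xi \<bullet> y))"

definition pos_def_kernel :: "'a set \<Rightarrow> ('a \<Rightarrow> 'a \<Rightarrow> real) \<Rightarrow> bool" where
  "pos_def_kernel D K \<longleftrightarrow>
     (\<forall>N (p :: nat \<Rightarrow> 'a) (c :: nat \<Rightarrow> real). (\<forall>i<N. p i \<in> D) \<longrightarrow>
        0 \<le> (\<Sum>i<N. \<Sum>j<N. c i * c j * K (p i) (p j)))"

definition kspan_rep :: "'a set \<Rightarrow> ('a \<Rightarrow> 'a \<Rightarrow> real) \<Rightarrow> ('a \<Rightarrow> real) \<Rightarrow> nat \<Rightarrow> (nat \<Rightarrow> real) \<Rightarrow> (nat \<Rightarrow> 'a) \<Rightarrow> bool" where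
  "kspan_rep D K g N a p \<longleftrightarrow> (\<forall>i<N. p i \<in> D) \<and>
     g = (\<lambda>z. if z \<in> D then (\<Sum>i<N. a i * K (p i) z) else 0)"

definition kspan :: "'a set \<Rightarrow> ('a \<Rightarrow> 'a \<Rightarrow> real) \<Rightarrow> ('a \<Rightarrow> real) set" where
  "kspan D K = {g. \<exists>N a p. kspan_rep D K g N a p}"

text \<open>Pre-Hilbert norm: |sum a_i K(x_i,.)|^2 = sum_ij a_i a_j K(x_i,x_j) (independent of the
  representation for a symmetric positive definite kernel).\<close>
definition knorm :: "'a set \<Rightarrow> ('a \<Rightarrow> 'a \<Rightarrow> real) \<Rightarrow> ('a \<Rightarrow> real) \<Rightarrow> real" where
  "knorm D K g = sqrt (SOME v. \<exists>N a p. kspan_rep D K g N a p \<and>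
                          v = (\<Sum>i<N. \<Sum>j<N. a i * a j * K (p i) (p j)))"

definition kapprox :: "'a set \<Rightarrow> ('a \<Rightarrow> 'a \<Rightarrow> real) \<Rightarrow> (nat \<Rightarrow> 'a \<Rightarrow> real) \<Rightarrow> ('a \<Rightarrow> real) \<Rightarrow> bool" where
  "kapprox D K g f \<longleftrightarrow> (\<forall>n. g n \<in> kspan D K) \<and>
     (\<forall>e>0. \<exists>M. \<forall>p\<ge>M. \<forall>q\<ge>M. knorm D K (\<lambda>z. g p z - g q z) < e) \<and>
     (\<forall>z\<in>D. (\<lambda>n. g n z) \<longlonglongrightarrow> f z)"

definition rkhs :: "'a set \<Rightarrow> ('a \<Rightarrow> 'a \<Rightarrow> real) \<Rightarrow> ('a \<Rightarrow> real) set" where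
  "rkhs D K = {f. (\<forall>z. z \<notin> D \<longrightarrow> f z = 0) \<and> (\<exists>g. kapprox D K g f)}"

definition rkhs_norm :: "'a set \<Rightarrow> ('a \<Rightarrow> 'a \<Rightarrow> real) \<Rightarrow> ('a \<Rightarrow> real) \<Rightarrow> real" where
  "rkhs_norm D K f = (SOME r. \<exists>g. kapprox D K g f \<and> (\<lambda>n. knorm D K (g n)) \<longlonglongrightarrow> r)"

definition rkhs_unit_sphere :: "'a set \<Rightarrow> ('a \<Rightarrow> 'a \<Rightarrow> real) \<Rightarrow> ('a \<Rightarrow> real) set" where
  "rkhs_unit_sphere D K = {f \<in> rkhs D K. rkhs_norm D K f = 1}"

definition L2 :: "'a measure \<Rightarrow> ('a \<Rightarrow> real) \<Rightarrow> bool" where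
  "L2 M f \<longleftrightarrow> f \<in> borel_measurable M \<and> integrable M (\<lambda>x. (f x)\<^sup>2)"

definition L2norm :: "'a measure \<Rightarrow> ('a \<Rightarrow> real) \<Rightarrow> real" where
  "L2norm M f = sqrt (integral\<^sup>L M (\<lambda>x. (f x)\<^sup>2))"

text \<open>n-dimensional subspaces of L^2(M): spans of n elements of L^2 that are linearly
  independent in L^2 (i.e. modulo null functions).\<close>
definition L2_basis :: "'a measure \<Rightarrow> nat \<Rightarrow> (nat \<Rightarrow> 'a \<Rightarrow> real) set" where
  "L2_basis M n = {g. (\<forall>i<n. L2 M (g i)) \<and>
      (\<forall>c. (AE x in M. (\<Sum>i<n. c i * g i x) = 0) \<longrightarrow> (\<forall>i<n. c i = 0))}"

definition kolmogorov_width :: "'a measure \<Rightarrow> ('a \<Rightarrow> real) set \<Rightarrow> nat \<Rightarrow> ereal" where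
  "kolmogorov_width M A n =
     (INF g \<in> L2_basis M n. SUP f \<in> A. INF c \<in> (UNIV :: (nat \<Rightarrow> real) set).
         ereal (L2norm M (\<lambda>x. f x - (\<Sum>i<n. c i * g i x))))"

end

theory Submission
  imports Defs
begin

text \<open>Let \<open>T\<close> be the integral operator of \<open>K\<close> and \<open>\<tau>\<^sub>k\<close> the integral of \<open>K\<close> against the
  zonal kernel \<open>C\<^sub>k(x \<sqdot> y)\<close>, a nonnegative multiple of the trace of \<open>T\<close> on degree \<open>k\<close>. Pairing
  the Hoelder estimate with \<open>J\<^sub>N * J\<^sub>N = \<Sum> b\<^sub>k C\<^sub>k\<close>, where \<open>J\<^sub>N\<close> is the normalised kernel
  \<open>(1 + x \<sqdot> y)\<^sup>N\<close>, gives \<open>\<Sum> b\<^sub>k (1 - \<mu>\<^sub>t\<^sup>k) \<tau>\<^sub>k = O(t\<^sup>\<rho>)\<close> uniformly in \<open>N\<close>. On the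
  degrees with \<open>\<tau>\<^sub>k \<noteq> 0\<close> the multiplier equals the Gegenbauer value \<open>P(cos t)\<close> up to a
  factor \<open>1 + O(t\<^sup>\<rho>)\<close>, and \<open>1 - P(cos t)\<close> is nonnegative and bounded below once the degree
  exceeds a multiple of \<open>1 / t\<close>; hence \<open>\<Sum>\<^sub>k\<^sub>\<ge>\<^sub>n b\<^sub>k \<tau>\<^sub>k = O(n\<^sup>-\<^sup>\<rho>)\<close>, and so the trace of
  \<open>T\<close> on the complement of the polynomials of degree below \<open>n\<close> is \<open>O(n\<^sup>-\<^sup>\<rho>)\<close>. These polynomials
  span a space of dimension \<open>d = O(n\<^sup>m)\<close>, and adjoining at most \<open>d\<close> functions of large energy
  leaves a complement on which \<open>T\<close> is bounded by \<open>O(n\<^sup>-\<^sup>\<rho> / d)\<close>. The reproducing kernel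
  inequality \<open>\<langle>f, h\<rangle>\<^sup>2 \<le> \<langle>T h, h\<rangle>\<close> turns this into the bound for the width.\<close>

subsection \<open>Gegenbauer polynomials\<close>

text \<open>The Hoelder condition bounds \<open>K x * \<mu>\<^sub>t - K x\<close> in the sup norm,
  so it can be paired only with functions of controlled \<open>L\<^sup>1\<close> norm, while a tail
  estimate wants nonnegative weights. Squaring under convolution supplies both:
  \<open>J\<^sub>N * J\<^sub>N\<close> is nonnegative with integral one, and its Gegenbauer
  coefficients are squares times positive constants, whatever the signs in the expansion of
  \<open>J\<^sub>N\<close>. These weights depend on \<open>N\<close>; they leave the final estimate
  because the energy \<open>QF\<close> of a smoothed function tends to the energy of the function
  itself. The energies of orthonormal families act as eigenvalues: a trace bound for all such
  families limits how often a large energy can be split off. Spaces of harmonics appear only through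
  the zonal polynomials \<open>C\<^sub>k(x \<sqdot> y)\<close>, whose convolution identity follows
  from a triangularity and symmetry argument. The tail may start at \<open>k = n\<close> although
  the multipliers involve the degree \<open>alpha k\<close>, because a strictly increasing sequence
  of naturals satisfies \<open>k \<le> alpha k\<close>.\<close>

lemma gegenC_rec:
  "(real k + 2) * gegenC l (Suc (Suc k)) x =
     2 * (real k + 1 + l) * x * gegenC l (Suc k) x - (real k + 2 * l) * gegenC l k x"
  by simp

declare gegenC.simps(3) [simp del]

text \<open>At \<open>x = 1\<close> the three-term recurrence collapses, by induction, to two terms.
  Iterated, it gives the value \<open>2l (2l+1) ... (2l+k-1) / k!\<close>, positive for
  \<open>l > 0\<close>.\<close>

lemma gegenC_one_rec: "(real k + 1) * gegenC l (Suc k) 1 = (real k + 2 * l) * gegenC l k 1"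
proof (induction k)
  case (Suc k)
  have "(real k + 2) * gegenC l (Suc (Suc k)) 1 =
      2 * (real k + 1 + l) * gegenC l (Suc k) 1 - (real k + 1) * gegenC l (Suc k) 1"
    using gegenC_rec[of k l 1] Suc by simp
  also have "\<dots> = (real (Suc k) + 2 * l) * gegenC l (Suc k) 1"
    by (simp add: algebra_simps)
  finally show ?case by (simp add: algebra_simps)
qed simp

lemma gegenC_one_pos:
  assumes "l > 0"
  shows "gegenC l k 1 > 0"
proof (induction k)
  case (Suc k)
  have "(real k + 1) * gegenC l (Suc k) 1 > 0"
    unfolding gegenC_one_rec using Suc assms by (intro mult_pos_pos) auto
  then show ?case by (simp add: zero_less_mult_iff)
qed simp

text \<open>Both identities express index \<open>l\<close> through index \<open>l+1\<close> and are
  proved together: the first one in degrees \<open>k+1\<close> and \<open>k\<close> yields the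
  second in degree \<open>k+2\<close> (\<open>key\<close>), and the second yields the first in the
  same degree by the recurrence of index \<open>l+1\<close> (\<open>key2\<close>).\<close>

lemma gegenC_raise:
  assumes "l > 0"
  shows "(real k + 2 + l) * gegenC l (Suc (Suc k)) x = l * (gegenC (l+1) (Suc (Suc k)) x - gegenC (l+1) k x)"
    and "(real k + 2) * gegenC l (Suc (Suc k)) x = 2 * l * (x * gegenC (l+1) (Suc k) x - gegenC (l+1) k x)"
proof -
  have key: "(real k + 2) * gegenC l (Suc (Suc k)) x = 2 * l * (x * gegenC (l+1) (Suc k) x - gegenC (l+1) k x)"
    if "(real k + 1 + l) * gegenC l (Suc k) x =
          l * (gegenC (l+1) (Suc k) x - (if k = 0 then 0 else gegenC (l+1) (k-1) x))"
       "(real k + l) * gegenC l k x =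
          l * (gegenC (l+1) k x - (if k < 2 then 0 else gegenC (l+1) (k-2) x))" for k
  proof -
    \<comment> \<open>The recurrence of index \<open>l+1\<close>, shifted down to degree
      \<open>k\<close>; the conditionals read polynomials of negative degree as zero.\<close>
    have r: "real k * gegenC (l+1) k x = 2 * (real k + l) * x * (if k = 0 then 0 else gegenC (l+1) (k-1) x)
        - (real k + 2 * l) * (if k < 2 then 0 else gegenC (l+1) (k-2) x)"
    proof (cases k)
      case (Suc j)
      then show ?thesis
      proof (cases j)
        case (Suc i)
        then show ?thesis using \<open>k = Suc j\<close> gegenC_rec[of i "l+1" x] by (simp add: algebra_simps)
      qed (simp add: algebra_simps)
    qed simp
    define e1 e2 e0 where "e1 = (if k = 0 then 0 else gegenC (l+1) (k-1) x)"
      and "e2 = (if k < 2 then 0 else gegenC (l+1) (k-2) x)" and "e0 = gegenC (l+1) k x"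
    have p: "real k + l > 0" using assms by (simp add: add_nonneg_pos)
    have "(real k + l) * ((real k + 2) * gegenC l (Suc (Suc k)) x)
       = 2 * x * (real k + l) * ((real k + 1 + l) * gegenC l (Suc k) x)
         - (real k + 2 * l) * ((real k + l) * gegenC l k x)"
      unfolding gegenC_rec by (simp add: algebra_simps)
    also have "\<dots> = 2 * x * (real k + l) * (l * (gegenC (l+1) (Suc k) x - e1))
         - (real k + 2 * l) * (l * (e0 - e2))"
      using that unfolding e1_def e2_def e0_def by simp
    also have "\<dots> = 2 * x * (real k + l) * l * gegenC (l+1) (Suc k) x
        - l * (2 * (real k + l) * x * e1 - (real k + 2*l) * e2) - l * (real k + 2 * l) * e0"
      by (simp add: algebra_simps)
    also have "\<dots> = 2 * x * (real k + l) * l * gegenC (l+1) (Suc k) x - l * (real k * e0) - l * (real k + 2 * l) * e0"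
      using r unfolding e1_def e2_def e0_def by simp
    also have "\<dots> = (real k + l) * (2 * l * (x * gegenC (l+1) (Suc k) x - e0))"
      by (simp add: algebra_simps)
    finally show ?thesis using p unfolding e0_def by simp
  qed
  have key2: "(real k + 2 + l) * gegenC l (Suc (Suc k)) x = l * (gegenC (l+1) (Suc (Suc k)) x - gegenC (l+1) k x)"
    if "(real k + 2) * gegenC l (Suc (Suc k)) x = 2 * l * (x * gegenC (l+1) (Suc k) x - gegenC (l+1) k x)" for k
  proof -
    define E where "E = gegenC (l+1) k x"
    have a: "(real k + 2) * ((real k + 2 + l) * gegenC l (Suc (Suc k)) x)
      = (real k + 2 + l) * (2 * l * (x * gegenC (l+1) (Suc k) x - E))"
      unfolding E_def that[symmetric] by (simp only: mult.left_commute)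
    have b: "(real k + 2) * (l * (gegenC (l+1) (Suc (Suc k)) x - E))
      = l * ((real k + 2) * gegenC (l+1) (Suc (Suc k)) x) - (real k + 2) * l * E"
      by (simp add: algebra_simps)
    have "(real k + 2) * ((real k + 2 + l) * gegenC l (Suc (Suc k)) x) =
      (real k + 2) * (l * (gegenC (l+1) (Suc (Suc k)) x - gegenC (l+1) k x))"
      using a b unfolding gegenC_rec E_def by (simp add: algebra_simps)
    then show ?thesis by (simp add: add_eq_0_iff)
  qed
  have "((real k + 1 + l) * gegenC l (Suc k) x =
          l * (gegenC (l+1) (Suc k) x - (if k = 0 then 0 else gegenC (l+1) (k-1) x))) \<and>
       ((real k + l) * gegenC l k x =
          l * (gegenC (l+1) k x - (if k < 2 then 0 else gegenC (l+1) (k-2) x)))" for k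
  proof (induction k)
    case 0
    show ?case using assms by (simp add: algebra_simps)
  next
    case (Suc k)
    have "(real k + 2 + l) * gegenC l (Suc (Suc k)) x = l * (gegenC (l+1) (Suc (Suc k)) x - gegenC (l+1) k x)"
      using key2[OF key] Suc by blast
    moreover have "(if Suc k < 2 then 0 else gegenC (l+1) (Suc k-2) x) = (if k = 0 then 0 else gegenC (l+1) (k-1) x)"
      by (auto simp: numeral_2_eq_2)
    ultimately show ?case using Suc by (simp add: algebra_simps)
  qed
  then show "(real k + 2) * gegenC l (Suc (Suc k)) x = 2 * l * (x * gegenC (l+1) (Suc k) x - gegenC (l+1) k x)"
    using key by blast
  then show "(real k + 2 + l) * gegenC l (Suc (Suc k)) x = l * (gegenC (l+1) (Suc (Suc k)) x - gegenC (l+1) k x)"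
    by (rule key2)
qed

text \<open>Differentiating the recurrence leaves one undifferentiated term of index
  \<open>l\<close>; the first identity of \<open>gegenC_raise\<close> rewrites it in index
  \<open>l+1\<close>, and the recurrence of index \<open>l+1\<close> closes the induction.\<close>

lemma DERIV_gegenC:
  assumes "l > 0"
  shows "(gegenC l (Suc k) has_real_derivative 2 * l * gegenC (l+1) k x) (at x)"
proof (induction k rule: less_induct)
  case (less k)
  consider "k = 0" | "k = 1" | j where "k = Suc (Suc j)"
    by (metis One_nat_def not0_implies_Suc)
  then show ?case
  proof cases
    case 1
    have "((\<lambda>x. 2 * l * x) has_real_derivative 2 * l) (at x)"
      by (auto intro!: derivative_eq_intros)
    moreover have "gegenC l (Suc 0) = (\<lambda>x. 2 * l * x)" by (simp add: fun_eq_iff)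
    ultimately show ?thesis using 1 by simp
  next
    case 2
    have "((\<lambda>x. (2 * (1 + l) * x * (2 * l * x) - 2 * l) / 2) has_real_derivative 2 * l * (2 * (l+1) * x)) (at x)"
      by (auto intro!: derivative_eq_intros simp: algebra_simps)
    moreover have "gegenC l (Suc (Suc 0)) = (\<lambda>x. (2 * (1 + l) * x * (2 * l * x) - 2 * l) / 2)"
      by (simp add: fun_eq_iff gegenC.simps(3))
    ultimately show ?thesis using 2 by simp
  next
    case 3
    define E where "E = (\<lambda>i. gegenC (l+1) i x)"
    have d1: "(gegenC l (Suc (Suc j)) has_real_derivative 2 * l * E (Suc j)) (at x)"
      and d2: "(gegenC l (Suc j) has_real_derivative 2 * l * E j) (at x)"
      using less[of "Suc j"] less[of j] 3 by (auto simp: E_def)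
    have "((\<lambda>x. (2 * (real (Suc j) + 1 + l) * x * gegenC l (Suc (Suc j)) x - (real (Suc j) + 2 * l) * gegenC l (Suc j) x)
        / (real (Suc j) + 2)) has_real_derivative
        (2 * (real (Suc j) + 1 + l) * (gegenC l (Suc (Suc j)) x + x * (2 * l * E (Suc j)))
           - (real (Suc j) + 2 * l) * (2 * l * E j)) / (real (Suc j) + 2)) (at x)"
      by (rule DERIV_cdivide) (auto intro!: derivative_eq_intros d1 d2 simp: algebra_simps)
    moreover have "gegenC l (Suc k) =
       (\<lambda>x. (2 * (real (Suc j) + 1 + l) * x * gegenC l (Suc (Suc j)) x - (real (Suc j) + 2 * l) * gegenC l (Suc j) x)
        / (real (Suc j) + 2))"
      by (simp add: 3 fun_eq_iff gegenC.simps(3)[of _ "Suc j"])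
    moreover have "(2 * (real (Suc j) + 1 + l) * (gegenC l (Suc (Suc j)) x + x * (2 * l * E (Suc j)))
           - (real (Suc j) + 2 * l) * (2 * l * E j)) / (real (Suc j) + 2) = 2 * l * E k"
    proof -
      have r: "(real j + 2) * E (Suc (Suc j)) = 2 * (real j + 2 + l) * x * E (Suc j) - (real j + 2 * l + 2) * E j"
        using gegenC_rec[of j "l+1" x] unfolding E_def by (simp add: algebra_simps)
      have s: "(real j + 2 + l) * gegenC l (Suc (Suc j)) x = l * (E (Suc (Suc j)) - E j)"
        using gegenC_raise(1)[OF assms, of j x] unfolding E_def by simp
      have "2 * (real (Suc j) + 1 + l) * (gegenC l (Suc (Suc j)) x + x * (2 * l * E (Suc j)))
           - (real (Suc j) + 2 * l) * (2 * l * E j)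
        = 2 * ((real j + 2 + l) * gegenC l (Suc (Suc j)) x) + 2 * l * (2 * (real j + 2 + l) * x * E (Suc j))
           - (real j + 1 + 2 * l) * (2 * l * E j)"
        by (simp add: algebra_simps)
      also have "\<dots> = 2 * (l * (E (Suc (Suc j)) - E j)) + 2 * l * ((real j + 2) * E (Suc (Suc j)) + (real j + 2 * l + 2) * E j)
           - (real j + 1 + 2 * l) * (2 * l * E j)"
        unfolding s r by (simp add: algebra_simps)
      also have "\<dots> = (real (Suc j) + 2) * (2 * l * E k)"
        by (simp add: 3 algebra_simps)
      finally show ?thesis by (simp add: add_eq_0_iff)
    qed
    ultimately show ?thesis by (simp add: E_def)
  qed
qed

text \<open>The raising identities in two consecutive degrees reduce both sides to index
  \<open>l+1\<close>. The left side is \<open>1 - x\<^sup>2\<close> times a derivative, so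
  differentiating once more leads to the differential equation.\<close>

lemma gegenC_lower:
  assumes "l > 0"
  shows "(1 - x\<^sup>2) * (2 * l * gegenC (l+1) k x) = (real k + 2 * l) * gegenC l k x - (real k + 1) * x * gegenC l (Suc k) x"
proof -
  consider "k = 0" | "k = 1" | j where "k = Suc (Suc j)"
    by (metis One_nat_def not0_implies_Suc)
  then show ?thesis
  proof cases
    case 3
    define E C where "E = (\<lambda>i. gegenC (l+1) i x)" and "C = (\<lambda>i. gegenC l i x)"
    have a: "(real j + 2) * C (Suc (Suc j)) = 2 * l * (x * E (Suc j) - E j)"
      using gegenC_raise(2)[OF assms, of j x] unfolding E_def C_def by simp
    have b: "(real j + 3) * C (Suc (Suc (Suc j))) = 2 * l * (x * E (Suc (Suc j)) - E (Suc j))"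
      using gegenC_raise(2)[OF assms, of "Suc j" x] unfolding E_def C_def by (simp add: algebra_simps)
    have s: "(real j + 2 + l) * C (Suc (Suc j)) = l * (E (Suc (Suc j)) - E j)"
      using gegenC_raise(1)[OF assms, of j x] unfolding E_def C_def by simp
    have "(real j + 2 + 2 * l) * C (Suc (Suc j)) - x * ((real j + 3) * C (Suc (Suc (Suc j))))
      = 2 * ((real j + 2 + l) * C (Suc (Suc j))) - (real j + 2) * C (Suc (Suc j))
          - x * ((real j + 3) * C (Suc (Suc (Suc j))))"
      by (simp add: algebra_simps)
    also have "\<dots> = (1 - x\<^sup>2) * (2 * l * E (Suc (Suc j)))"
      unfolding a b s by (simp add: algebra_simps power2_eq_square)
    finally show ?thesis unfolding E_def C_def 3 by (simp add: algebra_simps)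
  qed (use assms in \<open>simp_all add: numeral_2_eq_2 gegenC.simps(3) field_simps power2_eq_square\<close>)
qed

text \<open>Differentiate \<open>gegenC_lower\<close> and eliminate the derivative of the lower
  degree by the second raising identity. The terms of index \<open>l+2\<close> and
  \<open>l+1\<close> are \<open>y''\<close> and \<open>y'\<close> for the polynomial
  \<open>y\<close> of degree \<open>k+2\<close>.\<close>

lemma gegenC_ode:
  assumes "l > 0"
  shows "(1 - x\<^sup>2) * (4 * l * (l+1) * gegenC (l+2) k x) - (2 * l + 1) * x * (2 * l * gegenC (l+1) (Suc k) x)
     + (real k + 2) * (real k + 2 + 2 * l) * gegenC l (Suc (Suc k)) x = 0"
proof -
  define D where "D = (\<lambda>k. 2 * l * gegenC (l+1) k x)"
  have d: "(gegenC l (Suc i) has_real_derivative D i) (at x)" for i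
    using DERIV_gegenC[OF assms] unfolding D_def by blast
  have e: "(gegenC (l+1) (Suc k) has_real_derivative 2 * (l+1) * gegenC (l+2) k x) (at x)"
    using DERIV_gegenC[of "l+1" k x] assms by (simp add: add.assoc)
  have "((\<lambda>x. (1 - x\<^sup>2) * (2 * l * gegenC (l+1) (Suc k) x)) has_real_derivative
     - (2 * x) * D (Suc k) + (1 - x\<^sup>2) * (2 * l * (2 * (l+1) * gegenC (l+2) k x))) (at x)"
    unfolding D_def by (rule derivative_eq_intros e | simp add: algebra_simps)+
  moreover have "((\<lambda>x. (real (Suc k) + 2 * l) * gegenC l (Suc k) x - (real (Suc k) + 1) * x * gegenC l (Suc (Suc k)) x)
     has_real_derivative (real (Suc k) + 2 * l) * D k - (real (Suc k) + 1) * (gegenC l (Suc (Suc k)) x + x * D (Suc k))) (at x)"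
    by (rule derivative_eq_intros d | simp add: algebra_simps)+
  ultimately have eq: "- (2 * x) * D (Suc k) + (1 - x\<^sup>2) * (2 * l * (2 * (l+1) * gegenC (l+2) k x)) =
     (real (Suc k) + 2 * l) * D k - (real (Suc k) + 1) * (gegenC l (Suc (Suc k)) x + x * D (Suc k))"
    unfolding gegenC_lower[OF assms] by (rule DERIV_unique)
  have "(real k + 2) * gegenC l (Suc (Suc k)) x = x * D (Suc k) - D k"
    using gegenC_raise(2)[OF assms, of k x] unfolding D_def by (simp add: algebra_simps)
  then have Dk: "D k = x * D (Suc k) - (real k + 2) * gegenC l (Suc (Suc k)) x" by simp
  show ?thesis
    using eq unfolding Dk by (simp add: D_def algebra_simps)
qed

lemma gegenP_one [simp]: "l > 0 \<Longrightarrow> gegenP l k 1 = 1"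
  unfolding gegenP_def using gegenC_one_pos[of l k] by simp

lemma gegenP_0 [simp]: "gegenP l 0 x = 1"
  by (simp add: gegenP_def)

text \<open>The numerical factor is the derivative at \<open>1\<close>, where \<open>gegenP\<close>
  of index \<open>l+1\<close> has value one; it comes from the ratio of the two normalising
  values.\<close>

lemma DERIV_gegenP:
  assumes "l > 0"
  shows "(gegenP l (Suc k) has_real_derivative
      (real k + 1) * (real k + 1 + 2 * l) / (2 * l + 1) * gegenP (l+1) k x) (at x)"
proof -
  have "((\<lambda>x. gegenC l (Suc k) x / gegenC l (Suc k) 1) has_real_derivative
      2 * l * gegenC (l+1) k x / gegenC l (Suc k) 1) (at x)"
    by (rule DERIV_cdivide[OF DERIV_gegenC[OF assms]])
  moreover have "2 * l * gegenC (l+1) k x / gegenC l (Suc k) 1 =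
      (real k + 1) * (real k + 1 + 2 * l) / (2 * l + 1) * gegenP (l+1) k x"
  proof -
    have p: "gegenC l (Suc k) 1 > 0" "gegenC (l+1) k 1 > 0" using gegenC_one_pos assms by auto
    have "(2 * l + 1) * (2 * l) * gegenC (l+1) k 1 = (real k + 1) * (real k + 1 + 2 * l) * gegenC l (Suc k) 1"
    proof (cases k)
      case (Suc j)
      define E C where "E = (\<lambda>i. gegenC (l+1) i 1)" and "C = gegenC l (Suc (Suc j)) 1"
      have a: "(real j + 2) * C = 2 * l * (E (Suc j) - E j)"
        using gegenC_raise(2)[OF assms, of j 1] unfolding E_def C_def by simp
      have b: "(real j + 1) * E (Suc j) = (real j + 2 * l + 2) * E j"
        using gegenC_one_rec[of j "l+1"] unfolding E_def by (simp add: algebra_simps)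
      have "(real j + 2) * (real j + 2 + 2 * l) * C = (real j + 2 + 2 * l) * ((real j + 2) * C)"
        by simp
      also have "\<dots> = 2 * l * ((real j + 2 + 2 * l) * E (Suc j) - (real j + 2 * l + 2) * E j)"
        unfolding a by (simp add: algebra_simps)
      also have "\<dots> = (2 * l + 1) * (2 * l) * E (Suc j)"
        unfolding b[symmetric] by (simp add: algebra_simps)
      finally show ?thesis unfolding E_def C_def Suc by (simp add: algebra_simps)
    qed (simp add: algebra_simps)
    then have "gegenC (l+1) k x * ((2 * l + 1) * (2 * l) * gegenC (l+1) k 1) =
        gegenC (l+1) k x * ((real k + 1) * (real k + 1 + 2 * l) * gegenC l (Suc k) 1)"
      by simp
    then have "2 * l * gegenC (l+1) k x * ((2 * l + 1) * gegenC (l+1) k 1) =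
        (real k + 1) * (real k + 1 + 2 * l) * gegenC (l+1) k x * gegenC l (Suc k) 1"
      by (simp only: mult_ac)
    then have "2 * l * gegenC (l+1) k x / gegenC l (Suc k) 1 =
        (real k + 1) * (real k + 1 + 2 * l) * gegenC (l+1) k x / ((2 * l + 1) * gegenC (l+1) k 1)"
      using p assms by (subst frac_eq_eq) auto
    then show ?thesis by (simp add: gegenP_def)
  qed
  ultimately show ?thesis
    unfolding gegenP_def[abs_def] by simp
qed

text \<open>Monotonicity of Sonin's function \<open>y\<^sup>2 + (1 - s\<^sup>2) y'\<^sup>2 / (k (k + 2l))\<close> on \<open>[0,1]\<close>
  gives both the uniform bound and the decay of \<open>P\<^sub>k\<close> away from \<open>1\<close>.\<close>

definition sonin :: "real \<Rightarrow> nat \<Rightarrow> real \<Rightarrow> real" where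
  "sonin l k s = (gegenP l (Suc k) s)\<^sup>2
     + (1 - s\<^sup>2) * ((real k + 1) * (real k + 1 + 2 * l) / (2 * l + 1) * gegenP (l+1) k s)\<^sup>2
        / ((real k + 1) * (real k + 1 + 2 * l))"

text \<open>The second derivative appears as a witness \<open>y2\<close> because it is a Gegenbauer
  polynomial of index \<open>l+2\<close> only from degree two on; in degree one it is
  \<open>0\<close>.\<close>

lemma gegenP_ode:
  assumes "l > 0"
  obtains y2 where
    "((\<lambda>s. (real k + 1) * (real k + 1 + 2 * l) / (2 * l + 1) * gegenP (l+1) k s) has_real_derivative y2) (at s)"
    "(1 - s\<^sup>2) * y2 - (2 * l + 1) * s * ((real k + 1) * (real k + 1 + 2 * l) / (2 * l + 1) * gegenP (l+1) k s)
      + (real k + 1) * (real k + 1 + 2 * l) * gegenP l (Suc k) s = 0"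
proof (cases k)
  case 0
  have "gegenP l (Suc 0) s = s" using assms by (simp add: gegenP_def)
  then show ?thesis using 0 assms
    by (intro that[of 0]) (auto intro!: derivative_eq_intros simp: field_simps)
next
  case (Suc j)
  define c where "c = gegenC l (Suc k) 1"
  define L where "L = (real k + 1) * (real k + 1 + 2 * l)"
  have c: "c > 0" unfolding c_def using gegenC_one_pos assms by blast
  have D: "L / (2 * l + 1) * gegenP (l+1) k s = 2 * l * gegenC (l+1) k s / c" for s
  proof -
    have "((\<lambda>x. gegenC l (Suc k) x / gegenC l (Suc k) 1) has_real_derivative
      2 * l * gegenC (l+1) k s / gegenC l (Suc k) 1) (at s)"
      by (rule DERIV_cdivide[OF DERIV_gegenC[OF assms]])
    from DERIV_unique[OF this DERIV_gegenP[OF assms, of k s, unfolded gegenP_def[of l, abs_def]]]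
    show ?thesis unfolding L_def c_def by simp
  qed
  have "((\<lambda>s. 2 * l * gegenC (l+1) (Suc j) s / c) has_real_derivative
      2 * l * (2 * (l+1) * gegenC (l+1+1) j s) / c) (at s)"
    by (intro DERIV_cdivide DERIV_cmult DERIV_gegenC) (use assms in auto)
  moreover have "(1 - s\<^sup>2) * (2 * l * (2 * (l+1) * gegenC (l+1+1) j s) / c) - (2 * l + 1) * s * (2 * l * gegenC (l+1) k s / c)
     + L * gegenP l (Suc k) s = ((1 - s\<^sup>2) * (4 * l * (l+1) * gegenC (l+2) j s) - (2 * l + 1) * s * (2 * l * gegenC (l+1) (Suc j) s)
     + (real j + 2) * (real j + 2 + 2 * l) * gegenC l (Suc (Suc j)) s) / c"
  proof -
    have "gegenP l (Suc k) s = gegenC l (Suc (Suc j)) s / c" by (simp add: gegenP_def c_def Suc)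
    then show ?thesis by (simp add: Suc L_def add_divide_distrib diff_divide_distrib algebra_simps)
  qed
  ultimately show ?thesis
    using that[of "2 * l * (2 * (l+1) * gegenC (l+1+1) j s) / c"] unfolding L_def[symmetric] D gegenC_ode[OF assms]
    by (simp add: Suc)
qed

text \<open>The differential equation replaces \<open>(1 - s\<^sup>2) y''\<close>; the terms in
  \<open>y y'\<close> then cancel and a square times \<open>s\<close> is left.\<close>

lemma DERIV_sonin:
  assumes "l > 0"
  shows "(sonin l k has_real_derivative 4 * l * s *
    ((real k + 1) * (real k + 1 + 2 * l) / (2 * l + 1) * gegenP (l+1) k s)\<^sup>2 / ((real k + 1) * (real k + 1 + 2 * l))) (at s)"
proof -
  define L where "L = (real k + 1) * (real k + 1 + 2 * l)"
  define D where "D = (\<lambda>s. L / (2 * l + 1) * gegenP (l+1) k s)"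
  define P where "P = gegenP l (Suc k)"
  have L: "L > 0" unfolding L_def using assms by (intro mult_pos_pos) auto
  obtain y2 where y2: "(D has_real_derivative y2) (at s)"
    "(1 - s\<^sup>2) * y2 - (2 * l + 1) * s * D s + L * P s = 0"
    using gegenP_ode[OF assms, of k s] unfolding D_def L_def P_def by blast
  have P: "(P has_real_derivative D s) (at s)"
    using DERIV_gegenP[OF assms, of k s] unfolding P_def D_def L_def .
  have "((\<lambda>s. (P s)\<^sup>2) has_real_derivative 2 * P s * D s) (at s)"
    by (auto intro!: derivative_eq_intros P)
  moreover have "((\<lambda>s. (1 - s\<^sup>2) * (D s)\<^sup>2) has_real_derivative
     - 2 * s * (D s)\<^sup>2 + (1 - s\<^sup>2) * (2 * D s * y2)) (at s)"
    by (auto intro!: derivative_eq_intros y2(1))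
  ultimately have "((\<lambda>s. (P s)\<^sup>2 + (1 - s\<^sup>2) * (D s)\<^sup>2 / L) has_real_derivative
     2 * P s * D s + (- 2 * s * (D s)\<^sup>2 + (1 - s\<^sup>2) * (2 * D s * y2)) / L) (at s)"
    by (intro DERIV_add DERIV_cdivide)
  moreover have "2 * P s * D s + (- 2 * s * (D s)\<^sup>2 + (1 - s\<^sup>2) * (2 * D s * y2)) / L
      = 4 * l * s * (D s)\<^sup>2 / L"
  proof -
    have "2 * P s * D s * L + (- 2 * s * (D s)\<^sup>2 + (1 - s\<^sup>2) * (2 * D s * y2))
       = 2 * D s * ((1 - s\<^sup>2) * y2 - (2 * l + 1) * s * D s + L * P s) + 4 * l * s * (D s)\<^sup>2"
      by (simp add: algebra_simps power2_eq_square)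
    then show ?thesis using L unfolding y2(2) by (simp add: field_simps)
  qed
  moreover have "sonin l k = (\<lambda>s. (P s)\<^sup>2 + (1 - s\<^sup>2) * (D s)\<^sup>2 / L)"
    unfolding sonin_def[abs_def] P_def D_def L_def by simp
  ultimately show ?thesis unfolding D_def L_def by simp
qed

lemma sonin_mono:
  assumes "l > 0" "0 \<le> a" "a \<le> b"
  shows "sonin l k a \<le> sonin l k b"
proof (rule DERIV_nonneg_imp_nondecreasing[OF assms(3)])
  fix x assume "a \<le> x" "x \<le> b"
  have "0 \<le> 4 * l * x * ((real k + 1) * (real k + 1 + 2 * l) / (2 * l + 1) * gegenP (l+1) k x)\<^sup>2
      / ((real k + 1) * (real k + 1 + 2 * l))"
    using assms \<open>a \<le> x\<close> by (intro divide_nonneg_nonneg mult_nonneg_nonneg) auto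
  then show "\<exists>y. DERIV (sonin l k) x :> y \<and> 0 \<le> y"
    using DERIV_sonin[OF assms(1), of k x] by blast
qed

lemma gegenP_sq_le_sonin:
  assumes "l > 0" "\<bar>s\<bar> \<le> 1"
  shows "(gegenP l (Suc k) s)\<^sup>2 \<le> sonin l k s"
proof -
  have "s\<^sup>2 \<le> 1" using assms by (simp add: abs_square_le_1)
  then show ?thesis
    unfolding sonin_def using assms by (auto intro!: divide_nonneg_nonneg mult_nonneg_nonneg)
qed

text \<open>Sonin's function dominates the square of the polynomial, increases on
  \<open>[0,1]\<close> and equals \<open>1\<close> at the right end.\<close>

lemma abs_gegenP_le_1:
  assumes "l > 0" "0 \<le> s" "s \<le> 1"
  shows "\<bar>gegenP l k s\<bar> \<le> 1"
proof (cases k)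
  case (Suc j)
  have "(gegenP l (Suc j) s)\<^sup>2 \<le> sonin l j 1"
    using gegenP_sq_le_sonin[of l s j] sonin_mono[of l s 1 j] assms by simp
  also have "\<dots> = 1" using assms by (simp add: sonin_def)
  finally show ?thesis using Suc by (simp add: abs_square_le_1)
qed simp

text \<open>By the uniform bound for index \<open>l+1\<close> the derivative never exceeds its value
  at \<open>1\<close>, so on \<open>[0,1]\<close> the graph lies above the tangent at
  \<open>1\<close>.\<close>

lemma gegenP_ge:
  assumes "l > 0" "0 \<le> s" "s \<le> 1"
  shows "gegenP l k s \<ge> 1 - (1 - s) * (real k * (real k + 2 * l) / (2 * l + 1))"
proof (cases k)
  case (Suc j)
  define Y where "Y = (real j + 1) * (real j + 1 + 2 * l) / (2 * l + 1)"
  have Y: "Y \<ge> 0" unfolding Y_def using assms by auto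
  have "gegenP l k 1 - gegenP l k s \<le> Y * 1 - Y * s"
  proof -
    have "(\<lambda>x. Y * x - gegenP l k x) s \<le> (\<lambda>x. Y * x - gegenP l k x) 1"
    proof (rule DERIV_nonneg_imp_nondecreasing[OF assms(3)])
      fix x assume x: "s \<le> x" "x \<le> 1"
      have "((\<lambda>x. Y * x - gegenP l k x) has_real_derivative Y - Y * gegenP (l+1) j x) (at x)"
        unfolding Suc Y_def by (rule derivative_eq_intros DERIV_gegenP assms | simp)+
      moreover have "gegenP (l+1) j x \<le> 1"
        using abs_gegenP_le_1[of "l+1" x j] assms x by auto
      then have "0 \<le> Y - Y * gegenP (l+1) j x"
        using Y by (simp add: mult_left_le)
      ultimately show "\<exists>y. ((\<lambda>x. Y * x - gegenP l k x) has_real_derivative y) (at x) \<and> 0 \<le> y" by blast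
    qed
    then show ?thesis by simp
  qed
  moreover have "real k * (real k + 2 * l) / (2 * l + 1) = Y"
    unfolding Y_def Suc by (simp add: add.commute)
  ultimately show ?thesis using assms by (simp add: algebra_simps)
qed simp

text \<open>On the interval of length \<open>1 / (2L)\<close> next to \<open>1\<close>, with
  \<open>L = k (k + 2l)\<close>, the derivative keeps at least half of its value at
  \<open>1\<close>. Sonin's function therefore loses a fixed amount across this interval and, being
  increasing, stays below that level further left.\<close>

lemma gegenP_decay_aux:
  assumes l: "l > 0" and k: "k \<ge> 1" and s: "0 \<le> s" "s \<le> 1 - 1 / (2 * (real k * (real k + 2 * l)))"
  shows "(gegenP l k s)\<^sup>2 \<le> 1 - l / (4 * (2 * l + 1)\<^sup>2)"
proof -
  obtain j where j: "k = Suc j" using k by (metis Suc_le_D One_nat_def)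
  define L where "L = (real j + 1) * (real j + 1 + 2 * l)"
  have Lk: "L = real k * (real k + 2 * l)" unfolding L_def j by (simp add: algebra_simps)
  have L1: "L \<ge> 1" unfolding L_def using l mult_mono[of 1 "real j + 1" 1 "real j + 1 + 2 * l"] by simp
  define s1 where "s1 = 1 - 1 / (2 * L)"
  have s1: "1/2 \<le> s1" "s1 < 1" using L1 unfolding s1_def by (auto simp: field_simps)
  have ss: "s \<le> s1" using s unfolding s1_def Lk by simp
  obtain z where z: "s1 < z" "z < 1" "sonin l j 1 - sonin l j s1 = (1 - s1) *
      (4 * l * z * (L / (2 * l + 1) * gegenP (l+1) j z)\<^sup>2 / L)"
    using MVT2[of s1 1 "sonin l j" "\<lambda>s. 4 * l * s * (L / (2 * l + 1) * gegenP (l+1) j s)\<^sup>2 / L"] s1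
      DERIV_sonin[OF l, of j] unfolding L_def by blast
  have "gegenP (l+1) j z \<ge> 1 - (1 - z) * (real j * (real j + 2 * (l+1)) / (2 * (l+1) + 1))"
    by (rule gegenP_ge) (use l z s1 in auto)
  moreover have "(1 - z) * (real j * (real j + 2 * (l+1)) / (2 * (l+1) + 1)) \<le> 1 / 2"
  proof -
    have "real j * (real j + 2 * (l+1)) / (2 * (l+1) + 1) \<le> real j * (real j + 2 * (l+1))"
      using l by (simp add: divide_le_eq_1 field_simps mult_left_mono)
    also have "\<dots> \<le> L" unfolding L_def using l by (simp add: algebra_simps)
    finally have "(1 - z) * (real j * (real j + 2 * (l+1)) / (2 * (l+1) + 1)) \<le> (1 - s1) * L"
      using z s1 l by (intro mult_mono) auto
    also have "\<dots> = 1 / 2" using L1 unfolding s1_def by simp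
    finally show ?thesis .
  qed
  ultimately have g: "gegenP (l+1) j z \<ge> 1 / 2" by linarith
  have "(1/2)\<^sup>2 \<le> (gegenP (l+1) j z)\<^sup>2" by (rule power_mono[OF g]) simp
  then have g2: "1/4 \<le> (gegenP (l+1) j z)\<^sup>2" by (simp add: power2_eq_square)
  have "(1 - s1) * (4 * l * z * (L / (2 * l + 1) * gegenP (l+1) j z)\<^sup>2 / L)
      = 2 * l / (2 * l + 1)\<^sup>2 * (z * (gegenP (l+1) j z)\<^sup>2)"
  proof -
    have "2 * l + 1 \<noteq> 0" "L \<noteq> 0" using l L1 by auto
    then show ?thesis unfolding s1_def by (simp add: power2_eq_square divide_simps)
  qed
  \<comment> \<open>The factors \<open>1/2\<close> and \<open>1/4\<close> bound \<open>z\<close> and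
    the squared polynomial of index \<open>l+1\<close> from below; their product is the constant of
    the statement.\<close>
  also have "\<dots> \<ge> 2 * l / (2 * l + 1)\<^sup>2 * (1/2 * (1/4))"
    using l z s1 g2 by (intro mult_left_mono mult_mono) auto
  finally have "sonin l j s1 \<le> 1 - l / (4 * (2 * l + 1)\<^sup>2)"
    using z(3) l by (simp add: sonin_def)
  moreover have "(gegenP l k s)\<^sup>2 \<le> sonin l j s1"
    using gegenP_sq_le_sonin[of l s j] sonin_mono[OF l s(1) ss, of j] l s s1 ss unfolding j by linarith
  ultimately show ?thesis by linarith
qed

lemma one_minus_cos_bounds:
  fixes t :: real
  assumes "0 \<le> t" "t \<le> 1"
  shows "1 - cos t \<le> t\<^sup>2" "t\<^sup>2 / 4 \<le> 1 - cos t"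
proof -
  have c: "1 - cos t = 2 * (sin (t/2))\<^sup>2"
    using cos_double_sin[of "t/2"] by simp
  have s: "sin (t/2) \<le> t/2" using sin_x_le_x[of "t/2"] assms by simp
  have s0: "0 \<le> sin (t/2)" by (rule sin_ge_zero) (use assms pi_gt3 in auto)
  have "(sin (t/2))\<^sup>2 \<le> (t/2)\<^sup>2" using s s0 by (rule power_mono)
  moreover have "(t/2)\<^sup>2 = t\<^sup>2 / 4" by (simp add: power2_eq_square)
  ultimately show "1 - cos t \<le> t\<^sup>2" unfolding c using zero_le_power2[of t] by linarith
  \<comment> \<open>The cubic Taylor bound for the sine loses at most \<open>t/24\<close> for
    \<open>t \<le> 1\<close>, which leaves the factor \<open>11/24\<close>; twice its square exceeds
    \<open>1/4\<close>.\<close>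
  have "t/2 - (t/2)^3/6 \<le> sin (t/2)"
  proof -
    have "(\<lambda>x::real. sin x - x + x^3/6) 0 \<le> (\<lambda>x. sin x - x + x^3/6) (t/2)"
    proof (rule DERIV_nonneg_imp_nondecreasing[where f = "\<lambda>x::real. sin x - x + x^3/6"])
      fix x :: real assume x: "0 \<le> x" "x \<le> t/2"
      have "((\<lambda>x. sin x - x + x^3/6) has_real_derivative cos x - 1 + x\<^sup>2/2) (at x)"
        by (auto intro!: derivative_eq_intros simp: power2_eq_square)
      moreover have "0 \<le> cos x - 1 + x\<^sup>2/2"
      proof -
        have "1 - cos x = 2 * (sin (x/2))\<^sup>2" using cos_double_sin[of "x/2"] by simp
        moreover have "(sin (x/2))\<^sup>2 \<le> (x/2)\<^sup>2"
          by (rule power_mono) (use x assms pi_gt3 sin_x_le_x[of "x/2"] in \<open>auto intro!: sin_ge_zero\<close>)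
        ultimately show ?thesis by (simp add: power2_eq_square)
      qed
      ultimately show "\<exists>y. ((\<lambda>x. sin x - x + x^3/6) has_real_derivative y) (at x) \<and> 0 \<le> y" by blast
    qed (use assms in simp)
    then show ?thesis by simp
  qed
  moreover have "(t/2)^3/6 \<le> t/24"
  proof -
    have "(t/2)^3 = t/8 * (t*t)" by (simp add: power3_eq_cube)
    also have "\<dots> \<le> t/8 * 1" using assms by (intro mult_left_mono mult_le_one) auto
    finally show ?thesis using assms by simp
  qed
  ultimately have "t * (11/24) \<le> sin (t/2)" by simp
  then have "(t * (11/24))\<^sup>2 \<le> (sin (t/2))\<^sup>2" using assms by (intro power_mono) auto
  moreover have "t\<^sup>2 / 4 \<le> 2 * (t * (11/24))\<^sup>2" by (simp add: power2_eq_square)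
  ultimately show "t\<^sup>2 / 4 \<le> 1 - cos t" unfolding c by linarith
qed

text \<open>From \<open>k t \<ge> 2\<close> follows \<open>k (k + 2l) t\<^sup>2 \<ge> 4\<close>;
  together with \<open>1 - cos t \<ge> t\<^sup>2 / 4\<close> this puts \<open>cos t\<close> to the
  left of the critical interval of \<open>gegenP_decay_aux\<close>. The gap \<open>d\<close> depends
  on \<open>l\<close> alone.\<close>

lemma gegenP_decay:
  assumes l: "l > 0"
  obtains d where "d > 0" "\<And>k t. 0 < t \<Longrightarrow> t \<le> 1 \<Longrightarrow> real k * t \<ge> 2 \<Longrightarrow> gegenP l k (cos t) \<le> 1 - d"
proof
  show "l / (4 * (2 * l + 1)\<^sup>2) / 2 > 0" using l by simp
  fix k :: nat and t :: real assume t: "0 < t" "t \<le> 1" "real k * t \<ge> 2"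
  define d where "d = l / (4 * (2 * l + 1)\<^sup>2)"
  have k: "k \<ge> 1" using t by (cases k) auto
  have c0: "0 \<le> cos t" by (rule cos_ge_zero) (use t pi_gt3 in auto)
  have "real k * real k \<le> real k * (real k + 2 * l)" using l by (intro mult_left_mono) auto
  moreover have "4 \<le> (real k * t)\<^sup>2" using power_mono[OF t(3), of 2] by simp
  ultimately have "4 \<le> real k * (real k + 2 * l) * t\<^sup>2"
    by (smt (verit) mult_right_mono power2_eq_square power_mult_distrib zero_le_power2)
  then have "1 / (2 * (real k * (real k + 2 * l))) \<le> t\<^sup>2 / 4"
  proof -
    define M where "M = real k * (real k + 2 * l)"
    have "M > 0" unfolding M_def using k l by simp
    moreover have "4 \<le> M * t\<^sup>2" unfolding M_def by fact
    ultimately show "1 / (2 * (real k * (real k + 2 * l))) \<le> t\<^sup>2 / 4"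
      unfolding M_def[symmetric] by (simp add: divide_simps mult.commute)
  qed
  then have "cos t \<le> 1 - 1 / (2 * (real k * (real k + 2 * l)))"
    using one_minus_cos_bounds(2)[of t] t by linarith
  then have "(gegenP l k (cos t))\<^sup>2 \<le> 1 - d"
    unfolding d_def using gegenP_decay_aux[OF l k c0] by blast
  \<comment> \<open>Halving the gap passes from the bound on the square to a bound on the
    value.\<close>
  moreover have "1 - d \<le> (1 - d/2)\<^sup>2" by (simp add: power2_eq_square algebra_simps)
  moreover have "d / 2 \<le> 1"
  proof -
    have "l \<le> 4 * (2 * l + 1)\<^sup>2" using l by (simp add: power2_eq_square algebra_simps add_increasing)
    then have "d \<le> 1" unfolding d_def using l by (simp add: divide_le_eq_1)
    then show ?thesis by simp
  qed
  ultimately have "\<bar>gegenP l k (cos t)\<bar> \<le> \<bar>1 - d/2\<bar>"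
    by (meson abs_le_square_iff order_trans)
  then show "gegenP l k (cos t) \<le> 1 - l / (4 * (2 * l + 1)\<^sup>2) / 2" using \<open>d/2 \<le> 1\<close> unfolding d_def[symmetric] by linarith
qed

subsection \<open>Surface measure\<close>

lemma nn_integral_lborel_translate:
  fixes g :: "'a::euclidean_space \<Rightarrow> ennreal"
  assumes [measurable]: "g \<in> borel_measurable borel"
  shows "(\<integral>\<^sup>+x. g (c + x) \<partial>lborel) = (\<integral>\<^sup>+x. g x \<partial>lborel)"
proof -
  have "(\<integral>\<^sup>+x. g x \<partial>lborel) = (\<integral>\<^sup>+x. g x \<partial>distr lborel borel ((+) c))"
    by (simp add: lborel_distr_plus)
  also have "\<dots> = (\<integral>\<^sup>+x. g (c + x) \<partial>lborel)"
    by (subst nn_integral_distr) auto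
  finally show ?thesis by simp
qed

text \<open>Since \<open>f\<close> is linear and onto, a translation by \<open>c\<close> outside
  \<open>f\<close> is a translation by \<open>inv f c\<close> inside it.\<close>

lemma nn_integral_lborel_uminus_shift:
  fixes g :: "'a::euclidean_space \<Rightarrow> ennreal" and f :: "'a \<Rightarrow> 'a"
  assumes [measurable]: "g \<in> borel_measurable borel" and f: "orthogonal_transformation f"
  shows "(\<integral>\<^sup>+y. g (c + f y) \<partial>lborel) = (\<integral>\<^sup>+y. g (f y) \<partial>lborel)"
proof -
  have lf: "linear f" using f by (rule orthogonal_transformation_linear)
  have [measurable]: "f \<in> borel_measurable borel"
    using linear_continuous_on[OF linear_conv_bounded_linear[THEN iffD1, OF lf]]
    by (rule borel_measurable_continuous_onI)
  have "f (inv f c) = c" using orthogonal_transformation_surj[OF f] by (rule surj_f_inv_f)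
  then have "c + f y = f (inv f c + y)" for y by (simp add: linear_add[OF lf])
  then show ?thesis using nn_integral_lborel_translate[of "\<lambda>y. g (f y)" "inv f c"] by simp
qed

text \<open>Uniqueness of Haar measure, specialised: comparing \<open>\<nu> = \<lambda> \<circ> f\<inverse>\<close> with
  \<open>\<lambda>\<close> by integrating \<open>1\<^sub>B(x) 1\<^sub>A(x + f y)\<close> in both orders, for the unit ball \<open>B\<close>.\<close>

lemma lborel_distr_orthogonal:
  fixes f :: "'a::euclidean_space \<Rightarrow> 'a"
  assumes f: "orthogonal_transformation f"
  shows "distr lborel borel f = lborel"
proof (rule measure_eqI)
  have [measurable]: "f \<in> borel_measurable borel"
    using linear_continuous_on[OF linear_conv_bounded_linear[THEN iffD1, OF orthogonal_transformation_linear[OF f]]]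
    by (rule borel_measurable_continuous_onI)
  fix A assume "A \<in> sets (distr lborel borel f)"
  then have [measurable]: "A \<in> sets borel" by simp
  define B :: "'a set" where "B = cball 0 1"
  have [measurable]: "B \<in> sets borel" unfolding B_def by simp
  have B: "emeasure lborel B \<noteq> 0" "emeasure lborel B \<noteq> \<infinity>"
    unfolding B_def using content_cball_pos[of 1 "0::'a"]
    by (auto simp: emeasure_eq_ennreal_measure emeasure_lborel_cball_finite less_top[symmetric] measure_def)
  have "emeasure lborel B * emeasure (distr lborel borel f) A
      = (\<integral>\<^sup>+x. indicator B x * (\<integral>\<^sup>+y. indicator A (f y) \<partial>lborel) \<partial>lborel)"
  proof -
    have "emeasure (distr lborel borel f) A = (\<integral>\<^sup>+y. indicator A (f y) \<partial>lborel)"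
      by (subst nn_integral_indicator[symmetric], simp, subst nn_integral_distr) auto
    then show ?thesis by (simp add: nn_integral_multc)
  qed
  also have "\<dots> = (\<integral>\<^sup>+x. \<integral>\<^sup>+y. indicator B x * indicator A (x + f y) \<partial>lborel \<partial>lborel)"
    by (simp add: nn_integral_cmult nn_integral_lborel_uminus_shift[OF _ f])
  also have "\<dots> = (\<integral>\<^sup>+y. \<integral>\<^sup>+x. indicator B x * indicator A (x + f y) \<partial>lborel \<partial>lborel)"
    by (rule lborel_pair.Fubini') measurable
  also have "\<dots> = (\<integral>\<^sup>+y. \<integral>\<^sup>+x. indicator B (- f y + x) * indicator A x \<partial>lborel \<partial>lborel)"
  proof (rule nn_integral_cong)
    fix y
    show "(\<integral>\<^sup>+x. indicator B x * indicator A (x + f y) \<partial>lborel) = (\<integral>\<^sup>+x. indicator B (- f y + x) * indicator A x \<partial>lborel)"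
      using nn_integral_lborel_translate[of "\<lambda>x. indicator B (- f y + x) * indicator A x" "f y"]
      by (simp add: add.commute)
  qed
  also have "\<dots> = (\<integral>\<^sup>+x. \<integral>\<^sup>+y. indicator B (- f y + x) * indicator A x \<partial>lborel \<partial>lborel)"
    by (rule lborel_pair.Fubini') measurable
  \<comment> \<open>The ball is symmetric about the origin, so the difference of \<open>x\<close>
    and \<open>f y\<close> may change its sign.\<close>
  also have "\<dots> = (\<integral>\<^sup>+x. \<integral>\<^sup>+y. indicator B (- x + f y) * indicator A x \<partial>lborel \<partial>lborel)"
    by (intro nn_integral_cong) (auto simp: B_def indicator_def dist_norm norm_minus_commute)
  also have "\<dots> = (\<integral>\<^sup>+x. indicator A x * (\<integral>\<^sup>+y. indicator B (f y) \<partial>lborel) \<partial>lborel)"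
  proof (rule nn_integral_cong)
    fix x :: 'a
    have "(\<integral>\<^sup>+y. indicator B (- x + f y) * indicator A x \<partial>lborel) = (\<integral>\<^sup>+y. indicator B (- x + f y) \<partial>lborel) * indicator A x"
      by (rule nn_integral_multc) measurable
    also have "(\<integral>\<^sup>+y. indicator B (- x + f y) \<partial>lborel) = (\<integral>\<^sup>+y. indicator B (f y) \<partial>lborel)"
      by (rule nn_integral_lborel_uminus_shift[OF _ f]) measurable
    finally show "(\<integral>\<^sup>+y. indicator B (- x + f y) * indicator A x \<partial>lborel) = indicator A x * (\<integral>\<^sup>+y. indicator B (f y) \<partial>lborel)"
      by (simp add: mult.commute)
  qed
  \<comment> \<open>The ball is invariant under \<open>f\<close>; this fixes the proportionality
    constant of the two measures at one.\<close>
  also have "(\<integral>\<^sup>+y. indicator B (f y) \<partial>lborel) = emeasure lborel B"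
    by (subst nn_integral_indicator[symmetric], simp, rule nn_integral_cong)
       (auto simp: B_def indicator_def orthogonal_transformation_norm[OF f])
  finally have "emeasure lborel B * emeasure (distr lborel borel f) A = emeasure lborel B * emeasure lborel A"
    by (simp add: nn_integral_multc mult.commute)
  then show "emeasure (distr lborel borel f) A = emeasure lborel A"
    using B by (simp add: ennreal_mult_cancel_left)
qed simp

text \<open>Shared by the surface measure and by the two parts of a signed measure. Functions are
  controlled on the sphere only, so each estimate goes through an almost-everywhere
  statement.\<close>

locale sph_measure =
  fixes M :: "(real^'n::finite) measure"
  assumes fin: "finite_measure M" and sets_M [measurable_cong, simp]: "sets M = sets borel"
    and null: "emeasure M (- Sph) = 0"
begin

sublocale finite_measure M by (rule fin)

lemma space_M [simp]: "space M = UNIV"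
  using sets_eq_imp_space_eq[OF sets_M] by simp

lemma AE_Sph: "AE x in M. x \<in> Sph"
  by (rule AE_I[of _ _ "- Sph"]) (use null in auto)

lemma integrable_bounded:
  assumes "f \<in> borel_measurable borel" "\<And>x. x \<in> Sph \<Longrightarrow> \<bar>f x\<bar> \<le> (C::real)"
  shows "integrable M f"
proof (rule integrable_const_bound[of _ C])
  show "AE x in M. norm (f x) \<le> C" using AE_Sph by eventually_elim (use assms in auto)
qed (use assms in simp)

lemma integral_cong_Sph:
  assumes "f \<in> borel_measurable borel" "g \<in> borel_measurable borel" "\<And>x. x \<in> Sph \<Longrightarrow> f x = (g x::real)"
  shows "integral\<^sup>L M f = integral\<^sup>L M g"
  by (rule integral_cong_AE) (use AE_Sph assms in auto)

lemma integral_mono_Sph: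
  assumes "integrable M f" "integrable M g" "\<And>x. x \<in> Sph \<Longrightarrow> f x \<le> (g x::real)"
  shows "integral\<^sup>L M f \<le> integral\<^sup>L M g"
  by (rule integral_mono_AE) (use AE_Sph assms in auto)

lemma integral_nonneg_Sph:
  assumes "\<And>x. x \<in> Sph \<Longrightarrow> 0 \<le> (f x::real)"
  shows "0 \<le> integral\<^sup>L M f"
  by (rule integral_nonneg_AE) (use AE_Sph assms in auto)

lemma abs_integral_le_Sph:
  assumes "integrable M f" "\<And>x. x \<in> Sph \<Longrightarrow> \<bar>f x\<bar> \<le> (C::real)"
  shows "\<bar>integral\<^sup>L M f\<bar> \<le> C * measure M UNIV"
proof -
  have "\<bar>integral\<^sup>L M f\<bar> \<le> (\<integral>x. \<bar>f x\<bar> \<partial>M)" by simp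
  also have "\<dots> \<le> (\<integral>x. C \<partial>M)" by (rule integral_mono_Sph) (use assms in auto)
  finally show ?thesis by (simp add: mult.commute)
qed

end

lemma emeasure_surf:
  assumes "A \<in> sets borel"
  shows "emeasure (surf :: (real^'n::finite) measure) A =
    of_nat CARD('n) * emeasure lborel {x. norm x \<le> 1 \<and> x \<noteq> 0 \<and> (1 / norm x) *\<^sub>R x \<in> A}"
proof -
  have m: "(\<lambda>x. (1 / norm x) *\<^sub>R x) \<in> measurable (restrict_space lborel (cball 0 1 - {0 :: real^'n})) borel"
    by (rule measurable_restrict_space1) measurable
  have "emeasure (distr (restrict_space lborel (cball 0 1 - {0})) borel (\<lambda>x. (1 / norm x) *\<^sub>R x)) A
     = emeasure lborel {x::real^'n. norm x \<le> 1 \<and> x \<noteq> 0 \<and> (1 / norm x) *\<^sub>R x \<in> A}"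
    using assms
    by (subst emeasure_distr[OF m])
       (auto simp: emeasure_restrict_space space_restrict_space intro!: arg_cong[where f="emeasure lborel"])
  then show ?thesis
    unfolding surf_def by (simp only: emeasure_scale_measure ennreal_of_nat_eq_real_of_nat)
qed

lemma sets_surf [measurable_cong, simp]: "sets (surf :: (real^'n::finite) measure) = sets borel"
  by (simp add: surf_def)

lemma borel_cone:
  fixes A :: "(real^'n::finite) set"
  assumes [measurable]: "A \<in> sets borel"
  shows "{x. norm x \<le> 1 \<and> x \<noteq> 0 \<and> (1 / norm x) *\<^sub>R x \<in> A} \<in> sets borel"
  by measurable

interpretation surf: sph_measure "surf :: (real^'n::finite) measure"
proof (rule sph_measure.intro)
  have "{x::real^'n. norm x \<le> 1 \<and> x \<noteq> 0 \<and> (1 / norm x) *\<^sub>R x \<in> UNIV} \<subseteq> cball 0 1" by auto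
  then have "emeasure lborel {x::real^'n. norm x \<le> 1 \<and> x \<noteq> 0 \<and> (1 / norm x) *\<^sub>R x \<in> UNIV} \<le> emeasure lborel (cball (0::real^'n) 1)"
    by (rule emeasure_mono) simp
  also have "\<dots> < \<infinity>" using emeasure_lborel_cball_finite by (simp add: less_top)
  finally have "emeasure surf (UNIV :: (real^'n) set) \<noteq> \<infinity>"
    by (subst emeasure_surf) (auto simp: ennreal_mult_eq_top_iff)
  then show "finite_measure (surf :: (real^'n) measure)"
    using sets_eq_imp_space_eq[OF sets_surf[where 'n='n]] by (intro finite_measureI) simp
  have "{x::real^'n. norm x \<le> 1 \<and> x \<noteq> 0 \<and> (1 / norm x) *\<^sub>R x \<in> - Sph} = {}" by auto
  then show "emeasure (surf :: (real^'n) measure) (- Sph) = 0"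
    by (subst emeasure_surf) auto
qed simp

lemma orthogonal_transformation_borel:
  fixes f :: "'a::euclidean_space \<Rightarrow> 'a"
  assumes f: "orthogonal_transformation f"
  shows "f \<in> borel_measurable borel"
  using linear_continuous_on[OF linear_conv_bounded_linear[THEN iffD1, OF orthogonal_transformation_linear[OF f]]]
  by (rule borel_measurable_continuous_onI)

text \<open>An orthogonal map commutes with radial projection, so the cone over a preimage is the
  preimage of the cone; the rest is the invariance of Lebesgue measure.\<close>

lemma surf_distr_orthogonal:
  fixes f :: "real^'n::finite \<Rightarrow> real^'n"
  assumes f: "orthogonal_transformation f"
  shows "distr surf borel f = surf"
proof (rule measure_eqI)
  note [measurable] = orthogonal_transformation_borel[OF f]
  fix A assume "A \<in> sets (distr surf borel f)"
  then have [measurable]: "A \<in> sets borel" by simp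
  have "{x. norm x \<le> 1 \<and> x \<noteq> 0 \<and> (1 / norm x) *\<^sub>R x \<in> f -` A}
      = f -` {x. norm x \<le> 1 \<and> x \<noteq> 0 \<and> (1 / norm x) *\<^sub>R x \<in> A}"
  proof -
    have "f x = 0 \<longleftrightarrow> x = 0" for x
      using orthogonal_transformation_norm[OF f, of x] by (metis norm_eq_zero)
    then show ?thesis
      by (auto simp: orthogonal_transformation_scaleR[OF f] orthogonal_transformation_norm[OF f])
  qed
  then have "emeasure lborel {x. norm x \<le> 1 \<and> x \<noteq> 0 \<and> (1 / norm x) *\<^sub>R x \<in> f -` A}
    = emeasure (distr lborel borel f) {x. norm x \<le> 1 \<and> x \<noteq> 0 \<and> (1 / norm x) *\<^sub>R x \<in> A}"
    using borel_cone[of A] by (subst emeasure_distr) auto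
  moreover have "emeasure (distr surf borel f) A = emeasure surf (f -` A)"
    by (subst emeasure_distr) auto
  moreover have "f -` A \<in> sets borel" using measurable_sets[of f borel borel A] by simp
  ultimately show "emeasure (distr surf borel f) A = emeasure surf A"
    by (simp add: emeasure_surf lborel_distr_orthogonal[OF f])
qed simp

lemma surf_integral_orthogonal:
  fixes f :: "real^'n::finite \<Rightarrow> real^'n"
  assumes "orthogonal_transformation f" "g \<in> borel_measurable borel"
  shows "(\<integral>x. g (f x) \<partial>surf) = (\<integral>x. (g x :: real) \<partial>surf)"
  using integral_distr[of f surf borel g] assms orthogonal_transformation_borel[OF assms(1)]
  by (simp add: surf_distr_orthogonal)

lemma omega_eq: "omega TYPE('n::finite) = measure (surf :: (real^'n) measure) UNIV"
  unfolding omega_def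
  by (rule measure_eq_AE) (use surf.AE_Sph[where 'n='n] in auto)

lemma omega_pos: "omega TYPE('n::finite) > 0"
proof -
  have eq: "emeasure lborel {x::real^'n. norm x \<le> 1 \<and> x \<noteq> 0 \<and> (1 / norm x) *\<^sub>R x \<in> UNIV} = emeasure lborel (cball (0::real^'n) 1)"
    by (rule emeasure_eq_AE) (use AE_lborel_singleton[of "0::real^'n"] in auto)
  have "emeasure (surf :: (real^'n) measure) UNIV \<noteq> 0"
    using content_cball_pos[of 1 "0::real^'n"]
    by (subst emeasure_surf, simp, unfold eq) (auto simp: measure_def)
  then show ?thesis
    unfolding omega_eq by (simp add: surf.emeasure_eq_measure zero_less_measure_iff)
qed

lemma abs_inner_le_1:
  fixes x y :: "real^'n::finite"
  assumes "x \<in> Sph" "y \<in> Sph"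
  shows "\<bar>x \<bullet> y\<bar> \<le> 1"
  using Cauchy_Schwarz_ineq2[of x y] assms by simp

lemma continuous_bounded_unit_interval:
  assumes "continuous_on UNIV (p :: real \<Rightarrow> real)"
  obtains C where "C \<ge> 0" "\<And>s. \<bar>s\<bar> \<le> 1 \<Longrightarrow> \<bar>p s\<bar> \<le> C"
proof -
  have "compact (p ` {-1..1})"
    by (rule compact_continuous_image[OF continuous_on_subset[OF assms]]) auto
  then obtain C where C: "\<And>y. y \<in> p ` {-1..1} \<Longrightarrow> norm y \<le> C"
    using compact_imp_bounded bounded_iff by metis
  have "\<bar>p s\<bar> \<le> max C 0" if "\<bar>s\<bar> \<le> 1" for s
    using C[of "p s"] that by (force simp: abs_le_iff)
  then show ?thesis using that[of "max C 0"] by simp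
qed

context sph_measure begin

lemma integrable_zonal:
  assumes p: "continuous_on UNIV (p :: real \<Rightarrow> real)" and y: "y \<in> Sph"
  shows "integrable M (\<lambda>z. p (z \<bullet> y))"
proof -
  obtain C where C: "\<And>s. \<bar>s\<bar> \<le> 1 \<Longrightarrow> \<bar>p s\<bar> \<le> C"
    using continuous_bounded_unit_interval[OF p] by blast
  show ?thesis
  proof (rule integrable_bounded)
    show "(\<lambda>z. p (z \<bullet> y)) \<in> borel_measurable borel"
      by (intro borel_measurable_continuous_onI continuous_on_compose2[OF p] continuous_intros) auto
    show "\<bar>p (x \<bullet> y)\<bar> \<le> C" if "x \<in> Sph" for x using C abs_inner_le_1[OF that y] by blast
  qed
qed

end

section \<open>Integrals of zonal functions and moments of the surface measure\<close>

lemma surf_integral_zonal_indep: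
  fixes y y' :: "real^'n::finite"
  assumes p: "continuous_on UNIV (p :: real \<Rightarrow> real)" and y: "y \<in> Sph" "y' \<in> Sph"
  shows "(\<integral>z. p (z \<bullet> y) \<partial>surf) = (\<integral>z. p (z \<bullet> y') \<partial>surf)"
proof -
  obtain f where f: "orthogonal_transformation f" "f y = y'"
    using orthogonal_transformation_exists[of y y'] y by auto
  have "(\<integral>z. p (z \<bullet> y) \<partial>surf) = (\<integral>z. p (f z \<bullet> y') \<partial>surf)"
    using f by (metis orthogonal_transformation_def)
  also have "\<dots> = (\<integral>z. p (z \<bullet> y') \<partial>surf)"
    by (rule surf_integral_orthogonal[OF f(1), of "\<lambda>z. p (z \<bullet> y')"])
      (intro borel_measurable_continuous_onI continuous_on_compose2[OF p] continuous_intros; auto)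
  finally show ?thesis .
qed

text \<open>Comparing coefficients of \<open>b\<^sup>2\<close> in \<open>\<integral>(z\<sqdot>y + b z\<sqdot>e)\<^sup>2\<^sup>p = (1 + b\<^sup>2)\<^sup>p \<integral>(z\<sqdot>y)\<^sup>2\<^sup>p\<close>,
  which is rotation invariance.\<close>

lemma surf_moment_orthogonal:
  fixes y e :: "real^'n::finite"
  assumes y: "y \<in> Sph" and e: "e \<in> Sph" and ye: "y \<bullet> e = 0"
  shows "(real j + 1) * (\<integral>z. (z \<bullet> y)^j * (z \<bullet> e)\<^sup>2 \<partial>surf) = (\<integral>z. (z \<bullet> y)^(j+2) \<partial>surf)"
proof (cases "even j")
  case False
  \<comment> \<open>For odd \<open>j\<close> both integrands are odd under the antipodal map, so
    both sides vanish.\<close>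
  have neg: "orthogonal_transformation (\<lambda>x::real^'n. - x)"
    by (simp add: orthogonal_transformation_neg)
  have "(\<integral>z. (- z \<bullet> y)^j * (- z \<bullet> e)\<^sup>2 \<partial>surf) = (\<integral>z. (z \<bullet> y)^j * (z \<bullet> e)\<^sup>2 \<partial>surf)"
    by (rule surf_integral_orthogonal[OF neg]) measurable
  moreover have "(\<integral>z. (- z \<bullet> y)^(j+2) \<partial>surf) = (\<integral>z. (z \<bullet> y)^(j+2) \<partial>surf)"
    by (rule surf_integral_orthogonal[OF neg]) measurable
  ultimately show ?thesis using False by (simp add: power_minus_odd)
next
  case True
  then obtain q where q: "j = 2 * q" by (elim evenE)
  define N where "N = j + 2"
  define p where "p = q + 1"
  have N: "N = 2 * p" unfolding N_def p_def q by simp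
  define E where "E = (\<lambda>i. (\<integral>z. (z \<bullet> e)^i * (z \<bullet> y)^(N-i) \<partial>surf))"
  define M where "M = (\<integral>z. (z \<bullet> y)^N \<partial>surf)"
  have int: "integrable surf (\<lambda>z::real^'n. (z \<bullet> e)^i * (z \<bullet> y)^k)" for i k
  proof (rule surf.integrable_bounded[of _ 1])
    fix x :: "real^'n" assume x: "x \<in> Sph"
    have "\<bar>x \<bullet> e\<bar>^i * \<bar>x \<bullet> y\<bar>^k \<le> 1 * 1"
      using abs_inner_le_1[OF x e] abs_inner_le_1[OF x y] by (intro mult_mono power_le_one) auto
    then show "\<bar>(x \<bullet> e)^i * (x \<bullet> y)^k\<bar> \<le> 1" by (simp add: abs_mult power_abs)
  qed measurable
  have L: "(\<integral>z. (z \<bullet> (y + b *\<^sub>R e))^N \<partial>surf) = (\<Sum>i\<le>N. (real (N choose i) * E i) * b^i)" for b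
  proof -
    have "(z \<bullet> (y + b *\<^sub>R e))^N = (\<Sum>i\<le>N. real (N choose i) * b^i * ((z \<bullet> e)^i * (z \<bullet> y)^(N-i)))" for z
      unfolding inner_add_right inner_scaleR_right add.commute[of "z \<bullet> y" "b * (z \<bullet> e)"] binomial_ring power_mult_distrib
      by (simp only: mult_ac)
    then have "(\<integral>z. (z \<bullet> (y + b *\<^sub>R e))^N \<partial>surf)
        = (\<integral>z. (\<Sum>i\<le>N. real (N choose i) * b^i * ((z \<bullet> e)^i * (z \<bullet> y)^(N-i))) \<partial>surf)"
      by (simp only:)
    also have "\<dots> = (\<Sum>i\<le>N. \<integral>z. real (N choose i) * b^i * ((z \<bullet> e)^i * (z \<bullet> y)^(N-i)) \<partial>surf)"
      by (intro Bochner_Integration.integral_sum integrable_mult_right int)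
    also have "\<dots> = (\<Sum>i\<le>N. (real (N choose i) * E i) * b^i)"
    proof (rule sum.cong[OF refl])
      fix i
      have "(\<integral>z. real (N choose i) * b^i * ((z \<bullet> e)^i * (z \<bullet> y)^(N-i)) \<partial>surf) = real (N choose i) * b^i * E i"
        unfolding E_def by (rule integral_mult_right_zero)
      then show "(\<integral>z. real (N choose i) * b^i * ((z \<bullet> e)^i * (z \<bullet> y)^(N-i)) \<partial>surf) = (real (N choose i) * E i) * b^i"
        by simp
    qed
    finally show ?thesis .
  qed
  \<comment> \<open>The vector \<open>y + b e\<close> has norm
    \<open>r = sqrt (1 + b\<^sup>2)\<close>. Scaling it to the sphere pulls out
    \<open>r ^ N\<close>, and the remaining integral does not depend on the axis.\<close>
  have R: "(\<integral>z. (z \<bullet> (y + b *\<^sub>R e))^N \<partial>surf) = (1 + b\<^sup>2)^p * M" for b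
  proof -
    define r where "r = sqrt (1 + b\<^sup>2)"
    have r: "r > 0" "r\<^sup>2 = 1 + b\<^sup>2" unfolding r_def by (auto intro: add_pos_nonneg)
    have "(norm (y + b *\<^sub>R e))\<^sup>2 = r\<^sup>2"
      using y e ye by (simp only: power2_norm_eq_inner inner_add_left inner_add_right inner_scaleR_left
          inner_scaleR_right r) (simp add: norm_eq_1 inner_commute power2_eq_square)
    then have nr: "norm (y + b *\<^sub>R e) = r" using r(1) by (simp add: power2_eq_iff_nonneg)
    have "(z \<bullet> (y + b *\<^sub>R e))^N = (1 + b\<^sup>2)^p * (z \<bullet> ((1/r) *\<^sub>R (y + b *\<^sub>R e)))^N" for z
    proof -
      have "r ^ N = (1 + b\<^sup>2)^p" unfolding N power_mult r ..
      moreover have "1 + b\<^sup>2 \<noteq> 0" using zero_le_power2[of b] by linarith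
      ultimately show ?thesis by (simp add: power_divide)
    qed
    then have "(\<integral>z. (z \<bullet> (y + b *\<^sub>R e))^N \<partial>surf) = (1 + b\<^sup>2)^p * (\<integral>z. (z \<bullet> ((1/r) *\<^sub>R (y + b *\<^sub>R e)))^N \<partial>surf)"
      by simp
    also have "(\<integral>z. (z \<bullet> ((1/r) *\<^sub>R (y + b *\<^sub>R e)))^N \<partial>surf) = M"
      unfolding M_def by (rule surf_integral_zonal_indep[of "\<lambda>s. s^N"])
        (use nr r y in \<open>auto intro!: continuous_intros\<close>)
    finally show ?thesis .
  qed
  have R2: "(1 + b\<^sup>2)^p * M = (\<Sum>i\<le>N. (if even i then real (p choose (i div 2)) * M else 0) * b^i)" for b
  proof -
    have "(1 + b\<^sup>2)^p * M = (\<Sum>k\<le>p. real (p choose k) * M * b^(2*k))"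
    proof -
      have eq: "(1 + b\<^sup>2)^p = (\<Sum>k\<le>p. real (p choose k) * b^(2*k))"
        using binomial_ring[of "b\<^sup>2" 1 p] by (simp add: add.commute power_mult)
      show ?thesis unfolding eq sum_distrib_right by (intro sum.cong refl) (simp only: mult_ac)
    qed
    also have "\<dots> = (\<Sum>i\<in>(\<lambda>k. 2*k) ` {..p}. (if even i then real (p choose (i div 2)) * M else 0) * b^i)"
      by (subst sum.reindex) (auto simp: inj_on_def)
    also have "\<dots> = (\<Sum>i\<le>N. (if even i then real (p choose (i div 2)) * M else 0) * b^i)"
    proof (rule sum.mono_neutral_left)
      show "\<forall>i\<in>{..N} - (\<lambda>k. 2*k) ` {..p}. (if even i then real (p choose (i div 2)) * M else 0) * b^i = 0"
      proof
        fix i assume i: "i \<in> {..N} - (\<lambda>k. 2*k) ` {..p}"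
        have "odd i"
        proof
          assume "even i"
          then have "i = 2 * (i div 2)" by simp
          moreover have "i div 2 \<le> p" using i N by auto
          ultimately show False using i by blast
        qed
        then show "(if even i then real (p choose (i div 2)) * M else 0) * b^i = 0" by simp
      qed
    qed (auto simp: N)
    finally show ?thesis .
  qed
  have "\<forall>b. (\<Sum>i\<le>N. (real (N choose i) * E i) * b^i) = (\<Sum>i\<le>N. (if even i then real (p choose (i div 2)) * M else 0) * b^i)"
    by (intro allI) (simp only: L[symmetric] R2[symmetric] R)
  then have "\<forall>i\<le>N. real (N choose i) * E i = (if even i then real (p choose (i div 2)) * M else 0)"
    by (simp only: polyfun_eq_coeffs)
  moreover have "2 \<le> N" by (simp add: N_def)
  ultimately have "real (N choose 2) * E 2 = (if even (2::nat) then real (p choose (2 div 2)) * M else 0)"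
    by (elim allE[of _ 2] impE)
  then have "real (N choose 2) * E 2 = real p * M" by simp
  \<comment> \<open>With \<open>N = 2p\<close> and \<open>j = 2q\<close>, \<open>p = q + 1\<close>,
    the binomial coefficient is \<open>p (j + 1)\<close>, and \<open>p\<close> cancels against the
    right side.\<close>
  moreover have "real (N choose 2) = real p * (real j + 1)"
  proof -
    have "N * (N - 1) = 2 * (p * (j + 1))" unfolding N q p_def by simp
    then have "N choose 2 = p * (j + 1)" unfolding choose_two by simp
    then show ?thesis by (simp add: algebra_simps)
  qed
  ultimately have "(real j + 1) * E 2 = M" using p_def by simp
  then show ?thesis unfolding E_def M_def N_def by (simp add: mult.commute)
qed

text \<open>It suffices to take a coordinate axis: there \<open>1 - s\<^sup>2\<close> is the sum of
  the squares of the other \<open>m\<close> coordinates, each of which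
  \<open>surf_moment_orthogonal\<close> evaluates.\<close>

lemma surf_moment_rec:
  fixes y :: "real^'n::finite"
  assumes y: "y \<in> Sph"
  shows "(real j + 1) * ((\<integral>z. (z \<bullet> y)^j \<partial>surf) - (\<integral>z. (z \<bullet> y)^(j+2) \<partial>surf)) = (real CARD('n) - 1) * (\<integral>z. (z \<bullet> y)^(j+2) \<partial>surf)"
proof -
  define i0 :: 'n where "i0 = undefined"
  define a where "a = axis i0 (1::real)"
  have a: "a \<in> Sph" unfolding a_def by (simp add: norm_axis_1)
  have pw: "(\<integral>z. (z \<bullet> y)^k \<partial>surf) = (\<integral>z. (z \<bullet> a)^k \<partial>surf)" for k
    by (rule surf_integral_zonal_indep[of "\<lambda>s. s^k"]) (use y a in \<open>auto intro!: continuous_intros\<close>)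
  have intp: "integrable surf (\<lambda>z. (z \<bullet> a)^k)" for k
    by (rule surf.integrable_zonal[of "\<lambda>s. s^k", OF _ a]) (intro continuous_intros)
  have int: "integrable surf (\<lambda>z. (z \<bullet> a)^k * (z \<bullet> axis i 1)\<^sup>2)" for k i
  proof (rule surf.integrable_bounded[of _ 1])
    fix x :: "real^'n" assume x: "x \<in> Sph"
    have "\<bar>x \<bullet> a\<bar>^k * \<bar>x \<bullet> axis i 1\<bar>\<^sup>2 \<le> 1 * 1"
      using abs_inner_le_1[OF x a] abs_inner_le_1[OF x, of "axis i 1"]
      by (intro mult_mono power_le_one) (auto simp: norm_axis_1)
    then show "\<bar>(x \<bullet> a)^k * (x \<bullet> axis i 1)\<^sup>2\<bar> \<le> 1" by (simp add: abs_mult power_abs)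
  qed measurable
  have "(real j + 1) * ((\<integral>z. (z \<bullet> a)^j \<partial>surf) - (\<integral>z. (z \<bullet> a)^(j+2) \<partial>surf))
      = (real j + 1) * (\<integral>z. (\<Sum>i\<in>UNIV - {i0}. (z \<bullet> a)^j * (z \<bullet> axis i 1)\<^sup>2) \<partial>surf)"
  proof -
    have "(\<integral>z. (z \<bullet> a)^j - (z \<bullet> a)^(j+2) \<partial>surf) = (\<integral>z. (\<Sum>i\<in>UNIV - {i0}. (z \<bullet> a)^j * (z \<bullet> axis i 1)\<^sup>2) \<partial>surf)"
    proof (rule surf.integral_cong_Sph)
      fix x :: "real^'n" assume "x \<in> Sph"
      then have "1 = x \<bullet> x" by (simp add: norm_eq_1)
      also have "\<dots> = (\<Sum>i\<in>UNIV. (x \<bullet> axis i 1)\<^sup>2)"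
        by (simp add: inner_vec_def[of x x] inner_axis power2_eq_square)
      also have "\<dots> = (x \<bullet> a)\<^sup>2 + (\<Sum>i\<in>UNIV - {i0}. (x \<bullet> axis i 1)\<^sup>2)"
        unfolding a_def by (rule sum.remove) auto
      finally have "(\<Sum>i\<in>UNIV - {i0}. (x \<bullet> axis i 1)\<^sup>2) = 1 - (x \<bullet> a)\<^sup>2" by simp
      then show "(x \<bullet> a)^j - (x \<bullet> a)^(j+2) = (\<Sum>i\<in>UNIV - {i0}. (x \<bullet> a)^j * (x \<bullet> axis i 1)\<^sup>2)"
        by (simp add: power_add right_diff_distrib power2_eq_square flip: sum_distrib_left)
    qed measurable
    moreover have "(\<integral>z. (z \<bullet> a)^j - (z \<bullet> a)^(j+2) \<partial>surf) = (\<integral>z. (z \<bullet> a)^j \<partial>surf) - (\<integral>z. (z \<bullet> a)^(j+2) \<partial>surf)"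
      using intp[of j] intp[of "j+2"] by (rule Bochner_Integration.integral_diff)
    ultimately show ?thesis by simp
  qed
  also have "\<dots> = (\<Sum>i\<in>UNIV - {i0}. (real j + 1) * (\<integral>z. (z \<bullet> a)^j * (z \<bullet> axis i 1)\<^sup>2 \<partial>surf))"
    using int by (simp add: sum_distrib_left)
  also have "\<dots> = (\<Sum>i\<in>UNIV - {i0}. (\<integral>z. (z \<bullet> a)^(j+2) \<partial>surf))"
    by (intro sum.cong refl surf_moment_orthogonal a) (auto simp: a_def norm_axis_1 inner_axis_axis)
  also have "\<dots> = (real CARD('n) - 1) * (\<integral>z. (z \<bullet> a)^(j+2) \<partial>surf)"
    by (simp add: card_Diff_singleton of_nat_diff)
  finally show ?thesis unfolding pw .
qed

text \<open>Integration by parts in \<open>s = z \<sqdot> y\<close>: against the density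
  \<open>(1 - s\<^sup>2) powr (m/2 - 1)\<close> the integrand is the derivative of
  \<open>(1 - s\<^sup>2) powr (m/2)\<close> times \<open>p\<close>. The proof obtains it monomial by
  monomial from the moment recurrence.\<close>

lemma surf_integral_poly:
  fixes y :: "real^'n::finite"
  assumes y: "y \<in> Sph"
  shows "(\<integral>z. (1 - (z \<bullet> y)\<^sup>2) * poly (pderiv p) (z \<bullet> y) - (real CARD('n) - 1) * (z \<bullet> y) * poly p (z \<bullet> y) \<partial>surf) = 0"
proof -
  define \<phi> where "\<phi> = (\<lambda>p s. (1 - s\<^sup>2) * poly (pderiv p) s - (real CARD('n) - 1) * s * poly p s)"
  have int: "integrable surf (\<lambda>z. \<phi> q (z \<bullet> y))" for q
    by (rule surf.integrable_zonal[OF _ y]) (auto simp: \<phi>_def intro!: continuous_intros)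
  have intp: "integrable surf (\<lambda>z. (z \<bullet> y)^k)" for k
    by (rule surf.integrable_zonal[of "\<lambda>s. s^k", OF _ y]) (intro continuous_intros)
  have mon: "(\<integral>z. \<phi> (monom c i) (z \<bullet> y) \<partial>surf) = 0" for c i
  proof (cases i)
    case 0
    have neg: "orthogonal_transformation (\<lambda>x::real^'n. - x)"
      by (simp add: orthogonal_transformation_neg)
    have "(\<integral>z. - z \<bullet> y \<partial>surf) = (\<integral>z. z \<bullet> y \<partial>surf)"
      by (rule surf_integral_orthogonal[OF neg]) measurable
    then have "(\<integral>z. z \<bullet> y \<partial>surf) = 0" by simp
    then show ?thesis using 0 by (simp add: \<phi>_def pderiv_monom monom_0 mult_ac)
  next
    case (Suc j)
    have "\<phi> (monom c i) s = c * (real j + 1) * s^j - c * (real j + 1) * s^(j+2) - (real CARD('n) - 1) * c * s^(j+2)" for s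
      unfolding \<phi>_def Suc pderiv_monom poly_monom by (simp add: algebra_simps power2_eq_square)
    then have "(\<integral>z. \<phi> (monom c i) (z \<bullet> y) \<partial>surf)
      = c * (real j + 1) * (\<integral>z. (z \<bullet> y)^j \<partial>surf) - c * (real j + 1) * (\<integral>z. (z \<bullet> y)^(j+2) \<partial>surf)
        - (real CARD('n) - 1) * c * (\<integral>z. (z \<bullet> y)^(j+2) \<partial>surf)"
      using intp[of "j+2"] intp[of j] by simp
    also have "\<dots> = c * ((real j + 1) * ((\<integral>z. (z \<bullet> y)^j \<partial>surf) - (\<integral>z. (z \<bullet> y)^(j+2) \<partial>surf))
        - (real CARD('n) - 1) * (\<integral>z. (z \<bullet> y)^(j+2) \<partial>surf))"
      by (simp add: algebra_simps)
    finally show ?thesis unfolding surf_moment_rec[OF y] by simp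
  qed
  have "\<phi> p s = (\<Sum>i\<le>degree p. \<phi> (monom (coeff p i) i) s)" for s
  proof -
    have "poly p s = (\<Sum>i\<le>degree p. poly (monom (coeff p i) i) s)"
      by (subst poly_as_sum_of_monoms[symmetric]) (simp add: poly_sum)
    moreover have "poly (pderiv p) s = (\<Sum>i\<le>degree p. poly (pderiv (monom (coeff p i) i)) s)"
      by (subst poly_as_sum_of_monoms[symmetric]) (simp add: poly_sum higher_pderiv_sum[of 1, simplified])
    ultimately show ?thesis by (simp add: \<phi>_def sum_subtractf sum_distrib_left)
  qed
  then have "(\<integral>z. \<phi> p (z \<bullet> y) \<partial>surf) = (\<Sum>i\<le>degree p. (\<integral>z. \<phi> (monom (coeff p i) i) (z \<bullet> y) \<partial>surf))"
    using int by simp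
  then show ?thesis unfolding mon by (simp add: \<phi>_def)
qed

subsection \<open>Zonal averages\<close>

lemma surf_sph_measure: "sph_measure (surf :: (real^'n::finite) measure)"
  by (rule surf.sph_measure_axioms)

text \<open>The bound on \<open>f\<close> is available on the sphere only, so it becomes an
  almost-everywhere bound on the product space before Fubini's theorem is applied.\<close>

lemma sph_pair:
  fixes M N :: "(real^'n::finite) measure"
  assumes M: "sph_measure M" and N: "sph_measure N"
    and f [measurable]: "(\<lambda>(x, y). f x y) \<in> borel_measurable (borel \<Otimes>\<^sub>M borel)"
    and b: "\<And>x y. x \<in> Sph \<Longrightarrow> y \<in> Sph \<Longrightarrow> \<bar>f x y\<bar> \<le> (C::real)"
  shows sph_Fubini: "(\<integral>x. \<integral>y. f x y \<partial>N \<partial>M) = (\<integral>y. \<integral>x. f x y \<partial>M \<partial>N)"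
    and sph_integrable_inner: "integrable M (\<lambda>x. \<integral>y. f x y \<partial>N)"
    and sph_measurable_inner: "(\<lambda>x. \<integral>y. f x y \<partial>N) \<in> borel_measurable borel"
proof -
  interpret M: sph_measure M by fact
  interpret N: sph_measure N by fact
  interpret P: pair_sigma_finite M N by unfold_locales
  interpret Q: finite_measure "M \<Otimes>\<^sub>M N"
    by (rule finite_measure_pair_measure) unfold_locales
  have s: "sets (M \<Otimes>\<^sub>M N) = sets (borel \<Otimes>\<^sub>M borel)" by (rule sets_pair_measure_cong) auto
  have [measurable]: "(Sph :: (real^'n) set) \<in> sets borel" by (rule borel_closed) simp
  have "AE z in M \<Otimes>\<^sub>M N. fst z \<in> Sph \<and> snd z \<in> Sph"
  proof (rule P.AE_pair_measure)
    show "{z \<in> space (M \<Otimes>\<^sub>M N). fst z \<in> Sph \<and> snd z \<in> Sph} \<in> sets (M \<Otimes>\<^sub>M N)" by measurable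
    show "AE x in M. AE y in N. fst (x, y) \<in> Sph \<and> snd (x, y) \<in> Sph"
      using M.AE_Sph
    proof eventually_elim
      case (elim x)
      show ?case using N.AE_Sph by eventually_elim (use elim in auto)
    qed
  qed
  then have ae: "AE z in M \<Otimes>\<^sub>M N. norm (case z of (x, y) \<Rightarrow> f x y) \<le> C"
    by eventually_elim (use b in auto)
  have int: "integrable (M \<Otimes>\<^sub>M N) (\<lambda>(x, y). f x y)"
    by (rule Q.integrable_const_bound[OF ae]) (simp add: measurable_cong_sets[OF s refl])
  show "(\<integral>x. \<integral>y. f x y \<partial>N \<partial>M) = (\<integral>y. \<integral>x. f x y \<partial>M \<partial>N)"
    by (rule P.Fubini_integral[OF int, symmetric])
  show "integrable M (\<lambda>x. \<integral>y. f x y \<partial>N)"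
    using P.integrable_fst'[OF int] by simp
  have "(\<lambda>x. \<integral>y. f x y \<partial>N) \<in> borel_measurable M" by measurable
  then show "(\<lambda>x. \<integral>y. f x y \<partial>N) \<in> borel_measurable borel" by simp
qed

section \<open>Reflections, and rotations that fix the pole\<close>

definition householder :: "'a::real_inner \<Rightarrow> 'a \<Rightarrow> 'a" where
  "householder u x = x - (2 * (x \<bullet> u) / (u \<bullet> u)) *\<^sub>R u"

text \<open>For \<open>u = 0\<close> division by zero makes the map the identity, hence the case
  distinction in the proof.\<close>

lemma householder_orthogonal: "orthogonal_transformation (householder u)"
proof -
  have "linear (householder u)"
    by (rule linearI) (simp_all add: householder_def inner_add_left algebra_simps add_divide_distrib)
  moreover have "householder u v \<bullet> householder u w = v \<bullet> w" for v w
    by (cases "u = 0") (simp_all add: householder_def inner_diff_left inner_diff_right inner_commute)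
  ultimately show ?thesis by (simp add: orthogonal_transformation_def)
qed

lemma householder_swap:
  assumes "norm a = norm b"
  shows "householder (a - b) a = b" "householder (a - b) b = a"
proof -
  have n: "a \<bullet> a = b \<bullet> b" using assms by (simp add: norm_eq)
  have "2 * (a \<bullet> (a - b)) = (a - b) \<bullet> (a - b)" "2 * (b \<bullet> (a - b)) = - ((a - b) \<bullet> (a - b))"
    using n by (simp_all add: inner_diff_left inner_diff_right inner_commute)
  then show "householder (a - b) a = b" "householder (a - b) b = a"
    unfolding householder_def by (cases "a = b"; simp)+
qed

lemma householder_fix: "x \<bullet> u = 0 \<Longrightarrow> householder u x = x"
  by (simp add: householder_def)

text \<open>An orthogonal map taking \<open>u\<close> to \<open>v\<close> conjugates one reflection
  into the other. With determinants equal to \<open>1\<close> or \<open>-1\<close>, a product of two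
  such reflections then has determinant one.\<close>

lemma det_householder_eq:
  fixes u v :: "real^'n::finite"
  assumes "norm u = norm v"
  shows "det (matrix (householder u)) = det (matrix (householder v))"
proof -
  obtain Q where Q: "orthogonal_transformation Q" "Q u = v"
    using orthogonal_transformation_exists[OF assms] .
  have lq: "linear Q" "linear (householder u)" "linear (householder v)"
    using Q(1) householder_orthogonal orthogonal_transformation_linear by auto
  have "Q \<circ> householder u = householder v \<circ> Q"
  proof
    fix x
    have "Q x \<bullet> v = x \<bullet> u" "v \<bullet> v = u \<bullet> u" using Q unfolding orthogonal_transformation_def by metis+
    then show "(Q \<circ> householder u) x = (householder v \<circ> Q) x"
      using Q(2) by (simp add: householder_def linear_diff[OF lq(1)] linear_cmul[OF lq(1)])
  qed
  then have "matrix Q ** matrix (householder u) = matrix (householder v) ** matrix Q"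
    using lq by (simp flip: matrix_compose)
  then have "det (matrix Q) * det (matrix (householder u)) = det (matrix (householder v)) * det (matrix Q)"
    by (metis det_mul)
  moreover have "det (matrix Q) \<noteq> 0"
    using Q(1) det_orthogonal_matrix[of "matrix Q"] by (auto simp: orthogonal_transformation_matrix)
  ultimately show ?thesis by simp
qed

lemma exists_unit_orthogonal:
  fixes a b :: "real^'n::finite"
  assumes "CARD('n) \<ge> 3"
  obtains v where "v \<in> Sph" "v \<bullet> a = 0" "v \<bullet> b = 0"
proof -
  have "dim {a, b} \<le> card {a, b}" by (rule dim_le_card') simp
  also have "\<dots> \<le> 2" by (simp add: card_insert_if)
  finally have "dim {a, b} < DIM(real^'n)" using assms by simp
  then obtain x where x: "x \<noteq> 0" "\<And>y. y \<in> span {a, b} \<Longrightarrow> orthogonal x y"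
    using orthogonal_to_subspace_exists by blast
  have "x \<bullet> a = 0" "x \<bullet> b = 0" using x(2)[of a] x(2)[of b] by (auto simp: orthogonal_def span_base)
  then show ?thesis using x(1) by (intro that[of "(1 / norm x) *\<^sub>R x"]) auto
qed

text \<open>The reflection exchanging \<open>a\<close> and \<open>b\<close> fixes \<open>xi\<close>
  but reverses orientation. A second reflection, along a vector orthogonal to \<open>xi\<close> and
  \<open>a\<close>, restores the determinant and moves neither of them; such a vector exists in
  dimension at least three.\<close>

lemma exists_rotation_fixing:
  fixes xi a b :: "real^'n::finite"
  assumes card: "CARD('n) \<ge> 3" and a: "a \<in> Sph" "a \<bullet> xi = 0" and b: "b \<in> Sph" "b \<bullet> xi = 0"
  obtains R where "rotation R" "R xi = xi" "R a = b"
proof (cases "a = b")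
  case True
  then show ?thesis
    using that[of "\<lambda>x. x"] by (simp add: rotation_def matrix_id_mat_1 flip: id_def) (simp add: id_def)
next
  case False
  obtain v where v: "v \<in> Sph" "v \<bullet> xi = 0" "v \<bullet> a = 0"
    using exists_unit_orthogonal[OF card, of xi a] by blast
  \<comment> \<open>Scaled to the length of \<open>a - b\<close>, so that
    \<open>det_householder_eq\<close> applies to the two reflections.\<close>
  define V where "V = norm (a - b) *\<^sub>R v"
  define R where "R = householder (a - b) \<circ> householder V"
  have V: "V \<bullet> xi = 0" "V \<bullet> a = 0" "norm V = norm (a - b)" using v by (auto simp: V_def)
  have "det (matrix (householder V)) = 1 \<or> det (matrix (householder V)) = -1"
    using householder_orthogonal[of V] by (auto simp: orthogonal_transformation_matrix intro!: det_orthogonal_matrix)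
  then have "det (matrix R) = 1"
    using det_householder_eq[OF V(3)] unfolding R_def
    by (auto simp: matrix_compose householder_orthogonal orthogonal_transformation_linear det_mul)
  then have "rotation R"
    unfolding rotation_def R_def by (simp add: orthogonal_transformation_compose householder_orthogonal)
  moreover have "R xi = xi" unfolding R_def using V a b
    by (simp add: householder_fix inner_commute inner_diff_right)
  moreover have "R a = b" unfolding R_def using V a b
    by (simp add: householder_fix inner_commute householder_swap)
  ultimately show ?thesis by (rule that)
qed

section \<open>Gegenbauer polynomials as polynomial objects, and expansions in them\<close>

lemma continuous_on_gegenC [continuous_intros]:
  assumes "continuous_on S f"
  shows "continuous_on S (\<lambda>x. gegenC l k (f x))"
  using assms
proof (induction l k "0::real" rule: gegenC.induct)
  case (3 lam k)
  then show ?case unfolding gegenC.simps(3) by (intro continuous_intros) auto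
qed (auto intro!: continuous_intros)

lemma borel_measurable_gegenC [measurable (raw)]:
  assumes "f \<in> borel_measurable M"
  shows "(\<lambda>x. gegenC l k (f x)) \<in> borel_measurable M"
proof -
  have "continuous_on UNIV (gegenC l k)" using continuous_on_gegenC[OF continuous_on_id] by simp
  from borel_measurable_continuous_on[OF this assms] show ?thesis .
qed

text \<open>A polynomial object carries a degree and a formal derivative; triangularity relies on
  the former and orthogonality on the latter. In degrees \<open>0\<close> and \<open>1\<close> the
  differential equation is checked by hand.\<close>

lemma gegenC_poly:
  assumes l: "l > 0"
  obtains f where "\<And>s. poly f s = gegenC l k s" "degree f \<le> k"
    "\<And>s. (1 - s\<^sup>2) * poly (pderiv (pderiv f)) s - (2 * l + 1) * s * poly (pderiv f) s
       + real k * (real k + 2 * l) * poly f s = 0"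
proof -
  have ex: "\<exists>f. (\<forall>s. poly f s = gegenC l k s) \<and> degree f \<le> k" for l k
  proof (induction l k "0::real" rule: gegenC.induct)
    case (1 lam)
    show ?case by (rule exI[of _ "[:1:]"]) simp
  next
    case (2 lam)
    show ?case by (rule exI[of _ "[:0, 2 * lam:]"]) simp
  next
    case (3 lam k)
    then obtain f g where f: "\<forall>s. poly f s = gegenC lam (Suc k) s" "degree f \<le> Suc k"
      and g: "\<forall>s. poly g s = gegenC lam k s" "degree g \<le> k" by blast
    let ?h = "smult (2 * (real k + 1 + lam) / (real k + 2)) (pCons 0 f) - smult ((real k + 2 * lam) / (real k + 2)) g"
    have "\<forall>s. poly ?h s = gegenC lam (Suc (Suc k)) s"
      unfolding gegenC.simps(3) using f g by (simp add: diff_divide_distrib mult_ac)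
    moreover have "degree ?h \<le> Suc (Suc k)"
      using f g by (intro degree_diff_le order_trans[OF degree_smult_le]) (auto simp: degree_pCons_eq_if)
    ultimately show ?case by blast
  qed
  have pd: "poly (pderiv f) s = d" if "\<And>s. poly f s = h s" "(h has_real_derivative d) (at s)" for f s d and h :: "real \<Rightarrow> real"
  proof -
    have "poly f = h" using that(1) by auto
    then show ?thesis using poly_DERIV[of f s] that(2) DERIV_unique by metis
  qed
  obtain f where f: "\<And>s. poly f s = gegenC l k s" "degree f \<le> k" using ex[of l k] by blast
  consider "k = 0" | "k = 1" | j where "k = Suc (Suc j)"
    by (metis One_nat_def not0_implies_Suc)
  then show ?thesis
  proof cases
    case 1
    then show ?thesis by (intro that[of "[:1:]"]) simp_all
  next
    case 2
    then show ?thesis by (intro that[of "[:0, 2 * l:]"]) (simp_all add: pderiv_pCons algebra_simps)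
  next
    case 3
    have d1: "poly (pderiv f) s = 2 * l * gegenC (l+1) (Suc j) s" for s
      by (rule pd[OF f(1)]) (use DERIV_gegenC[OF l, of "Suc j" s] 3 in simp)
    have "((\<lambda>s. 2 * l * gegenC (l+1) (Suc j) s) has_real_derivative 2 * l * (2 * (l+1) * gegenC (l+1+1) j s)) (at s)" for s
      using DERIV_gegenC[of "l+1" j s] l by (intro DERIV_cmult) auto
    from pd[OF d1 this] have d2: "poly (pderiv (pderiv f)) s = 4 * l * (l+1) * gegenC (l+2) j s" for s
      by (simp add: algebra_simps)
    show ?thesis
      by (rule that[OF f]) (use gegenC_ode[OF l] 3 in \<open>simp add: d1 d2 f(1) add.commute[of 2]\<close>)
  qed
qed

lemma gegenC_mult_x:
  assumes "l > 0"
  shows "s * gegenC l (Suc k) s = ((real k + 2) * gegenC l (Suc (Suc k)) s + (real k + 2 * l) * gegenC l k s) / (2 * (real k + 1 + l))"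
proof -
  have "real k + 1 + l > 0" using assms by simp
  then show ?thesis using gegenC_rec[of k l s] by (simp add: field_simps)
qed

text \<open>For \<open>l > 0\<close> these are the polynomial functions of degree at most
  \<open>N\<close>, described by their Gegenbauer coefficients.\<close>

definition gegen_span :: "real \<Rightarrow> nat \<Rightarrow> (real \<Rightarrow> real) set" where
  "gegen_span l N = {q. \<exists>b. \<forall>s. q s = (\<Sum>k\<le>N. b k * gegenC l k s)}"

lemma gegen_span_add: "p \<in> gegen_span l N \<Longrightarrow> q \<in> gegen_span l N \<Longrightarrow> (\<lambda>s. p s + q s) \<in> gegen_span l N"
  unfolding gegen_span_def
  by (clarsimp, rule_tac x="\<lambda>k. b k + ba k" in exI) (simp add: sum.distrib distrib_right)

lemma gegen_span_cmult: "p \<in> gegen_span l N \<Longrightarrow> (\<lambda>s. c * p s) \<in> gegen_span l N"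
  unfolding gegen_span_def
  by (clarsimp, rule_tac x="\<lambda>k. c * b k" in exI) (simp add: sum_distrib_left mult_ac)

lemma gegen_span_zero: "(\<lambda>s. 0) \<in> gegen_span l N"
  unfolding gegen_span_def by (auto intro!: exI[of _ "\<lambda>_. 0"])

lemma gegen_span_sum:
  "(\<And>i. i \<in> I \<Longrightarrow> f i \<in> gegen_span l N) \<Longrightarrow> (\<lambda>s. \<Sum>i\<in>I. f i s) \<in> gegen_span l N"
  by (induction I rule: infinite_finite_induct) (auto intro: gegen_span_add gegen_span_zero)

lemma gegen_span_base: "k \<le> N \<Longrightarrow> gegenC l k \<in> gegen_span l N"
  unfolding gegen_span_def
  by (auto intro!: exI[of _ "\<lambda>i. if i = k then 1 else 0"] simp: if_distrib[of "\<lambda>c. c * _"] cong: if_cong)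

lemma gegen_span_mono:
  assumes "p \<in> gegen_span l N" "N \<le> N'"
  shows "p \<in> gegen_span l N'"
proof -
  obtain b where "\<And>s. p s = (\<Sum>k\<le>N. b k * gegenC l k s)" using assms by (auto simp: gegen_span_def)
  then have "p = (\<lambda>s. \<Sum>k\<le>N. b k * gegenC l k s)" by auto
  then show ?thesis using assms(2) by (auto intro!: gegen_span_sum gegen_span_cmult gegen_span_base)
qed

lemma gegen_span_mult_x:
  assumes l: "l > 0" and p: "p \<in> gegen_span l N"
  shows "(\<lambda>s. s * p s) \<in> gegen_span l (Suc N)"
proof -
  obtain b where b: "\<And>s. p s = (\<Sum>k\<le>N. b k * gegenC l k s)" using p by (auto simp: gegen_span_def)
  have x: "(\<lambda>s. s * gegenC l k s) \<in> gegen_span l (Suc N)" if "k \<le> N" for k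
  proof (cases k)
    case 0
    have "(\<lambda>s. s * gegenC l k s) = (\<lambda>s. (1 / (2 * l)) * gegenC l (Suc 0) s)" using 0 l by auto
    then show ?thesis using gegen_span_cmult[OF gegen_span_base[of "Suc 0" "Suc N" l], of "1 / (2 * l)"] by simp
  next
    case (Suc j)
    have eq: "(\<lambda>s. s * gegenC l k s) = (\<lambda>s. ((real j + 2) / (2 * (real j + 1 + l))) * gegenC l (Suc (Suc j)) s
        + ((real j + 2 * l) / (2 * (real j + 1 + l))) * gegenC l j s)"
      unfolding Suc gegenC_mult_x[OF l] by (simp only: add_divide_distrib[of "_ * _" "_ * _"] times_divide_eq_left)
    show ?thesis unfolding eq using that Suc
      by (intro gegen_span_add gegen_span_cmult gegen_span_base) auto
  qed
  have "(\<lambda>s. s * p s) = (\<lambda>s. \<Sum>k\<le>N. b k * (s * gegenC l k s))"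
    by (simp add: b sum_distrib_left mult_ac)
  then show ?thesis using x by (auto intro!: gegen_span_sum gegen_span_cmult)
qed

lemma gegen_span_power:
  assumes l: "l > 0"
  shows "(\<lambda>s. s^i) \<in> gegen_span l i"
proof (induction i)
  case 0
  have "gegenC l 0 = (\<lambda>s. 1)" by (simp add: fun_eq_iff)
  then show ?case using gegen_span_base[of 0 0 l] by simp
next
  case (Suc i)
  show ?case using gegen_span_mult_x[OF l Suc] by simp
qed

lemma gegen_span_poly:
  assumes l: "l > 0" and "degree q \<le> N"
  shows "poly q \<in> gegen_span l N"
proof -
  have "poly q = (\<lambda>s. \<Sum>i\<le>degree q. coeff q i * s^i)" by (auto simp: poly_altdef)
  then show ?thesis using assms gegen_span_mono[OF gegen_span_power[OF l]]
    by (auto intro!: gegen_span_sum gegen_span_cmult)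
qed

text \<open>The direction \<open>a\<close> is the normalised tangential part of \<open>w\<close>; at
  the two poles this part vanishes and any unit vector orthogonal to \<open>xi\<close>
  serves.\<close>

lemma exists_orthogonal_decomposition:
  fixes xi w :: "real^'n::finite"
  assumes card: "CARD('n) \<ge> 3" and xi: "xi \<in> Sph" and w: "w \<in> Sph"
  obtains a where "a \<in> Sph" "a \<bullet> xi = 0" "w = (w \<bullet> xi) *\<^sub>R xi + sqrt (1 - (w \<bullet> xi)\<^sup>2) *\<^sub>R a"
proof -
  define u where "u = w - (w \<bullet> xi) *\<^sub>R xi"
  have u0: "u \<bullet> xi = 0" unfolding u_def using xi by (simp add: inner_diff_left norm_eq_1)
  have "u \<bullet> u = 1 - (w \<bullet> xi)\<^sup>2" unfolding u_def using xi w
    by (simp add: inner_diff_left inner_diff_right norm_eq_1 inner_commute power2_eq_square)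
  then have nu: "norm u = sqrt (1 - (w \<bullet> xi)\<^sup>2)" by (simp add: norm_eq_sqrt_inner)
  show ?thesis
  proof (cases "u = 0")
    case True
    obtain a where "a \<in> Sph" "a \<bullet> xi = 0" using exists_unit_orthogonal[OF card, of xi xi] by blast
    then show ?thesis using that[of a] True nu u_def by (simp del: real_sqrt_eq_zero_cancel_iff)
  next
    case False
    then show ?thesis
      by (intro that[of "(1 / norm u) *\<^sub>R u"]) (use u0 nu[symmetric] u_def in auto)
  qed
qed

text \<open>\<open>l = (m - 1) / 2\<close> is the index that belongs to the sphere of dimension
  \<open>m = CARD('n) - 1\<close>. The pole is a parameter, so that the locale can be interpreted
  again at another point.\<close>

locale sphere_dim =
  fixes l :: real and xi :: "real^'n::finite"
  assumes dim: "CARD('n) \<ge> 3" and l_def: "l = (real CARD('n) - 2) / 2" and xi: "xi \<in> Sph"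
begin

lemma l_pos: "l > 0" using dim unfolding l_def by simp

lemma integrable_poly: "y \<in> Sph \<Longrightarrow> integrable surf (\<lambda>z::real^'n. poly q (z \<bullet> y))"
  by (rule surf.integrable_zonal) (auto intro!: continuous_intros)

text \<open>Sturm-Liouville argument: \<open>surf_integral_poly\<close> for \<open>f' g\<close> and
  for \<open>g' f\<close>, subtracted and simplified by the differential equations, gives
  \<open>k (k + 2l) - j (j + 2l)\<close> times the integral of \<open>f g\<close>; this factor is
  nonzero for \<open>j \<noteq> k\<close>.\<close>

lemma gegen_orthogonal:
  fixes y :: "real^'n"
  assumes "j \<noteq> k" and y: "y \<in> Sph"
  shows "(\<integral>z. gegenC l j (z \<bullet> y) * gegenC l k (z \<bullet> y) \<partial>surf) = 0"
proof -
  obtain f where f: "\<And>s. poly f s = gegenC l j s"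
    "\<And>s. (1 - s\<^sup>2) * poly (pderiv (pderiv f)) s - (2 * l + 1) * s * poly (pderiv f) s
       + real j * (real j + 2 * l) * poly f s = 0" using gegenC_poly[OF l_pos] by blast
  obtain g where g: "\<And>s. poly g s = gegenC l k s"
    "\<And>s. (1 - s\<^sup>2) * poly (pderiv (pderiv g)) s - (2 * l + 1) * s * poly (pderiv g) s
       + real k * (real k + 2 * l) * poly g s = 0" using gegenC_poly[OF l_pos] by blast
  have m: "2 * l + 1 = real CARD('n) - 1" unfolding l_def by (simp add: field_simps)
  define I where "I = (\<lambda>q. \<integral>z. poly q (z \<bullet> y) \<partial>(surf :: (real^'n) measure))"
  have I0: "I ([:1, 0, -1:] * pderiv q - [:0, 2 * l + 1:] * q) = 0" for q
    using surf_integral_poly[OF y, of q] unfolding I_def m by (simp add: algebra_simps power2_eq_square)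
  have Idiff: "I (p - q) = I p - I q" for p q
    unfolding I_def using integrable_poly[OF y] by simp
  have Ismult: "I (smult c p) = c * I p" for c p unfolding I_def by simp
  have eq: "[:1, 0, -1:] * pderiv (pderiv f * g) - [:0, 2 * l + 1:] * (pderiv f * g)
     - ([:1, 0, -1:] * pderiv (pderiv g * f) - [:0, 2 * l + 1:] * (pderiv g * f))
     = smult (real k * (real k + 2 * l) - real j * (real j + 2 * l)) (f * g)"
  proof -
    have "poly ([:1, 0, -1:] * pderiv (pderiv f * g) - [:0, 2 * l + 1:] * (pderiv f * g)
     - ([:1, 0, -1:] * pderiv (pderiv g * f) - [:0, 2 * l + 1:] * (pderiv g * f))) s
     = poly (smult (real k * (real k + 2 * l) - real j * (real j + 2 * l)) (f * g)) s" for s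
    proof -
      define F0 F1 F2 G0 G1 G2 where "F0 = poly f s" and "F1 = poly (pderiv f) s" and "F2 = poly (pderiv (pderiv f)) s"
        and "G0 = poly g s" and "G1 = poly (pderiv g) s" and "G2 = poly (pderiv (pderiv g)) s"
      have "(1 - s\<^sup>2) * F2 = (2 * l + 1) * s * F1 - real j * (real j + 2 * l) * F0"
        "(1 - s\<^sup>2) * G2 = (2 * l + 1) * s * G1 - real k * (real k + 2 * l) * G0"
        using f(2)[of s] g(2)[of s] unfolding F0_def F1_def F2_def G0_def G1_def G2_def by linarith+
      then have "G0 * ((1 - s\<^sup>2) * F2) - F0 * ((1 - s\<^sup>2) * G2) =
         G0 * ((2 * l + 1) * s * F1 - real j * (real j + 2 * l) * F0) - F0 * ((2 * l + 1) * s * G1 - real k * (real k + 2 * l) * G0)"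
        by simp
      then show ?thesis
        unfolding pderiv_mult poly_diff poly_mult poly_add poly_smult poly_pCons
          F0_def[symmetric] F1_def[symmetric] F2_def[symmetric] G0_def[symmetric] G1_def[symmetric] G2_def[symmetric]
        by (simp add: algebra_simps power2_eq_square)
    qed
    then show ?thesis by (intro poly_eq_poly_eq_iff[THEN iffD1] ext)
  qed
  have "(real k * (real k + 2 * l) - real j * (real j + 2 * l)) * I (f * g) = 0"
    unfolding Ismult[symmetric] eq[symmetric] Idiff[of "_ - _" "_ - _"] I0 by simp
  moreover have "real k * (real k + 2 * l) - real j * (real j + 2 * l) = (real k - real j) * (real k + real j + 2 * l)"
    by (simp add: algebra_simps)
  moreover have "real k + real j + 2 * l > 0" using l_pos by simp
  ultimately have "I (f * g) = 0" using assms by simp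
  then show ?thesis unfolding I_def by (simp add: f g)
qed

definition H :: "nat \<Rightarrow> real" where
  "H k = (\<integral>z. (gegenC l k (z \<bullet> xi))\<^sup>2 \<partial>(surf :: (real^'n) measure))"

lemma integrable_gegen: "y \<in> Sph \<Longrightarrow> integrable surf (\<lambda>z::real^'n. gegenC l k (z \<bullet> y) * gegenC l j (z \<bullet> y))"
  by (rule surf.integrable_zonal[of "\<lambda>s. gegenC l k s * gegenC l j s"]) (intro continuous_intros)

text \<open>The integral \<open>X\<close> of \<open>s\<close> times two consecutive polynomials is
  evaluated twice, the recurrence being applied to either of them; orthogonality keeps one squared
  norm each time, so consecutive norms have a positive ratio.\<close>

lemma H_pos: "H k > 0"
proof (induction k)
  case 0
  have "H 0 = omega TYPE('n)" unfolding H_def omega_eq by simp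
  then show ?case using omega_pos by simp
next
  case (Suc k)
  define X where "X = (\<integral>z. (z \<bullet> xi) * (gegenC l k (z \<bullet> xi) * gegenC l (Suc k) (z \<bullet> xi)) \<partial>surf)"
  have int: "integrable surf (\<lambda>z. gegenC l i (z \<bullet> xi) * gegenC l j (z \<bullet> xi))" for i j
    using integrable_gegen[OF xi] .
  have orth: "(\<integral>z. gegenC l i (z \<bullet> xi) * gegenC l j (z \<bullet> xi) \<partial>surf) = (if i = j then H i else 0)" for i j
    using gegen_orthogonal[OF _ xi, of i j] by (auto simp: H_def power2_eq_square)
  have X1: "2 * (real k + 1 + l) * X = (real k + 2 * l) * H k"
  proof -
    have "2 * (real k + 1 + l) * (s * (gegenC l k s * gegenC l (Suc k) s)) =
      (real k + 2) * (gegenC l (Suc (Suc k)) s * gegenC l k s) + (real k + 2 * l) * (gegenC l k s * gegenC l k s)" for s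
    proof -
      have "2 * (real k + 1 + l) * (s * (gegenC l k s * gegenC l (Suc k) s)) = gegenC l k s * (2 * (real k + 1 + l) * s * gegenC l (Suc k) s)"
        by simp
      also have "\<dots> = gegenC l k s * ((real k + 2) * gegenC l (Suc (Suc k)) s + (real k + 2 * l) * gegenC l k s)"
        using gegenC_rec[of k l s] by simp
      finally show ?thesis by (simp add: algebra_simps)
    qed
    then have "(\<integral>z. 2 * (real k + 1 + l) * ((z \<bullet> xi) * (gegenC l k (z \<bullet> xi) * gegenC l (Suc k) (z \<bullet> xi))) \<partial>surf)
       = (\<integral>z. (real k + 2) * (gegenC l (Suc (Suc k)) (z \<bullet> xi) * gegenC l k (z \<bullet> xi)) + (real k + 2 * l) * (gegenC l k (z \<bullet> xi) * gegenC l k (z \<bullet> xi)) \<partial>surf)"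
      by (simp only:)
    also have "\<dots> = (real k + 2) * (if Suc (Suc k) = k then H (Suc (Suc k)) else 0) + (real k + 2 * l) * H k"
      by (subst Bochner_Integration.integral_add) (auto simp: int orth)
    finally show ?thesis unfolding X_def by simp
  qed
  have X2: "2 * (real k + l) * X = (real k + 1) * H (Suc k)"
  proof (cases k)
    case 0
    have "2 * (real k + l) * (s * (gegenC l k s * gegenC l (Suc k) s)) = (real k + 1) * (gegenC l (Suc k) s * gegenC l (Suc k) s)" for s
      using 0 by simp
    then have "(\<integral>z. 2 * (real k + l) * ((z \<bullet> xi) * (gegenC l k (z \<bullet> xi) * gegenC l (Suc k) (z \<bullet> xi))) \<partial>surf)
       = (\<integral>z. (real k + 1) * (gegenC l (Suc k) (z \<bullet> xi) * gegenC l (Suc k) (z \<bullet> xi)) \<partial>surf)"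
      by (simp only:)
    also have "\<dots> = (real k + 1) * H (Suc k)" by (simp add: orth del: gegenC.simps)
    finally show ?thesis unfolding X_def by simp
  next
    case (Suc i)
    have "2 * (real k + l) * (s * (gegenC l k s * gegenC l (Suc k) s)) =
      (real k + 1) * (gegenC l (Suc k) s * gegenC l (Suc k) s) + (real i + 2 * l) * (gegenC l i s * gegenC l (Suc k) s)" for s
    proof -
      have "2 * (real k + l) * (s * (gegenC l k s * gegenC l (Suc k) s)) = gegenC l (Suc k) s * (2 * (real i + 1 + l) * s * gegenC l (Suc i) s)"
        by (simp add: Suc add.commute)
      also have "\<dots> = gegenC l (Suc k) s * ((real i + 2) * gegenC l (Suc (Suc i)) s + (real i + 2 * l) * gegenC l i s)"
        using gegenC_rec[of i l s] by simp
      finally show ?thesis by (simp add: Suc algebra_simps)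
    qed
    then have "(\<integral>z. 2 * (real k + l) * ((z \<bullet> xi) * (gegenC l k (z \<bullet> xi) * gegenC l (Suc k) (z \<bullet> xi))) \<partial>surf)
       = (\<integral>z. (real k + 1) * (gegenC l (Suc k) (z \<bullet> xi) * gegenC l (Suc k) (z \<bullet> xi)) + (real i + 2 * l) * (gegenC l i (z \<bullet> xi) * gegenC l (Suc k) (z \<bullet> xi)) \<partial>surf)"
      by (simp only:)
    also have "\<dots> = (real k + 1) * H (Suc k)"
      by (subst Bochner_Integration.integral_add) (auto simp: int orth Suc)
    finally show ?thesis unfolding X_def by simp
  qed
  have p: "real k + 1 + l > 0" "real k + l > 0" "real k + 2 * l > 0" using l_pos by simp_all
  have "2 * (real k + 1 + l) * X > 0" unfolding X1 using p Suc by simp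
  then have "X > 0" using p by (simp add: zero_less_mult_iff)
  then have "(real k + 1) * H (Suc k) > 0" using p unfolding X2[symmetric] by simp
  then show ?case by (simp add: zero_less_mult_iff)
qed

end

section \<open>Averages over measures invariant under the rotations about the pole\<close>

locale zonal_measure = sphere_dim l xi + sph_measure M
  for l :: real and xi :: "real^'n::finite" and M :: "(real^'n) measure" +
  assumes invariant: "\<And>R. rotation R \<Longrightarrow> R xi = xi \<Longrightarrow> distr M borel R = M"
begin

lemma integral_rotation:
  fixes g :: "real^'n \<Rightarrow> real"
  assumes R: "rotation R" "R xi = xi" and g: "g \<in> borel_measurable borel"
  shows "(\<integral>x. g (R x) \<partial>M) = (\<integral>x. g x \<partial>M)"
proof -
  have "R \<in> borel_measurable borel" using R by (intro orthogonal_transformation_borel) (simp add: rotation_def)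
  then show ?thesis using integral_distr[of R M borel g] g invariant[OF R] by simp
qed

text \<open>Write \<open>w = s xi + r a\<close> with \<open>a\<close> orthogonal to the pole and
  expand the power. Rotations about the pole make the moments in direction \<open>a\<close>
  independent of \<open>a\<close>, the change from \<open>a\<close> to \<open>-a\<close> kills the
  odd ones, and even powers of \<open>r\<close> are powers of \<open>1 - s\<^sup>2\<close>. The
  degree bound is what makes averaging triangular.\<close>

lemma zonal_average_power:
  fixes p :: "real \<Rightarrow> real"
  assumes p: "continuous_on UNIV p"
  obtains q where "degree q \<le> i" "\<And>w. w \<in> Sph \<Longrightarrow> (\<integral>z. (z \<bullet> w)^i * p (z \<bullet> xi) \<partial>M) = poly q (w \<bullet> xi)"
proof -
  obtain C where C: "C \<ge> 0" "\<And>s. \<bar>s\<bar> \<le> 1 \<Longrightarrow> \<bar>p s\<bar> \<le> C" using continuous_bounded_unit_interval[OF p] by blast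
  have [measurable]: "p \<in> borel_measurable borel" using p by (rule borel_measurable_continuous_onI)
  obtain e0 where e0: "e0 \<in> Sph" "e0 \<bullet> xi = 0" using exists_unit_orthogonal[OF dim, of xi xi] by blast
  define m where "m = (\<lambda>k. \<integral>z. (z \<bullet> e0)^k * ((z \<bullet> xi)^(i-k) * p (z \<bullet> xi)) \<partial>M)"
  have mom: "(\<integral>z. (z \<bullet> a)^k * ((z \<bullet> xi)^(i-k) * p (z \<bullet> xi)) \<partial>M) = m k" if a: "a \<in> Sph" "a \<bullet> xi = 0" for a k
  proof -
    obtain R where R: "rotation R" "R xi = xi" "R a = e0"
      using exists_rotation_fixing[OF dim a e0] by blast
    have in_R: "R x \<bullet> R y = x \<bullet> y" for x y using R(1) by (simp add: rotation_def orthogonal_transformation_def)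
    have eqa: "R z \<bullet> e0 = z \<bullet> a" "R z \<bullet> xi = z \<bullet> xi" for z
      using in_R[of z a] in_R[of z xi] R by auto
    show ?thesis unfolding m_def
      using integral_rotation[OF R(1,2), of "\<lambda>z. (z \<bullet> e0)^k * ((z \<bullet> xi)^(i-k) * p (z \<bullet> xi))"] by (simp add: eqa)
  qed
  have odd0: "m k = 0" if "odd k" for k
    using mom[of "- e0" k] e0 that by (simp add: m_def power_minus_odd)
  define q where "q = (\<Sum>k\<le>i. if even k then smult (real (i choose k) * m k) ([:1, 0, -1:] ^ (k div 2) * monom 1 (i - k)) else 0)"
  show ?thesis
  proof (rule that[of q])
    show "degree q \<le> i" unfolding q_def
    proof (intro degree_sum_le finite_atMost)
      fix k assume "k \<in> {..i}"
      then have k: "k \<le> i" by simp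
      have "degree ([:1, 0, -1:] ^ (k div 2) * monom (1::real) (i - k)) \<le> degree ([:1, 0, -1::real:] ^ (k div 2)) + (i - k)"
        by (rule order_trans[OF degree_mult_le]) (simp add: degree_monom_eq)
      also have "\<dots> \<le> 2 * (k div 2) + (i - k)"
        using degree_power_le[of "[:1, 0, -1::real:]" "k div 2"] by simp
      also have "\<dots> \<le> i" using k by linarith
      finally show "degree (if even k then smult (real (i choose k) * m k) ([:1, 0, -1:] ^ (k div 2) * monom 1 (i - k)) else 0) \<le> i"
        by (auto intro: order_trans[OF degree_smult_le])
    qed
    fix w :: "real^'n" assume w: "w \<in> Sph"
    obtain a where a: "a \<in> Sph" "a \<bullet> xi = 0" "w = (w \<bullet> xi) *\<^sub>R xi + sqrt (1 - (w \<bullet> xi)\<^sup>2) *\<^sub>R a"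
      using exists_orthogonal_decomposition[OF dim xi w] by blast
    define s r where "s = w \<bullet> xi" and "r = sqrt (1 - s\<^sup>2)"
    have "s\<^sup>2 \<le> 1" unfolding s_def using abs_inner_le_1[OF w xi] by (simp add: abs_square_le_1)
    then have r2: "r\<^sup>2 = 1 - s\<^sup>2" unfolding r_def by simp
    have zw: "z \<bullet> w = r * (z \<bullet> a) + s * (z \<bullet> xi)" for z
      by (subst a(3)) (simp add: inner_add_right s_def r_def)
    have int: "integrable M (\<lambda>z. (z \<bullet> a)^k * ((z \<bullet> xi)^j * p (z \<bullet> xi)))" for k j
    proof (rule integrable_bounded[of _ C])
      fix x :: "real^'n" assume x: "x \<in> Sph"
      have "\<bar>x \<bullet> a\<bar>^k * (\<bar>x \<bullet> xi\<bar>^j * \<bar>p (x \<bullet> xi)\<bar>) \<le> 1 * (1 * C)"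
        using abs_inner_le_1[OF x a(1)] abs_inner_le_1[OF x xi] C
        by (intro mult_mono power_le_one) auto
      then show "\<bar>(x \<bullet> a)^k * ((x \<bullet> xi)^j * p (x \<bullet> xi))\<bar> \<le> C" by (simp add: abs_mult power_abs)
    qed measurable
    have "(z \<bullet> w)^i * p (z \<bullet> xi) =
        (\<Sum>k\<le>i. (real (i choose k) * r^k * s^(i-k)) * ((z \<bullet> a)^k * ((z \<bullet> xi)^(i-k) * p (z \<bullet> xi))))" for z
    proof -
      have "(z \<bullet> w)^i * p (z \<bullet> xi) = (\<Sum>k\<le>i. real (i choose k) * (r * (z \<bullet> a))^k * (s * (z \<bullet> xi))^(i-k) * p (z \<bullet> xi))"
        unfolding zw binomial_ring sum_distrib_right by simp
      also have "\<dots> = (\<Sum>k\<le>i. (real (i choose k) * r^k * s^(i-k)) * ((z \<bullet> a)^k * ((z \<bullet> xi)^(i-k) * p (z \<bullet> xi))))"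
        by (intro sum.cong refl) (simp add: power_mult_distrib)
      finally show ?thesis .
    qed
    then have "(\<integral>z. (z \<bullet> w)^i * p (z \<bullet> xi) \<partial>M) =
        (\<integral>z. (\<Sum>k\<le>i. (real (i choose k) * r^k * s^(i-k)) * ((z \<bullet> a)^k * ((z \<bullet> xi)^(i-k) * p (z \<bullet> xi)))) \<partial>M)"
      by (simp only:)
    also have "\<dots> = (\<Sum>k\<le>i. (real (i choose k) * r^k * s^(i-k)) * m k)"
      using int by (simp add: mom[OF a(1,2)])
    also have "\<dots> = poly q s"
      unfolding q_def poly_sum
    proof (rule sum.cong[OF refl])
      fix k
      have "r^k = (1 - s\<^sup>2)^(k div 2)" if "even k"
        using that by (metis dvd_mult_div_cancel power_mult r2)
      then show "(real (i choose k) * r^k * s^(i-k)) * m k =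
          poly (if even k then smult (real (i choose k) * m k) ([:1, 0, -1:] ^ (k div 2) * monom 1 (i - k)) else 0) s"
        using odd0[of k] by (auto simp: poly_monom poly_power power2_eq_square)
    qed
    finally show "(\<integral>z. (z \<bullet> w)^i * p (z \<bullet> xi) \<partial>M) = poly q (w \<bullet> xi)" unfolding s_def .
  qed
qed

lemma zonal_average_poly:
  fixes p :: "real \<Rightarrow> real"
  assumes p: "continuous_on UNIV p"
  obtains q where "degree q \<le> degree f" "\<And>w. w \<in> Sph \<Longrightarrow> (\<integral>z. poly f (z \<bullet> w) * p (z \<bullet> xi) \<partial>M) = poly q (w \<bullet> xi)"
proof -
  obtain C where C: "C \<ge> 0" "\<And>s. \<bar>s\<bar> \<le> 1 \<Longrightarrow> \<bar>p s\<bar> \<le> C" using continuous_bounded_unit_interval[OF p] by blast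
  have [measurable]: "p \<in> borel_measurable borel" using p by (rule borel_measurable_continuous_onI)
  have "\<exists>q. degree q \<le> i \<and> (\<forall>w\<in>Sph. (\<integral>z. (z \<bullet> w)^i * p (z \<bullet> xi) \<partial>M) = poly q (w \<bullet> xi))" for i
    by (rule zonal_average_power[OF p, of i]) blast
  then have "\<forall>i. \<exists>q. degree q \<le> i \<and> (\<forall>w\<in>Sph. (\<integral>z. (z \<bullet> w)^i * p (z \<bullet> xi) \<partial>M) = poly q (w \<bullet> xi))"
    by (rule allI)
  from choice[OF this] obtain Q where Q: "\<And>i. degree (Q i) \<le> i" "\<And>i w. w \<in> Sph \<Longrightarrow> (\<integral>z. (z \<bullet> w)^i * p (z \<bullet> xi) \<partial>M) = poly (Q i) (w \<bullet> xi)"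
    by blast
  show ?thesis
  proof (rule that[of "\<Sum>i\<le>degree f. smult (coeff f i) (Q i)"])
    show "degree (\<Sum>i\<le>degree f. smult (coeff f i) (Q i)) \<le> degree f"
      by (intro degree_sum_le finite_atMost order_trans[OF degree_smult_le]) (use Q(1) in \<open>auto intro: order_trans\<close>)
    fix w :: "real^'n" assume w: "w \<in> Sph"
    have int: "integrable M (\<lambda>z. (z \<bullet> w)^j * p (z \<bullet> xi))" for j
    proof (rule integrable_bounded[of _ C])
      fix x :: "real^'n" assume x: "x \<in> Sph"
      have "\<bar>x \<bullet> w\<bar>^j * \<bar>p (x \<bullet> xi)\<bar> \<le> 1 * C"
        using abs_inner_le_1[OF x w] abs_inner_le_1[OF x xi] C
        by (intro mult_mono power_le_one) auto
      then show "\<bar>(x \<bullet> w)^j * p (x \<bullet> xi)\<bar> \<le> C" by (simp add: abs_mult power_abs)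
    qed measurable
    have "poly f (z \<bullet> w) * p (z \<bullet> xi) = (\<Sum>i\<le>degree f. coeff f i * ((z \<bullet> w)^i * p (z \<bullet> xi)))" for z
      by (simp add: poly_altdef sum_distrib_right mult.assoc)
    then have "(\<integral>z. poly f (z \<bullet> w) * p (z \<bullet> xi) \<partial>M) = (\<integral>z. (\<Sum>i\<le>degree f. coeff f i * ((z \<bullet> w)^i * p (z \<bullet> xi))) \<partial>M)"
      by (simp only:)
    also have "\<dots> = (\<Sum>i\<le>degree f. coeff f i * poly (Q i) (w \<bullet> xi))"
      using int by (simp add: Q(2)[OF w])
    finally show "(\<integral>z. poly f (z \<bullet> w) * p (z \<bullet> xi) \<partial>M) = poly (\<Sum>i\<le>degree f. smult (coeff f i) (Q i)) (w \<bullet> xi)"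
      by (simp add: poly_sum)
  qed
qed

text \<open>The zonal averaging operator is triangular with respect to the degree and symmetric
  (the reflection exchanging \<open>z\<close> and \<open>\<xi>\<close> preserves \<open>\<sigma>\<close>), hence diagonal in the \<open>C\<^sub>k\<close>.\<close>

lemma zonal_average_gegen:
  fixes p :: "real \<Rightarrow> real"
  assumes p: "continuous_on UNIV p" and w: "w \<in> Sph"
  shows "(\<integral>z. gegenC l k (z \<bullet> w) * p (z \<bullet> xi) \<partial>M)
    = (\<integral>z. gegenC l k (z \<bullet> xi) * p (z \<bullet> xi) \<partial>M) / gegenC l k 1 * gegenC l k (w \<bullet> xi)"
proof -
  have [measurable]: "p \<in> borel_measurable borel" using p by (rule borel_measurable_continuous_onI)
  obtain C where C: "C \<ge> 0" "\<And>s. \<bar>s\<bar> \<le> 1 \<Longrightarrow> \<bar>p s\<bar> \<le> C" using continuous_bounded_unit_interval[OF p] by blast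
  have "\<exists>b. \<forall>w\<in>Sph. (\<integral>z. gegenC l k (z \<bullet> w) * p (z \<bullet> xi) \<partial>M) = (\<Sum>j\<le>k. b j * gegenC l j (w \<bullet> xi))" for k
  proof -
    obtain f where f: "\<And>s. poly f s = gegenC l k s" "degree f \<le> k"
      by (rule gegenC_poly[OF l_pos, of k]) (rule that)
    obtain q where q: "degree q \<le> degree f" "\<And>w. w \<in> Sph \<Longrightarrow> (\<integral>z. poly f (z \<bullet> w) * p (z \<bullet> xi) \<partial>M) = poly q (w \<bullet> xi)"
      by (rule zonal_average_poly[OF p, of f]) (rule that, simp_all)
    have "degree q \<le> k" using f(2) q(1) by (rule order_trans[rotated])
    then have "poly q \<in> gegen_span l k" by (rule gegen_span_poly[OF l_pos])
    then obtain b where b: "\<And>s. poly q s = (\<Sum>j\<le>k. b j * gegenC l j s)" unfolding gegen_span_def by blast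
    show ?thesis
    proof (intro exI ballI)
      fix w :: "real^'n" assume "w \<in> Sph"
      from q(2)[OF this] show "(\<integral>z. gegenC l k (z \<bullet> w) * p (z \<bullet> xi) \<partial>M) = (\<Sum>j\<le>k. b j * gegenC l j (w \<bullet> xi))"
        by (simp only: f(1) b)
    qed
  qed
  then have "\<forall>k. \<exists>b. \<forall>w\<in>Sph. (\<integral>z. gegenC l k (z \<bullet> w) * p (z \<bullet> xi) \<partial>M) = (\<Sum>j\<le>k. b j * gegenC l j (w \<bullet> xi))"
    by (rule allI)
  from choice[OF this] obtain b where b: "\<And>k w. w \<in> Sph \<Longrightarrow> (\<integral>z. gegenC l k (z \<bullet> w) * p (z \<bullet> xi) \<partial>M) = (\<Sum>j\<le>k. b k j * gegenC l j (w \<bullet> xi))"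
    by blast
  \<comment> \<open>\<open>S k j\<close> vanishes for \<open>j > k\<close> by triangularity. Once it
    is known to be symmetric it also vanishes for \<open>j < k\<close>, and division by
    \<open>H j\<close> leaves the diagonal coefficient only.\<close>
  define S where "S = (\<lambda>k j. \<integral>w. (\<integral>z. gegenC l k (z \<bullet> w) * p (z \<bullet> xi) \<partial>M) * gegenC l j (w \<bullet> xi) \<partial>surf)"
  have Sb: "S k j = (if j \<le> k then b k j * H j else 0)" for k j
  proof -
    have "S k j = (\<integral>w. (\<Sum>i\<le>k. b k i * (gegenC l i (w \<bullet> xi) * gegenC l j (w \<bullet> xi))) \<partial>surf)"
      unfolding S_def
    proof (rule surf.integral_cong_Sph)
      show "(\<lambda>w. (\<integral>z. gegenC l k (z \<bullet> w) * p (z \<bullet> xi) \<partial>M) * gegenC l j (w \<bullet> xi)) \<in> borel_measurable borel"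
        by measurable
    qed (simp_all add: b sum_distrib_right mult.assoc)
    also have "\<dots> = (\<Sum>i\<le>k. b k i * (\<integral>w. gegenC l i (w \<bullet> xi) * gegenC l j (w \<bullet> xi) \<partial>surf))"
      using integrable_gegen[OF xi] by simp
    also have "\<dots> = (\<Sum>i\<le>k. if i = j then b k j * H j else 0)"
      using gegen_orthogonal[OF _ xi] by (intro sum.cong refl) (auto simp: H_def power2_eq_square)
    finally show ?thesis by simp
  qed
  have gb: "\<exists>D\<ge>0. \<forall>s. \<bar>s\<bar> \<le> 1 \<longrightarrow> \<bar>gegenC l k s\<bar> \<le> D" for k
    using continuous_bounded_unit_interval[OF continuous_on_gegenC[OF continuous_on_id], of l k] by metis
  have SF: "S k j = (\<integral>z. (\<integral>w. gegenC l k (z \<bullet> w) * gegenC l j (w \<bullet> xi) \<partial>surf) * p (z \<bullet> xi) \<partial>M)" for k j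
  proof -
    obtain D1 where D1: "D1 \<ge> 0" "\<And>s. \<bar>s\<bar> \<le> 1 \<Longrightarrow> \<bar>gegenC l k s\<bar> \<le> D1" using gb[of k] by blast
    obtain D2 where D2: "D2 \<ge> 0" "\<And>s. \<bar>s\<bar> \<le> 1 \<Longrightarrow> \<bar>gegenC l j s\<bar> \<le> D2" using gb[of j] by blast
    have "S k j = (\<integral>w. \<integral>z. gegenC l k (z \<bullet> w) * p (z \<bullet> xi) * gegenC l j (w \<bullet> xi) \<partial>M \<partial>surf)"
      unfolding S_def by simp
    also have "\<dots> = (\<integral>z. \<integral>w. gegenC l k (z \<bullet> w) * p (z \<bullet> xi) * gegenC l j (w \<bullet> xi) \<partial>surf \<partial>M)"
    proof (rule sph_Fubini[OF surf_sph_measure sph_measure_axioms, where C = "D1 * C * D2"])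
      fix x y :: "real^'n" assume xy: "x \<in> Sph" "y \<in> Sph"
      show "\<bar>gegenC l k (y \<bullet> x) * p (y \<bullet> xi) * gegenC l j (x \<bullet> xi)\<bar> \<le> D1 * C * D2"
        unfolding abs_mult
        by (intro mult_mono D1 D2 C abs_inner_le_1 xy xi mult_nonneg_nonneg) auto
    qed measurable
    also have "\<dots> = (\<integral>z. \<integral>w. (gegenC l k (z \<bullet> w) * gegenC l j (w \<bullet> xi)) * p (z \<bullet> xi) \<partial>surf \<partial>M)"
      by (simp only: mult.assoc mult.commute[of "p _"])
    finally show ?thesis by simp
  qed
  have sym: "(\<integral>w. gegenC l k (z \<bullet> w) * gegenC l j (w \<bullet> xi) \<partial>surf) = (\<integral>w. gegenC l j (z \<bullet> w) * gegenC l k (w \<bullet> xi) \<partial>surf)"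
    if z: "z \<in> Sph" for z k j
  proof -
    define h where "h = householder (z - xi)"
    have h: "orthogonal_transformation h" "h z = xi" "h xi = z"
      unfolding h_def using householder_swap[of z xi] z xi by (auto simp: householder_orthogonal)
    have ih: "h x \<bullet> h y = x \<bullet> y" for x y using h(1) by (simp add: orthogonal_transformation_def)
    have eqs: "z \<bullet> h w = w \<bullet> xi" "h w \<bullet> xi = z \<bullet> w" for w
      using ih[of xi w] ih[of w z] h by (simp_all add: inner_commute)
    show ?thesis
      using surf_integral_orthogonal[OF h(1), of "\<lambda>w. gegenC l j (z \<bullet> w) * gegenC l k (w \<bullet> xi)"]
      by (simp add: eqs mult.commute)
  qed
  have "S k j = S j k" for k j
    unfolding SF by (rule integral_cong_Sph) (measurable, use sym in auto)
  then have "b k j = 0" if "j < k" for j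
    using Sb[of k j] Sb[of j k] that H_pos[of j] by simp
  then have "(\<Sum>j\<le>k. b k j * gegenC l j s) = b k k * gegenC l k s" for s
    by (subst sum.remove[of _ k]) (auto intro!: sum.neutral)
  then have bk: "(\<integral>z. gegenC l k (z \<bullet> w) * p (z \<bullet> xi) \<partial>M) = b k k * gegenC l k (w \<bullet> xi)" if "w \<in> Sph" for w
    using b[OF that, of k] by simp
  have "xi \<bullet> xi = 1" using xi by (simp add: norm_eq_1)
  then show ?thesis using bk[OF w] bk[OF xi] gegenC_one_pos[OF l_pos, of k] by simp
qed

end

context sphere_dim begin

sublocale surf: zonal_measure l xi surf
  by unfold_locales (simp add: surf_distr_orthogonal rotation_def)

lemma gegen_convolution:
  assumes w: "w \<in> Sph"
  shows "(\<integral>z. gegenC l k (z \<bullet> w) * gegenC l j (z \<bullet> xi) \<partial>surf)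
    = (if j = k then H k / gegenC l k 1 * gegenC l k (w \<bullet> xi) else 0)"
proof -
  have "continuous_on UNIV (gegenC l j)" using continuous_on_gegenC[OF continuous_on_id] by simp
  from surf.zonal_average_gegen[OF this w, of k] show ?thesis
    using gegen_orthogonal[OF _ xi, of k j] by (auto simp: H_def power2_eq_square)
qed

end

text \<open>The working class of functions: Borel on the whole space but bounded on the sphere only,
  since values elsewhere do not affect the integrals.\<close>

definition sbounded :: "(real^'n::finite \<Rightarrow> real) \<Rightarrow> bool" where
  "sbounded f \<longleftrightarrow> f \<in> borel_measurable borel \<and> (\<exists>C. \<forall>x\<in>Sph. \<bar>f x\<bar> \<le> C)"

lemma sbounded_measurable [measurable_dest]: "sbounded f \<Longrightarrow> f \<in> borel_measurable borel"
  by (simp add: sbounded_def)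

lemma sboundedI: "f \<in> borel_measurable borel \<Longrightarrow> (\<And>x. x \<in> Sph \<Longrightarrow> \<bar>f x\<bar> \<le> C) \<Longrightarrow> sbounded f"
  unfolding sbounded_def by blast

lemma sboundedE:
  assumes "sbounded f"
  obtains C where "C \<ge> 0" "\<And>x. x \<in> Sph \<Longrightarrow> \<bar>f x\<bar> \<le> C"
proof -
  obtain C where "\<forall>x\<in>Sph. \<bar>f x\<bar> \<le> C" using assms by (auto simp: sbounded_def)
  then show ?thesis by (intro that[of "max C 0"]) (auto simp: le_max_iff_disj)
qed

lemma sbounded_const: "sbounded (\<lambda>x. c)"
  by (rule sboundedI[where C = "\<bar>c\<bar>"]) auto

lemma sbounded_add:
  assumes f: "sbounded f" and g: "sbounded g"
  shows "sbounded (\<lambda>x. f x + g x)"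
proof -
  obtain C where C: "\<And>x. x \<in> Sph \<Longrightarrow> \<bar>f x\<bar> \<le> C" using f by (rule sboundedE) blast
  obtain D where D: "\<And>x. x \<in> Sph \<Longrightarrow> \<bar>g x\<bar> \<le> D" using g by (rule sboundedE) blast
  show ?thesis
  proof (rule sboundedI[where C = "C + D"])
    show "(\<lambda>x. f x + g x) \<in> borel_measurable borel" using f g by measurable
    show "\<bar>f x + g x\<bar> \<le> C + D" if "x \<in> Sph" for x using C[OF that] D[OF that] by linarith
  qed
qed

lemma sbounded_mult:
  assumes f: "sbounded f" and g: "sbounded g"
  shows "sbounded (\<lambda>x. f x * g x)"
proof -
  obtain C where C: "C \<ge> 0" "\<And>x. x \<in> Sph \<Longrightarrow> \<bar>f x\<bar> \<le> C" using f by (rule sboundedE) blast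
  obtain D where D: "D \<ge> 0" "\<And>x. x \<in> Sph \<Longrightarrow> \<bar>g x\<bar> \<le> D" using g by (rule sboundedE) blast
  show ?thesis
  proof (rule sboundedI[where C = "C * D"])
    show "(\<lambda>x. f x * g x) \<in> borel_measurable borel" using f g by measurable
    show "\<bar>f x * g x\<bar> \<le> C * D" if "x \<in> Sph" for x
      unfolding abs_mult using C D that by (intro mult_mono) auto
  qed
qed

lemma sbounded_cmult: "sbounded f \<Longrightarrow> sbounded (\<lambda>x. c * f x)"
  by (rule sbounded_mult[OF sbounded_const])

lemma sbounded_diff:
  assumes f: "sbounded f" and g: "sbounded g"
  shows "sbounded (\<lambda>x. f x - g x)"
  using sbounded_add[OF f sbounded_cmult[OF g, of "-1"]] by simp

lemma sbounded_sum: "(\<And>i. i \<in> I \<Longrightarrow> sbounded (f i)) \<Longrightarrow> sbounded (\<lambda>x. \<Sum>i\<in>I. f i x)"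
  by (induction I rule: infinite_finite_induct) (auto intro: sbounded_add sbounded_const)

lemma sbounded_zonal:
  assumes p: "continuous_on UNIV (p :: real \<Rightarrow> real)" and y: "y \<in> Sph"
  shows "sbounded (\<lambda>z. p (z \<bullet> y))"
proof -
  obtain C where C: "\<And>s. \<bar>s\<bar> \<le> 1 \<Longrightarrow> \<bar>p s\<bar> \<le> C" using p by (rule continuous_bounded_unit_interval) blast
  show ?thesis
  proof (rule sboundedI[where C = C])
    show "(\<lambda>z. p (z \<bullet> y)) \<in> borel_measurable borel"
      by (intro borel_measurable_continuous_onI continuous_on_compose2[OF p] continuous_intros) auto
    show "\<bar>p (x \<bullet> y)\<bar> \<le> C" if "x \<in> Sph" for x using C[OF abs_inner_le_1[OF that y]] .
  qed
qed

lemma (in sph_measure) integrable_sbounded: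
  assumes "sbounded f" shows "integrable M f"
proof -
  obtain C where "\<And>x. x \<in> Sph \<Longrightarrow> \<bar>f x\<bar> \<le> C" using assms by (rule sboundedE) blast
  then show ?thesis using assms by (intro integrable_bounded) (auto simp: sbounded_def)
qed

lemma (in sph_measure) integral_dominated_Sph:
  fixes f :: "nat \<Rightarrow> real^'n \<Rightarrow> real"
  assumes f: "\<And>i. f i \<in> borel_measurable borel" and g: "g \<in> borel_measurable borel"
    and b: "\<And>i x. x \<in> Sph \<Longrightarrow> \<bar>f i x\<bar> \<le> C" and lim: "\<And>x. x \<in> Sph \<Longrightarrow> (\<lambda>i. f i x) \<longlonglongrightarrow> g x"
  shows "(\<lambda>i. integral\<^sup>L M (f i)) \<longlonglongrightarrow> integral\<^sup>L M g"
proof (rule integral_dominated_convergence[where w = "\<lambda>_. C"])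
  show "AE x in M. (\<lambda>i. f i x) \<longlonglongrightarrow> g x" using AE_Sph by eventually_elim (rule lim)
  show "AE x in M. norm (f i x) \<le> C" for i using AE_Sph by eventually_elim (simp add: b)
qed (use f g in simp_all)

context sphere_dim begin

lemma continuous_gegen: "continuous_on UNIV (gegenC l k)"
  using continuous_on_gegenC[OF continuous_on_id] by simp

lemma sbounded_gegen: "y \<in> Sph \<Longrightarrow> sbounded (\<lambda>z::real^'n. gegenC l k (z \<bullet> y))"
  by (rule sbounded_zonal[OF continuous_gegen])

lemma gegen_bounded:
  obtains D where "D \<ge> 0" "\<And>x y::real^'n. x \<in> Sph \<Longrightarrow> y \<in> Sph \<Longrightarrow> \<bar>gegenC l k (x \<bullet> y)\<bar> \<le> D"
proof -
  obtain D where "D \<ge> 0" "\<And>s. \<bar>s\<bar> \<le> 1 \<Longrightarrow> \<bar>gegenC l k s\<bar> \<le> D"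
    by (rule continuous_bounded_unit_interval[OF continuous_gegen[of k]]) blast
  then show ?thesis using abs_inner_le_1 by (intro that[of D]) auto
qed

text \<open>The factor in \<open>C\<^sub>k * C\<^sub>k = ck C\<^sub>k\<close> for convolution over
  the sphere. The recurrences for \<open>H\<close> and for the value at \<open>1\<close> show that
  it equals \<open>omega l / (k + l)\<close>.\<close>

definition ck :: "nat \<Rightarrow> real" where "ck k = H k / gegenC l k 1"

lemma ck_pos: "ck k > 0"
  unfolding ck_def using H_pos gegenC_one_pos[OF l_pos] by simp

text \<open>The locale is interpreted a second time with \<open>y\<close> as its pole; rotation
  invariance makes the two values of \<open>H\<close> agree.\<close>

lemma gegen_convolution2:
  fixes x y :: "real^'n"
  assumes x: "x \<in> Sph" and y: "y \<in> Sph"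
  shows "(\<integral>z. gegenC l k (z \<bullet> x) * gegenC l j (z \<bullet> y) \<partial>surf) = (if j = k then ck k * gegenC l k (x \<bullet> y) else 0)"
proof -
  interpret Y: sphere_dim l y by unfold_locales (use dim l_def y in auto)
  have "Y.H k = H k" unfolding Y.H_def H_def
    by (rule surf_integral_zonal_indep[OF _ y xi, of "\<lambda>s. (gegenC l k s)\<^sup>2"]) (intro continuous_intros)
  then show ?thesis using Y.gegen_convolution[OF x, of k j] by (simp add: ck_def)
qed

subsection \<open>A nonnegative polynomial approximate identity\<close>

definition JI :: "nat \<Rightarrow> real" where
  "JI N = (\<integral>z. (1 + z \<bullet> xi)^N \<partial>(surf :: (real^'n) measure))"

definition J :: "nat \<Rightarrow> real \<Rightarrow> real" where "J N s = (1 + s)^N / JI N"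

text \<open>Bernoulli's inequality bounds the power below by \<open>1 + N (z \<sqdot> xi)\<close>,
  whose linear part integrates to zero by antipodal symmetry; hence \<open>JI N\<close> is at least
  \<open>omega\<close>.\<close>

lemma JI_pos: "JI N > 0"
proof -
  have neg: "orthogonal_transformation (\<lambda>x::real^'n. - x)"
    by (simp add: orthogonal_transformation_neg)
  have "(\<integral>z. - z \<bullet> xi \<partial>surf) = (\<integral>z. z \<bullet> xi \<partial>surf)"
    by (rule surf_integral_orthogonal[OF neg]) measurable
  then have 0: "(\<integral>z. z \<bullet> xi \<partial>surf) = 0" by simp
  have i1: "integrable surf (\<lambda>z. z \<bullet> xi)"
    by (rule surf.integrable_zonal[of "\<lambda>s. s", OF _ xi]) (intro continuous_intros)
  have "omega TYPE('n) = (\<integral>z. 1 + real N * (z \<bullet> xi) \<partial>surf)"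
    using i1 0 by (simp add: omega_eq)
  also have "\<dots> \<le> JI N" unfolding JI_def
  proof (rule surf.integral_mono_Sph)
    show "integrable surf (\<lambda>z. (1 + z \<bullet> xi)^N)"
      by (rule surf.integrable_zonal[of "\<lambda>s. (1+s)^N", OF _ xi]) (intro continuous_intros)
    show "1 + real N * (x \<bullet> xi) \<le> (1 + x \<bullet> xi)^N" if "x \<in> Sph" for x
      using abs_inner_le_1[OF that xi] by (intro Bernoulli_inequality) linarith
  qed (use i1 in simp)
  finally show ?thesis using omega_pos[where 'n='n] by linarith
qed

lemma continuous_J [continuous_intros]: "continuous_on S f \<Longrightarrow> continuous_on S (\<lambda>x. J N (f x))"
  unfolding J_def by (intro continuous_intros) (use JI_pos[of N] in auto)

lemma measurable_J [measurable]: "J N \<in> borel_measurable borel"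
  by (rule borel_measurable_continuous_onI) (rule continuous_J[OF continuous_on_id, unfolded id_def] continuous_intros)+

lemma J_nonneg: "\<bar>s\<bar> \<le> 1 \<Longrightarrow> J N s \<ge> 0"
  unfolding J_def using JI_pos[of N] by (intro divide_nonneg_pos zero_le_power) auto

lemma integrable_J: "y \<in> Sph \<Longrightarrow> integrable surf (\<lambda>z::real^'n. J N (z \<bullet> y))"
  by (rule surf.integrable_zonal) (intro continuous_intros)

lemma integral_J: 
  fixes y :: "real^'n"
  assumes y: "y \<in> Sph" shows "(\<integral>z. J N (z \<bullet> y) \<partial>surf) = 1"
proof -
  have "(\<integral>z. J N (z \<bullet> y) \<partial>surf) = (\<integral>z. J N (z \<bullet> xi) \<partial>surf)"
    by (rule surf_integral_zonal_indep[OF _ y xi]) (intro continuous_intros)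
  also have "\<dots> = JI N / JI N" unfolding J_def JI_def by simp
  finally show ?thesis using JI_pos[of N] by simp
qed

text \<open>Because \<open>(1 - s\<^sup>2) (1 + s)^(N-1) = (1 - s) (1 + s)^N\<close>, applying
  \<open>surf_integral_poly\<close> to \<open>(1 + s)^N\<close> expresses \<open>N\<close> times
  this moment as the integral of \<open>m s J N s\<close>, which is at most \<open>m\<close>. The
  decay in \<open>N\<close> makes \<open>J N\<close> an approximate identity.\<close>

lemma integral_J_first_moment:
  fixes y :: "real^'n"
  assumes y: "y \<in> Sph" and N: "N \<ge> 1"
  shows "(\<integral>z. (1 - z \<bullet> y) * J N (z \<bullet> y) \<partial>surf) \<le> (real CARD('n) - 1) / real N"
proof -
  obtain n where n: "N = Suc n" using N by (metis Suc_le_D One_nat_def)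
  have int: "integrable surf (\<lambda>z. (1 - z \<bullet> y) * J N (z \<bullet> y))"
    by (rule surf.integrable_zonal[of "\<lambda>s. (1 - s) * J N s", OF _ y]) (intro continuous_intros)
  have int2: "integrable surf (\<lambda>z. (real CARD('n) - 1) * (z \<bullet> y) * J N (z \<bullet> y))"
    by (rule surf.integrable_zonal[of "\<lambda>s. (real CARD('n) - 1) * s * J N s", OF _ y]) (intro continuous_intros)
  have e: "(1 - s\<^sup>2) * poly (pderiv ([:1, 1:]^N)) s - (real CARD('n) - 1) * s * poly ([:1, 1:]^N) s
      = JI N * (real N * ((1 - s) * J N s) - (real CARD('n) - 1) * s * J N s)" for s :: real
  proof -
    have "pderiv ([:1, 1:]^N) = smult (real N) ([:1, 1::real:]^n)"
      unfolding n pderiv_power_Suc by (simp add: pderiv_pCons)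
    then have "poly (pderiv ([:1, 1:]^N)) s = real N * (1 + s)^n" by (simp add: poly_power add.commute)
    moreover have "poly ([:1, 1:]^N) s = (1 + s)^N" by (simp add: poly_power add.commute)
    moreover have "(1 - s\<^sup>2) * (real N * (1 + s)^n) = real N * ((1 - s) * (1 + s)^N)"
      unfolding n by (simp add: algebra_simps power2_eq_square)
    moreover have "JI N * J N s = (1 + s)^N" unfolding J_def using JI_pos[of N] by simp
    moreover have "JI N * (real N * ((1 - s) * J N s) - (real CARD('n) - 1) * s * J N s)
        = real N * ((1 - s) * (JI N * J N s)) - (real CARD('n) - 1) * s * (JI N * J N s)"
      by (simp add: algebra_simps)
    ultimately show ?thesis by simp
  qed
  have "(\<integral>z. JI N * (real N * ((1 - z \<bullet> y) * J N (z \<bullet> y)) - (real CARD('n) - 1) * (z \<bullet> y) * J N (z \<bullet> y)) \<partial>surf) = 0"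
    using surf_integral_poly[OF y, of "[:1, 1:]^N"] unfolding e .
  then have "(\<integral>z. real N * ((1 - z \<bullet> y) * J N (z \<bullet> y)) - (real CARD('n) - 1) * (z \<bullet> y) * J N (z \<bullet> y) \<partial>surf) = 0"
    using JI_pos[of N] by simp
  then have "real N * (\<integral>z. (1 - z \<bullet> y) * J N (z \<bullet> y) \<partial>surf) = (\<integral>z. (real CARD('n) - 1) * (z \<bullet> y) * J N (z \<bullet> y) \<partial>surf)"
    using int int2 by simp
  also have "\<dots> \<le> (\<integral>z. (real CARD('n) - 1) * J N (z \<bullet> y) \<partial>surf)"
  proof (rule surf.integral_mono_Sph[OF int2])
    show "integrable surf (\<lambda>z. (real CARD('n) - 1) * J N (z \<bullet> y))" using integrable_J[OF y] by simp
    fix x :: "real^'n" assume x: "x \<in> Sph"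
    have "(x \<bullet> y) * J N (x \<bullet> y) \<le> 1 * J N (x \<bullet> y)"
      using abs_inner_le_1[OF x y] J_nonneg[of "x \<bullet> y" N] by (intro mult_right_mono) auto
    then show "(real CARD('n) - 1) * (x \<bullet> y) * J N (x \<bullet> y) \<le> (real CARD('n) - 1) * J N (x \<bullet> y)"
      unfolding mult.assoc using dim by (intro mult_left_mono) auto
  qed
  also have "\<dots> = real CARD('n) - 1" using integral_J[OF y, of N] by simp
  finally show ?thesis using N by (simp add: field_simps)
qed

lemma J_expansion: "\<exists>b. \<forall>s. J N s = (\<Sum>k\<le>N. b k * gegenC l k s)"
proof -
  have "degree ([:1, 1::real:]^N) \<le> N" using degree_power_le[of "[:1, 1::real:]" N] by simp
  then have "poly (smult (1 / JI N) ([:1, 1:]^N)) \<in> gegen_span l N"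
    by (intro gegen_span_poly[OF l_pos] order_trans[OF degree_smult_le])
  moreover have "poly (smult (1 / JI N) ([:1, 1:]^N)) = J N"
    by (simp add: fun_eq_iff J_def poly_power add.commute)
  ultimately show ?thesis by (simp add: gegen_span_def)
qed

definition jc :: "nat \<Rightarrow> nat \<Rightarrow> real" where
  "jc N = (SOME b. \<forall>s. J N s = (\<Sum>k\<le>N. b k * gegenC l k s))"

lemma J_eq: "J N s = (\<Sum>k\<le>N. jc N k * gegenC l k s)"
  using someI_ex[OF J_expansion[of N]] unfolding jc_def by blast

definition jb :: "nat \<Rightarrow> nat \<Rightarrow> real" where "jb N k = (jc N k)\<^sup>2 * ck k"

lemma jb_nonneg: "jb N k \<ge> 0"
  unfolding jb_def using ck_pos[of k] by simp

text \<open>Stated for any finite set of degrees: all degrees up to \<open>N\<close> give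
  \<open>JJ N\<close>, and those from \<open>n\<close> to \<open>N\<close> give the truncated kernel
  in the trace estimate.\<close>

lemma partial_convolution:
  fixes x y :: "real^'n"
  assumes A: "finite A" and x: "x \<in> Sph" and y: "y \<in> Sph"
  shows "(\<integral>z. (\<Sum>k\<in>A. jc N k * gegenC l k (z \<bullet> x)) * (\<Sum>k\<in>A. jc N k * gegenC l k (z \<bullet> y)) \<partial>surf)
    = (\<Sum>k\<in>A. jb N k * gegenC l k (x \<bullet> y))"
proof -
  have int: "integrable surf (\<lambda>z. jc N k * jc N j * (gegenC l k (z \<bullet> x) * gegenC l j (z \<bullet> y)))" for k j
    by (intro surf.integrable_sbounded sbounded_cmult sbounded_mult sbounded_gegen x y)
  have "(\<integral>z. (\<Sum>k\<in>A. jc N k * gegenC l k (z \<bullet> x)) * (\<Sum>k\<in>A. jc N k * gegenC l k (z \<bullet> y)) \<partial>surf)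
    = (\<integral>z. (\<Sum>k\<in>A. \<Sum>j\<in>A. jc N k * jc N j * (gegenC l k (z \<bullet> x) * gegenC l j (z \<bullet> y))) \<partial>surf)"
  proof -
    have "(\<Sum>k\<in>A. jc N k * gegenC l k (z \<bullet> x)) * (\<Sum>k\<in>A. jc N k * gegenC l k (z \<bullet> y))
      = (\<Sum>k\<in>A. \<Sum>j\<in>A. jc N k * jc N j * (gegenC l k (z \<bullet> x) * gegenC l j (z \<bullet> y)))" for z
      unfolding sum_product by (intro sum.cong refl) simp
    then show ?thesis by (simp only:)
  qed
  also have "\<dots> = (\<Sum>k\<in>A. \<Sum>j\<in>A. \<integral>z. jc N k * jc N j * (gegenC l k (z \<bullet> x) * gegenC l j (z \<bullet> y)) \<partial>surf)"
    using int by (subst Bochner_Integration.integral_sum, simp)+ (simp only:)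
  also have "\<dots> = (\<Sum>k\<in>A. \<Sum>j\<in>A. if j = k then jb N k * gegenC l k (x \<bullet> y) else 0)"
    by (intro sum.cong refl) (simp add: gegen_convolution2[OF x y] jb_def power2_eq_square)
  finally show ?thesis using A by (simp add: sum.delta')
qed

definition JJ :: "nat \<Rightarrow> real \<Rightarrow> real" where "JJ N s = (\<Sum>k\<le>N. jb N k * gegenC l k s)"

lemma J_convolution:
  fixes x y :: "real^'n"
  assumes "x \<in> Sph" "y \<in> Sph"
  shows "(\<integral>z. J N (z \<bullet> x) * J N (z \<bullet> y) \<partial>surf) = JJ N (x \<bullet> y)"
  unfolding J_eq JJ_def by (rule partial_convolution) (use assms in auto)

lemma continuous_JJ: "continuous_on UNIV (JJ N)"
  unfolding JJ_def[abs_def] by (intro continuous_intros)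

lemma JJ_nonneg: 
  fixes x y :: "real^'n"
  assumes "x \<in> Sph" "y \<in> Sph"
  shows "JJ N (x \<bullet> y) \<ge> 0"
  unfolding J_convolution[OF assms, symmetric]
  by (intro surf.integral_nonneg_Sph mult_nonneg_nonneg J_nonneg abs_inner_le_1 assms)

lemma J_bounded:
  obtains D where "D \<ge> 0" "\<And>x y::real^'n. x \<in> Sph \<Longrightarrow> y \<in> Sph \<Longrightarrow> \<bar>J N (x \<bullet> y)\<bar> \<le> D"
proof -
  have "continuous_on UNIV (J N)" using continuous_J[OF continuous_on_id] by simp
  from continuous_bounded_unit_interval[OF this] obtain D where "D \<ge> 0" "\<And>s. \<bar>s\<bar> \<le> 1 \<Longrightarrow> \<bar>J N s\<bar> \<le> D"
    by blast
  then show ?thesis using abs_inner_le_1 by (intro that[of D]) auto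
qed

lemma integral_JJ:
  fixes x :: "real^'n"
  assumes x: "x \<in> Sph"
  shows "(\<integral>y. JJ N (y \<bullet> x) \<partial>surf) = 1"
proof -
  obtain D where D: "D \<ge> 0" "\<And>x y::real^'n. x \<in> Sph \<Longrightarrow> y \<in> Sph \<Longrightarrow> \<bar>J N (x \<bullet> y)\<bar> \<le> D"
    by (rule J_bounded[of N]) blast
  have [measurable]: "JJ N \<in> borel_measurable borel" by (rule borel_measurable_continuous_onI[OF continuous_JJ])
  have "(\<integral>y. JJ N (y \<bullet> x) \<partial>surf) = (\<integral>y. \<integral>z. J N (z \<bullet> y) * J N (z \<bullet> x) \<partial>surf \<partial>surf)"
  proof (rule surf.integral_cong_Sph)
    fix y :: "real^'n" assume "y \<in> Sph"
    then show "JJ N (y \<bullet> x) = (\<integral>z. J N (z \<bullet> y) * J N (z \<bullet> x) \<partial>surf)"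
      by (rule J_convolution[OF _ x, symmetric])
  qed measurable
  also have "\<dots> = (\<integral>z. \<integral>y. J N (z \<bullet> y) * J N (z \<bullet> x) \<partial>surf \<partial>surf)"
  proof (rule sph_Fubini[OF surf_sph_measure surf_sph_measure, where C = "D * D"])
    fix y z :: "real^'n" assume "y \<in> Sph" "z \<in> Sph"
    then show "\<bar>J N (z \<bullet> y) * J N (z \<bullet> x)\<bar> \<le> D * D"
      unfolding abs_mult using x by (intro mult_mono D) auto
  qed measurable
  also have "\<dots> = (\<integral>z. J N (z \<bullet> x) \<partial>surf)"
  proof (rule surf.integral_cong_Sph)
    fix z :: "real^'n" assume "z \<in> Sph"
    then show "(\<integral>y. J N (z \<bullet> y) * J N (z \<bullet> x) \<partial>surf) = J N (z \<bullet> x)"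
      using integral_J[of z N] by (simp add: inner_commute[of z])
  qed measurable
  finally show ?thesis using integral_J[OF x] by simp
qed

section \<open>Smoothing by the approximate identity\<close>

definition smooth :: "nat \<Rightarrow> (real^'n \<Rightarrow> real) \<Rightarrow> real^'n \<Rightarrow> real" where
  "smooth N f u = (\<integral>v. J N (v \<bullet> u) * f v \<partial>surf)"

lemma measurable_smooth [measurable]:
  assumes [measurable]: "f \<in> borel_measurable borel"
  shows "smooth N f \<in> borel_measurable borel"
  unfolding smooth_def[abs_def] by measurable

lemma smooth_bound:
  assumes f: "f \<in> borel_measurable borel" "\<And>x. x \<in> Sph \<Longrightarrow> \<bar>f x\<bar> \<le> C" and u: "u \<in> Sph"
  shows "\<bar>smooth N f u\<bar> \<le> C"
proof -
  have sf: "sbounded f" using f by (rule sboundedI)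
  have sJ: "sbounded (\<lambda>v. J N (v \<bullet> u))" by (rule sbounded_zonal[OF _ u]) (intro continuous_intros)
  have "\<bar>smooth N f u\<bar> \<le> (\<integral>v. \<bar>J N (v \<bullet> u) * f v\<bar> \<partial>surf)" unfolding smooth_def by simp
  also have "\<dots> \<le> (\<integral>v. C * J N (v \<bullet> u) \<partial>surf)"
  proof (rule surf.integral_mono_Sph)
    show "integrable surf (\<lambda>v. \<bar>J N (v \<bullet> u) * f v\<bar>)"
      using surf.integrable_sbounded[OF sbounded_mult[OF sJ sf]] by simp
    show "integrable surf (\<lambda>v. C * J N (v \<bullet> u))" using integrable_J[OF u] by simp
    fix x :: "real^'n" assume x: "x \<in> Sph"
    have "J N (x \<bullet> u) * \<bar>f x\<bar> \<le> J N (x \<bullet> u) * C"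
      by (intro mult_left_mono f J_nonneg abs_inner_le_1 x u)
    then show "\<bar>J N (x \<bullet> u) * f x\<bar> \<le> C * J N (x \<bullet> u)"
      using J_nonneg[OF abs_inner_le_1[OF x u], of N] by (simp add: abs_mult mult.commute)
  qed
  also have "\<dots> = C" using integral_J[OF u] by simp
  finally show ?thesis .
qed

text \<open>A Korovkin-type argument: continuity near \<open>u\<close> and boundedness elsewhere
  combine into a bound for \<open>f v - f u\<close> by \<open>e/2 + A (1 - v \<sqdot> u)\<close>,
  and the first moment of \<open>J N\<close> controls the second term.\<close>

lemma smooth_tendsto:
  assumes sf: "sbounded f" and cont: "continuous_on Sph f" and u: "u \<in> Sph"
  shows "(\<lambda>N. smooth N f u) \<longlonglongrightarrow> f u"
proof (rule LIMSEQ_I)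
  fix e :: real assume e: "0 < e"
  obtain C where C: "C \<ge> 0" "\<And>x. x \<in> Sph \<Longrightarrow> \<bar>f x\<bar> \<le> C" using sf by (rule sboundedE) blast
  have "e / 2 > 0" using e by simp
  with cont u have "\<exists>d>0. \<forall>x\<in>Sph. dist x u < d \<longrightarrow> dist (f x) (f u) < e / 2"
    unfolding continuous_on_iff by blast
  then obtain d where d: "d > 0" "\<And>x. x \<in> Sph \<Longrightarrow> dist x u < d \<Longrightarrow> dist (f x) (f u) < e / 2"
    by blast
  \<comment> \<open>Chosen so that \<open>A (1 - v \<sqdot> u)\<close> reaches \<open>2 C\<close>
    once the distance of \<open>v\<close> and \<open>u\<close> is at least \<open>d\<close>; the
    squared distance is \<open>2 (1 - v \<sqdot> u)\<close>.\<close>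
  define A where "A = 4 * C / d\<^sup>2"
  have A0: "A \<ge> 0" unfolding A_def using C by simp
  have est: "\<bar>f v - f u\<bar> \<le> e / 2 + A * (1 - v \<bullet> u)" if v: "v \<in> Sph" for v
  proof (cases "dist v u < d")
    case True
    have "0 \<le> A * (1 - v \<bullet> u)" using A0 abs_inner_le_1[OF v u] by (intro mult_nonneg_nonneg) auto
    moreover have "\<bar>f v - f u\<bar> < e / 2" using d(2)[OF v True] by (simp add: dist_real_def)
    ultimately show ?thesis by linarith
  next
    case False
    have "(dist v u)\<^sup>2 = 2 * (1 - v \<bullet> u)"
      using v u by (simp add: dist_norm power2_norm_eq_inner inner_diff_left inner_diff_right norm_eq_1 inner_commute)
    moreover have "d\<^sup>2 \<le> (dist v u)\<^sup>2" using False d by (intro power_mono) auto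
    ultimately have "d\<^sup>2 \<le> 2 * (1 - v \<bullet> u)" by simp
    then have "2 * C * d\<^sup>2 \<le> 2 * C * (2 * (1 - v \<bullet> u))" using C by (intro mult_left_mono) auto
    then have "2 * C \<le> 2 * C * (2 * (1 - v \<bullet> u)) / d\<^sup>2" using d(1) by (subst pos_le_divide_eq) auto
    moreover have "2 * C * (2 * (1 - v \<bullet> u)) / d\<^sup>2 = A * (1 - v \<bullet> u)" unfolding A_def by (simp add: algebra_simps)
    ultimately have "2 * C \<le> A * (1 - v \<bullet> u)" by simp
    moreover have "\<bar>f v - f u\<bar> \<le> 2 * C" using C(2)[OF v] C(2)[OF u] by linarith
    ultimately show ?thesis using e by linarith
  qed
  have sJ: "sbounded (\<lambda>v. J N (v \<bullet> u))" for N by (rule sbounded_zonal[OF _ u]) (intro continuous_intros)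
  have sI: "sbounded (\<lambda>v. 1 - v \<bullet> u)" by (rule sbounded_zonal[of "\<lambda>s. 1 - s", OF _ u]) (intro continuous_intros)
  have main: "\<bar>smooth N f u - f u\<bar> \<le> e / 2 + A * ((real CARD('n) - 1) / real N)" if N: "N \<ge> 1" for N
  proof -
    have "f u = (\<integral>v. J N (v \<bullet> u) * f u \<partial>surf)" using integral_J[OF u, of N] by simp
    then have "smooth N f u - f u = (\<integral>v. J N (v \<bullet> u) * f v \<partial>surf) - (\<integral>v. J N (v \<bullet> u) * f u \<partial>surf)"
      unfolding smooth_def by simp
    also have "\<dots> = (\<integral>v. J N (v \<bullet> u) * f v - J N (v \<bullet> u) * f u \<partial>surf)"
      by (rule Bochner_Integration.integral_diff[symmetric]; intro surf.integrable_sbounded sbounded_mult sJ sf sbounded_const)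
    also have "\<dots> = (\<integral>v. J N (v \<bullet> u) * (f v - f u) \<partial>surf)" by (simp add: right_diff_distrib)
    finally have "\<bar>smooth N f u - f u\<bar> \<le> (\<integral>v. \<bar>J N (v \<bullet> u) * (f v - f u)\<bar> \<partial>surf)" by simp
    also have "\<dots> \<le> (\<integral>v. (e / 2) * J N (v \<bullet> u) + A * ((1 - v \<bullet> u) * J N (v \<bullet> u)) \<partial>surf)"
    proof (rule surf.integral_mono_Sph)
      show "integrable surf (\<lambda>v. \<bar>J N (v \<bullet> u) * (f v - f u)\<bar>)"
        by (rule integrable_abs, intro surf.integrable_sbounded sbounded_mult sbounded_diff sJ sf sbounded_const)
      show "integrable surf (\<lambda>v. (e / 2) * J N (v \<bullet> u) + A * ((1 - v \<bullet> u) * J N (v \<bullet> u)))"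
        by (intro surf.integrable_sbounded sbounded_add sbounded_mult sI sJ sbounded_const)
      fix v :: "real^'n" assume v: "v \<in> Sph"
      have J0: "J N (v \<bullet> u) \<ge> 0" by (rule J_nonneg[OF abs_inner_le_1[OF v u]])
      have "J N (v \<bullet> u) * \<bar>f v - f u\<bar> \<le> J N (v \<bullet> u) * (e / 2 + A * (1 - v \<bullet> u))"
        by (rule mult_left_mono[OF est[OF v] J0])
      then show "\<bar>J N (v \<bullet> u) * (f v - f u)\<bar> \<le> (e / 2) * J N (v \<bullet> u) + A * ((1 - v \<bullet> u) * J N (v \<bullet> u))"
        unfolding abs_mult abs_of_nonneg[OF J0] by (simp only: distrib_left mult.left_commute mult.commute)
    qed
    also have "\<dots> = (e / 2) * (\<integral>v. J N (v \<bullet> u) \<partial>surf) + A * (\<integral>v. (1 - v \<bullet> u) * J N (v \<bullet> u) \<partial>surf)"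
    proof -
      have "(\<integral>v. (e / 2) * J N (v \<bullet> u) + A * ((1 - v \<bullet> u) * J N (v \<bullet> u)) \<partial>surf)
        = (\<integral>v. (e / 2) * J N (v \<bullet> u) \<partial>surf) + (\<integral>v. A * ((1 - v \<bullet> u) * J N (v \<bullet> u)) \<partial>surf)"
        by (rule Bochner_Integration.integral_add; intro surf.integrable_sbounded sbounded_mult sI sJ sbounded_const)
      then show ?thesis by simp
    qed
    also have "\<dots> \<le> e / 2 + A * ((real CARD('n) - 1) / real N)"
      using integral_J[OF u, of N] mult_left_mono[OF integral_J_first_moment[OF u N] A0] by simp
    finally show ?thesis .
  qed
  have "(\<lambda>N. A * ((real CARD('n) - 1) / real N)) \<longlonglongrightarrow> A * 0"
    by (intro tendsto_mult tendsto_const lim_const_over_n)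
  then have "\<forall>\<^sub>F N in sequentially. A * ((real CARD('n) - 1) / real N) < e / 2"
    using e by (auto dest!: order_tendstoD(2)[where a = "e/2"])
  then obtain N0 where N0: "\<And>N. N \<ge> N0 \<Longrightarrow> A * ((real CARD('n) - 1) / real N) < e / 2"
    by (auto simp: eventually_sequentially)
  show "\<exists>no. \<forall>n\<ge>no. norm (smooth n f u - f u) < e"
  proof (intro exI allI impI)
    fix n assume "n \<ge> max N0 1"
    then have "n \<ge> 1" "n \<ge> N0" by auto
    then show "norm (smooth n f u - f u) < e" using main[of n] N0[of n] unfolding real_norm_def by linarith
  qed
qed

lemma smooth_eq:
  assumes sf: "sbounded f" and u: "u \<in> Sph"
  shows "smooth N f u = (\<Sum>k\<le>N. jc N k * (\<integral>v. gegenC l k (v \<bullet> u) * f v \<partial>surf))"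
proof -
  have "smooth N f u = (\<integral>v. (\<Sum>k\<le>N. jc N k * (gegenC l k (v \<bullet> u) * f v)) \<partial>surf)"
    unfolding smooth_def J_eq sum_distrib_right mult.assoc ..
  also have "\<dots> = (\<Sum>k\<le>N. \<integral>v. jc N k * (gegenC l k (v \<bullet> u) * f v) \<partial>surf)"
    by (intro Bochner_Integration.integral_sum surf.integrable_sbounded sbounded_mult sbounded_const sbounded_gegen u sf)
  finally show ?thesis by simp
qed

text \<open>After Fubini the inner integral is a convolution of two zonal polynomials: distinct
  degrees annihilate each other, equal degrees reproduce up to \<open>ck\<close>.\<close>

lemma gegen_reproduces:
  fixes f :: "real^'n \<Rightarrow> real"
  assumes sf: "sbounded f" and x: "x \<in> Sph"
  shows "(\<integral>u. (\<integral>v. gegenC l k (v \<bullet> u) * f v \<partial>surf) * gegenC l j (u \<bullet> x) \<partial>surf)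
    = (if j = k then ck k * (\<integral>v. gegenC l k (v \<bullet> x) * f v \<partial>surf) else 0)"
proof -
  obtain C where C: "C \<ge> 0" "\<And>x. x \<in> Sph \<Longrightarrow> \<bar>f x\<bar> \<le> C" using sf by (rule sboundedE) blast
  obtain D where D: "D \<ge> 0" "\<And>x y::real^'n. x \<in> Sph \<Longrightarrow> y \<in> Sph \<Longrightarrow> \<bar>gegenC l k (x \<bullet> y)\<bar> \<le> D" by (rule gegen_bounded[of k]) blast
  obtain E where E: "E \<ge> 0" "\<And>x y::real^'n. x \<in> Sph \<Longrightarrow> y \<in> Sph \<Longrightarrow> \<bar>gegenC l j (x \<bullet> y)\<bar> \<le> E" by (rule gegen_bounded[of j]) blast
  have [measurable]: "f \<in> borel_measurable borel" using sf by (rule sbounded_measurable)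
  have "(\<integral>u. (\<integral>v. gegenC l k (v \<bullet> u) * f v \<partial>surf) * gegenC l j (u \<bullet> x) \<partial>surf)
     = (\<integral>u. \<integral>v. gegenC l k (v \<bullet> u) * f v * gegenC l j (u \<bullet> x) \<partial>surf \<partial>surf)" by simp
  also have "\<dots> = (\<integral>v. \<integral>u. gegenC l k (v \<bullet> u) * f v * gegenC l j (u \<bullet> x) \<partial>surf \<partial>surf)"
  proof (rule sph_Fubini[OF surf_sph_measure surf_sph_measure, where C = "D * C * E"])
    fix u v :: "real^'n" assume "u \<in> Sph" "v \<in> Sph"
    then show "\<bar>gegenC l k (v \<bullet> u) * f v * gegenC l j (u \<bullet> x)\<bar> \<le> D * C * E"
      unfolding abs_mult using x D C E by (intro mult_mono) auto
  qed measurable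
  also have "\<dots> = (\<integral>v. (if j = k then ck k * (gegenC l k (v \<bullet> x) * f v) else 0) \<partial>surf)"
  proof (rule surf.integral_cong_Sph)
    fix v :: "real^'n" assume v: "v \<in> Sph"
    have "(\<integral>u. gegenC l k (v \<bullet> u) * f v * gegenC l j (u \<bullet> x) \<partial>surf) = (\<integral>u. (gegenC l k (u \<bullet> v) * gegenC l j (u \<bullet> x)) * f v \<partial>surf)"
      by (simp only: inner_commute[of v] mult.assoc mult.commute[of "f v"])
    also have "\<dots> = (\<integral>u. gegenC l k (u \<bullet> v) * gegenC l j (u \<bullet> x) \<partial>surf) * f v" by simp
    finally show "(\<integral>u. gegenC l k (v \<bullet> u) * f v * gegenC l j (u \<bullet> x) \<partial>surf) = (if j = k then ck k * (gegenC l k (v \<bullet> x) * f v) else 0)"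
      unfolding gegen_convolution2[OF v x] by simp
  qed measurable
  finally show ?thesis by simp
qed

end

subsection \<open>Convolution with zonal measures\<close>

lemma rotation_inv:
  fixes R :: "real^'n::finite \<Rightarrow> real^'n"
  assumes R: "rotation R"
  shows "rotation (inv R)"
proof -
  have o: "orthogonal_transformation R" "det (matrix R) = 1" using R by (auto simp: rotation_def)
  have oi: "orthogonal_transformation (inv R)" by (rule orthogonal_transformation_inv[OF o(1)])
  have "inv R \<circ> R = id" using orthogonal_transformation_inj[OF o(1)] by (rule inv_o_cancel)
  then have "matrix (inv R) ** matrix R = mat 1"
    using matrix_compose[of R "inv R"] o oi by (simp add: orthogonal_transformation_linear matrix_id_mat_1)
  then have "det (matrix (inv R)) * det (matrix R) = 1" by (metis det_mul det_I)
  then show ?thesis using oi o by (simp add: rotation_def)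
qed

text \<open>A rotation taking \<open>y\<close> to \<open>xi\<close> exists, so \<open>SOME\<close>
  returns one; all the other properties follow from its being orthogonal.\<close>

lemma Orot_props:
  fixes xi y :: "real^'n::finite"
  assumes "CARD('n) \<ge> 3" "xi \<in> Sph" "y \<in> Sph"
  shows "rotation (Orot xi y)" "Orot xi y y = xi"
    "orthogonal_transformation (inv (Orot xi y))" "inv (Orot xi y) xi = y"
    "inv (Orot xi y) z \<bullet> x = z \<bullet> Orot xi y x" "Orot xi y x \<bullet> xi = x \<bullet> y"
    "norm (Orot xi y x) = norm x" "norm (inv (Orot xi y) x) = norm x"
proof -
  define U where "U = Orot xi y"
  obtain R where "rotation R \<and> R y = xi"
  proof (rule rotation_exists_1[of y xi])
    fix f assume "orthogonal_transformation f" "det (matrix f) = 1" "f y = xi"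
    then show thesis by (intro that[of f]) (simp add: rotation_def)
  qed (use assms in auto)
  then have U: "rotation U \<and> U y = xi" unfolding U_def Orot_def by (rule someI[of "\<lambda>R. rotation R \<and> R y = xi"])
  then have oo: "orthogonal_transformation U" by (simp add: rotation_def)
  have inn: "U a \<bullet> U b = a \<bullet> b" for a b using oo by (simp add: orthogonal_transformation_def)
  have Oi: "U (inv U z) = z" for z using orthogonal_transformation_surj[OF oo] by (rule surj_f_inv_f)
  have iO: "inv U (U z) = z" for z using orthogonal_transformation_inj[OF oo] by (rule inv_f_f)
  have oi: "orthogonal_transformation (inv U)" by (rule orthogonal_transformation_inv[OF oo])
  show "rotation (Orot xi y)" "Orot xi y y = xi" using U unfolding U_def by auto
  show "orthogonal_transformation (inv (Orot xi y))" using oi unfolding U_def .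
  show "inv (Orot xi y) xi = y" using iO[of y] U unfolding U_def by simp
  show "inv (Orot xi y) z \<bullet> x = z \<bullet> Orot xi y x" using inn[of "inv U z" x] Oi[of z] unfolding U_def by simp
  show "Orot xi y x \<bullet> xi = x \<bullet> y" using inn[of x y] U unfolding U_def by simp
  show "norm (Orot xi y x) = norm x" "norm (inv (Orot xi y) x) = norm x"
    using orthogonal_transformation_norm[OF oo] orthogonal_transformation_norm[OF oi] unfolding U_def by auto
qed

context zonal_measure begin

text \<open>Unnormalised, as is \<open>zmult\<close> below: the factor \<open>1 / omega\<close>
  enters when the two parts of a signed measure are combined.\<close>

definition conv :: "(real^'n \<Rightarrow> real) \<Rightarrow> real^'n \<Rightarrow> real" where
  "conv f y = (\<integral>z. f (inv (Orot xi y) z) \<partial>M)"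

definition zmult :: "nat \<Rightarrow> real" where
  "zmult k = (\<integral>z. gegenC l k (z \<bullet> xi) \<partial>M) / gegenC l k 1"

lemmas Orot = Orot_props[OF dim xi]

lemma Orot_measurable: "y \<in> Sph \<Longrightarrow> inv (Orot xi y) \<in> borel_measurable borel"
  by (rule orthogonal_transformation_borel[OF Orot(3)])

text \<open>The chosen rotation carries \<open>x\<close> to a point whose inner product with the
  pole is \<open>x \<sqdot> y\<close>, and the averaging formula with \<open>p = 1\<close> applies
  there. The result is the same for every admissible choice of rotation.\<close>

lemma conv_gegen:
  fixes x y :: "real^'n"
  assumes x: "x \<in> Sph" and y: "y \<in> Sph"
  shows "(\<integral>z. gegenC l k (inv (Orot xi y) z \<bullet> x) \<partial>M) = zmult k * gegenC l k (x \<bullet> y)"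
proof -
  have "Orot xi y x \<in> Sph" using Orot(7)[OF y, of x] x by simp
  from zonal_average_gegen[of "\<lambda>_. 1", OF _ this, of k]
  show ?thesis unfolding zmult_def Orot(5)[OF y] Orot(6)[OF y] by simp
qed

text \<open>Fubini moves the average onto each zonal polynomial in the expansion of
  \<open>J N\<close>, where \<open>conv_gegen\<close> applies. The right side is visibly measurable
  in \<open>y\<close>, which the left side is not.\<close>

lemma conv_smooth:
  fixes f :: "real^'n \<Rightarrow> real"
  assumes sf: "sbounded f" and y: "y \<in> Sph"
  shows "conv (smooth N f) y = (\<Sum>k\<le>N. jc N k * (zmult k * (\<integral>v. gegenC l k (v \<bullet> y) * f v \<partial>surf)))"
proof -
  obtain C where C: "C \<ge> 0" "\<And>x. x \<in> Sph \<Longrightarrow> \<bar>f x\<bar> \<le> C" using sf by (rule sboundedE) blast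
  have [measurable]: "f \<in> borel_measurable borel" using sf by (rule sbounded_measurable)
  define U where "U = inv (Orot xi y)"
  have [measurable]: "U \<in> borel_measurable borel" unfolding U_def by (rule Orot_measurable[OF y])
  have OS: "U z \<in> Sph" if "z \<in> Sph" for z using Orot(8)[OF y, of z] that unfolding U_def by simp
  have each: "(\<integral>z. \<integral>v. gegenC l k (v \<bullet> U z) * f v \<partial>surf \<partial>M) = zmult k * (\<integral>v. gegenC l k (v \<bullet> y) * f v \<partial>surf)"
    and inte: "integrable M (\<lambda>z. \<integral>v. gegenC l k (v \<bullet> U z) * f v \<partial>surf)" for k
  proof -
    obtain D where D: "D \<ge> 0" "\<And>x y::real^'n. x \<in> Sph \<Longrightarrow> y \<in> Sph \<Longrightarrow> \<bar>gegenC l k (x \<bullet> y)\<bar> \<le> D" by (rule gegen_bounded[of k]) blast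
    have m: "(\<lambda>(z, v). gegenC l k (v \<bullet> U z) * f v) \<in> borel_measurable (borel \<Otimes>\<^sub>M borel)" by measurable
    have b: "\<bar>gegenC l k (v \<bullet> U z) * f v\<bar> \<le> D * C" if "z \<in> Sph" "v \<in> Sph" for z v
      unfolding abs_mult using OS that D C by (intro mult_mono) auto
    show "integrable M (\<lambda>z. \<integral>v. gegenC l k (v \<bullet> U z) * f v \<partial>surf)"
      by (rule sph_integrable_inner[OF sph_measure_axioms surf_sph_measure m b])
    have "(\<integral>z. \<integral>v. gegenC l k (v \<bullet> U z) * f v \<partial>surf \<partial>M) = (\<integral>v. \<integral>z. gegenC l k (v \<bullet> U z) * f v \<partial>M \<partial>surf)"
      by (rule sph_Fubini[OF sph_measure_axioms surf_sph_measure m b])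
    also have "\<dots> = (\<integral>v. zmult k * (gegenC l k (v \<bullet> y) * f v) \<partial>surf)"
    proof (rule surf.integral_cong_Sph)
      fix v :: "real^'n" assume v: "v \<in> Sph"
      have "(\<integral>z. gegenC l k (v \<bullet> U z) * f v \<partial>M) = (\<integral>z. gegenC l k (U z \<bullet> v) \<partial>M) * f v"
        by (simp add: inner_commute)
      then show "(\<integral>z. gegenC l k (v \<bullet> U z) * f v \<partial>M) = zmult k * (gegenC l k (v \<bullet> y) * f v)"
        using conv_gegen[OF v y, of k] by (simp add: U_def)
    qed measurable
    finally show "(\<integral>z. \<integral>v. gegenC l k (v \<bullet> U z) * f v \<partial>surf \<partial>M) = zmult k * (\<integral>v. gegenC l k (v \<bullet> y) * f v \<partial>surf)"
      by simp
  qed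
  have "conv (smooth N f) y = (\<integral>z. (\<Sum>k\<le>N. jc N k * (\<integral>v. gegenC l k (v \<bullet> U z) * f v \<partial>surf)) \<partial>M)"
    unfolding conv_def U_def[symmetric]
  proof (rule integral_cong_Sph)
    show "smooth N f (U z) = (\<Sum>k\<le>N. jc N k * (\<integral>v. gegenC l k (v \<bullet> U z) * f v \<partial>surf))" if "z \<in> Sph" for z
      by (rule smooth_eq[OF sf OS[OF that]])
  qed measurable
  also have "\<dots> = (\<Sum>k\<le>N. \<integral>z. jc N k * (\<integral>v. gegenC l k (v \<bullet> U z) * f v \<partial>surf) \<partial>M)"
    by (intro Bochner_Integration.integral_sum integrable_mult_right inte)
  also have "\<dots> = (\<Sum>k\<le>N. jc N k * (zmult k * (\<integral>v. gegenC l k (v \<bullet> y) * f v \<partial>surf)))"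
    unfolding integral_mult_right_zero each ..
  finally show ?thesis .
qed

text \<open>The choice of the rotation makes \<open>y \<mapsto> (f * \<mu>)(y)\<close> a priori irregular; on the
  sphere it is a limit of the polynomials \<open>(J\<^sub>N * f) * \<mu>\<close>, which gives measurability and
  the multiplier identity at once.\<close>

lemma conv_multiplier:
  fixes f :: "real^'n \<Rightarrow> real"
  assumes sf: "sbounded f" and cont: "continuous_on Sph f" and x: "x \<in> Sph"
  shows "sbounded (\<lambda>y. if y \<in> Sph then conv f y else 0)"
    and "(\<integral>y. (if y \<in> Sph then conv f y else 0) * gegenC l j (y \<bullet> x) \<partial>surf)
      = zmult j * (\<integral>u. f u * gegenC l j (u \<bullet> x) \<partial>surf)"
proof -
  obtain C where C: "C \<ge> 0" "\<And>x. x \<in> Sph \<Longrightarrow> \<bar>f x\<bar> \<le> C" using sf by (rule sboundedE) blast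
  have [measurable]: "f \<in> borel_measurable borel" using sf by (rule sbounded_measurable)
  have [measurable]: "(Sph :: (real^'n) set) \<in> sets borel" by (rule borel_closed) simp
  define g where "g = (\<lambda>y. if y \<in> Sph then conv f y else 0)"
  define gN where "gN = (\<lambda>N y. if y \<in> Sph then conv (smooth N f) y else 0)"
  have sm: "\<bar>smooth N f u\<bar> \<le> C" if "u \<in> Sph" for N u
    by (rule smooth_bound[OF _ C(2) that]) measurable
  have lim: "(\<lambda>N. gN N y) \<longlonglongrightarrow> g y" for y
  proof (cases "y \<in> Sph")
    case True
    have [measurable]: "inv (Orot xi y) \<in> borel_measurable borel" by (rule Orot_measurable[OF True])
    have "(\<lambda>N. conv (smooth N f) y) \<longlonglongrightarrow> conv f y" unfolding conv_def
    proof (rule integral_dominated_Sph[where C = C])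
      fix z :: "real^'n" assume "z \<in> Sph"
      then have z: "inv (Orot xi y) z \<in> Sph" using Orot(8)[OF True, of z] by simp
      show "\<bar>smooth N f (inv (Orot xi y) z)\<bar> \<le> C" for N by (rule sm[OF z])
      show "(\<lambda>N. smooth N f (inv (Orot xi y) z)) \<longlonglongrightarrow> f (inv (Orot xi y) z)"
        by (rule smooth_tendsto[OF sf cont z])
    qed measurable
    then show ?thesis using True by (simp add: g_def gN_def)
  qed (simp add: g_def gN_def)
  have gN_eq: "gN N y = (if y \<in> Sph then (\<Sum>k\<le>N. jc N k * (zmult k * (\<integral>v. gegenC l k (v \<bullet> y) * f v \<partial>surf))) else 0)" for N y
    unfolding gN_def using conv_smooth[OF sf, of y N] by simp
  have gNm [measurable]: "gN N \<in> borel_measurable borel" for N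
    unfolding gN_eq by measurable
  have gm [measurable]: "g \<in> borel_measurable borel"
    by (rule borel_measurable_LIMSEQ_real[OF lim gNm])
  have b: "\<bar>conv h y\<bar> \<le> C * measure M UNIV" if y: "y \<in> Sph" and [measurable]: "h \<in> borel_measurable borel" and h: "\<And>u. u \<in> Sph \<Longrightarrow> \<bar>h u\<bar> \<le> C" for h y
  proof -
    have [measurable]: "inv (Orot xi y) \<in> borel_measurable borel" by (rule Orot_measurable[OF y])
    have hb: "\<bar>h (inv (Orot xi y) z)\<bar> \<le> C" if "z \<in> Sph" for z
      using h[of "inv (Orot xi y) z"] Orot(8)[OF y, of z] that by simp
    show ?thesis unfolding conv_def
      by (rule abs_integral_le_Sph[OF integrable_bounded hb]) (measurable, rule hb)
  qed
  have gb: "\<bar>g y\<bar> \<le> C * measure M UNIV" if "y \<in> Sph" for y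
    using b[OF that _ C(2)] that by (simp add: g_def)
  show "sbounded (\<lambda>y. if y \<in> Sph then conv f y else 0)"
    unfolding g_def[symmetric] by (rule sboundedI[OF gm gb])
  have gNb: "\<bar>gN N y\<bar> \<le> C * measure M UNIV" if "y \<in> Sph" for N y
    using b[OF that measurable_smooth[OF \<open>f \<in> borel_measurable borel\<close>] sm, of N] that by (simp add: gN_def)
  obtain D where D: "D \<ge> 0" "\<And>x y::real^'n. x \<in> Sph \<Longrightarrow> y \<in> Sph \<Longrightarrow> \<bar>gegenC l j (x \<bullet> y)\<bar> \<le> D" by (rule gegen_bounded[of j]) blast
  have L1: "(\<lambda>N. \<integral>y. gN N y * gegenC l j (y \<bullet> x) \<partial>surf) \<longlonglongrightarrow> (\<integral>y. g y * gegenC l j (y \<bullet> x) \<partial>surf)"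
  proof (rule surf.integral_dominated_Sph[where C = "C * measure M UNIV * D"])
    fix y :: "real^'n" assume y: "y \<in> Sph"
    show "\<bar>gN N y * gegenC l j (y \<bullet> x)\<bar> \<le> C * measure M UNIV * D" for N
      unfolding abs_mult using gNb[OF y] D y x C by (intro mult_mono) auto
    show "(\<lambda>N. gN N y * gegenC l j (y \<bullet> x)) \<longlonglongrightarrow> g y * gegenC l j (y \<bullet> x)"
      by (intro tendsto_mult lim tendsto_const)
  qed measurable
  have L2: "(\<lambda>N. \<integral>u. smooth N f u * gegenC l j (u \<bullet> x) \<partial>surf) \<longlonglongrightarrow> (\<integral>u. f u * gegenC l j (u \<bullet> x) \<partial>surf)"
  proof (rule surf.integral_dominated_Sph[where C = "C * D"])
    fix y :: "real^'n" assume y: "y \<in> Sph"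
    show "\<bar>smooth N f y * gegenC l j (y \<bullet> x)\<bar> \<le> C * D" for N
      unfolding abs_mult using sm[OF y] D y x C by (intro mult_mono) auto
    show "(\<lambda>N. smooth N f y * gegenC l j (y \<bullet> x)) \<longlonglongrightarrow> f y * gegenC l j (y \<bullet> x)"
      by (intro tendsto_mult tendsto_const smooth_tendsto[OF sf cont y])
  qed measurable
  \<comment> \<open>The weights \<open>w\<close> are left free: \<open>zmult\<close> produces the
    convolved functions, the constant \<open>1\<close> the smoothed functions themselves.\<close>
  have series: "(\<integral>y. (\<Sum>k\<le>N. jc N k * (w k * (\<integral>v. gegenC l k (v \<bullet> y) * f v \<partial>surf))) * gegenC l j (y \<bullet> x) \<partial>surf)
    = (if j \<le> N then jc N j * (w j * (ck j * (\<integral>v. gegenC l j (v \<bullet> x) * f v \<partial>surf))) else 0)" for N w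
  proof -
    have int: "integrable surf (\<lambda>y. (\<integral>v. gegenC l k (v \<bullet> y) * f v \<partial>surf) * gegenC l j (y \<bullet> x))" for k
    proof (rule surf.integrable_sbounded[OF sbounded_mult[OF _ sbounded_gegen[OF x]]])
      obtain E where E: "E \<ge> 0" "\<And>x y::real^'n. x \<in> Sph \<Longrightarrow> y \<in> Sph \<Longrightarrow> \<bar>gegenC l k (x \<bullet> y)\<bar> \<le> E" by (rule gegen_bounded[of k]) blast
      show "sbounded (\<lambda>y. \<integral>v. gegenC l k (v \<bullet> y) * f v \<partial>surf)"
      proof (rule sboundedI)
        fix y :: "real^'n" assume y: "y \<in> Sph"
        show "\<bar>\<integral>v. gegenC l k (v \<bullet> y) * f v \<partial>surf\<bar> \<le> E * C * measure (surf :: (real^'n) measure) UNIV"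
        proof (rule surf.abs_integral_le_Sph)
          show "integrable surf (\<lambda>v. gegenC l k (v \<bullet> y) * f v)"
            by (intro surf.integrable_sbounded sbounded_mult sbounded_gegen y sf)
          fix v :: "real^'n" assume v: "v \<in> Sph"
          show "\<bar>gegenC l k (v \<bullet> y) * f v\<bar> \<le> E * C" unfolding abs_mult using E C v y by (intro mult_mono) auto
        qed
      qed measurable
    qed
    have "(\<Sum>k\<le>N. jc N k * (w k * (\<integral>v. gegenC l k (v \<bullet> y) * f v \<partial>surf))) * gegenC l j (y \<bullet> x)
      = (\<Sum>k\<le>N. (jc N k * w k) * ((\<integral>v. gegenC l k (v \<bullet> y) * f v \<partial>surf) * gegenC l j (y \<bullet> x)))" for y
      by (simp only: sum_distrib_right mult.assoc)
    then have "(\<integral>y. (\<Sum>k\<le>N. jc N k * (w k * (\<integral>v. gegenC l k (v \<bullet> y) * f v \<partial>surf))) * gegenC l j (y \<bullet> x) \<partial>surf)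
      = (\<integral>y. (\<Sum>k\<le>N. (jc N k * w k) * ((\<integral>v. gegenC l k (v \<bullet> y) * f v \<partial>surf) * gegenC l j (y \<bullet> x))) \<partial>surf)"
      by (simp only:)
    also have "\<dots> = (\<Sum>k\<le>N. \<integral>y. (jc N k * w k) * ((\<integral>v. gegenC l k (v \<bullet> y) * f v \<partial>surf) * gegenC l j (y \<bullet> x)) \<partial>surf)"
      by (intro Bochner_Integration.integral_sum integrable_mult_right int)
    also have "\<dots> = (\<Sum>k\<le>N. if k = j then jc N j * (w j * (ck j * (\<integral>v. gegenC l j (v \<bullet> x) * f v \<partial>surf))) else 0)"
      unfolding integral_mult_right_zero gegen_reproduces[OF sf x] by (intro sum.cong refl) simp
    finally show ?thesis by simp
  qed
  have "(\<integral>y. gN N y * gegenC l j (y \<bullet> x) \<partial>surf) = zmult j * (\<integral>u. smooth N f u * gegenC l j (u \<bullet> x) \<partial>surf)" for N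
  proof -
    have "(\<integral>y. gN N y * gegenC l j (y \<bullet> x) \<partial>surf) =
      (\<integral>y. (\<Sum>k\<le>N. jc N k * (zmult k * (\<integral>v. gegenC l k (v \<bullet> y) * f v \<partial>surf))) * gegenC l j (y \<bullet> x) \<partial>surf)"
      by (rule surf.integral_cong_Sph) (measurable, simp add: gN_eq)
    moreover have "(\<integral>u. smooth N f u * gegenC l j (u \<bullet> x) \<partial>surf) =
      (\<integral>y. (\<Sum>k\<le>N. jc N k * (1 * (\<integral>v. gegenC l k (v \<bullet> y) * f v \<partial>surf))) * gegenC l j (y \<bullet> x) \<partial>surf)"
      by (rule surf.integral_cong_Sph) (measurable, simp add: smooth_eq[OF sf])
    ultimately show ?thesis unfolding series by simp
  qed
  then have "(\<lambda>N. \<integral>y. gN N y * gegenC l j (y \<bullet> x) \<partial>surf) \<longlonglongrightarrow> zmult j * (\<integral>u. f u * gegenC l j (u \<bullet> x) \<partial>surf)"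
    using tendsto_mult_left[OF L2, of "zmult j"] by (simp only:)
  from LIMSEQ_unique[OF L1 this]
  show "(\<integral>y. (if y \<in> Sph then conv f y else 0) * gegenC l j (y \<bullet> x) \<partial>surf)
      = zmult j * (\<integral>u. f u * gegenC l j (u \<bullet> x) \<partial>surf)" unfolding g_def .
qed

end

context sphere_dim begin

text \<open>On a Hahn set the signed measure coincides with its positive (negative) part, so
  monotonicity transfers the invariance to each part.\<close>

lemma Mxi_zonal:
  fixes mu :: "'n smeasure"
  assumes mu: "mu \<in> Mxi xi"
  shows "zonal_measure l xi (fst mu)" "zonal_measure l xi (snd mu)"
proof -
  define P N where "P = fst mu" and "N = snd mu"
  have sm: "signed_meas mu" using mu by (simp add: Mxi_def)
  interpret P: sph_measure P using sm unfolding signed_meas_def P_def by (intro sph_measure.intro) auto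
  interpret N: sph_measure N using sm unfolding signed_meas_def N_def by (intro sph_measure.intro) auto
  obtain A where A [measurable]: "A \<in> sets borel" and PA: "emeasure P A = 0" and NA: "emeasure N (- A) = 0"
    using sm unfolding signed_meas_def P_def N_def by blast
  have PA0: "measure P E = 0" if "E \<subseteq> A" for E
  proof -
    have "measure P E \<le> measure P A" using that by (intro P.finite_measure_mono) auto
    moreover have "measure P A = 0" using PA by (simp add: measure_def)
    ultimately show ?thesis using measure_nonneg[of P E] by linarith
  qed
  have NA0: "measure N E = 0" if "E \<subseteq> - A" for E
  proof -
    have "measure N E \<le> measure N (- A)" using that by (intro N.finite_measure_mono) auto
    moreover have "measure N (- A) = 0" using NA by (simp add: measure_def)
    ultimately show ?thesis using measure_nonneg[of N E] by linarith
  qed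
  have im: "R ` E \<in> sets borel" if R: "rotation R" and E: "E \<in> sets borel" for R :: "real^'n \<Rightarrow> real^'n" and E
  proof -
    have "bij R" using R by (simp add: rotation_def orthogonal_transformation_bij)
    then have "R ` E = inv R -` E"
      using bij_vimage_eq_inv_image[OF bij_imp_bij_inv, of R E] by (simp add: inv_inv_eq)
    moreover have "inv R -` E \<in> sets borel"
      using measurable_sets[OF orthogonal_transformation_borel E, of "inv R"] rotation_inv[OF R] by (simp add: rotation_def)
    ultimately show ?thesis by simp
  qed
  have sv: "sval mu (R ` E) = sval mu E" if "rotation R" "R xi = xi" "E \<in> sets borel" for R E
    using mu that by (auto simp: Mxi_def)
  have leP: "measure P E \<le> measure P (R ` E)" if R: "rotation R" "R xi = xi" and E [measurable]: "E \<in> sets borel" for R E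
  proof -
    have "measure P E = measure P (E - A)"
      using P.finite_measure_Diff'[of E A] PA0[of "E \<inter> A"] by simp
    also have "\<dots> = sval mu (E - A)" using NA0[of "E - A"] by (auto simp: sval_def P_def N_def)
    also have "\<dots> = sval mu (R ` (E - A))" using sv[OF R, of "E - A"] by simp
    also have "\<dots> \<le> measure P (R ` (E - A))" by (simp add: sval_def P_def)
    also have "\<dots> \<le> measure P (R ` E)" using im[OF R(1) E] by (intro P.finite_measure_mono) auto
    finally show ?thesis .
  qed
  have leN: "measure N E \<le> measure N (R ` E)" if R: "rotation R" "R xi = xi" and E [measurable]: "E \<in> sets borel" for R E
  proof -
    have "measure N E = measure N (E \<inter> A)"
      using N.finite_measure_Diff'[of E A] NA0[of "E - A"] by auto
    also have "\<dots> = - sval mu (E \<inter> A)" using PA0[of "E \<inter> A"] by (auto simp: sval_def P_def N_def)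
    also have "\<dots> = - sval mu (R ` (E \<inter> A))" using sv[OF R, of "E \<inter> A"] by simp
    also have "\<dots> \<le> measure N (R ` (E \<inter> A))" by (simp add: sval_def N_def)
    also have "\<dots> \<le> measure N (R ` E)" using im[OF R(1) E] by (intro N.finite_measure_mono) auto
    finally show ?thesis .
  qed
  \<comment> \<open>The inequality for \<open>R\<close> and the one for its inverse together give
    equality.\<close>
  have inv: "distr Q borel R = Q"
    if Q: "sph_measure Q" and le: "\<And>R E. rotation R \<Longrightarrow> R xi = xi \<Longrightarrow> E \<in> sets borel \<Longrightarrow> measure Q E \<le> measure Q (R ` E)"
      and R: "rotation R" "R xi = xi" for Q R
  proof (rule measure_eqI)
    interpret Q: sph_measure Q by fact
    have bR: "bij R" using R by (simp add: rotation_def orthogonal_transformation_bij)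
    have Rm: "R \<in> borel_measurable borel" using R by (intro orthogonal_transformation_borel) (simp add: rotation_def)
    show "sets (distr Q borel R) = sets Q" by simp
    fix E assume "E \<in> sets (distr Q borel R)"
    then have E: "E \<in> sets borel" by simp
    have RE: "R -` E \<in> sets borel" using measurable_sets[OF Rm E] by simp
    have "inv R xi = xi" using R bR by (metis bij_inv_eq_iff)
    have 1: "inv R ` E = R -` E" using bR by (rule bij_vimage_eq_inv_image[symmetric])
    have 2: "R ` (R -` E) = E" using bR by (simp add: bij_is_surj surj_image_vimage_eq)
    have "measure Q E \<le> measure Q (R -` E)"
      using le[OF rotation_inv[OF R(1)] \<open>inv R xi = xi\<close> E] 1 by simp
    moreover have "measure Q (R -` E) \<le> measure Q E" using le[OF R RE] 2 by simp
    ultimately have "measure Q (R -` E) = measure Q E" by simp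
    then show "emeasure (distr Q borel R) E = emeasure Q E"
      using E Rm by (subst emeasure_distr) (auto simp: Q.emeasure_eq_measure)
  qed
  have "zonal_measure l xi P"
    by (intro zonal_measure.intro zonal_measure_axioms.intro inv P.sph_measure_axioms leP sphere_dim_axioms)
  then show "zonal_measure l xi (fst mu)" unfolding P_def .
  have "zonal_measure l xi N"
    by (intro zonal_measure.intro zonal_measure_axioms.intro inv N.sph_measure_axioms leN sphere_dim_axioms)
  then show "zonal_measure l xi (snd mu)" unfolding N_def .
qed

lemma sconv_multiplier:
  fixes f :: "real^'n \<Rightarrow> real" and mu :: "'n smeasure"
  assumes mu: "mu \<in> Mxi xi" and sf: "sbounded f" and cont: "continuous_on Sph f" and x: "x \<in> Sph"
  shows "sbounded (\<lambda>y. if y \<in> Sph then sconv xi f mu y else 0)"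
    and "(\<integral>y. (if y \<in> Sph then sconv xi f mu y else 0) * gegenC l j (y \<bullet> x) \<partial>surf)
      = multiplier xi mu j * (\<integral>u. f u * gegenC l j (u \<bullet> x) \<partial>surf)"
proof -
  define W where "W = 1 / omega TYPE('n)"
  interpret P: zonal_measure l xi "fst mu" by (rule Mxi_zonal[OF mu])
  interpret N: zonal_measure l xi "snd mu" by (rule Mxi_zonal[OF mu])
  define p where "p = (\<lambda>y. if y \<in> Sph then P.conv f y else 0)"
  define n where "n = (\<lambda>y. if y \<in> Sph then N.conv f y else 0)"
  have s: "sbounded p" "sbounded n"
    unfolding p_def n_def by (rule P.conv_multiplier[OF sf cont x] N.conv_multiplier[OF sf cont x])+
  have eq: "(if y \<in> Sph then sconv xi f mu y else 0) = W * (p y - n y)" for y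
    by (simp add: sconv_def sint_def W_def p_def n_def P.conv_def N.conv_def)
  show "sbounded (\<lambda>y. if y \<in> Sph then sconv xi f mu y else 0)"
    unfolding eq by (intro sbounded_cmult sbounded_diff s)
  have m: "multiplier xi mu j = W * (P.zmult j - N.zmult j)"
    unfolding multiplier_def sint_def gegenP_def l_def[symmetric] W_def P.zmult_def N.zmult_def
    by (simp add: inner_commute[of xi])
  have "(\<integral>y. W * (p y - n y) * gegenC l j (y \<bullet> x) \<partial>surf) = (\<integral>y. W * (p y * gegenC l j (y \<bullet> x) - n y * gegenC l j (y \<bullet> x)) \<partial>surf)"
    by (simp only: mult.assoc left_diff_distrib)
  also have "\<dots> = W * (\<integral>y. p y * gegenC l j (y \<bullet> x) - n y * gegenC l j (y \<bullet> x) \<partial>surf)" by simp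
  also have "(\<integral>y. p y * gegenC l j (y \<bullet> x) - n y * gegenC l j (y \<bullet> x) \<partial>surf)
      = (\<integral>y. p y * gegenC l j (y \<bullet> x) \<partial>surf) - (\<integral>y. n y * gegenC l j (y \<bullet> x) \<partial>surf)"
    by (rule Bochner_Integration.integral_diff; intro surf.integrable_sbounded sbounded_mult s sbounded_gegen x)
  also have "\<dots> = (P.zmult j - N.zmult j) * (\<integral>u. f u * gegenC l j (u \<bullet> x) \<partial>surf)"
    unfolding p_def n_def P.conv_multiplier(2)[OF sf cont x] N.conv_multiplier(2)[OF sf cont x] by (simp only: left_diff_distrib)
  finally show "(\<integral>y. (if y \<in> Sph then sconv xi f mu y else 0) * gegenC l j (y \<bullet> x) \<partial>surf)
      = multiplier xi mu j * (\<integral>u. f u * gegenC l j (u \<bullet> x) \<partial>surf)"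
    unfolding eq m by simp
qed

end

subsection \<open>Positive definite kernels and their quadratic forms\<close>

definition kform :: "('a \<Rightarrow> 'a \<Rightarrow> real) \<Rightarrow> nat \<Rightarrow> (nat \<Rightarrow> real) \<Rightarrow> (nat \<Rightarrow> 'a) \<Rightarrow> nat \<Rightarrow> (nat \<Rightarrow> real) \<Rightarrow> (nat \<Rightarrow> 'a) \<Rightarrow> real" where
  "kform K N a p n c q = (\<Sum>i<N. \<Sum>j<n. a i * c j * K (p i) (q j))"

lemma sum_lessThan_add: "(\<Sum>i<N + n. f i) = (\<Sum>i<N. f i) + (\<Sum>i<n. f (N + i))" for f :: "nat \<Rightarrow> real"
  by (induction n) simp_all

text \<open>Concatenation of two families, so that a sum of two kernel combinations is again a
  single combination.\<close>

definition cat :: "nat \<Rightarrow> (nat \<Rightarrow> 'a) \<Rightarrow> (nat \<Rightarrow> 'a) \<Rightarrow> nat \<Rightarrow> 'a" where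
  "cat N p q i = (if i < N then p i else q (i - N))"

locale pd_kernel =
  fixes D :: "'a set" and K :: "'a \<Rightarrow> 'a \<Rightarrow> real"
  assumes sym: "\<And>x y. x \<in> D \<Longrightarrow> y \<in> D \<Longrightarrow> K x y = K y x" and pd: "pos_def_kernel D K"
begin

lemma kform_nonneg: "(\<And>i. i < N \<Longrightarrow> p i \<in> D) \<Longrightarrow> 0 \<le> kform K N a p N a p"
  using pd unfolding pos_def_kernel_def kform_def by simp

lemma kform_sym:
  assumes "\<And>i. i < N \<Longrightarrow> p i \<in> D" "\<And>i. i < n \<Longrightarrow> q i \<in> D"
  shows "kform K N a p n c q = kform K n c q N a p"
  unfolding kform_def
  by (subst sum.swap) (intro sum.cong refl, use assms sym in auto)

lemma kform_cat:
  assumes p: "\<And>i. i < N \<Longrightarrow> p i \<in> D" and q: "\<And>i. i < n \<Longrightarrow> q i \<in> D"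
  shows "kform K (N + n) (cat N a (\<lambda>i. t * c i)) (cat N p q) (N + n) (cat N a (\<lambda>i. t * c i)) (cat N p q)
    = kform K N a p N a p + 2 * t * kform K N a p n c q + t\<^sup>2 * kform K n c q n c q"
proof -
  have "kform K (N + n) (cat N a (\<lambda>i. t * c i)) (cat N p q) (N + n) (cat N a (\<lambda>i. t * c i)) (cat N p q)
    = kform K N a p N a p + (\<Sum>i<N. \<Sum>j<n. t * (a i * c j * K (p i) (q j)))
      + ((\<Sum>i<n. \<Sum>j<N. t * (c i * a j * K (q i) (p j))) + (\<Sum>i<n. \<Sum>j<n. t\<^sup>2 * (c i * c j * K (q i) (q j))))"
    unfolding kform_def sum_lessThan_add cat_def
    by (simp add: sum.distrib power2_eq_square mult_ac)
  also have "\<dots> = kform K N a p N a p + t * kform K N a p n c q + (t * kform K n c q N a p + t\<^sup>2 * kform K n c q n c q)"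
    unfolding kform_def by (simp only: sum_distrib_left)
  also have "kform K n c q N a p = kform K N a p n c q" by (rule kform_sym) (use p q in auto)
  finally show ?thesis by simp
qed

lemma kform_Cauchy_Schwarz:
  assumes p: "\<And>i. i < N \<Longrightarrow> p i \<in> D" and q: "\<And>i. i < n \<Longrightarrow> q i \<in> D"
  shows "(kform K N a p n c q)\<^sup>2 \<le> kform K N a p N a p * kform K n c q n c q"
proof -
  define A B C where "A = kform K N a p N a p" and "B = kform K N a p n c q" and "C = kform K n c q n c q"
  have nn: "0 \<le> A + 2 * t * B + t\<^sup>2 * C" for t
  proof -
    have "cat N p q i \<in> D" if "i < N + n" for i using p q that by (auto simp: cat_def)
    then have "0 \<le> kform K (N + n) (cat N a (\<lambda>i. t * c i)) (cat N p q) (N + n) (cat N a (\<lambda>i. t * c i)) (cat N p q)"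
      by (rule kform_nonneg)
    also have "\<dots> = A + 2 * t * B + t\<^sup>2 * C"
      unfolding A_def B_def C_def by (rule kform_cat) (use p q in auto)
    finally show ?thesis .
  qed
  have C0: "C \<ge> 0" unfolding C_def by (rule kform_nonneg[OF q])
  have "B\<^sup>2 \<le> A * C"
  proof (cases "C = 0")
    case True
    \<comment> \<open>With \<open>C = 0\<close> the nonnegative polynomial in \<open>t\<close> is
      affine, so its slope must vanish; otherwise the \<open>t\<close> used below gives it the value
      \<open>-1\<close>.\<close>
    have "B = 0"
    proof (rule ccontr)
      assume "B \<noteq> 0"
      then have "A + 2 * (- (A + 1) / (2 * B)) * B = -1" by (simp add: field_simps)
      then show False using nn[of "- (A + 1) / (2 * B)"] True by simp
    qed
    then show ?thesis using True by simp
  next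
    case False
    have "A + 2 * (- B / C) * B + (- B / C)\<^sup>2 * C = A - B\<^sup>2 / C"
      using False by (simp add: power2_eq_square field_simps)
    then have "B\<^sup>2 / C \<le> A" using nn[of "- B / C"] by simp
    then show ?thesis using C0 False by (simp add: pos_divide_le_eq)
  qed
  then show ?thesis unfolding A_def B_def C_def .
qed

end

section \<open>Discretisation of integrals over the sphere\<close>

lemma simple_approximation_Sph:
  fixes xi :: "real^'n::finite"
  assumes "xi \<in> Sph"
  obtains \<pi> :: "nat \<Rightarrow> real^'n \<Rightarrow> real^'n" where
    "\<And>i. finite (range (\<pi> i))" "\<And>i. \<pi> i \<in> borel_measurable borel" "\<And>i x. \<pi> i x \<in> Sph"
    "\<And>x. x \<in> Sph \<Longrightarrow> (\<lambda>i. \<pi> i x) \<longlonglongrightarrow> x"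
proof -
  have "(\<lambda>x::real^'n. x) \<in> borel_measurable borel" by measurable
  from borel_measurable_implies_sequence_metric[OF this, of 0] obtain F where
    F: "\<And>i. simple_function borel (F i)" "\<And>x::real^'n. (\<lambda>i. F i x) \<longlonglongrightarrow> x" by auto
  \<comment> \<open>Simple functions approximating the identity are projected back to the sphere;
    where they vanish, the value \<open>xi\<close> keeps them on it.\<close>
  define \<pi> where "\<pi> = (\<lambda>i x. if F i x = 0 then xi else sgn (F i x))"
  have [measurable]: "F i \<in> borel_measurable borel" for i
    using F(1)[of i] by (rule borel_measurable_simple_function)
  show ?thesis
  proof (rule that[of \<pi>])
    fix i
    have "range (\<pi> i) \<subseteq> insert xi (sgn ` range (F i))" unfolding \<pi>_def by auto
    moreover have "finite (range (F i))" using F(1)[of i] by (simp add: simple_function_def)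
    ultimately show "finite (range (\<pi> i))" by (meson finite_imageI finite_insert finite_subset)
    show "\<pi> i \<in> borel_measurable borel" unfolding \<pi>_def sgn_div_norm by measurable
    show "\<pi> i x \<in> Sph" for x using assms by (simp add: \<pi>_def norm_sgn)
  next
    fix x :: "real^'n" assume x: "x \<in> Sph"
    then have x0: "x \<noteq> 0" and sx: "sgn x = x" by (auto simp: sgn_div_norm)
    have "(\<lambda>i. sgn (F i x)) \<longlonglongrightarrow> x" using tendsto_sgn[OF F(2)[of x] x0] sx by simp
    moreover have "\<forall>\<^sub>F i in sequentially. F i x \<noteq> 0"
      using F(2)[of x] x0 by (rule tendsto_imp_eventually_ne)
    then have "\<forall>\<^sub>F i in sequentially. sgn (F i x) = \<pi> i x"
      by eventually_elim (simp add: \<pi>_def)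
    ultimately show "(\<lambda>i. \<pi> i x) \<longlonglongrightarrow> x" by (rule Lim_transform_eventually)
  qed
qed

text \<open>The fibres of \<open>\<pi>\<close> are the cells, and the integral of \<open>h\<close>
  over a cell is its weight. Nodes and weights do not depend on \<open>\<phi>\<close>, so one rule
  serves both variables of a kernel.\<close>

lemma integral_finite_range:
  fixes h :: "real^'n::finite \<Rightarrow> real" and \<pi> :: "real^'n \<Rightarrow> real^'n"
  assumes fin: "finite (range \<pi>)" and m [measurable]: "\<pi> \<in> borel_measurable borel" and h: "sbounded h"
    and rng: "\<And>x. \<pi> x \<in> Sph"
  obtains n :: nat and q c where "\<And>j. j < n \<Longrightarrow> q j \<in> Sph"
    "\<And>\<phi>. (\<integral>y. \<phi> (\<pi> y) * h y \<partial>surf) = (\<Sum>j<n. c j * \<phi> (q j))"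
proof -
  obtain q where q: "bij_betw q {..<card (range \<pi>)} (range \<pi>)"
    using ex_bij_betw_nat_finite[OF fin] by (auto simp: atLeast0LessThan)
  define c where "c = (\<lambda>j. \<integral>y. indicator (\<pi> -` {q j}) y * h y \<partial>surf)"
  have mi: "\<pi> -` {u} \<in> sets borel" for u using measurable_sets[OF m, of "{u}"] by simp
  have int: "integrable surf (\<lambda>y. indicator (\<pi> -` {u}) y * h y)" for u
    by (intro surf.integrable_sbounded sbounded_mult h sboundedI[where C = 1])
       (use mi in \<open>auto simp: indicator_def\<close>)
  show ?thesis
  proof (rule that[of "card (range \<pi>)" q c])
    show "q j \<in> Sph" if "j < card (range \<pi>)" for j
    proof -
      have "q j \<in> range \<pi>" using bij_betw_apply[OF q, of j] that by simp
      then show ?thesis using rng by auto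
    qed
    fix \<phi> :: "real^'n \<Rightarrow> real"
    have "\<phi> (\<pi> y) * h y = (\<Sum>u\<in>range \<pi>. \<phi> u * (indicator (\<pi> -` {u}) y * h y))" for y
    proof -
      have "(\<Sum>u\<in>range \<pi>. \<phi> u * (indicator (\<pi> -` {u}) y * h y)) = (\<Sum>u\<in>range \<pi>. if \<pi> y = u then \<phi> u * h y else 0)"
        by (intro sum.cong refl) (auto simp: indicator_def)
      also have "\<dots> = \<phi> (\<pi> y) * h y" using fin by simp
      finally show ?thesis by simp
    qed
    then have "(\<integral>y. \<phi> (\<pi> y) * h y \<partial>surf) = (\<integral>y. (\<Sum>u\<in>range \<pi>. \<phi> u * (indicator (\<pi> -` {u}) y * h y)) \<partial>surf)"
      by (simp only:)
    also have "\<dots> = (\<Sum>u\<in>range \<pi>. \<integral>y. \<phi> u * (indicator (\<pi> -` {u}) y * h y) \<partial>surf)"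
      by (intro Bochner_Integration.integral_sum integrable_mult_right int)
    also have "\<dots> = (\<Sum>u\<in>range \<pi>. (\<integral>y. indicator (\<pi> -` {u}) y * h y \<partial>surf) * \<phi> u)"
      unfolding integral_mult_right_zero by (simp only: mult.commute)
    also have "\<dots> = (\<Sum>j<card (range \<pi>). c j * \<phi> (q j))"
      unfolding c_def by (rule sum.reindex_bij_betw[OF q, symmetric])
    finally show "(\<integral>y. \<phi> (\<pi> y) * h y \<partial>surf) = (\<Sum>j<card (range \<pi>). c j * \<phi> (q j))" .
  qed
qed

text \<open>Joint measurability is asked on the whole space; the kernel that is finally inserted is
  zero off the product of the spheres.\<close>

locale sphere_kernel = sphere_dim l xi + pd_kernel "Sph :: (real^'n) set" K
  for l :: real and xi :: "real^'n::finite" and K :: "real^'n \<Rightarrow> real^'n \<Rightarrow> real" +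
  fixes Kb :: real
  assumes K_meas [measurable]: "(\<lambda>(x, y). K x y) \<in> borel_measurable (borel \<Otimes>\<^sub>M borel)"
    and K_bound: "\<And>x y. x \<in> Sph \<Longrightarrow> y \<in> Sph \<Longrightarrow> \<bar>K x y\<bar> \<le> Kb"
    and K_cont: "continuous_on (Sph \<times> Sph) (\<lambda>(x, y). K x y)"
begin

lemma Kb_nonneg: "Kb \<ge> 0"
  using K_bound[OF xi xi] by linarith

lemma K_section_measurable [measurable]: "K x \<in> borel_measurable borel"
  using measurable_compose_Pair1[of x borel "\<lambda>(x, y). K x y" borel borel] K_meas by simp

lemma sbounded_K: "x \<in> Sph \<Longrightarrow> sbounded (K x)"
  by (rule sboundedI[OF _ K_bound]) measurable

lemma continuous_K:
  assumes "x \<in> Sph" shows "continuous_on Sph (K x)"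
proof -
  have "continuous_on Sph (\<lambda>y. (\<lambda>(x, y). K x y) (x, y))"
    by (rule continuous_on_compose2[OF K_cont]) (use assms in \<open>auto intro!: continuous_intros\<close>)
  then show ?thesis by simp
qed

lemma K_tendsto:
  assumes "\<And>i. x i \<in> Sph" "\<And>i. y i \<in> Sph" "a \<in> Sph" "b \<in> Sph" "x \<longlonglongrightarrow> a" "y \<longlonglongrightarrow> b"
  shows "(\<lambda>i. K (x i) (y i)) \<longlonglongrightarrow> K a b"
  using continuous_on_tendsto_compose[OF K_cont tendsto_Pair[OF assms(5,6)]] assms(1-4) by simp

definition T :: "(real^'n \<Rightarrow> real) \<Rightarrow> real^'n \<Rightarrow> real" where
  "T h x = (\<integral>y. K x y * h y \<partial>surf)"

definition QF :: "(real^'n \<Rightarrow> real) \<Rightarrow> real" where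
  "QF h = (\<integral>x. T h x * h x \<partial>surf)"

lemma T_measurable [measurable]:
  assumes [measurable]: "h \<in> borel_measurable borel"
  shows "T h \<in> borel_measurable borel"
  unfolding T_def[abs_def] by measurable

lemma T_bound:
  assumes h: "h \<in> borel_measurable borel" "\<And>x. x \<in> Sph \<Longrightarrow> \<bar>h x\<bar> \<le> C" and x: "x \<in> Sph"
  shows "\<bar>T h x\<bar> \<le> Kb * C * omega TYPE('n)"
  unfolding T_def omega_eq
proof (rule surf.abs_integral_le_Sph)
  have C: "C \<ge> 0" using h(2)[OF xi] by linarith
  show "integrable surf (\<lambda>y. K x y * h y)"
    by (intro surf.integrable_sbounded sbounded_mult sbounded_K x sboundedI[OF h])
  show "\<bar>K x y * h y\<bar> \<le> Kb * C" if "y \<in> Sph" for y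
    unfolding abs_mult using K_bound[OF x that] h(2)[OF that] Kb_nonneg C by (intro mult_mono) auto
qed

lemma sbounded_T: "sbounded h \<Longrightarrow> sbounded (T h)"
proof -
  assume h: "sbounded h"
  obtain C where C: "C \<ge> 0" "\<And>x. x \<in> Sph \<Longrightarrow> \<bar>h x\<bar> \<le> C" using h by (rule sboundedE) blast
  have m: "h \<in> borel_measurable borel" using h by (rule sbounded_measurable)
  show "sbounded (T h)" by (rule sboundedI[OF T_measurable[OF m] T_bound[OF m C(2)]])
qed

lemma T_symmetric:
  assumes g: "sbounded g" and h: "sbounded h"
  shows "(\<integral>x. T h x * g x \<partial>surf) = (\<integral>x. T g x * h x \<partial>surf)"
proof -
  obtain C where C: "C \<ge> 0" "\<And>x. x \<in> Sph \<Longrightarrow> \<bar>g x\<bar> \<le> C" using g by (rule sboundedE) blast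
  obtain D where D: "D \<ge> 0" "\<And>x. x \<in> Sph \<Longrightarrow> \<bar>h x\<bar> \<le> D" using h by (rule sboundedE) blast
  have [measurable]: "g \<in> borel_measurable borel" "h \<in> borel_measurable borel" using g h by (auto dest: sbounded_measurable)
  have "(\<integral>x. T h x * g x \<partial>surf) = (\<integral>x. \<integral>y. K x y * h y * g x \<partial>surf \<partial>surf)"
    unfolding T_def by simp
  also have "\<dots> = (\<integral>y. \<integral>x. K x y * h y * g x \<partial>surf \<partial>surf)"
  proof (rule sph_Fubini[OF surf_sph_measure surf_sph_measure, where C = "Kb * D * C"])
    fix x y :: "real^'n" assume xy: "x \<in> Sph" "y \<in> Sph"
    show "\<bar>K x y * h y * g x\<bar> \<le> Kb * D * C"
      unfolding abs_mult by (intro mult_mono K_bound C D xy mult_nonneg_nonneg Kb_nonneg) auto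
  qed measurable
  also have "\<dots> = (\<integral>y. T g y * h y \<partial>surf)"
  proof (rule surf.integral_cong_Sph)
    fix y :: "real^'n" assume y: "y \<in> Sph"
    have "T g y * h y = (\<integral>x. K y x * g x * h y \<partial>surf)" unfolding T_def by simp
    also have "\<dots> = (\<integral>x. K x y * h y * g x \<partial>surf)"
      by (rule surf.integral_cong_Sph) (measurable, use sym[OF y] in auto)
    finally show "(\<integral>x. K x y * h y * g x \<partial>surf) = T g y * h y" by simp
  qed measurable
  finally show ?thesis .
qed

text \<open>One sequence of finite combinations approximates both \<open>T h\<close> and its energy,
  so inequalities for finite kernel sums pass to bounded densities.\<close>

lemma quadrature:
  assumes h: "sbounded h"
  obtains n :: "nat \<Rightarrow> nat" and q c where "\<And>i j. j < n i \<Longrightarrow> q i j \<in> Sph"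
    "\<And>x. x \<in> Sph \<Longrightarrow> (\<lambda>i. \<Sum>j<n i. c i j * K x (q i j)) \<longlonglongrightarrow> T h x"
    "(\<lambda>i. kform K (n i) (c i) (q i) (n i) (c i) (q i)) \<longlonglongrightarrow> QF h"
proof -
  obtain \<pi> :: "nat \<Rightarrow> real^'n \<Rightarrow> real^'n" where \<pi>: "\<And>i. finite (range (\<pi> i))" "\<And>i. \<pi> i \<in> borel_measurable borel" "\<And>i x. \<pi> i x \<in> Sph"
    "\<And>x. x \<in> Sph \<Longrightarrow> (\<lambda>i. \<pi> i x) \<longlonglongrightarrow> x" by (rule simple_approximation_Sph[OF xi]) blast
  note [measurable] = \<pi>(2)
  obtain C where C: "C \<ge> 0" "\<And>x. x \<in> Sph \<Longrightarrow> \<bar>h x\<bar> \<le> C" using h by (rule sboundedE) blast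
  have [measurable]: "h \<in> borel_measurable borel" using h by (rule sbounded_measurable)
  have "\<exists>w. (\<forall>j::nat<fst w. fst (snd w) j \<in> Sph) \<and> (\<forall>\<phi>. (\<integral>y. \<phi> (\<pi> i y) * h y \<partial>surf) = (\<Sum>j<fst w. snd (snd w) j * \<phi> (fst (snd w) j)))" for i
  proof (rule integral_finite_range[OF \<pi>(1)[of i] \<pi>(2)[of i] h \<pi>(3)[of i]])
    fix n :: nat and q c
    assume "\<And>j. j < n \<Longrightarrow> q j \<in> Sph" "\<And>\<phi>. (\<integral>y. \<phi> (\<pi> i y) * h y \<partial>surf) = (\<Sum>j<n. c j * \<phi> (q j))"
    then show ?thesis by - (rule exI[of _ "(n, q, c)"], simp)
  qed
  then have "\<forall>i. \<exists>w. (\<forall>j::nat<fst w. fst (snd w) j \<in> Sph) \<and> (\<forall>\<phi>. (\<integral>y. \<phi> (\<pi> i y) * h y \<partial>surf) = (\<Sum>j<fst w. snd (snd w) j * \<phi> (fst (snd w) j)))"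
    by (rule allI)
  from choice[OF this] obtain w where w: "\<And>i (j::nat). j < fst (w i) \<Longrightarrow> fst (snd (w i)) j \<in> Sph"
    "\<And>i \<phi>. (\<integral>y. \<phi> (\<pi> i y) * h y \<partial>surf) = (\<Sum>j<fst (w i). snd (snd (w i)) j * \<phi> (fst (snd (w i)) j))"
    by blast
  define n q c where "n = (\<lambda>i. fst (w i))" and "q = (\<lambda>i. fst (snd (w i)))" and "c = (\<lambda>i. snd (snd (w i)))"
  have q: "\<And>i j. j < n i \<Longrightarrow> q i j \<in> Sph" unfolding n_def q_def by (rule w(1))
  have I: "(\<integral>y. \<phi> (\<pi> i y) * h y \<partial>surf) = (\<Sum>j<n i. c i j * \<phi> (q i j))" for i \<phi>
    unfolding n_def q_def c_def by (rule w(2))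
  have b: "\<bar>K x y * h z\<bar> \<le> Kb * C" if "x \<in> Sph" "y \<in> Sph" "z \<in> Sph" for x y z
    unfolding abs_mult by (intro mult_mono K_bound C that Kb_nonneg) auto
  show ?thesis
  proof (rule that[OF q])
    fix x :: "real^'n" assume x: "x \<in> Sph"
    have "(\<lambda>i. \<integral>y. K x (\<pi> i y) * h y \<partial>surf) \<longlonglongrightarrow> T h x" unfolding T_def
    proof (rule surf.integral_dominated_Sph[where C = "Kb * C"])
      fix y :: "real^'n" assume y: "y \<in> Sph"
      show "\<bar>K x (\<pi> i y) * h y\<bar> \<le> Kb * C" for i by (rule b[OF x \<pi>(3) y])
      show "(\<lambda>i. K x (\<pi> i y) * h y) \<longlonglongrightarrow> K x y * h y"
        by (intro tendsto_mult tendsto_const K_tendsto x y \<pi>)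
    qed measurable
    then show "(\<lambda>i. \<Sum>j<n i. c i j * K x (q i j)) \<longlonglongrightarrow> T h x" unfolding I .
  next
    define S where "S = (\<lambda>i x. \<integral>y. K (\<pi> i x) (\<pi> i y) * h y \<partial>surf)"
    have Sb: "\<bar>S i x\<bar> \<le> Kb * C * omega TYPE('n)" if x: "x \<in> Sph" for i x
      unfolding S_def omega_eq
    proof (rule surf.abs_integral_le_Sph)
      show bb: "\<bar>K (\<pi> i x) (\<pi> i y) * h y\<bar> \<le> Kb * C" if "y \<in> Sph" for y by (rule b[OF \<pi>(3) \<pi>(3) that])
      show "integrable surf (\<lambda>y. K (\<pi> i x) (\<pi> i y) * h y)"
        by (rule surf.integrable_bounded[OF _ bb]) measurable
    qed
    have "(\<lambda>i. \<integral>x. S i x * h x \<partial>surf) \<longlonglongrightarrow> (\<integral>x. T h x * h x \<partial>surf)"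
    proof (rule surf.integral_dominated_Sph[where C = "Kb * C * omega TYPE('n) * C"])
      fix x :: "real^'n" assume x: "x \<in> Sph"
      show "\<bar>S i x * h x\<bar> \<le> Kb * C * omega TYPE('n) * C" for i
        unfolding abs_mult using Sb[OF x] C x Kb_nonneg omega_pos[where 'n='n] by (intro mult_mono) auto
      have "(\<lambda>i. S i x) \<longlonglongrightarrow> T h x" unfolding T_def S_def
      proof (rule surf.integral_dominated_Sph[where C = "Kb * C"])
        fix y :: "real^'n" assume y: "y \<in> Sph"
        show "\<bar>K (\<pi> i x) (\<pi> i y) * h y\<bar> \<le> Kb * C" for i by (rule b[OF \<pi>(3) \<pi>(3) y])
        show "(\<lambda>i. K (\<pi> i x) (\<pi> i y) * h y) \<longlonglongrightarrow> K x y * h y"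
          by (intro tendsto_mult tendsto_const K_tendsto x y \<pi>)
      qed measurable
      then show "(\<lambda>i. S i x * h x) \<longlonglongrightarrow> T h x * h x" by (intro tendsto_mult tendsto_const)
    qed (unfold S_def, measurable)
    moreover have "(\<integral>x. S i x * h x \<partial>surf) = kform K (n i) (c i) (q i) (n i) (c i) (q i)" for i
    proof -
      have "S i x = (\<Sum>j<n i. c i j * K (\<pi> i x) (q i j))" for x
        unfolding S_def by (rule I)
      then have "(\<integral>x. S i x * h x \<partial>surf) = (\<integral>x. (\<lambda>u. \<Sum>j<n i. c i j * K u (q i j)) (\<pi> i x) * h x \<partial>surf)" by simp
      also have "\<dots> = (\<Sum>k<n i. c i k * (\<Sum>j<n i. c i j * K (q i k) (q i j)))" by (rule I)
      also have "\<dots> = kform K (n i) (c i) (q i) (n i) (c i) (q i)"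
        unfolding kform_def by (simp only: sum_distrib_left mult.assoc)
      finally show ?thesis .
    qed
    ultimately show "(\<lambda>i. kform K (n i) (c i) (q i) (n i) (c i) (q i)) \<longlonglongrightarrow> QF h"
      unfolding QF_def by simp
  qed
qed

lemma QF_nonneg:
  assumes h: "sbounded h" shows "QF h \<ge> 0"
proof -
  obtain n q c where q: "\<And>i j. j < n i \<Longrightarrow> q i j \<in> Sph"
    and lim: "(\<lambda>i. kform K (n i) (c i) (q i) (n i) (c i) (q i)) \<longlonglongrightarrow> QF h"
    by (rule quadrature[OF h]) blast
  show ?thesis by (rule LIMSEQ_le_const[OF lim]) (intro exI allI impI kform_nonneg q)
qed

text \<open>Cauchy-Schwarz for the kernel form between the given points and the quadrature nodes, in
  the limit.\<close>

lemma kernel_functional_bound: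
  assumes h: "sbounded h" and p: "\<And>i. i < N \<Longrightarrow> p i \<in> Sph"
  shows "(\<Sum>i<N. a i * T h (p i))\<^sup>2 \<le> kform K N a p N a p * QF h"
proof -
  obtain n q c where q: "\<And>i j. j < n i \<Longrightarrow> q i j \<in> Sph"
    and l1: "\<And>x. x \<in> Sph \<Longrightarrow> (\<lambda>i. \<Sum>j<n i. c i j * K x (q i j)) \<longlonglongrightarrow> T h x"
    and lim: "(\<lambda>i. kform K (n i) (c i) (q i) (n i) (c i) (q i)) \<longlonglongrightarrow> QF h"
    by (rule quadrature[OF h]) blast
  have "(\<lambda>i. (\<Sum>k<N. a k * (\<Sum>j<n i. c i j * K (p k) (q i j)))\<^sup>2) \<longlonglongrightarrow> (\<Sum>i<N. a i * T h (p i))\<^sup>2"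
    by (intro tendsto_power tendsto_sum tendsto_mult tendsto_const l1 p) simp
  moreover have "(\<Sum>k<N. a k * (\<Sum>j<n i. c i j * K (p k) (q i j))) = kform K N a p (n i) (c i) (q i)" for i
    unfolding kform_def by (simp only: sum_distrib_left mult.assoc)
  ultimately have L: "(\<lambda>i. (kform K N a p (n i) (c i) (q i))\<^sup>2) \<longlonglongrightarrow> (\<Sum>i<N. a i * T h (p i))\<^sup>2" by simp
  have R: "(\<lambda>i. kform K N a p N a p * kform K (n i) (c i) (q i) (n i) (c i) (q i)) \<longlonglongrightarrow> kform K N a p N a p * QF h"
    by (intro tendsto_mult tendsto_const lim)
  show ?thesis
    by (rule LIMSEQ_le[OF L R]) (intro exI allI impI kform_Cauchy_Schwarz p q)
qed

end

context sphere_kernel begin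

text \<open>Fubini turns the triple integral into the integral over \<open>z\<close> of the energies
  of the functions \<open>x \<mapsto> r x z\<close>. The kernel \<open>r\<close> will be a single
  zonal polynomial for \<open>tau_nonneg\<close> and a residual kernel for
  \<open>trace_bound\<close>.\<close>

lemma square_kernel_nonneg:
  fixes r :: "real^'n \<Rightarrow> real^'n \<Rightarrow> real"
  assumes r [measurable]: "(\<lambda>(x, z). r x z) \<in> borel_measurable (borel \<Otimes>\<^sub>M borel)"
    and rb: "\<And>x z. x \<in> Sph \<Longrightarrow> z \<in> Sph \<Longrightarrow> \<bar>r x z\<bar> \<le> C"
  shows "0 \<le> (\<integral>x. \<integral>y. K x y * (\<integral>z. r x z * r y z \<partial>surf) \<partial>surf \<partial>surf)"
proof -
  have C: "C \<ge> 0" using rb[OF xi xi] by linarith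
  have rm [measurable]: "(\<lambda>x. r x z) \<in> borel_measurable borel" for z
  proof -
    have "(\<lambda>x. (x, z)) \<in> borel \<rightarrow>\<^sub>M borel \<Otimes>\<^sub>M borel" by measurable
    from measurable_compose[OF this r] show ?thesis by simp
  qed
  have b: "\<bar>K x y * (r x z * r y z)\<bar> \<le> Kb * (C * C)" if "x \<in> Sph" "y \<in> Sph" "z \<in> Sph" for x y z
    unfolding abs_mult by (intro mult_mono K_bound rb that Kb_nonneg C mult_nonneg_nonneg) auto
  have s: "sbounded (\<lambda>x. r x z)" if "z \<in> Sph" for z
    by (rule sboundedI[OF rm]) (rule rb[OF _ that])
  have "(\<integral>x. \<integral>y. K x y * (\<integral>z. r x z * r y z \<partial>surf) \<partial>surf \<partial>surf)
      = (\<integral>x. \<integral>z. \<integral>y. K x y * (r x z * r y z) \<partial>surf \<partial>surf \<partial>surf)"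
  proof (rule surf.integral_cong_Sph)
    fix x :: "real^'n" assume x: "x \<in> Sph"
    have "(\<integral>y. K x y * (\<integral>z. r x z * r y z \<partial>surf) \<partial>surf) = (\<integral>y. \<integral>z. K x y * (r x z * r y z) \<partial>surf \<partial>surf)"
      by simp
    also have "\<dots> = (\<integral>z. \<integral>y. K x y * (r x z * r y z) \<partial>surf \<partial>surf)"
    proof (rule sph_Fubini[OF surf_sph_measure surf_sph_measure])
      show "\<bar>K x y * (r x z * r y z)\<bar> \<le> Kb * (C * C)" if "y \<in> Sph" "z \<in> Sph" for y z by (rule b[OF x that])
    qed measurable
    finally show "(\<integral>y. K x y * (\<integral>z. r x z * r y z \<partial>surf) \<partial>surf) = (\<integral>z. \<integral>y. K x y * (r x z * r y z) \<partial>surf \<partial>surf)" .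
  qed measurable
  also have "\<dots> = (\<integral>z. \<integral>x. \<integral>y. K x y * (r x z * r y z) \<partial>surf \<partial>surf \<partial>surf)"
  proof (rule sph_Fubini[OF surf_sph_measure surf_sph_measure])
    show "\<bar>\<integral>y. K x y * (r x z * r y z) \<partial>surf\<bar> \<le> Kb * (C * C) * measure (surf :: (real^'n) measure) UNIV"
      if x: "x \<in> Sph" and z: "z \<in> Sph" for x z
    proof (rule surf.abs_integral_le_Sph)
      show "integrable surf (\<lambda>y. K x y * (r x z * r y z))"
        by (intro surf.integrable_sbounded sbounded_mult sbounded_const sbounded_K x s z)
      show "\<bar>K x y * (r x z * r y z)\<bar> \<le> Kb * (C * C)" if "y \<in> Sph" for y by (rule b[OF x that z])
    qed
  qed measurable
  also have "\<dots> = (\<integral>z. QF (\<lambda>x. r x z) \<partial>surf)"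
  proof -
    have "(\<integral>x. \<integral>y. K x y * (r x z * r y z) \<partial>surf \<partial>surf) = QF (\<lambda>x. r x z)" for z
    proof -
      have "(\<integral>y. K x y * (r x z * r y z) \<partial>surf) = T (\<lambda>x. r x z) x * r x z" for x
      proof -
        have "(\<integral>y. K x y * (r x z * r y z) \<partial>surf) = (\<integral>y. K x y * r y z * r x z \<partial>surf)"
          by (simp only: mult.assoc mult.commute[of "r x z"])
        then show ?thesis unfolding T_def by simp
      qed
      then show ?thesis unfolding QF_def by (simp only:)
    qed
    then show ?thesis by (simp only:)
  qed
  also have "\<dots> \<ge> 0" by (intro surf.integral_nonneg_Sph QF_nonneg s)
  finally show ?thesis .
qed

definition tau :: "nat \<Rightarrow> real" where
  "tau k = (\<integral>x. \<integral>y. K x y * gegenC l k (y \<bullet> x) \<partial>surf \<partial>surf)"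

definition tk :: "nat \<Rightarrow> real^'n \<Rightarrow> real" where
  "tk k x = (\<integral>y. K x y * gegenC l k (y \<bullet> x) \<partial>surf)"

lemma tk_measurable [measurable]: "tk k \<in> borel_measurable borel"
  unfolding tk_def[abs_def] by measurable

lemma sbounded_tk: "sbounded (tk k)"
proof -
  obtain D where D: "D \<ge> 0" "\<And>x y::real^'n. x \<in> Sph \<Longrightarrow> y \<in> Sph \<Longrightarrow> \<bar>gegenC l k (x \<bullet> y)\<bar> \<le> D" by (rule gegen_bounded[of k]) blast
  show ?thesis
  proof (rule sboundedI)
    fix x :: "real^'n" assume x: "x \<in> Sph"
    show "\<bar>tk k x\<bar> \<le> Kb * D * measure (surf :: (real^'n) measure) UNIV" unfolding tk_def
    proof (rule surf.abs_integral_le_Sph)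
      show "integrable surf (\<lambda>y. K x y * gegenC l k (y \<bullet> x))"
        by (intro surf.integrable_sbounded sbounded_mult sbounded_K sbounded_gegen x)
      show "\<bar>K x y * gegenC l k (y \<bullet> x)\<bar> \<le> Kb * D" if "y \<in> Sph" for y
        unfolding abs_mult by (intro mult_mono K_bound D x that Kb_nonneg) auto
    qed
  qed measurable
qed

lemma tau_eq: "tau k = (\<integral>x. tk k x \<partial>surf)"
  unfolding tau_def tk_def ..

lemma tau_sum:
  assumes "finite A"
  shows "(\<Sum>k\<in>A. a k * tau k) = (\<integral>x. \<integral>y. K x y * (\<Sum>k\<in>A. a k * gegenC l k (y \<bullet> x)) \<partial>surf \<partial>surf)"
proof -
  have in1: "(\<integral>y. K x y * (\<Sum>k\<in>A. a k * gegenC l k (y \<bullet> x)) \<partial>surf) = (\<Sum>k\<in>A. a k * tk k x)" if x: "x \<in> Sph" for x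
  proof -
    have "K x y * (\<Sum>k\<in>A. a k * gegenC l k (y \<bullet> x)) = (\<Sum>k\<in>A. a k * (K x y * gegenC l k (y \<bullet> x)))" for y
      by (simp only: sum_distrib_left mult.left_commute)
    then have "(\<integral>y. K x y * (\<Sum>k\<in>A. a k * gegenC l k (y \<bullet> x)) \<partial>surf) = (\<integral>y. (\<Sum>k\<in>A. a k * (K x y * gegenC l k (y \<bullet> x))) \<partial>surf)"
      by (simp only:)
    also have "\<dots> = (\<Sum>k\<in>A. \<integral>y. a k * (K x y * gegenC l k (y \<bullet> x)) \<partial>surf)"
      by (intro Bochner_Integration.integral_sum surf.integrable_sbounded sbounded_mult sbounded_const sbounded_K sbounded_gegen x)
    finally show ?thesis unfolding integral_mult_right_zero tk_def .
  qed
  have "(\<Sum>k\<in>A. a k * tau k) = (\<Sum>k\<in>A. \<integral>x. a k * tk k x \<partial>surf)" by (simp add: tau_eq)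
  also have "\<dots> = (\<integral>x. (\<Sum>k\<in>A. a k * tk k x) \<partial>surf)"
    by (rule Bochner_Integration.integral_sum[symmetric]; intro surf.integrable_sbounded sbounded_mult sbounded_const sbounded_tk)
  also have "\<dots> = (\<integral>x. \<integral>y. K x y * (\<Sum>k\<in>A. a k * gegenC l k (y \<bullet> x)) \<partial>surf \<partial>surf)"
    by (rule surf.integral_cong_Sph[OF _ _ in1[symmetric]]) measurable
  finally show ?thesis .
qed

text \<open>A zonal polynomial convolved with itself is \<open>ck\<close> times itself, so it has
  the form required by \<open>square_kernel_nonneg\<close>.\<close>

lemma tau_nonneg: "tau k \<ge> 0"
proof -
  obtain D where D: "D \<ge> 0" "\<And>x y::real^'n. x \<in> Sph \<Longrightarrow> y \<in> Sph \<Longrightarrow> \<bar>gegenC l k (x \<bullet> y)\<bar> \<le> D" by (rule gegen_bounded[of k]) blast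
  have "0 \<le> (\<integral>x. \<integral>y. K x y * (\<integral>z. gegenC l k (z \<bullet> x) * gegenC l k (z \<bullet> y) \<partial>surf) \<partial>surf \<partial>surf)"
    by (rule square_kernel_nonneg[where C = D]) (measurable, rule D(2))
  also have "\<dots> = (\<integral>x. \<integral>y. K x y * (\<Sum>i\<in>{k}. ck i * gegenC l i (y \<bullet> x)) \<partial>surf \<partial>surf)"
  proof (rule surf.integral_cong_Sph)
    fix x :: "real^'n" assume x: "x \<in> Sph"
    show "(\<integral>y. K x y * (\<integral>z. gegenC l k (z \<bullet> x) * gegenC l k (z \<bullet> y) \<partial>surf) \<partial>surf) = (\<integral>y. K x y * (\<Sum>i\<in>{k}. ck i * gegenC l i (y \<bullet> x)) \<partial>surf)"
    proof (rule surf.integral_cong_Sph)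
      fix y :: "real^'n" assume y: "y \<in> Sph"
      show "K x y * (\<integral>z. gegenC l k (z \<bullet> x) * gegenC l k (z \<bullet> y) \<partial>surf) = K x y * (\<Sum>i\<in>{k}. ck i * gegenC l i (y \<bullet> x))"
        using gegen_convolution2[OF x y, of k k] by (simp add: inner_commute)
    qed measurable
  qed measurable
  also have "\<dots> = (\<Sum>i\<in>{k}. ck i * tau i)" by (rule tau_sum[symmetric]) simp
  finally show ?thesis using ck_pos[of k] by (simp add: zero_le_mult_iff)
qed

text \<open>Since \<open>JJ N\<close> is nonnegative with integral one, each inner integral is an
  average of kernel values.\<close>

lemma jb_tau_bound: "(\<Sum>k\<le>N. jb N k * tau k) \<le> Kb * omega TYPE('n)"
proof -
  have eq: "(\<Sum>k\<le>N. jb N k * tau k) = (\<integral>x. \<integral>y. K x y * JJ N (y \<bullet> x) \<partial>surf \<partial>surf)"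
    unfolding JJ_def by (rule tau_sum) simp
  have [measurable]: "JJ N \<in> borel_measurable borel" by (rule borel_measurable_continuous_onI[OF continuous_JJ])
  have sJ: "sbounded (\<lambda>y. JJ N (y \<bullet> x))" if "x \<in> Sph" for x :: "real^'n" by (rule sbounded_zonal[OF continuous_JJ that])
  have b: "\<bar>\<integral>y. K x y * JJ N (y \<bullet> x) \<partial>surf\<bar> \<le> Kb" if x: "x \<in> Sph" for x
  proof -
    have "\<bar>\<integral>y. K x y * JJ N (y \<bullet> x) \<partial>surf\<bar> \<le> (\<integral>y. \<bar>K x y * JJ N (y \<bullet> x)\<bar> \<partial>surf)" by simp
    also have "\<dots> \<le> (\<integral>y. Kb * JJ N (y \<bullet> x) \<partial>surf)"
    proof (rule surf.integral_mono_Sph)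
      show "integrable surf (\<lambda>y. \<bar>K x y * JJ N (y \<bullet> x)\<bar>)"
        by (rule integrable_abs, intro surf.integrable_sbounded sbounded_mult sbounded_K sJ x)
      show "integrable surf (\<lambda>y. Kb * JJ N (y \<bullet> x))"
        by (intro surf.integrable_sbounded sbounded_mult sbounded_const sJ x)
      show "\<bar>K x y * JJ N (y \<bullet> x)\<bar> \<le> Kb * JJ N (y \<bullet> x)" if y: "y \<in> Sph" for y
        unfolding abs_mult abs_of_nonneg[OF JJ_nonneg[OF y x]]
        by (rule mult_right_mono[OF K_bound[OF x y] JJ_nonneg[OF y x]])
    qed
    also have "\<dots> = Kb" using integral_JJ[OF x, of N] by simp
    finally show ?thesis .
  qed
  have "\<bar>\<integral>x. \<integral>y. K x y * JJ N (y \<bullet> x) \<partial>surf \<partial>surf\<bar> \<le> Kb * measure (surf :: (real^'n) measure) UNIV"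
    by (rule surf.abs_integral_le_Sph[OF surf.integrable_bounded[OF _ b] b]) measurable
  then show ?thesis unfolding eq omega_eq by linarith
qed

text \<open>For fixed \<open>x\<close> the difference of \<open>K x * mu\<close> and
  \<open>K x\<close> is paired in \<open>y\<close> with a zonal polynomial about \<open>x\<close>.
  The multiplier identity evaluates the pairing degree by degree, the Hoelder bound times the
  \<open>L\<^sup>1\<close> norm \<open>Q\<close> estimates it, and integration over \<open>x\<close>
  turns \<open>tk\<close> into \<open>tau\<close>.\<close>

lemma hoelder_trace:
  fixes mu :: "'n smeasure"
  assumes mu: "mu \<in> Mxi xi" and A: "finite A"
    and hol: "\<And>x y. x \<in> Sph \<Longrightarrow> y \<in> Sph \<Longrightarrow> \<bar>sconv xi (K x) mu y - K x y\<bar> \<le> B x * t"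
    and B: "AE x in surf. B x \<le> Cb" and t: "t \<ge> 0"
    and Q: "\<And>x::real^'n. x \<in> Sph \<Longrightarrow> (\<integral>y. \<bar>\<Sum>k\<in>A. a k * gegenC l k (y \<bullet> x)\<bar> \<partial>surf) \<le> Q"
  shows "\<bar>\<Sum>k\<in>A. a k * ((multiplier xi mu k - 1) * tau k)\<bar> \<le> max Cb 0 * t * Q * omega TYPE('n)"
proof -
  have Q0: "Q \<ge> 0"
  proof -
    have "0 \<le> (\<integral>y. \<bar>\<Sum>k\<in>A. a k * gegenC l k (y \<bullet> xi)\<bar> \<partial>surf)" by simp
    then show ?thesis using Q[OF xi] by linarith
  qed
  define F where "F = (\<lambda>x. \<Sum>k\<in>A. a k * ((multiplier xi mu k - 1) * tk k x))"
  have sF: "sbounded F" unfolding F_def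
    by (intro sbounded_sum sbounded_mult sbounded_const sbounded_tk)
  have Fb: "\<bar>F x\<bar> \<le> B x * t * Q" if x: "x \<in> Sph" for x
  proof -
    define s where "s = (\<lambda>y. if y \<in> Sph then sconv xi (K x) mu y else 0)"
    have ss: "sbounded s" unfolding s_def by (rule sconv_multiplier(1)[OF mu sbounded_K[OF x] continuous_K[OF x] x])
    have sq: "sbounded (\<lambda>y. \<Sum>k\<in>A. a k * gegenC l k (y \<bullet> x))"
      by (intro sbounded_sum sbounded_mult sbounded_const sbounded_gegen x)
    have each: "(\<integral>y. (s y - K x y) * gegenC l k (y \<bullet> x) \<partial>surf) = (multiplier xi mu k - 1) * tk k x" for k
    proof -
      have "(\<integral>y. (s y - K x y) * gegenC l k (y \<bullet> x) \<partial>surf) = (\<integral>y. s y * gegenC l k (y \<bullet> x) - K x y * gegenC l k (y \<bullet> x) \<partial>surf)"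
        by (simp only: left_diff_distrib)
      also have "\<dots> = (\<integral>y. s y * gegenC l k (y \<bullet> x) \<partial>surf) - (\<integral>y. K x y * gegenC l k (y \<bullet> x) \<partial>surf)"
        by (rule Bochner_Integration.integral_diff; intro surf.integrable_sbounded sbounded_mult ss sbounded_K sbounded_gegen x)
      also have "(\<integral>y. s y * gegenC l k (y \<bullet> x) \<partial>surf) = multiplier xi mu k * tk k x"
        unfolding s_def tk_def by (rule sconv_multiplier(2)[OF mu sbounded_K[OF x] continuous_K[OF x] x])
      finally show ?thesis by (simp add: tk_def left_diff_distrib)
    qed
    have "(s y - K x y) * (\<Sum>k\<in>A. a k * gegenC l k (y \<bullet> x)) = (\<Sum>k\<in>A. a k * ((s y - K x y) * gegenC l k (y \<bullet> x)))" for y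
      by (simp only: sum_distrib_left mult.left_commute)
    then have "(\<integral>y. (s y - K x y) * (\<Sum>k\<in>A. a k * gegenC l k (y \<bullet> x)) \<partial>surf) = (\<integral>y. (\<Sum>k\<in>A. a k * ((s y - K x y) * gegenC l k (y \<bullet> x))) \<partial>surf)"
      by (simp only:)
    also have "\<dots> = (\<Sum>k\<in>A. \<integral>y. a k * ((s y - K x y) * gegenC l k (y \<bullet> x)) \<partial>surf)"
      by (intro Bochner_Integration.integral_sum surf.integrable_sbounded sbounded_mult sbounded_diff sbounded_const ss sbounded_K sbounded_gegen x)
    also have "\<dots> = F x" unfolding integral_mult_right_zero each F_def ..
    finally have "\<bar>F x\<bar> = \<bar>\<integral>y. (s y - K x y) * (\<Sum>k\<in>A. a k * gegenC l k (y \<bullet> x)) \<partial>surf\<bar>" by simp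
    also have "\<dots> \<le> (\<integral>y. \<bar>(s y - K x y) * (\<Sum>k\<in>A. a k * gegenC l k (y \<bullet> x))\<bar> \<partial>surf)" by simp
    also have "\<dots> \<le> (\<integral>y. B x * t * \<bar>\<Sum>k\<in>A. a k * gegenC l k (y \<bullet> x)\<bar> \<partial>surf)"
    proof (rule surf.integral_mono_Sph)
      show "integrable surf (\<lambda>y. \<bar>(s y - K x y) * (\<Sum>k\<in>A. a k * gegenC l k (y \<bullet> x))\<bar>)"
        by (rule integrable_abs, intro surf.integrable_sbounded sbounded_mult sbounded_diff ss sbounded_K x sq)
      show "integrable surf (\<lambda>y. B x * t * \<bar>\<Sum>k\<in>A. a k * gegenC l k (y \<bullet> x)\<bar>)"
        by (rule integrable_mult_right, rule integrable_abs, rule surf.integrable_sbounded[OF sq])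
      show "\<bar>(s y - K x y) * (\<Sum>k\<in>A. a k * gegenC l k (y \<bullet> x))\<bar> \<le> B x * t * \<bar>\<Sum>k\<in>A. a k * gegenC l k (y \<bullet> x)\<bar>" if y: "y \<in> Sph" for y
        unfolding abs_mult using hol[OF x y] y by (intro mult_right_mono) (auto simp: s_def)
    qed
    also have "\<dots> = B x * t * (\<integral>y. \<bar>\<Sum>k\<in>A. a k * gegenC l k (y \<bullet> x)\<bar> \<partial>surf)" by simp
    also have "\<dots> \<le> B x * t * Q"
    proof (rule mult_left_mono[OF Q[OF x]])
      \<comment> \<open>Read off from the Hoelder inequality itself, on the diagonal.\<close>
      show "0 \<le> B x * t" using hol[OF x x] by linarith
    qed
    finally show ?thesis .
  qed
  have "(\<Sum>k\<in>A. a k * ((multiplier xi mu k - 1) * tau k)) = (\<Sum>k\<in>A. \<integral>x. a k * ((multiplier xi mu k - 1) * tk k x) \<partial>surf)"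
    by (simp add: tau_eq)
  also have "\<dots> = (\<integral>x. F x \<partial>surf)" unfolding F_def
    by (rule Bochner_Integration.integral_sum[symmetric]; intro surf.integrable_sbounded sbounded_mult sbounded_const sbounded_tk)
  finally have "\<bar>\<Sum>k\<in>A. a k * ((multiplier xi mu k - 1) * tau k)\<bar> = \<bar>\<integral>x. F x \<partial>surf\<bar>" by simp
  also have "\<dots> \<le> (\<integral>x. \<bar>F x\<bar> \<partial>surf)" by simp
  also have "\<dots> \<le> (\<integral>x. max Cb 0 * t * Q \<partial>(surf :: (real^'n) measure))"
  proof (rule integral_mono_AE)
    show "integrable surf (\<lambda>x. \<bar>F x\<bar>)" by (rule integrable_abs, rule surf.integrable_sbounded[OF sF])
    show "AE x in surf. \<bar>F x\<bar> \<le> max Cb 0 * t * Q"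
      using B surf.AE_Sph
    proof eventually_elim
      case (elim x)
      have "\<bar>F x\<bar> \<le> B x * t * Q" by (rule Fb[OF elim(2)])
      also have "\<dots> \<le> max Cb 0 * t * Q" using elim(1) t Q0 by (intro mult_right_mono) auto
      finally show ?case .
    qed
  qed simp
  also have "\<dots> = max Cb 0 * t * Q * omega TYPE('n)" by (simp add: omega_eq)
  finally show ?thesis .
qed

lemma hoelder_trace_JJ:
  fixes mu :: "'n smeasure"
  assumes mu: "mu \<in> Mxi xi"
    and hol: "\<And>x y. x \<in> Sph \<Longrightarrow> y \<in> Sph \<Longrightarrow> \<bar>sconv xi (K x) mu y - K x y\<bar> \<le> B x * t"
    and B: "AE x in surf. B x \<le> Cb" and t: "t \<ge> 0"
  shows "\<bar>\<Sum>k\<le>N. jb N k * ((multiplier xi mu k - 1) * tau k)\<bar> \<le> max Cb 0 * t * omega TYPE('n)"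
proof -
  have "\<bar>\<Sum>k\<le>N. jb N k * ((multiplier xi mu k - 1) * tau k)\<bar> \<le> max Cb 0 * t * 1 * omega TYPE('n)"
  proof (rule hoelder_trace[OF mu _ hol B t])
    fix x :: "real^'n" assume x: "x \<in> Sph"
    have "(\<integral>y. \<bar>\<Sum>k\<le>N. jb N k * gegenC l k (y \<bullet> x)\<bar> \<partial>surf) = (\<integral>y. JJ N (y \<bullet> x) \<partial>surf)"
    proof (rule surf.integral_cong_Sph)
      fix y :: "real^'n" assume y: "y \<in> Sph"
      show "\<bar>\<Sum>k\<le>N. jb N k * gegenC l k (y \<bullet> x)\<bar> = JJ N (y \<bullet> x)"
        using JJ_nonneg[OF y x, of N] by (simp add: JJ_def)
    qed (unfold JJ_def, measurable)
    then show "(\<integral>y. \<bar>\<Sum>k\<le>N. jb N k * gegenC l k (y \<bullet> x)\<bar> \<partial>surf) \<le> 1" using integral_JJ[OF x, of N] by simp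
  qed simp
  then show ?thesis by simp
qed

text \<open>The constant depends on the degree but not on the measure, so it remains fixed as
  \<open>t \<rightarrow> 0\<close>; this serves to compare the multipliers of individual
  degrees.\<close>

lemma hoelder_trace_single:
  obtains D where "D \<ge> 0" "\<And>mu B t Cb. mu \<in> Mxi xi
    \<Longrightarrow> (\<And>x y. x \<in> Sph \<Longrightarrow> y \<in> Sph \<Longrightarrow> \<bar>sconv xi (K x) mu y - K x y\<bar> \<le> B x * t)
    \<Longrightarrow> AE x in surf. B x \<le> Cb \<Longrightarrow> t \<ge> 0 \<Longrightarrow> \<bar>multiplier xi mu k - 1\<bar> * tau k \<le> max Cb 0 * t * D"
proof -
  obtain D where D: "D \<ge> 0" "\<And>x y::real^'n. x \<in> Sph \<Longrightarrow> y \<in> Sph \<Longrightarrow> \<bar>gegenC l k (x \<bullet> y)\<bar> \<le> D" by (rule gegen_bounded[of k]) blast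
  show ?thesis
  proof (rule that[of "D * omega TYPE('n) * omega TYPE('n)"])
    show "0 \<le> D * omega TYPE('n) * omega TYPE('n)" using D omega_pos[where 'n='n] by simp
    fix mu :: "'n smeasure" and B t Cb
    assume mu: "mu \<in> Mxi xi" and hol: "\<And>x y. x \<in> Sph \<Longrightarrow> y \<in> Sph \<Longrightarrow> \<bar>sconv xi (K x) mu y - K x y\<bar> \<le> B x * t"
      and B: "AE x in surf. B x \<le> Cb" and t: "t \<ge> 0"
    have "\<bar>\<Sum>i\<in>{k}. 1 * ((multiplier xi mu i - 1) * tau i)\<bar> \<le> max Cb 0 * t * (D * omega TYPE('n)) * omega TYPE('n)"
    proof (rule hoelder_trace[OF mu _ hol B t])
      fix x :: "real^'n" assume x: "x \<in> Sph"
      have "\<bar>\<integral>y. \<bar>\<Sum>i\<in>{k}. 1 * gegenC l i (y \<bullet> x)\<bar> \<partial>surf\<bar> \<le> D * measure (surf :: (real^'n) measure) UNIV"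
      proof (rule surf.abs_integral_le_Sph)
        show "integrable surf (\<lambda>y. \<bar>\<Sum>i\<in>{k}. 1 * gegenC l i (y \<bullet> x)\<bar>)"
          using surf.integrable_sbounded[OF sbounded_gegen[OF x, of k]] by simp
      qed (use D x in simp)
      then show "(\<integral>y. \<bar>\<Sum>i\<in>{k}. 1 * gegenC l i (y \<bullet> x)\<bar> \<partial>surf) \<le> D * omega TYPE('n)"
        unfolding omega_eq by linarith
    qed simp
    moreover have "\<bar>\<Sum>i\<in>{k}. 1 * ((multiplier xi mu i - 1) * tau i)\<bar> = \<bar>multiplier xi mu k - 1\<bar> * tau k"
      using tau_nonneg[of k] by (simp add: abs_mult)
    ultimately show "\<bar>multiplier xi mu k - 1\<bar> * tau k \<le> max Cb 0 * t * (D * omega TYPE('n) * omega TYPE('n))"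
      by (simp only: mult.assoc)
  qed
qed

end

subsection \<open>Traces over orthonormal families\<close>

definition sbounded2 :: "(real^'n::finite \<Rightarrow> real^'n \<Rightarrow> real) \<Rightarrow> bool" where
  "sbounded2 r \<longleftrightarrow> (\<exists>C. \<forall>x\<in>Sph. \<forall>z\<in>Sph. \<bar>r x z\<bar> \<le> C)"

lemma sbounded2I: "(\<And>x z. x \<in> Sph \<Longrightarrow> z \<in> Sph \<Longrightarrow> \<bar>r x z\<bar> \<le> C) \<Longrightarrow> sbounded2 r"
  unfolding sbounded2_def by (rule exI[of _ C]) blast

lemma sbounded2_add:
  assumes "sbounded2 r" "sbounded2 s" shows "sbounded2 (\<lambda>x z. r x z + s x z)"
proof -
  obtain C where C: "\<forall>x\<in>Sph. \<forall>z\<in>Sph. \<bar>r x z\<bar> \<le> C" using assms(1) unfolding sbounded2_def by blast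
  obtain D where D: "\<forall>x\<in>Sph. \<forall>z\<in>Sph. \<bar>s x z\<bar> \<le> D" using assms(2) unfolding sbounded2_def by blast
  show ?thesis
  proof (rule sbounded2I)
    fix x z :: "real^'a" assume "x \<in> Sph" "z \<in> Sph"
    then have "\<bar>r x z\<bar> \<le> C" "\<bar>s x z\<bar> \<le> D" using C D by blast+
    then show "\<bar>r x z + s x z\<bar> \<le> C + D" by linarith
  qed
qed

lemma sbounded2_minus: "sbounded2 r \<Longrightarrow> sbounded2 (\<lambda>x z. - r x z)"
  unfolding sbounded2_def by simp

lemma sbounded2_diff: "sbounded2 r \<Longrightarrow> sbounded2 s \<Longrightarrow> sbounded2 (\<lambda>x z. r x z - s x z)"
  using sbounded2_add[of r "\<lambda>x z. - s x z"] sbounded2_minus[of s] by simp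

lemma sbounded2_sum:
  "(\<And>i. i \<in> A \<Longrightarrow> sbounded2 (r i)) \<Longrightarrow> sbounded2 (\<lambda>x z. \<Sum>i\<in>A. r i x z)"
proof (induction A rule: infinite_finite_induct)
  case (insert i A)
  then show ?case using sbounded2_add[of "r i" "\<lambda>x z. \<Sum>i\<in>A. r i x z"] by simp
qed (auto intro: sbounded2I[of _ 0])

lemma sbounded2_times:
  assumes "sbounded f" "sbounded g" shows "sbounded2 (\<lambda>x z. f x * g z)"
proof -
  obtain C where C: "C \<ge> 0" "\<And>x. x \<in> Sph \<Longrightarrow> \<bar>f x\<bar> \<le> C" using assms(1) by (rule sboundedE) blast
  obtain D where D: "D \<ge> 0" "\<And>x. x \<in> Sph \<Longrightarrow> \<bar>g x\<bar> \<le> D" using assms(2) by (rule sboundedE) blast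
  show ?thesis
    by (rule sbounded2I[of _ "C * D"]) (unfold abs_mult, intro mult_mono C D abs_ge_zero)
qed

context sphere_kernel begin

lemma sbounded_smooth:
  assumes g: "sbounded g" shows "sbounded (smooth N g)"
proof -
  obtain C where C: "C \<ge> 0" "\<And>x. x \<in> Sph \<Longrightarrow> \<bar>g x\<bar> \<le> C" using g by (rule sboundedE) blast
  have m: "g \<in> borel_measurable borel" using g by (rule sbounded_measurable)
  show ?thesis by (rule sboundedI[OF measurable_smooth[OF m] smooth_bound[OF m C(2)]])
qed

text \<open>The smoothing moves from \<open>g\<close>, which may be discontinuous, to the continuous
  section \<open>K y\<close>, where \<open>smooth_tendsto\<close> applies.\<close>

lemma T_smooth:
  assumes g: "sbounded g" and y: "y \<in> Sph"
  shows "T (smooth N g) y = (\<integral>v. smooth N (K y) v * g v \<partial>surf)"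
proof -
  obtain C where C: "C \<ge> 0" "\<And>x. x \<in> Sph \<Longrightarrow> \<bar>g x\<bar> \<le> C" using g by (rule sboundedE) blast
  have [measurable]: "g \<in> borel_measurable borel" using g by (rule sbounded_measurable)
  obtain D where D: "D \<ge> 0" "\<And>x y::real^'n. x \<in> Sph \<Longrightarrow> y \<in> Sph \<Longrightarrow> \<bar>J N (x \<bullet> y)\<bar> \<le> D"
    by (rule J_bounded[of N]) blast
  have "T (smooth N g) y = (\<integral>x. \<integral>v. K y x * (J N (v \<bullet> x) * g v) \<partial>surf \<partial>surf)"
    unfolding T_def smooth_def by simp
  also have "\<dots> = (\<integral>v. \<integral>x. K y x * (J N (v \<bullet> x) * g v) \<partial>surf \<partial>surf)"
  proof (rule sph_Fubini[OF surf_sph_measure surf_sph_measure, where C = "Kb * (D * C)"])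
    fix x v :: "real^'n" assume xv: "x \<in> Sph" "v \<in> Sph"
    show "\<bar>K y x * (J N (v \<bullet> x) * g v)\<bar> \<le> Kb * (D * C)"
      unfolding abs_mult by (intro mult_mono K_bound D C xv y Kb_nonneg mult_nonneg_nonneg) auto
  qed measurable
  also have "\<dots> = (\<integral>v. smooth N (K y) v * g v \<partial>surf)"
  proof -
    have "(\<integral>x. K y x * (J N (v \<bullet> x) * g v) \<partial>surf) = smooth N (K y) v * g v" for v
    proof -
      have "K y x * (J N (v \<bullet> x) * g v) = J N (x \<bullet> v) * K y x * g v" for x
        by (simp only: inner_commute[of v x] mult.assoc mult.left_commute)
      then have "(\<integral>x. K y x * (J N (v \<bullet> x) * g v) \<partial>surf) = (\<integral>x. J N (x \<bullet> v) * K y x * g v \<partial>surf)"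
        by (simp only:)
      then show ?thesis unfolding smooth_def by simp
    qed
    then show ?thesis by (simp only:)
  qed
  finally show ?thesis .
qed

text \<open>By the symmetry of \<open>T\<close> the energy splits into a term smoothed once, which
  converges through \<open>T_smooth\<close>, and an error in which
  \<open>T (smooth N g) - T g\<close> tends to zero against a uniformly bounded factor.\<close>

lemma QF_smooth_tendsto:
  assumes g: "sbounded g"
  shows "(\<lambda>N. QF (smooth N g)) \<longlonglongrightarrow> QF g"
proof -
  obtain C where C: "C \<ge> 0" "\<And>x. x \<in> Sph \<Longrightarrow> \<bar>g x\<bar> \<le> C" using g by (rule sboundedE) blast
  have gm [measurable]: "g \<in> borel_measurable borel" using g by (rule sbounded_measurable)
  have sm: "\<bar>smooth N g u\<bar> \<le> C" if "u \<in> Sph" for N u by (rule smooth_bound[OF gm C(2) that])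
  have Tlim: "(\<lambda>N. T (smooth N g) y) \<longlonglongrightarrow> T g y" if y: "y \<in> Sph" for y
  proof -
    have "(\<lambda>N. \<integral>v. smooth N (K y) v * g v \<partial>surf) \<longlonglongrightarrow> (\<integral>v. K y v * g v \<partial>surf)"
    proof (rule surf.integral_dominated_Sph[where C = "Kb * C"])
      fix v :: "real^'n" assume v: "v \<in> Sph"
      show "\<bar>smooth N (K y) v * g v\<bar> \<le> Kb * C" for N
        unfolding abs_mult by (intro mult_mono smooth_bound K_section_measurable K_bound C v y Kb_nonneg) auto
      show "(\<lambda>N. smooth N (K y) v * g v) \<longlonglongrightarrow> K y v * g v"
        by (intro tendsto_mult tendsto_const smooth_tendsto sbounded_K continuous_K v y)
    qed measurable
    then show ?thesis unfolding T_smooth[OF g y] T_def[symmetric] .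
  qed
  define W where "W = Kb * C * omega TYPE('n)"
  have W: "W \<ge> 0" unfolding W_def using Kb_nonneg C omega_pos[where 'n='n] by simp
  have Tb: "\<bar>T (smooth N g) y\<bar> \<le> W" if "y \<in> Sph" for N y
    unfolding W_def by (rule T_bound[OF measurable_smooth[OF gm] sm that])
  have Tgb: "\<bar>T g y\<bar> \<le> W" if "y \<in> Sph" for y
    unfolding W_def by (rule T_bound[OF gm C(2) that])
  have L1: "(\<lambda>N. \<integral>x. T (smooth N g) x * g x \<partial>surf) \<longlonglongrightarrow> QF g" unfolding QF_def
  proof (rule surf.integral_dominated_Sph[where C = "W * C"])
    fix x :: "real^'n" assume x: "x \<in> Sph"
    show "\<bar>T (smooth N g) x * g x\<bar> \<le> W * C" for N
      unfolding abs_mult by (intro mult_mono Tb C x W) auto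
    show "(\<lambda>N. T (smooth N g) x * g x) \<longlonglongrightarrow> T g x * g x" by (intro tendsto_mult tendsto_const Tlim x)
  qed measurable
  have L2: "(\<lambda>N. \<integral>x. (T (smooth N g) x - T g x) * smooth N g x \<partial>surf) \<longlonglongrightarrow> (\<integral>x. 0 \<partial>(surf :: (real^'n) measure))"
  proof (rule surf.integral_dominated_Sph[where C = "(W + W) * C"])
    fix x :: "real^'n" assume x: "x \<in> Sph"
    have tb: "\<bar>T (smooth N g) x - T g x\<bar> \<le> W + W" for N using Tb[OF x, of N] Tgb[OF x] by linarith
    show "\<bar>(T (smooth N g) x - T g x) * smooth N g x\<bar> \<le> (W + W) * C" for N
      unfolding abs_mult using W by (intro mult_mono tb sm x) auto
    have "(\<lambda>N. (T (smooth N g) x - T g x) * C) \<longlonglongrightarrow> (T g x - T g x) * C"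
      by (intro tendsto_mult tendsto_diff tendsto_const Tlim x)
    then have "(\<lambda>N. (T (smooth N g) x - T g x) * C) \<longlonglongrightarrow> 0" by simp
    then show "(\<lambda>N. (T (smooth N g) x - T g x) * smooth N g x) \<longlonglongrightarrow> 0"
      by (rule Lim_null_comparison[rotated, OF tendsto_rabs_zero])
         (use sm[OF x] C in \<open>auto simp: abs_mult intro!: always_eventually mult_left_mono\<close>)
  qed measurable
  have "QF (smooth N g) = (\<integral>x. T (smooth N g) x * g x \<partial>surf) + (\<integral>x. (T (smooth N g) x - T g x) * smooth N g x \<partial>surf)" for N
  proof -
    have "(\<integral>x. (T (smooth N g) x - T g x) * smooth N g x \<partial>surf) = QF (smooth N g) - (\<integral>x. T g x * smooth N g x \<partial>surf)"
      unfolding QF_def left_diff_distrib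
      by (rule Bochner_Integration.integral_diff; intro surf.integrable_sbounded sbounded_mult sbounded_T sbounded_smooth g)
    moreover have "(\<integral>x. T g x * smooth N g x \<partial>surf) = (\<integral>x. T (smooth N g) x * g x \<partial>surf)"
      by (rule T_symmetric[OF sbounded_smooth[OF g] g])
    ultimately show ?thesis by simp
  qed
  then show ?thesis using tendsto_add[OF L1 L2] by simp
qed

end

context sphere_dim begin

section \<open>Finite orthonormal families\<close>

definition ip :: "(real^'n \<Rightarrow> real) \<Rightarrow> (real^'n \<Rightarrow> real) \<Rightarrow> real" where
  "ip f g = (\<integral>x. f x * g x \<partial>surf)"

lemma ip_commute: "ip f g = ip g f"
  unfolding ip_def by (simp add: mult.commute)

lemma ip_cmult_left: "ip (\<lambda>x. c * f x) g = c * ip f g"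
  unfolding ip_def by (simp add: mult.assoc)

lemma ip_diff_left:
  assumes "sbounded f" "sbounded g" "sbounded h"
  shows "ip (\<lambda>x. f x - g x) h = ip f h - ip g h"
  unfolding ip_def left_diff_distrib
  by (rule Bochner_Integration.integral_diff; intro surf.integrable_sbounded sbounded_mult assms)

lemma ip_sum_left:
  assumes f: "\<And>i. i \<in> I \<Longrightarrow> sbounded (f i)" and "sbounded h"
  shows "ip (\<lambda>x. \<Sum>i\<in>I. f i x) h = (\<Sum>i\<in>I. ip (f i) h)"
  unfolding ip_def sum_distrib_right
  by (rule Bochner_Integration.integral_sum; intro surf.integrable_sbounded sbounded_mult f \<open>sbounded h\<close>)

lemma ip_self_nonneg: "ip f f \<ge> 0"
  unfolding ip_def by (rule integral_nonneg_AE) auto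

lemma ip_null:
  assumes f: "sbounded f" and 0: "ip f f = 0"
  shows "AE x in surf. f x = 0"
proof -
  have "integrable surf (\<lambda>x. f x * f x)" by (intro surf.integrable_sbounded sbounded_mult f)
  then have "AE x in surf. f x * f x = 0"
    using 0 unfolding ip_def by (subst integral_nonneg_eq_0_iff_AE[symmetric]) auto
  then show ?thesis by eventually_elim simp
qed

lemma ip_null_left:
  assumes f: "sbounded f" and 0: "ip f f = 0" and h: "sbounded h"
  shows "ip f h = 0"
proof -
  have [measurable]: "f \<in> borel_measurable borel" "h \<in> borel_measurable borel" using f h by (auto dest: sbounded_measurable)
  have "ip f h = (\<integral>x. 0 \<partial>(surf :: (real^'n) measure))" unfolding ip_def
  proof (rule integral_cong_AE)
    show "AE x in surf. f x * h x = 0" using ip_null[OF f 0] by eventually_elim simp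
  qed simp_all
  then show ?thesis by simp
qed

definition onf :: "nat \<Rightarrow> (nat \<Rightarrow> real^'n \<Rightarrow> real) \<Rightarrow> bool" where
  "onf r g \<longleftrightarrow> (\<forall>i<r. sbounded (g i)) \<and> (\<forall>i<r. \<forall>j<r. ip (g i) (g j) = (if i = j then 1 else 0))"

definition resid :: "nat \<Rightarrow> (nat \<Rightarrow> real^'n \<Rightarrow> real) \<Rightarrow> (real^'n \<Rightarrow> real) \<Rightarrow> real^'n \<Rightarrow> real" where
  "resid r g f x = f x - (\<Sum>i<r. ip f (g i) * g i x)"

lemma resid:
  assumes g: "onf r g" and f: "sbounded f"
  shows sbounded_resid: "sbounded (resid r g f)"
    and ip_resid: "sbounded h \<Longrightarrow> ip (resid r g f) h = ip f h - (\<Sum>i<r. ip f (g i) * ip (g i) h)"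
    and resid_orthogonal: "i < r \<Longrightarrow> ip (resid r g f) (g i) = 0"
    and ip_resid_self: "ip (resid r g f) (resid r g f) = ip f f - (\<Sum>i<r. (ip f (g i))\<^sup>2)"
    and ip_resid_self': "ip (resid r g f) (resid r g f) = ip f (resid r g f)"
proof -
  have gs: "sbounded (g i)" if "i < r" for i using g that by (simp add: onf_def)
  have ss: "sbounded (\<lambda>x. \<Sum>i<r. ip f (g i) * g i x)"
    by (intro sbounded_sum sbounded_mult sbounded_const gs) simp
  show s: "sbounded (resid r g f)" unfolding resid_def[abs_def] by (intro sbounded_diff f ss)
  have I: "ip (resid r g f) h = ip f h - (\<Sum>i<r. ip f (g i) * ip (g i) h)" if h: "sbounded h" for h
  proof -
    have "ip (resid r g f) h = ip f h - ip (\<lambda>x. \<Sum>i<r. ip f (g i) * g i x) h"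
      unfolding resid_def[abs_def] by (rule ip_diff_left[OF f ss h])
    also have "ip (\<lambda>x. \<Sum>i<r. ip f (g i) * g i x) h = (\<Sum>i<r. ip (\<lambda>x. ip f (g i) * g i x) h)"
      by (rule ip_sum_left[OF _ h]) (intro sbounded_mult sbounded_const gs, simp)
    finally show ?thesis unfolding ip_cmult_left .
  qed
  show "ip (resid r g f) h = ip f h - (\<Sum>i<r. ip f (g i) * ip (g i) h)" if "sbounded h" by (rule I[OF that])
  have o: "ip (resid r g f) (g i) = 0" if i: "i < r" for i
  proof -
    have "(\<Sum>j<r. ip f (g j) * ip (g j) (g i)) = (\<Sum>j<r. if j = i then ip f (g i) else 0)"
      using g i by (intro sum.cong refl) (auto simp: onf_def)
    then show ?thesis using I[OF gs[OF i]] i by simp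
  qed
  show "i < r \<Longrightarrow> ip (resid r g f) (g i) = 0" by (rule o)
  have o': "ip (g i) (resid r g f) = 0" if "i < r" for i
    unfolding ip_commute[of "g i"] by (rule o[OF that])
  show e: "ip (resid r g f) (resid r g f) = ip f (resid r g f)"
  proof -
    have "(\<Sum>i<r. ip f (g i) * ip (g i) (resid r g f)) = 0" by (rule sum.neutral) (use o' in simp)
    then show ?thesis using I[OF s] by linarith
  qed
  have "ip (resid r g f) f = ip f f - (\<Sum>i<r. ip f (g i) * ip (g i) f)" by (rule I[OF f])
  then show "ip (resid r g f) (resid r g f) = ip f f - (\<Sum>i<r. (ip f (g i))\<^sup>2)"
    unfolding e ip_commute[of "resid r g f" f] power2_eq_square ip_commute[of "g _" f] .
qed

lemma onf_extend:
  assumes g: "onf r g" and u: "sbounded u" "ip u u > 0" "\<And>i. i < r \<Longrightarrow> ip u (g i) = 0"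
  shows "onf (Suc r) (g(r := (\<lambda>x. (1 / sqrt (ip u u)) * u x)))"
proof -
  define w where "w = (\<lambda>x. (1 / sqrt (ip u u)) * u x)"
  have sw: "sbounded w" unfolding w_def by (rule sbounded_cmult[OF u(1)])
  have wl: "ip w h = (1 / sqrt (ip u u)) * ip u h" for h unfolding w_def by (rule ip_cmult_left)
  have ww: "ip w w = 1"
  proof -
    have "ip w w = (1 / sqrt (ip u u)) * ((1 / sqrt (ip u u)) * ip u u)"
      unfolding wl ip_commute[of u w] ..
    also have "\<dots> = ip u u / (sqrt (ip u u) * sqrt (ip u u))" by simp
    finally show ?thesis using u(2) by simp
  qed
  have wg: "ip w (g i) = 0" "ip (g i) w = 0" if "i < r" for i
    using u(3)[OF that] by (simp_all add: wl ip_commute[of _ w])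
  show ?thesis unfolding w_def[symmetric] onf_def
    using g sw ww wg by (auto simp: onf_def less_Suc_eq)
qed

text \<open>Bessel's inequality for the zonal family shows that no finite orthonormal family is complete.\<close>

lemma onf_incomplete:
  assumes g: "onf r g"
  obtains u where "sbounded u" "ip u u > 0" "\<And>i. i < r \<Longrightarrow> ip u (g i) = 0"
proof -
  define e where "e = (\<lambda>k z. (1 / sqrt (H k)) * gegenC l k (z \<bullet> xi))"
  have es: "sbounded (e k)" for k unfolding e_def by (intro sbounded_cmult sbounded_gegen xi)
  have ee: "ip (e j) (e k) = (if j = k then 1 else 0)" for j k
  proof -
    have "ip (e j) (e k) = (1 / sqrt (H j)) * ((1 / sqrt (H k)) * ip (\<lambda>z. gegenC l k (z \<bullet> xi)) (\<lambda>z. gegenC l j (z \<bullet> xi)))"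
      unfolding e_def ip_cmult_left ip_commute[of "\<lambda>z. gegenC l j (z \<bullet> xi)"] ..
    also have "ip (\<lambda>z. gegenC l k (z \<bullet> xi)) (\<lambda>z. gegenC l j (z \<bullet> xi)) = (if j = k then H k else 0)"
      unfolding ip_def using gegen_orthogonal[OF _ xi, of k j] by (auto simp: H_def power2_eq_square)
    finally show ?thesis using H_pos[of k] by simp
  qed
  have E: "onf (Suc r) e" using es ee by (simp add: onf_def)
  have "(\<Sum>k<Suc r. (ip (g i) (e k))\<^sup>2) \<le> 1" if i: "i < r" for i
  proof -
    have "sbounded (g i)" "ip (g i) (g i) = 1" using g i by (auto simp: onf_def)
    then show ?thesis using ip_resid_self[OF E, of "g i"] ip_self_nonneg[of "resid (Suc r) e (g i)"] by linarith
  qed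
  \<comment> \<open>There are \<open>r + 1\<close> zonal functions, but their squared coefficients
    sum to at most \<open>r\<close>; so one of them has a nonzero residual.\<close>
  then have "(\<Sum>i<r. \<Sum>k<Suc r. (ip (g i) (e k))\<^sup>2) \<le> (\<Sum>i<r. 1)" by (intro sum_mono) simp
  also have "\<dots> < real (Suc r)" by simp
  finally have lt: "(\<Sum>k<Suc r. \<Sum>i<r. (ip (e k) (g i))\<^sup>2) < (\<Sum>k<Suc r. 1)"
    by (subst sum.swap) (simp add: ip_commute[of "e _"])
  have "\<exists>k<Suc r. (\<Sum>i<r. (ip (e k) (g i))\<^sup>2) < 1"
  proof (rule ccontr)
    assume "\<not> ?thesis"
    then have "1 \<le> (\<Sum>i<r. (ip (e k) (g i))\<^sup>2)" if "k < Suc r" for k using that by (meson not_less)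
    then have "(\<Sum>k<Suc r. (1::real)) \<le> (\<Sum>k<Suc r. \<Sum>i<r. (ip (e k) (g i))\<^sup>2)" by (intro sum_mono) simp
    then show False using lt by linarith
  qed
  then obtain k where k: "(\<Sum>i<r. (ip (e k) (g i))\<^sup>2) < 1" by blast
  show ?thesis
  proof (rule that[of "resid r g (e k)"])
    show "sbounded (resid r g (e k))" by (rule sbounded_resid[OF g es])
    show "0 < ip (resid r g (e k)) (resid r g (e k))" using ip_resid_self[OF g es[of k]] ee[of k k] k by simp
    show "ip (resid r g (e k)) (g i) = 0" if "i < r" for i by (rule resid_orthogonal[OF g es that])
  qed
qed

text \<open>The width ranges over subspaces of dimension exactly \<open>n\<close>, so a shorter
  family has to be filled up.\<close>

lemma onf_pad:
  assumes g: "onf r g" and "r \<le> n"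
  obtains g' where "onf n g'" "\<And>i. i < r \<Longrightarrow> g' i = g i"
proof -
  have "\<exists>g'. onf n g' \<and> (\<forall>i<r. g' i = g i)" using \<open>r \<le> n\<close>
  proof (induction n rule: dec_induct)
    case base
    show ?case using g by blast
  next
    case (step n)
    then obtain g' where g': "onf n g'" "\<forall>i<r. g' i = g i" by blast
    obtain u where u: "sbounded u" "ip u u > 0" "\<And>i. i < n \<Longrightarrow> ip u (g' i) = 0" by (rule onf_incomplete[OF g'(1)]) blast
    show ?case
    proof (rule exI, rule conjI)
      show "onf (Suc n) (g'(n := (\<lambda>x. (1 / sqrt (ip u u)) * u x)))" by (rule onf_extend[OF g'(1) u])
      show "\<forall>i<r. (g'(n := (\<lambda>x. (1 / sqrt (ip u u)) * u x))) i = g i" using g'(2) step(1) by simp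
    qed
  qed
  then show ?thesis using that by blast
qed

text \<open>The span is described by orthogonality: what is orthogonal to the family is orthogonal
  to every \<open>f j\<close>. A function whose residual has norm zero is skipped, so
  \<open>r\<close> may be smaller than \<open>d\<close>.\<close>

lemma gram_schmidt:
  assumes f: "\<And>j. j < d \<Longrightarrow> sbounded (f j)"
  obtains r g where "r \<le> d" "onf r g"
    "\<And>h j. sbounded h \<Longrightarrow> (\<And>i. i < r \<Longrightarrow> ip h (g i) = 0) \<Longrightarrow> j < d \<Longrightarrow> ip h (f j) = 0"
proof -
  have "\<exists>r g. r \<le> d \<and> onf r g \<and> (\<forall>h. sbounded h \<longrightarrow> (\<forall>i<r. ip h (g i) = 0) \<longrightarrow> (\<forall>j<d. ip h (f j) = 0))"
    using f
  proof (induction d)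
    case 0
    show ?case by (rule exI[of _ 0]) (simp add: onf_def)
  next
    case (Suc d)
    then obtain r g where rg: "r \<le> d" "onf r g" "\<And>h j. sbounded h \<Longrightarrow> (\<forall>i<r. ip h (g i) = 0) \<Longrightarrow> j < d \<Longrightarrow> ip h (f j) = 0"
      by (metis less_SucI)
    have fd: "sbounded (f d)" using Suc by simp
    define w where "w = resid r g (f d)"
    have sw: "sbounded w" unfolding w_def by (rule sbounded_resid[OF rg(2) fd])
    have key: "ip h (f d) = ip w h" if "sbounded h" "\<forall>i<r. ip h (g i) = 0" for h
      using ip_resid[OF rg(2) fd that(1)] that(2) unfolding w_def by (simp add: ip_commute)
    show ?case
    proof (cases "ip w w = 0")
      case True
      have "ip h (f j) = 0" if "sbounded h" "\<forall>i<r. ip h (g i) = 0" "j < Suc d" for h j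
        using key[OF that(1,2)] ip_null_left[OF sw True that(1)] rg(3)[OF that(1,2), of j] that(3)
        by (cases "j = d") auto
      then show ?thesis using rg(1,2) by (intro exI[of _ r] exI[of _ g]) auto
    next
      case False
      then have p: "ip w w > 0" using ip_self_nonneg[of w] by simp
      define g' where "g' = g(r := (\<lambda>x. (1 / sqrt (ip w w)) * w x))"
      have o: "onf (Suc r) g'" unfolding g'_def
        by (rule onf_extend[OF rg(2) sw p]) (simp add: w_def resid_orthogonal[OF rg(2) fd])
      have "ip h (f j) = 0" if h: "sbounded h" "\<forall>i<Suc r. ip h (g' i) = 0" "j < Suc d" for h j
      proof -
        have h': "\<forall>i<r. ip h (g i) = 0"
        proof (intro allI impI)
          fix i assume "i < r"
          then show "ip h (g i) = 0" using h(2)[rule_format, of i] by (simp add: g'_def)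
        qed
        have "ip h (\<lambda>x. (1 / sqrt (ip w w)) * w x) = 0" using h(2)[rule_format, of r] by (simp add: g'_def)
        then have "ip w h = 0" using p unfolding ip_commute[of h] ip_cmult_left by simp
        then show ?thesis using key[OF h(1) h'] rg(3)[OF h(1) h', of j] h(3) by (cases "j = d") auto
      qed
      then show ?thesis using rg(1) o by (intro exI[of _ "Suc r"] exI[of _ g']) auto
    qed
  qed
  then show ?thesis using that by blast
qed

end

context sphere_kernel begin

lemma QF_null:
  assumes h: "sbounded h" and 0: "ip h h = 0"
  shows "QF h = 0"
  using ip_null_left[OF h 0 sbounded_T[OF h]] unfolding QF_def ip_def by (simp add: mult.commute)

lemma QF_cmult: "QF (\<lambda>x. c * h x) = c\<^sup>2 * QF h"
proof -
  have "T (\<lambda>x. c * h x) = (\<lambda>x. c * T h x)"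
    unfolding T_def[abs_def] by (simp add: mult.left_commute)
  then show ?thesis unfolding QF_def by (simp add: power2_eq_square mult_ac)
qed

text \<open>Each new orthonormal function of energy above \<open>\<epsilon> / (d + 1)\<close> uses up that much of the
  trace \<open>\<epsilon>\<close>, so the extension stops after at most \<open>d\<close> steps.\<close>

lemma greedy:
  assumes g0: "onf r0 g0" and e: "e > 0"
    and tr: "\<And>r g. r \<ge> r0 \<Longrightarrow> onf r g \<Longrightarrow> (\<And>i. i < r0 \<Longrightarrow> g i = g0 i) \<Longrightarrow> (\<Sum>i\<in>{r0..<r}. QF (g i)) \<le> e"
  obtains r g where "r0 \<le> r" "r \<le> r0 + d" "onf r g"
    "\<And>h. sbounded h \<Longrightarrow> (\<And>i. i < r \<Longrightarrow> ip h (g i) = 0) \<Longrightarrow> QF h \<le> e / (real d + 1) * ip h h"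
proof (rule ccontr)
  assume neg: "\<not> thesis"
  define s where "s = e / (real d + 1)"
  have s: "s > 0" unfolding s_def using e by simp
  have "j \<le> Suc d \<Longrightarrow> \<exists>g. onf (r0 + j) g \<and> (\<forall>i<r0. g i = g0 i) \<and> (\<forall>i\<in>{r0..<r0 + j}. QF (g i) > s)" for j
  proof (induction j)
    case 0
    show ?case using g0 by auto
  next
    case (Suc j)
    then obtain g where g: "onf (r0 + j) g" "\<forall>i<r0. g i = g0 i" "\<forall>i\<in>{r0..<r0 + j}. QF (g i) > s" by auto
    have "\<exists>h. sbounded h \<and> (\<forall>i<r0 + j. ip h (g i) = 0) \<and> QF h > s * ip h h"
    proof (rule ccontr)
      assume "\<not> ?thesis"
      then have "\<And>h. sbounded h \<Longrightarrow> (\<And>i. i < r0 + j \<Longrightarrow> ip h (g i) = 0) \<Longrightarrow> QF h \<le> s * ip h h"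
        by (meson not_less)
      then show False using neg that[of "r0 + j" g] Suc.prems g(1) unfolding s_def by simp
    qed
    then obtain h where h: "sbounded h" "\<And>i. i < r0 + j \<Longrightarrow> ip h (g i) = 0" "QF h > s * ip h h" by blast
    have p: "ip h h > 0"
      using QF_null[OF h(1)] h(3) ip_self_nonneg[of h] by (cases "ip h h = 0") auto
    define u where "u = (\<lambda>x. (1 / sqrt (ip h h)) * h x)"
    have "QF u = QF h / ip h h" unfolding u_def QF_cmult using p by (simp add: power_divide)
    then have "QF u > s" using h(3) p by (simp add: pos_less_divide_eq)
    moreover have "onf (r0 + Suc j) (g(r0 + j := u))" unfolding u_def using onf_extend[OF g(1) h(1) p h(2)] by simp
    moreover have "\<forall>i<r0. (g(r0 + j := u)) i = g0 i" using g(2) by simp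
    moreover have "\<forall>i\<in>{r0..<r0 + Suc j}. QF ((g(r0 + j := u)) i) > s" using g(3) \<open>QF u > s\<close> by simp
    ultimately show ?case by blast
  qed
  from this[of "Suc d"] obtain g where g: "onf (r0 + Suc d) g" "\<forall>i<r0. g i = g0 i" "\<forall>i\<in>{r0..<r0 + Suc d}. QF (g i) > s" by auto
  have "real (Suc d) * s = (\<Sum>i\<in>{r0..<r0 + Suc d}. s)" by simp
  also have "\<dots> < (\<Sum>i\<in>{r0..<r0 + Suc d}. QF (g i))" using g(3) by (intro sum_strict_mono) auto
  also have "\<dots> \<le> e" using tr[OF _ g(1)] g(2) by simp
  finally show False unfolding s_def by (simp add: add.commute)
qed

text \<open>\<open>q\<close> is the part of \<open>J N\<close> in degrees \<open>n\<close> to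
  \<open>N\<close>, and \<open>r\<close> is what remains of \<open>q x\<close> after projection onto
  the \<open>g i\<close>. As lower degrees are orthogonal to the \<open>g i\<close>, the
  coefficients of \<open>q x\<close> are exactly the smoothed functions. Inserting \<open>r\<close>
  in \<open>square_kernel_nonneg\<close> bounds their energies by the weighted tail, and
  \<open>N \<rightarrow> \<infinity>\<close> removes the smoothing.\<close>

lemma trace_bound:
  assumes A: "finite A" and g: "\<And>i. i \<in> A \<Longrightarrow> sbounded (g i)"
    and on: "\<And>i j. i \<in> A \<Longrightarrow> j \<in> A \<Longrightarrow> ip (g i) (g j) = (if i = j then 1 else 0)"
    and perp: "\<And>i k x. i \<in> A \<Longrightarrow> k < n \<Longrightarrow> x \<in> Sph \<Longrightarrow> ip (\<lambda>z. gegenC l k (z \<bullet> x)) (g i) = 0"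
    and e: "\<And>N. (\<Sum>k\<in>{n..N}. jb N k * tau k) \<le> e"
  shows "(\<Sum>i\<in>A. QF (g i)) \<le> e"
proof -
  have main: "(\<Sum>i\<in>A. QF (smooth N (g i))) \<le> e" for N
  proof -
    define q where "q = (\<lambda>(x::real^'n) (z::real^'n). \<Sum>k\<in>{n..N}. jc N k * gegenC l k (z \<bullet> x))"
    define h where "h = (\<lambda>i. smooth N (g i))"
    define r where "r = (\<lambda>x z. q x z - (\<Sum>i\<in>A. h i x * g i z))"
    have gm: "g i \<in> borel_measurable borel" if "i \<in> A" for i using g[OF that] by (rule sbounded_measurable)
    have sh: "sbounded (h i)" if "i \<in> A" for i unfolding h_def by (rule sbounded_smooth[OF g[OF that]])
    have hm: "h i \<in> borel_measurable borel" if "i \<in> A" for i using sh[OF that] by (rule sbounded_measurable)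
    have sq: "sbounded (q x)" if "x \<in> Sph" for x unfolding q_def
      by (intro sbounded_sum sbounded_mult sbounded_const sbounded_gegen that)
    have sS: "sbounded (\<lambda>z. \<Sum>i\<in>A. h i x * g i z)" for x
      by (intro sbounded_sum sbounded_mult sbounded_const g)
    have sr: "sbounded (r x)" if "x \<in> Sph" for x unfolding r_def by (intro sbounded_diff sq sS that)
    have hq: "ip (q x) (g i) = h i x" if i: "i \<in> A" and x: "x \<in> Sph" for i x
    proof -
      have "h i x = (\<Sum>k\<le>N. jc N k * ip (\<lambda>z. gegenC l k (z \<bullet> x)) (g i))"
        unfolding h_def smooth_eq[OF g[OF i] x] ip_def ..
      also have "\<dots> = (\<Sum>k\<in>{n..N}. jc N k * ip (\<lambda>z. gegenC l k (z \<bullet> x)) (g i))"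
        using perp[OF i _ x] by (intro sum.mono_neutral_right) auto
      also have "\<dots> = (\<Sum>k\<in>{n..N}. ip (\<lambda>z. jc N k * gegenC l k (z \<bullet> x)) (g i))"
        unfolding ip_cmult_left ..
      also have "\<dots> = ip (q x) (g i)" unfolding q_def
        by (rule ip_sum_left[symmetric]; intro sbounded_mult sbounded_const sbounded_gegen x g i)
      finally show ?thesis by simp
    qed
    have rg: "ip (r x) (g j) = 0" if j: "j \<in> A" and x: "x \<in> Sph" for j x
    proof -
      have "ip (r x) (g j) = ip (q x) (g j) - ip (\<lambda>z. \<Sum>i\<in>A. h i x * g i z) (g j)"
        unfolding r_def by (rule ip_diff_left[OF sq[OF x] sS g[OF j]])
      also have "ip (\<lambda>z. \<Sum>i\<in>A. h i x * g i z) (g j) = (\<Sum>i\<in>A. ip (\<lambda>z. h i x * g i z) (g j))"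
        by (rule ip_sum_left; intro sbounded_mult sbounded_const g j)
      also have "\<dots> = (\<Sum>i\<in>A. if i = j then h j x else 0)"
        unfolding ip_cmult_left by (intro sum.cong refl) (simp add: on j)
      finally show ?thesis using hq[OF j x] A j by simp
    qed
    \<comment> \<open>Residuals are orthogonal to the family, so their inner product is that of the
      \<open>q\<close> minus that of the coefficients; \<open>partial_convolution\<close> evaluates
      the former.\<close>
    have rr: "(\<integral>z. r x z * r y z \<partial>surf) = (\<Sum>k\<in>{n..N}. jb N k * gegenC l k (y \<bullet> x)) - (\<Sum>i\<in>A. h i x * h i y)"
      if x: "x \<in> Sph" and y: "y \<in> Sph" for x y
    proof -
      have "ip (r x) (r y) = ip (r y) (r x)" by (rule ip_commute)
      also have "\<dots> = ip (q y) (r x) - ip (\<lambda>z. \<Sum>i\<in>A. h i y * g i z) (r x)"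
        by (subst (1) r_def) (rule ip_diff_left[OF sq[OF y] sS sr[OF x]])
      also have "ip (\<lambda>z. \<Sum>i\<in>A. h i y * g i z) (r x) = (\<Sum>i\<in>A. h i y * ip (g i) (r x))"
        unfolding ip_cmult_left[symmetric] by (rule ip_sum_left; intro sbounded_mult sbounded_const g sr x)
      also have "\<dots> = 0" using rg[OF _ x] by (intro sum.neutral ballI) (simp add: ip_commute[of _ "r x"])
      also have "ip (q y) (r x) - 0 = ip (r x) (q y)" by (simp add: ip_commute)
      also have "\<dots> = ip (q x) (q y) - ip (\<lambda>z. \<Sum>i\<in>A. h i x * g i z) (q y)"
        unfolding r_def by (rule ip_diff_left[OF sq[OF x] sS sq[OF y]])
      also have "ip (\<lambda>z. \<Sum>i\<in>A. h i x * g i z) (q y) = (\<Sum>i\<in>A. h i x * ip (g i) (q y))"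
        unfolding ip_cmult_left[symmetric] by (rule ip_sum_left; intro sbounded_mult sbounded_const g sq y)
      also have "\<dots> = (\<Sum>i\<in>A. h i x * h i y)"
      proof (rule sum.cong[OF refl])
        fix i assume i: "i \<in> A"
        show "h i x * ip (g i) (q y) = h i x * h i y" unfolding ip_commute[of "g i" "q y"] hq[OF i y] ..
      qed
      also have "ip (q x) (q y) = (\<Sum>k\<in>{n..N}. jb N k * gegenC l k (y \<bullet> x))"
        unfolding ip_def q_def inner_commute[of y x] by (rule partial_convolution[OF _ x y]) simp
      finally show ?thesis unfolding ip_def .
    qed
    have qm: "(\<lambda>(x, z). q x z) \<in> borel_measurable (borel \<Otimes>\<^sub>M borel)" unfolding q_def by measurable
    have rm: "(\<lambda>(x, z). r x z) \<in> borel_measurable (borel \<Otimes>\<^sub>M borel)"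
    proof -
      have "(\<lambda>p. \<Sum>i\<in>A. h i (fst p) * g i (snd p)) \<in> borel_measurable (borel \<Otimes>\<^sub>M borel)"
        by (intro borel_measurable_sum borel_measurable_times measurable_compose[OF measurable_fst hm] measurable_compose[OF measurable_snd gm])
      then show ?thesis using qm unfolding r_def by (simp add: case_prod_beta')
    qed
    have "sbounded2 q" unfolding q_def
    proof (rule sbounded2_sum)
      fix k
      obtain D where D: "D \<ge> 0" "\<And>x y::real^'n. x \<in> Sph \<Longrightarrow> y \<in> Sph \<Longrightarrow> \<bar>gegenC l k (x \<bullet> y)\<bar> \<le> D"
        by (rule gegen_bounded[of k]) blast
      show "sbounded2 (\<lambda>(x::real^'n) z. jc N k * gegenC l k (z \<bullet> x))"
        by (rule sbounded2I[of _ "\<bar>jc N k\<bar> * D"]) (unfold abs_mult, intro mult_left_mono D abs_ge_zero)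
    qed
    moreover have "sbounded2 (\<lambda>x z. \<Sum>i\<in>A. h i x * g i z)"
      by (rule sbounded2_sum) (intro sbounded2_times sh g)
    ultimately have "sbounded2 r" unfolding r_def by (rule sbounded2_diff)
    then obtain C where C: "\<And>x z. x \<in> Sph \<Longrightarrow> z \<in> Sph \<Longrightarrow> \<bar>r x z\<bar> \<le> C"
      unfolding sbounded2_def by blast
    have "0 \<le> (\<integral>x. \<integral>y. K x y * (\<integral>z. r x z * r y z \<partial>surf) \<partial>surf \<partial>surf)"
      by (rule square_kernel_nonneg[OF rm C])
    also have "\<dots> = (\<integral>x. (\<Sum>k\<in>{n..N}. jb N k * tk k x) - (\<Sum>i\<in>A. T (h i) x * h i x) \<partial>surf)"
    proof (rule surf.integral_cong_Sph)
      show "(\<lambda>x. \<integral>y. K x y * (\<integral>z. r x z * r y z \<partial>surf) \<partial>surf) \<in> borel_measurable borel"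
        using rm by measurable
      show "(\<lambda>x. (\<Sum>k\<in>{n..N}. jb N k * tk k x) - (\<Sum>i\<in>A. T (h i) x * h i x)) \<in> borel_measurable borel"
        by (intro borel_measurable_diff borel_measurable_sum borel_measurable_times T_measurable hm tk_measurable borel_measurable_const)
      fix x :: "real^'n" assume x: "x \<in> Sph"
      have "(\<integral>y. K x y * (\<integral>z. r x z * r y z \<partial>surf) \<partial>surf)
        = (\<integral>y. (\<Sum>k\<in>{n..N}. jb N k * (K x y * gegenC l k (y \<bullet> x))) - (\<Sum>i\<in>A. h i x * (K x y * h i y)) \<partial>surf)"
      proof (rule surf.integral_cong_Sph)
        have rx: "r x \<in> borel_measurable borel" by (rule sbounded_measurable[OF sr[OF x]])
        show "(\<lambda>y. K x y * (\<integral>z. r x z * r y z \<partial>surf)) \<in> borel_measurable borel"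
          using rm rx by measurable
        show "(\<lambda>y. (\<Sum>k\<in>{n..N}. jb N k * (K x y * gegenC l k (y \<bullet> x))) - (\<Sum>i\<in>A. h i x * (K x y * h i y))) \<in> borel_measurable borel"
          by (intro sbounded_measurable sbounded_diff sbounded_sum sbounded_mult sbounded_const sbounded_K sbounded_gegen sh x)
        fix y :: "real^'n" assume y: "y \<in> Sph"
        show "K x y * (\<integral>z. r x z * r y z \<partial>surf) = (\<Sum>k\<in>{n..N}. jb N k * (K x y * gegenC l k (y \<bullet> x))) - (\<Sum>i\<in>A. h i x * (K x y * h i y))"
          unfolding rr[OF x y] right_diff_distrib sum_distrib_left by (simp only: mult.left_commute)
      qed
      also have "\<dots> = (\<integral>y. (\<Sum>k\<in>{n..N}. jb N k * (K x y * gegenC l k (y \<bullet> x))) \<partial>surf) - (\<integral>y. (\<Sum>i\<in>A. h i x * (K x y * h i y)) \<partial>surf)"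
        by (rule Bochner_Integration.integral_diff; intro surf.integrable_sbounded sbounded_sum sbounded_mult sbounded_const sbounded_K sbounded_gegen sh x)
      also have "(\<integral>y. (\<Sum>k\<in>{n..N}. jb N k * (K x y * gegenC l k (y \<bullet> x))) \<partial>surf) = (\<Sum>k\<in>{n..N}. \<integral>y. jb N k * (K x y * gegenC l k (y \<bullet> x)) \<partial>surf)"
        by (intro Bochner_Integration.integral_sum surf.integrable_sbounded sbounded_mult sbounded_const sbounded_K sbounded_gegen x)
      also have "\<dots> = (\<Sum>k\<in>{n..N}. jb N k * tk k x)" unfolding integral_mult_right_zero tk_def ..
      also have "(\<integral>y. (\<Sum>i\<in>A. h i x * (K x y * h i y)) \<partial>surf) = (\<Sum>i\<in>A. \<integral>y. h i x * (K x y * h i y) \<partial>surf)"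
        by (intro Bochner_Integration.integral_sum surf.integrable_sbounded sbounded_mult sbounded_const sbounded_K sh x)
      also have "\<dots> = (\<Sum>i\<in>A. T (h i) x * h i x)" unfolding integral_mult_right_zero T_def by (simp only: mult.commute)
      finally show "(\<integral>y. K x y * (\<integral>z. r x z * r y z \<partial>surf) \<partial>surf) = (\<Sum>k\<in>{n..N}. jb N k * tk k x) - (\<Sum>i\<in>A. T (h i) x * h i x)" .
    qed
    also have "\<dots> = (\<integral>x. (\<Sum>k\<in>{n..N}. jb N k * tk k x) \<partial>surf) - (\<integral>x. (\<Sum>i\<in>A. T (h i) x * h i x) \<partial>surf)"
      by (rule Bochner_Integration.integral_diff; intro surf.integrable_sbounded sbounded_sum sbounded_mult sbounded_const sbounded_tk sbounded_T sh)
    also have "(\<integral>x. (\<Sum>k\<in>{n..N}. jb N k * tk k x) \<partial>surf) = (\<Sum>k\<in>{n..N}. \<integral>x. jb N k * tk k x \<partial>surf)"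
      by (intro Bochner_Integration.integral_sum surf.integrable_sbounded sbounded_mult sbounded_const sbounded_tk)
    also have "\<dots> = (\<Sum>k\<in>{n..N}. jb N k * tau k)" unfolding integral_mult_right_zero tau_eq ..
    also have "(\<integral>x. (\<Sum>i\<in>A. T (h i) x * h i x) \<partial>surf) = (\<Sum>i\<in>A. QF (h i))"
      unfolding QF_def by (intro Bochner_Integration.integral_sum surf.integrable_sbounded sbounded_mult sbounded_T sh)
    finally show ?thesis using e[of N] unfolding h_def by linarith
  qed
  have "(\<lambda>N. \<Sum>i\<in>A. QF (smooth N (g i))) \<longlonglongrightarrow> (\<Sum>i\<in>A. QF (g i))"
    by (intro tendsto_sum QF_smooth_tendsto g)
  then show ?thesis by (rule LIMSEQ_le_const2) (use main in blast)
qed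

end

subsection \<open>Decay of the trace of the kernel on high degrees\<close>

lemma gegenP_near_one:
  assumes b: "b > 0" and t: "0 < t" "t \<le> 1"
  shows "\<bar>gegenP b k (cos t)\<bar> \<le> 1"
    and "0 \<le> 1 - gegenP b k (cos t)"
    and "1 - gegenP b k (cos t) \<le> (real k * (real k + 2 * b) / (2 * b + 1)) * t\<^sup>2"
proof -
  have c: "0 \<le> cos t" "cos t \<le> 1" using t pi_gt3 by (auto intro!: cos_ge_zero)
  show a: "\<bar>gegenP b k (cos t)\<bar> \<le> 1" by (rule abs_gegenP_le_1[OF b c])
  then show "0 \<le> 1 - gegenP b k (cos t)" by simp
  have "1 - gegenP b k (cos t) \<le> (1 - cos t) * (real k * (real k + 2 * b) / (2 * b + 1))"
    using gegenP_ge[OF b c, of k] by linarith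
  also have "\<dots> \<le> t\<^sup>2 * (real k * (real k + 2 * b) / (2 * b + 1))"
    using one_minus_cos_bounds(1)[of t] t b by (intro mult_right_mono) auto
  finally show "1 - gegenP b k (cos t) \<le> (real k * (real k + 2 * b) / (2 * b + 1)) * t\<^sup>2" by (simp add: mult.commute)
qed

text \<open>For a degree \<open>j\<close> with \<open>\<tau>\<^sub>j \<noteq> 0\<close> the Hoelder condition forces the factor
  \<open>c\<^sub>j (sin t)\<^sup>\<gamma> / v(t)\<close> to be \<open>1 + O(t\<^sup>\<rho>)\<close>; hence all such \<open>c\<^sub>j\<close> coincide and the
  multipliers may be replaced by the values \<open>P(cos t)\<close>, which stay below \<open>1\<close>.\<close>

lemma multiplier_factor_near_one:
  assumes b: "b > 0" and rho: "0 < rho" "rho \<le> 2" and D: "D \<ge> 0"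
    and h: "\<And>t. 0 < t \<Longrightarrow> t < pi \<Longrightarrow> \<bar>\<kappa> t * gegenP b k (cos t) - 1\<bar> \<le> D * t powr rho"
  obtains C t1 where "C \<ge> 0" "0 < t1" "t1 \<le> 1" "\<And>t. 0 < t \<Longrightarrow> t \<le> t1 \<Longrightarrow> \<bar>\<kappa> t - 1\<bar> \<le> C * t powr rho"
proof -
  define L where "L = real k * (real k + 2 * b) / (2 * b + 1)"
  have L: "L \<ge> 0" unfolding L_def using b by simp
  \<comment> \<open>Small enough for \<open>L t\<^sup>2 \<le> 1/2\<close>, which keeps the
    Gegenbauer value above \<open>1/2\<close> and thereby bounds \<open>\<kappa> t\<close>.\<close>
  define t1 where "t1 = min 1 (1 / (2 * (L + 1)))"
  have t1: "0 < t1" "t1 \<le> 1" unfolding t1_def using L by auto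
  show ?thesis
  proof (rule that[of "D + 2 * (1 + D) * L" t1])
    fix t assume t: "0 < t" "t \<le> t1"
    then have t': "t \<le> 1" "t < pi" using t1 pi_gt3 by auto
    define P where "P = gegenP b k (cos t)"
    \<comment> \<open>Here \<open>rho \<le> 2\<close> enters: the deviation of the Gegenbauer value
      from one is quadratic in \<open>t\<close>.\<close>
    have t2: "t\<^sup>2 \<le> t powr rho"
      using powr_mono'[of rho 2 t] rho t t' by (simp add: powr_numeral)
    have tr1: "t powr rho \<le> 1" using powr_mono2[of rho t 1] rho t t' by simp
    have P: "1 - P \<le> L * t\<^sup>2" "0 \<le> 1 - P" "\<bar>P\<bar> \<le> 1"
      unfolding P_def L_def using gegenP_near_one[OF b t(1) t'(1), of k] by auto
    have "L * t\<^sup>2 \<le> L * t" using L t t' by (intro mult_left_mono) (auto simp: power2_eq_square mult_left_le)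
    also have "\<dots> \<le> (L + 1) * t1" using t L by (intro mult_mono) auto
    also have "\<dots> \<le> (L + 1) * (1 / (2 * (L + 1)))" unfolding t1_def using L by (intro mult_left_mono) auto
    also have "\<dots> = 1 / 2" using L by simp
    finally have P2: "P \<ge> 1 / 2" using P by linarith
    have hP: "\<bar>\<kappa> t * P - 1\<bar> \<le> D * t powr rho" unfolding P_def by (rule h[OF t(1) t'(2)])
    have "D * t powr rho \<le> D" using D tr1 by (simp add: mult_left_le)
    then have "\<bar>\<kappa> t * P\<bar> \<le> 1 + D" using hP by linarith
    moreover have "\<bar>\<kappa> t\<bar> * (1/2) \<le> \<bar>\<kappa> t\<bar> * P" using P2 by (intro mult_left_mono) auto
    ultimately have k: "\<bar>\<kappa> t\<bar> \<le> 2 * (1 + D)" using P2 by (simp add: abs_mult)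
    have "\<kappa> t - 1 = (\<kappa> t * P - 1) + \<kappa> t * (1 - P)" by (simp add: algebra_simps)
    then have "\<bar>\<kappa> t - 1\<bar> \<le> D * t powr rho + \<bar>\<kappa> t\<bar> * (1 - P)"
      using hP abs_triangle_ineq[of "\<kappa> t * P - 1" "\<kappa> t * (1 - P)"] P(2) by (simp add: abs_mult)
    also have "\<bar>\<kappa> t\<bar> * (1 - P) \<le> (2 * (1 + D)) * (L * t powr rho)"
    proof (rule mult_mono[OF k])
      show "1 - P \<le> L * t powr rho" using P(1) mult_left_mono[OF t2 L] by linarith
    qed (use D P in auto)
    finally show "\<bar>\<kappa> t - 1\<bar> \<le> (D + 2 * (1 + D) * L) * t powr rho"
      by (simp add: algebra_simps)
  qed (use D L t1 in auto)
qed

lemma powr_small: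
  assumes "rho > 0" "e > 0" "C \<ge> (0::real)" "t1 > 0"
  obtains t where "0 < t" "t \<le> t1" "C * t powr rho < e"
proof -
  define t where "t = min t1 ((e / (C + 1)) powr (1 / rho))"
  have t: "0 < t" "t \<le> t1" unfolding t_def using assms by auto
  have "t powr rho \<le> ((e / (C + 1)) powr (1 / rho)) powr rho"
    using t assms by (intro powr_mono2) (auto simp: t_def)
  also have "\<dots> = e / (C + 1)" using assms by (simp add: powr_powr)
  finally have "C * t powr rho \<le> C * (e / (C + 1))" using assms by (intro mult_left_mono) auto
  also have "\<dots> < e" using assms by (simp add: field_simps)
  finally show ?thesis using t that by blast
qed

text \<open>Abstract in the weights, the traces and the degree-independent factor \<open>w\<close>
  of the multiplier. \<open>E1\<close> and \<open>E2\<close> are uniform in \<open>N\<close>, hence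
  so is the tail bound; \<open>E3\<close> is used for one degree at a time, and a single degree
  \<open>j\<close> with nonzero trace calibrates \<open>w\<close>.\<close>

lemma multiplier_tail:
  fixes c :: "nat \<Rightarrow> real" and b :: "nat \<Rightarrow> nat \<Rightarrow> real" and \<tau> :: "nat \<Rightarrow> real"
  assumes beta: "beta > 0" and rho: "0 < rho" "rho \<le> 2" and alpha: "strict_mono (alpha :: nat \<Rightarrow> nat)"
    and c: "\<And>k. c k \<noteq> 0"
    and M: "\<And>t k. 0 < t \<Longrightarrow> t < pi \<Longrightarrow> M t k = c k * w t * gegenP beta (alpha k) (cos t)"
    and b: "\<And>N k. b N k \<ge> 0" and tau: "\<And>k. \<tau> k \<ge> 0"
    and E1: "\<And>t N. 0 < t \<Longrightarrow> t < pi \<Longrightarrow> \<bar>\<Sum>k\<le>N. b N k * ((M t k - 1) * \<tau> k)\<bar> \<le> C1 * t powr rho"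
    and E2: "\<And>N. (\<Sum>k\<le>N. b N k * \<tau> k) \<le> C2"
    and E3: "\<And>k. \<exists>D\<ge>0. \<forall>t. 0 < t \<longrightarrow> t < pi \<longrightarrow> \<bar>M t k - 1\<bar> * \<tau> k \<le> D * t powr rho"
  obtains C n0 where "C > 0" "n0 \<ge> 1" "\<And>n N. n \<ge> n0 \<Longrightarrow> (\<Sum>k\<in>{n..N}. b N k * \<tau> k) \<le> C * real n powr (- rho)"
proof (cases "\<forall>k. \<tau> k = 0")
  case True
  then show ?thesis by (intro that[of 1 1]) auto
next
  case False
  then obtain j where j: "\<tau> j \<noteq> 0" by blast
  have near: "\<exists>C t1. C \<ge> 0 \<and> 0 < t1 \<and> t1 \<le> 1 \<and> (\<forall>t. 0 < t \<longrightarrow> t \<le> t1 \<longrightarrow> \<bar>c k * w t - 1\<bar> \<le> C * t powr rho)" if k: "\<tau> k \<noteq> 0" for k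
  proof -
    have tk: "\<tau> k > 0" using tau[of k] k by simp
    obtain D where D: "D \<ge> 0" "\<And>t. 0 < t \<Longrightarrow> t < pi \<Longrightarrow> \<bar>M t k - 1\<bar> * \<tau> k \<le> D * t powr rho" using E3[of k] by blast
    have "\<bar>c k * w t * gegenP beta (alpha k) (cos t) - 1\<bar> \<le> (D / \<tau> k) * t powr rho" if "0 < t" "t < pi" for t
      using D(2)[OF that] tk unfolding M[OF that] by (simp add: field_simps)
    moreover have "0 \<le> D / \<tau> k" using D(1) tk by simp
    ultimately obtain C t1 where "C \<ge> 0" "0 < t1" "t1 \<le> 1" "\<forall>t. 0 < t \<longrightarrow> t \<le> t1 \<longrightarrow> \<bar>c k * w t - 1\<bar> \<le> C * t powr rho"
      using multiplier_factor_near_one[OF beta rho, of "D / \<tau> k" "\<lambda>t. c k * w t" "alpha k"] by blast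
    then show ?thesis by blast
  qed
  obtain Cj tj where Cj: "Cj \<ge> 0" "0 < tj" "tj \<le> 1" "\<And>t. 0 < t \<Longrightarrow> t \<le> tj \<Longrightarrow> \<bar>c j * w t - 1\<bar> \<le> Cj * t powr rho"
    using near[OF j] by blast
  \<comment> \<open>Eliminating the common factor \<open>w t\<close> from the two estimates leaves
    \<open>c k - c j\<close>, bounded by a multiple of \<open>t powr rho\<close> for all small
    \<open>t\<close>.\<close>
  have ceq: "c k = c j" if k: "\<tau> k \<noteq> 0" for k
  proof (rule ccontr)
    assume ne: "c k \<noteq> c j"
    obtain Ck tk where Ck: "Ck \<ge> 0" "0 < tk" "tk \<le> 1" "\<And>t. 0 < t \<Longrightarrow> t \<le> tk \<Longrightarrow> \<bar>c k * w t - 1\<bar> \<le> Ck * t powr rho"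
      using near[OF k] by blast
    have pos: "\<bar>c k - c j\<bar> > 0" using ne by simp
    obtain t where t: "0 < t" "t \<le> min tj tk" "(\<bar>c j\<bar> * Ck + \<bar>c k\<bar> * Cj) * t powr rho < \<bar>c k - c j\<bar>"
      by (rule powr_small[OF rho(1) pos, of "\<bar>c j\<bar> * Ck + \<bar>c k\<bar> * Cj" "min tj tk"]) (use Ck Cj in auto)
    have "\<bar>c j * (c k * w t - 1) - c k * (c j * w t - 1)\<bar> \<le> \<bar>c j\<bar> * \<bar>c k * w t - 1\<bar> + \<bar>c k\<bar> * \<bar>c j * w t - 1\<bar>"
      using abs_triangle_ineq4[of "c j * (c k * w t - 1)" "c k * (c j * w t - 1)"] by (simp add: abs_mult)
    also have "\<dots> \<le> \<bar>c j\<bar> * (Ck * t powr rho) + \<bar>c k\<bar> * (Cj * t powr rho)"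
      using Ck(4)[of t] Cj(4)[of t] t by (intro add_mono mult_left_mono) auto
    also have "\<dots> = (\<bar>c j\<bar> * Ck + \<bar>c k\<bar> * Cj) * t powr rho" by (simp add: algebra_simps)
    also have "c j * (c k * w t - 1) - c k * (c j * w t - 1) = c k - c j" by (simp add: algebra_simps)
    finally show False using t(3) by linarith
  qed
  obtain d where d: "d > 0" "\<And>k t. 0 < t \<Longrightarrow> t \<le> 1 \<Longrightarrow> real k * t \<ge> 2 \<Longrightarrow> gegenP beta k (cos t) \<le> 1 - d"
    by (rule gegenP_decay[OF beta]) blast
  have C20: "C2 \<ge> 0" using E2[of 0] mult_nonneg_nonneg[OF b[of 0 0] tau[of 0]] by simp
  have C10: "C1 \<ge> 0" using E1[of 1 0] pi_gt3 by simp
  define C where "C = (C1 + Cj * C2) / d * 2 powr rho"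
  obtain n0 :: nat where n0: "2 / tj < real n0" using reals_Archimedean2 by blast
  show ?thesis
  proof (rule that[of "C + 1" "max n0 1"])
    show "C + 1 > 0" unfolding C_def using C10 C20 Cj d by (intro add_nonneg_pos mult_nonneg_nonneg divide_nonneg_nonneg add_nonneg_nonneg) auto
    show "1 \<le> max n0 1" by simp
    fix n N assume n: "n \<ge> max n0 1"
    \<comment> \<open>The scale at which each degree \<open>alpha k \<ge> k \<ge> n\<close>
      satisfies \<open>alpha k * t \<ge> 2\<close>, as \<open>gegenP_decay\<close> asks; large
      \<open>n\<close> makes \<open>t \<le> tj\<close>.\<close>
    define t where "t = 2 / real n"
    have n1: "real n \<ge> 1" "real n \<ge> real n0" using n by auto
    have "2 / tj \<le> real n" using n0 n1 by linarith
    then have "2 \<le> real n * tj" using Cj(2) by (simp only: pos_divide_le_eq)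
    then have "2 / real n \<le> tj" using n1 by (simp add: pos_divide_le_eq mult.commute)
    then have tj': "t \<le> tj" unfolding t_def .
    have t0: "0 < t" unfolding t_def using n1 by simp
    have t: "0 < t" "t \<le> tj" "t \<le> 1" "t < pi" using t0 tj' Cj(3) pi_gt3 by linarith+
    define P where "P = (\<lambda>k. gegenP beta (alpha k) (cos t))"
    have P: "\<bar>P k\<bar> \<le> 1" "0 \<le> 1 - P k" for k
      unfolding P_def using gegenP_near_one[OF beta t(1) t(3), of "alpha k"] by auto
    \<comment> \<open>Where the trace is nonzero the multiplier equals
      \<open>c j * w t * P k\<close>; elsewhere both sides vanish.\<close>
    have key: "b N k * ((1 - P k) * \<tau> k) = - (b N k * ((M t k - 1) * \<tau> k)) + (c j * w t - 1) * (b N k * (P k * \<tau> k))" for k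
    proof (cases "\<tau> k = 0")
      case False
      have Mk: "M t k = c j * w t * P k" unfolding M[OF t(1) t(4)] P_def ceq[OF False] ..
      show ?thesis unfolding Mk by (simp add: algebra_simps)
    qed simp
    have "(\<Sum>k\<le>N. b N k * ((1 - P k) * \<tau> k)) = - (\<Sum>k\<le>N. b N k * ((M t k - 1) * \<tau> k)) + (c j * w t - 1) * (\<Sum>k\<le>N. b N k * (P k * \<tau> k))"
      unfolding key sum.distrib sum_negf sum_distrib_left ..
    also have "\<dots> \<le> C1 * t powr rho + Cj * t powr rho * C2"
    proof (rule add_mono)
      show "- (\<Sum>k\<le>N. b N k * ((M t k - 1) * \<tau> k)) \<le> C1 * t powr rho" using E1[OF t(1) t(4), of N] by linarith
      have "\<bar>\<Sum>k\<le>N. b N k * (P k * \<tau> k)\<bar> \<le> (\<Sum>k\<le>N. b N k * \<tau> k)"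
      proof (rule order_trans[OF sum_abs], rule sum_mono)
        fix k
        have "\<bar>P k\<bar> * \<tau> k \<le> 1 * \<tau> k" by (rule mult_right_mono[OF P(1) tau])
        then show "\<bar>b N k * (P k * \<tau> k)\<bar> \<le> b N k * \<tau> k"
          using b[of N k] tau[of k] by (simp add: abs_mult mult_left_mono)
      qed
      also have "\<dots> \<le> C2" by (rule E2)
      finally have "\<bar>(c j * w t - 1) * (\<Sum>k\<le>N. b N k * (P k * \<tau> k))\<bar> \<le> (Cj * t powr rho) * C2"
        unfolding abs_mult using Cj(1) Cj(4)[OF t(1) t(2)] by (intro mult_mono) auto
      then show "(c j * w t - 1) * (\<Sum>k\<le>N. b N k * (P k * \<tau> k)) \<le> Cj * t powr rho * C2" by linarith
    qed
    finally have up: "(\<Sum>k\<le>N. b N k * ((1 - P k) * \<tau> k)) \<le> (C1 + Cj * C2) * t powr rho"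
      by (simp add: algebra_simps)
    have "d * (\<Sum>k\<in>{n..N}. b N k * \<tau> k) = (\<Sum>k\<in>{n..N}. b N k * (d * \<tau> k))"
      by (simp add: sum_distrib_left mult.left_commute)
    also have "\<dots> \<le> (\<Sum>k\<in>{n..N}. b N k * ((1 - P k) * \<tau> k))"
    proof (rule sum_mono)
      fix k assume "k \<in> {n..N}"
      then have "n \<le> k" by simp
      also have "k \<le> alpha k" using alpha by (rule strict_mono_imp_increasing)
      finally have "real n * t \<le> real (alpha k) * t" using t by (intro mult_right_mono) auto
      then have "2 \<le> real (alpha k) * t" unfolding t_def using n1 by simp
      then have "d \<le> 1 - P k" using d(2)[OF t(1) t(3), of "alpha k"] unfolding P_def by linarith
      then show "b N k * (d * \<tau> k) \<le> b N k * ((1 - P k) * \<tau> k)"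
        by (intro mult_left_mono mult_right_mono b tau)
    qed
    \<comment> \<open>The sum may be extended downwards because \<open>1 - P k\<close> is
      nonnegative in every degree, not only in the high ones.\<close>
    also have "\<dots> \<le> (\<Sum>k\<le>N. b N k * ((1 - P k) * \<tau> k))"
      by (intro sum_mono2) (auto intro!: mult_nonneg_nonneg b tau P)
    also note up
    finally have "(\<Sum>k\<in>{n..N}. b N k * \<tau> k) \<le> (C1 + Cj * C2) * t powr rho / d"
      using d(1) by (simp add: pos_le_divide_eq mult.commute)
    also have "\<dots> = C * real n powr (- rho)"
    proof -
      have "t powr rho = 2 powr rho * real n powr (- rho)"
        unfolding t_def powr_minus by (subst powr_divide) (simp_all add: divide_inverse)
      then show ?thesis by (simp add: C_def)
    qed
    also have "\<dots> \<le> (C + 1) * real n powr (- rho)" by (intro mult_right_mono) auto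
    finally show "(\<Sum>k\<in>{n..N}. b N k * \<tau> k) \<le> (C + 1) * real n powr (- rho)" .
  qed
qed

subsection \<open>Monomials on the sphere\<close>

definition monomial :: "('n::finite \<Rightarrow> nat) \<Rightarrow> real^'n \<Rightarrow> real" where
  "monomial a x = (\<Prod>i\<in>UNIV. (x $ i) ^ a i)"

lemma monomial_update: "monomial (a(i := a i + n)) x = monomial a x * (x $ i) ^ n"
proof -
  have "monomial (a(i := a i + n)) x = (x $ i) ^ (a i + n) * (\<Prod>j\<in>UNIV - {i}. (x $ j) ^ a j)"
    unfolding monomial_def by (subst prod.remove[of _ i]) (auto intro!: prod.cong)
  also have "\<dots> = (x $ i) ^ n * ((x $ i) ^ a i * (\<Prod>j\<in>UNIV - {i}. (x $ j) ^ a j))" by (simp add: power_add)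
  also have "(x $ i) ^ a i * (\<Prod>j\<in>UNIV - {i}. (x $ j) ^ a j) = monomial a x"
    unfolding monomial_def by (rule prod.remove[symmetric]) auto
  finally show ?thesis by (subst mult.commute)
qed

lemma sum_update: "(\<Sum>j\<in>UNIV. (a(i := a i + n)) j) = (\<Sum>j\<in>UNIV. a j) + (n::nat)" for i :: "'n::finite"
proof -
  have "(\<Sum>j\<in>UNIV. (a(i := a i + n)) j) = (a i + n) + (\<Sum>j\<in>UNIV - {i}. a j)"
    by (subst sum.remove[of _ i]) (auto intro!: sum.cong)
  moreover have "(\<Sum>j\<in>UNIV. a j) = a i + (\<Sum>j\<in>UNIV - {i}. a j)" by (rule sum.remove) auto
  ultimately show ?thesis by simp
qed

lemma sbounded_monomial: "sbounded (monomial a)"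
proof (rule sboundedI[where C = 1])
  show "monomial a \<in> borel_measurable borel" unfolding monomial_def[abs_def] by measurable
  fix x :: "real^'a" assume x: "x \<in> Sph"
  have "\<bar>monomial a x\<bar> = (\<Prod>i\<in>UNIV. \<bar>x $ i\<bar> ^ a i)" unfolding monomial_def by (simp add: abs_prod power_abs)
  also have "\<dots> \<le> (\<Prod>i\<in>(UNIV :: 'a set). 1)"
  proof (rule prod_mono)
    fix i
    have "\<bar>x $ i\<bar> \<le> 1" using component_le_norm_cart[of x i] x by simp
    then show "0 \<le> \<bar>x $ i\<bar> ^ a i \<and> \<bar>x $ i\<bar> ^ a i \<le> 1" by (simp add: power_le_one)
  qed
  finally show "\<bar>monomial a x\<bar> \<le> 1" by simp
qed

text \<open>Exponents with \<open>a i\<^sub>0 \<le> 1\<close> suffice on the sphere, since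
  \<open>x\<^sub>i\<^sub>0\<^sup>2 = 1 - \<Sum> x\<^sub>i\<^sup>2\<close>; this makes the count \<open>O(k\<^sup>m)\<close>.\<close>

definition expos :: "'n::finite \<Rightarrow> nat \<Rightarrow> ('n \<Rightarrow> nat) set" where
  "expos i0 k = PiE UNIV (\<lambda>i. if i = i0 then {0, 1} else {..<k})"

lemma expos: "finite (expos i0 k)" "card (expos (i0 :: 'n::finite) k) = 2 * k ^ (CARD('n) - 1)"
proof -
  show "finite (expos i0 k)" unfolding expos_def by (rule finite_PiE) auto
  have "card (expos i0 k) = (\<Prod>i\<in>UNIV. card (if i = i0 then {0, 1::nat} else {..<k}))"
    unfolding expos_def by (rule card_PiE) simp
  also have "\<dots> = 2 * (\<Prod>i\<in>UNIV - {i0}. k)" by (subst prod.remove[of _ i0]) (auto intro!: prod.cong)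
  finally show "card (expos i0 k) = 2 * k ^ (CARD('n) - 1)" by (simp add: card_Diff_singleton)
qed

context sphere_dim begin

text \<open>Induction on the exponent of the distinguished coordinate: replacing the square of that
  coordinate by one minus the other squares lowers its exponent by two and does not raise the total
  degree.\<close>

lemma monomial_perp:
  fixes i0 :: 'n
  assumes h: "sbounded h" and 0: "\<And>a. a \<in> expos i0 k \<Longrightarrow> ip (monomial a) h = 0"
  shows "(\<Sum>i\<in>UNIV. a i) < k \<Longrightarrow> ip (monomial a) h = 0"
proof (induction "a i0" arbitrary: a rule: less_induct)
  case less
  show ?case
  proof (cases "a i0 \<le> 1")
    case True
    have "a i < k" for i
      using less.prems member_le_sum[of i UNIV a] by simp
    then have "a \<in> expos i0 k" using True unfolding expos_def by auto
    then show ?thesis by (rule 0)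
  next
    case False
    define b where "b = a(i0 := a i0 - 2)"
    have "b i0 + 2 = a i0" unfolding b_def using False by (simp del: add_2_eq_Suc')
    then have a: "a = b(i0 := b i0 + 2)" by (simp only:) (simp add: b_def)
    have sb: "(\<Sum>i\<in>UNIV. b i) + 2 < k" using less.prems sum_update[of b i0 2] a by simp
    have bi: "b i0 < a i0" unfolding b_def using False by simp
    have ib: "ip (monomial b) h = 0" by (rule less.hyps[of b, OF bi]) (use sb in simp)
    have ib': "ip (monomial (b(i := b i + 2))) h = 0" if "i \<noteq> i0" for i
      by (rule less.hyps[of "b(i := b i + 2)"]) (use that bi sum_update[of b i 2] sb in simp_all)
    have "ip (monomial a) h = ip (\<lambda>x. monomial b x - (\<Sum>i\<in>UNIV - {i0}. monomial (b(i := b i + 2)) x)) h"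
      unfolding ip_def
    proof (rule surf.integral_cong_Sph)
      show "(\<lambda>x. monomial a x * h x) \<in> borel_measurable borel"
        by (intro sbounded_measurable sbounded_mult sbounded_monomial h)
      show "(\<lambda>x. (monomial b x - (\<Sum>i\<in>UNIV - {i0}. monomial (b(i := b i + 2)) x)) * h x) \<in> borel_measurable borel"
        by (intro sbounded_measurable sbounded_mult sbounded_diff sbounded_sum sbounded_monomial h)
      fix x :: "real^'n" assume "x \<in> Sph"
      then have "1 = (\<Sum>i\<in>UNIV. (x $ i)\<^sup>2)"
        using norm_eq_1[of x] by (simp add: inner_vec_def power2_eq_square)
      also have "\<dots> = (x $ i0)\<^sup>2 + (\<Sum>i\<in>UNIV - {i0}. (x $ i)\<^sup>2)" by (rule sum.remove) auto
      finally have "(x $ i0)\<^sup>2 = 1 - (\<Sum>i\<in>UNIV - {i0}. (x $ i)\<^sup>2)" by simp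
      then have "monomial a x = monomial b x * (1 - (\<Sum>i\<in>UNIV - {i0}. (x $ i)\<^sup>2))"
        by (subst a) (simp only: monomial_update)
      also have "\<dots> = monomial b x - (\<Sum>i\<in>UNIV - {i0}. monomial (b(i := b i + 2)) x)"
        unfolding monomial_update by (simp add: right_diff_distrib sum_distrib_left)
      finally show "monomial a x * h x = (monomial b x - (\<Sum>i\<in>UNIV - {i0}. monomial (b(i := b i + 2)) x)) * h x" by simp
    qed
    also have "\<dots> = ip (monomial b) h - ip (\<lambda>x. \<Sum>i\<in>UNIV - {i0}. monomial (b(i := b i + 2)) x) h"
      by (rule ip_diff_left; intro sbounded_sum sbounded_monomial h)
    also have "ip (\<lambda>x. \<Sum>i\<in>UNIV - {i0}. monomial (b(i := b i + 2)) x) h = (\<Sum>i\<in>UNIV - {i0}. ip (monomial (b(i := b i + 2))) h)"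
      by (rule ip_sum_left; intro sbounded_monomial h)
    also have "\<dots> = 0" by (intro sum.neutral ballI ib') simp
    finally show ?thesis using ib by simp
  qed
qed

text \<open>One factor \<open>x \<sqdot> y\<close> is spread over the coordinates, which trades a
  power of the inner product for one unit of the exponent \<open>a\<close>.\<close>

lemma ridge_perp:
  fixes i0 :: 'n and y :: "real^'n"
  assumes h: "sbounded h" and 0: "\<And>a. a \<in> expos i0 k \<Longrightarrow> ip (monomial a) h = 0" and y: "y \<in> Sph"
  shows "(\<Sum>i\<in>UNIV. a i) + j < k \<Longrightarrow> ip (\<lambda>x. monomial a x * (x \<bullet> y)^j) h = 0"
proof (induction j arbitrary: a)
  case 0
  then show ?case using monomial_perp[OF h assms(2), where a = a] by simp
next
  case (Suc j)
  have sp: "sbounded (\<lambda>x. (x \<bullet> y)^j)" for j by (rule sbounded_zonal[of "\<lambda>s. s^j", OF _ y]) (intro continuous_intros)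
  have eq: "monomial a x * (x \<bullet> y)^Suc j = (\<Sum>i\<in>UNIV. y $ i * (monomial (a(i := a i + 1)) x * (x \<bullet> y)^j))" for x
  proof -
    have "monomial a x * (x \<bullet> y)^Suc j = (\<Sum>i\<in>UNIV. x $ i * y $ i) * (monomial a x * (x \<bullet> y)^j)"
      by (simp add: inner_vec_def)
    also have "\<dots> = (\<Sum>i\<in>UNIV. y $ i * (monomial (a(i := a i + 1)) x * (x \<bullet> y)^j))"
      unfolding monomial_update sum_distrib_right by (intro sum.cong refl) simp
    finally show ?thesis .
  qed
  have "ip (\<lambda>x. monomial a x * (x \<bullet> y)^Suc j) h = (\<Sum>i\<in>UNIV. ip (\<lambda>x. y $ i * (monomial (a(i := a i + 1)) x * (x \<bullet> y)^j)) h)"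
    unfolding eq by (rule ip_sum_left; intro sbounded_mult sbounded_const sbounded_monomial sp h)
  also have "\<dots> = 0"
  proof (intro sum.neutral ballI)
    fix i :: 'n
    have "ip (\<lambda>x. monomial (a(i := a i + 1)) x * (x \<bullet> y)^j) h = 0"
      by (rule Suc.IH) (use Suc.prems sum_update[of a i 1] in simp)
    then show "ip (\<lambda>x. y $ i * (monomial (a(i := a i + 1)) x * (x \<bullet> y)^j)) h = 0" unfolding ip_cmult_left by simp
  qed
  finally show ?case .
qed

lemma gegen_perp:
  fixes i0 :: 'n and y :: "real^'n"
  assumes h: "sbounded h" and 0: "\<And>a. a \<in> expos i0 k \<Longrightarrow> ip (monomial a) h = 0" and y: "y \<in> Sph" and d: "d < k"
  shows "ip (\<lambda>x. gegenC l d (x \<bullet> y)) h = 0"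
proof -
  obtain f where f: "\<And>s. poly f s = gegenC l d s" "degree f \<le> d"
    by (rule gegenC_poly[OF l_pos, of d]) (rule that)
  have sp: "sbounded (\<lambda>x. (x \<bullet> y)^j)" for j by (rule sbounded_zonal[of "\<lambda>s. s^j", OF _ y]) (intro continuous_intros)
  have "ip (\<lambda>x. gegenC l d (x \<bullet> y)) h = ip (\<lambda>x. \<Sum>i\<le>degree f. coeff f i * (x \<bullet> y)^i) h"
    unfolding f(1)[symmetric] poly_altdef ..
  also have "\<dots> = (\<Sum>i\<le>degree f. ip (\<lambda>x. coeff f i * (x \<bullet> y)^i) h)"
    by (rule ip_sum_left; intro sbounded_mult sbounded_const sp h)
  also have "\<dots> = 0"
  proof (intro sum.neutral ballI)
    fix i assume i: "i \<in> {..degree f}"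
    have "ip (\<lambda>x. monomial (\<lambda>_. 0) x * (x \<bullet> y)^i) h = 0"
      by (rule ridge_perp[OF h 0 y]) (use i f d in auto)
    then show "ip (\<lambda>x. coeff f i * (x \<bullet> y)^i) h = 0" unfolding ip_cmult_left by (simp add: monomial_def)
  qed
  finally show ?thesis .
qed

end

subsection \<open>The unit sphere of the reproducing kernel Hilbert space\<close>

context pd_kernel begin

text \<open>The reproducing property for finite combinations: pairing with a kernel section
  evaluates the function.\<close>

lemma kform_eval:
  assumes g: "kspan_rep D K g M b q" and p: "\<And>i. i < N \<Longrightarrow> p i \<in> D"
  shows "kform K N a p M b q = (\<Sum>i<N. a i * g (p i))"
proof -
  have q: "\<And>j. j < M \<Longrightarrow> q j \<in> D" and ge: "\<And>z. z \<in> D \<Longrightarrow> g z = (\<Sum>j<M. b j * K (q j) z)"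
    using g by (auto simp: kspan_rep_def)
  have "a i * g (p i) = (\<Sum>j<M. a i * b j * K (p i) (q j))" if "i < N" for i
    unfolding ge[OF p[OF that]] sum_distrib_left
    by (intro sum.cong refl) (use q sym p[OF that] in simp)
  then show ?thesis unfolding kform_def by simp
qed

lemma kspan_repD: "kspan_rep D K g N a p \<Longrightarrow> i < N \<Longrightarrow> p i \<in> D"
  by (simp add: kspan_rep_def)

text \<open>For two representations of one function, each quadratic form is an evaluation of that
  function and hence equals the mixed form. The value chosen by \<open>SOME\<close> is therefore
  determined.\<close>

lemma knorm_rep:
  assumes g: "kspan_rep D K g N a p"
  shows "knorm D K g = sqrt (kform K N a p N a p)"
proof -
  have uniq: "kform K M b q M b q = kform K N a p N a p" if r: "kspan_rep D K g M b q" for M b q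
  proof -
    have "kform K M b q M b q = (\<Sum>i<M. b i * g (q i))" by (rule kform_eval[OF r kspan_repD[OF r]])
    also have "\<dots> = kform K M b q N a p" by (rule kform_eval[OF g kspan_repD[OF r], symmetric])
    also have "\<dots> = kform K N a p M b q" by (rule kform_sym[OF kspan_repD[OF r] kspan_repD[OF g]])
    also have "\<dots> = (\<Sum>i<N. a i * g (p i))" by (rule kform_eval[OF r kspan_repD[OF g]])
    also have "\<dots> = kform K N a p N a p" by (rule kform_eval[OF g kspan_repD[OF g], symmetric])
    finally show ?thesis .
  qed
  have "(SOME v. \<exists>N a p. kspan_rep D K g N a p \<and> v = (\<Sum>i<N. \<Sum>j<N. a i * a j * K (p i) (p j))) = kform K N a p N a p"
  proof (rule some_equality)
    show "\<exists>N' a' p'. kspan_rep D K g N' a' p' \<and> kform K N a p N a p = (\<Sum>i<N'. \<Sum>j<N'. a' i * a' j * K (p' i) (p' j))"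
      using g unfolding kform_def by blast
    show "v = kform K N a p N a p" if "\<exists>N a p. kspan_rep D K g N a p \<and> v = (\<Sum>i<N. \<Sum>j<N. a i * a j * K (p i) (p j))" for v
      using that uniq unfolding kform_def by blast
  qed
  then show ?thesis unfolding knorm_def by simp
qed

lemma kspan_rep_diff:
  assumes g: "kspan_rep D K g N a p" and h: "kspan_rep D K h M b q"
  shows "kspan_rep D K (\<lambda>z. g z - h z) (N + M) (cat N a (\<lambda>i. -1 * b i)) (cat N p q)"
  using g h unfolding kspan_rep_def
  by (auto simp: fun_eq_iff sum_lessThan_add cat_def sum_negf)

lemma knorm_diff_ge:
  assumes g: "g \<in> kspan D K" and h: "h \<in> kspan D K"
  shows "\<bar>knorm D K g - knorm D K h\<bar> \<le> knorm D K (\<lambda>z. g z - h z)"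
proof -
  obtain N a p where gr: "kspan_rep D K g N a p" using g by (auto simp: kspan_def)
  obtain M b q where hr: "kspan_rep D K h M b q" using h by (auto simp: kspan_def)
  define A B C where "A = kform K N a p N a p" and "B = kform K N a p M b q" and "C = kform K M b q M b q"
  have A: "A \<ge> 0" unfolding A_def by (rule kform_nonneg[OF kspan_repD[OF gr]])
  have C: "C \<ge> 0" unfolding C_def by (rule kform_nonneg[OF kspan_repD[OF hr]])
  have "B\<^sup>2 \<le> A * C" unfolding A_def B_def C_def
    by (rule kform_Cauchy_Schwarz[OF kspan_repD[OF gr] kspan_repD[OF hr]])
  then have "\<bar>B\<bar> \<le> sqrt (A * C)" by (rule real_le_rsqrt[of "\<bar>B\<bar>", simplified])
  then have BB: "B \<le> sqrt A * sqrt C" by (simp add: real_sqrt_mult)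
  have kd: "knorm D K (\<lambda>z. g z - h z) = sqrt (A - 2 * B + C)"
    unfolding knorm_rep[OF kspan_rep_diff[OF gr hr]] A_def B_def C_def
    using kform_cat[OF kspan_repD[OF gr] kspan_repD[OF hr], where t = "-1" and a = a and c = b] by simp
  have "(sqrt A - sqrt C)\<^sup>2 = A + C - 2 * (sqrt A * sqrt C)"
    using A C by (simp add: power2_diff)
  then have "(sqrt A - sqrt C)\<^sup>2 \<le> A - 2 * B + C" using BB by linarith
  then have "\<bar>sqrt A - sqrt C\<bar> \<le> sqrt (A - 2 * B + C)"
    using real_le_rsqrt[of "\<bar>sqrt A - sqrt C\<bar>"] by simp
  then show ?thesis unfolding kd knorm_rep[OF gr] knorm_rep[OF hr] A_def C_def .
qed

text \<open>The reverse triangle inequality makes the norms of an approximating sequence Cauchy, so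
  the \<open>SOME\<close> in \<open>rkhs_norm\<close> has a witness. The sequence returned belongs
  to the chosen value and may differ from the initial one.\<close>

lemma rkhs_unit_sphereE:
  assumes f: "f \<in> rkhs_unit_sphere D K"
  obtains g where "kapprox D K g f" "(\<lambda>n. knorm D K (g n)) \<longlonglongrightarrow> 1" "\<And>z. z \<notin> D \<Longrightarrow> f z = 0"
proof -
  have fr: "f \<in> rkhs D K" and f1: "rkhs_norm D K f = 1" using f by (auto simp: rkhs_unit_sphere_def)
  obtain g where g: "kapprox D K g f" using fr by (auto simp: rkhs_def)
  have "Cauchy (\<lambda>n. knorm D K (g n))"
  proof (rule metric_CauchyI)
    fix e :: real assume "e > 0"
    then obtain M where M: "\<And>p q. p \<ge> M \<Longrightarrow> q \<ge> M \<Longrightarrow> knorm D K (\<lambda>z. g p z - g q z) < e"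
      using g unfolding kapprox_def by blast
    have "dist (knorm D K (g m)) (knorm D K (g n)) < e" if "m \<ge> M" "n \<ge> M" for m n
    proof -
      have "g m \<in> kspan D K" "g n \<in> kspan D K" using g unfolding kapprox_def by blast+
      from knorm_diff_ge[OF this] M[OF that] show ?thesis unfolding dist_real_def by linarith
    qed
    then show "\<exists>M. \<forall>m\<ge>M. \<forall>n\<ge>M. dist (knorm D K (g m)) (knorm D K (g n)) < e" by blast
  qed
  then obtain r where "(\<lambda>n. knorm D K (g n)) \<longlonglongrightarrow> r" using Cauchy_convergent_iff convergent_def by blast
  then have "\<exists>r g. kapprox D K g f \<and> (\<lambda>n. knorm D K (g n)) \<longlonglongrightarrow> r" using g by blast
  from someI_ex[OF this] have "\<exists>g. kapprox D K g f \<and> (\<lambda>n. knorm D K (g n)) \<longlonglongrightarrow> rkhs_norm D K f"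
    unfolding rkhs_norm_def .
  then obtain g' where "kapprox D K g' f" "(\<lambda>n. knorm D K (g' n)) \<longlonglongrightarrow> 1" unfolding f1 by blast
  then show ?thesis using that fr by (auto simp: rkhs_def)
qed

end

context sphere_kernel begin

text \<open>Elements of the kernel span are bounded by \<open>sqrt (K z z)\<close> times their norm,
  which makes the limit bounded and permits dominated convergence. On the span the second claim,
  scaled by the norm, is \<open>kernel_functional_bound\<close>.\<close>

lemma rkhs_unit_sphere_bound:
  assumes f: "f \<in> rkhs_unit_sphere Sph K"
  shows "sbounded f" and "sbounded h \<Longrightarrow> (ip f h)\<^sup>2 \<le> QF h"
proof -
  obtain g where g: "kapprox Sph K g f" and lim1: "(\<lambda>n. knorm Sph K (g n)) \<longlonglongrightarrow> 1" and f0: "\<And>z. z \<notin> Sph \<Longrightarrow> f z = 0"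
    by (rule rkhs_unit_sphereE[OF f]) (rule that)
  have gs: "g n \<in> kspan Sph K" for n using g unfolding kapprox_def by blast
  have lim: "(\<lambda>n. g n z) \<longlonglongrightarrow> f z" if "z \<in> Sph" for z using g that unfolding kapprox_def by blast
  have [measurable]: "(Sph :: (real^'n) set) \<in> sets borel" by (rule borel_closed) simp
  have gm [measurable]: "g n \<in> borel_measurable borel" for n
  proof -
    obtain N a p where r: "kspan_rep Sph K (g n) N a p" using gs[of n] by (auto simp: kspan_def)
    then have eq: "g n = (\<lambda>z. if z \<in> Sph then (\<Sum>i<N. a i * K (p i) z) else 0)" by (simp add: kspan_rep_def)
    show ?thesis unfolding eq by measurable
  qed
  have g0: "g n z = 0" if z: "z \<notin> Sph" for n z
    using gs[of n] z unfolding kspan_def kspan_rep_def by auto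
  have lim': "(\<lambda>n. g n z) \<longlonglongrightarrow> f z" for z
    by (cases "z \<in> Sph") (use lim g0 f0 in auto)
  have fm [measurable]: "f \<in> borel_measurable borel" by (rule borel_measurable_LIMSEQ_real[OF lim' gm])
  have "Bseq (\<lambda>n. knorm Sph K (g n))" using lim1 by (intro convergent_imp_Bseq convergentI)
  then obtain W where W: "\<And>n. \<bar>knorm Sph K (g n)\<bar> \<le> W" unfolding Bseq_def by auto
  have W0: "W \<ge> 0" using W[of 0] by linarith
  have gb: "\<bar>g n z\<bar> \<le> W * sqrt Kb" if z: "z \<in> Sph" for n z
  proof -
    obtain N a p where r: "kspan_rep Sph K (g n) N a p" using gs[of n] by (auto simp: kspan_def)
    \<comment> \<open>Evaluation at \<open>z\<close> as the form against the one-point family, to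
      which Cauchy-Schwarz applies.\<close>
    have "kform K (Suc 0) (\<lambda>_. 1) (\<lambda>_. z) N a p = g n z"
      using kform_eval[OF r, of "Suc 0" "\<lambda>_. z" "\<lambda>_. 1"] z by simp
    moreover have "(kform K (Suc 0) (\<lambda>_. 1) (\<lambda>_. z) N a p)\<^sup>2 \<le> kform K (Suc 0) (\<lambda>_. 1) (\<lambda>_. z) (Suc 0) (\<lambda>_. 1) (\<lambda>_. z) * kform K N a p N a p"
      by (rule kform_Cauchy_Schwarz[OF _ kspan_repD[OF r]]) (use z in simp)
    ultimately have "(g n z)\<^sup>2 \<le> K z z * kform K N a p N a p" by (simp add: kform_def)
    then have "\<bar>g n z\<bar> \<le> sqrt (K z z * kform K N a p N a p)" using real_le_rsqrt[of "\<bar>g n z\<bar>"] by simp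
    also have "\<dots> = sqrt (K z z) * knorm Sph K (g n)" by (simp add: real_sqrt_mult knorm_rep[OF r])
    also have "\<dots> \<le> sqrt Kb * W"
    proof (rule mult_mono)
      show "sqrt (K z z) \<le> sqrt Kb" using K_bound[OF z z] by simp
      show "knorm Sph K (g n) \<le> W" using W[of n] by linarith
      show "0 \<le> knorm Sph K (g n)" using knorm_rep[OF r] kform_nonneg[OF kspan_repD[OF r]] by simp
    qed (use Kb_nonneg in simp)
    finally show ?thesis by (simp add: mult.commute)
  qed
  have fb: "\<bar>f z\<bar> \<le> W * sqrt Kb" if z: "z \<in> Sph" for z
    by (rule LIMSEQ_le_const2[OF tendsto_rabs[OF lim[OF z]]]) (use gb[OF z] in blast)
  show "sbounded f" by (rule sboundedI[OF fm fb])
  show "(ip f h)\<^sup>2 \<le> QF h" if h: "sbounded h"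
  proof -
    obtain C where C: "C \<ge> 0" "\<And>x. x \<in> Sph \<Longrightarrow> \<bar>h x\<bar> \<le> C" using h by (rule sboundedE) blast
    have [measurable]: "h \<in> borel_measurable borel" using h by (rule sbounded_measurable)
    have L: "(\<lambda>n. ip (g n) h) \<longlonglongrightarrow> ip f h" unfolding ip_def
    proof (rule surf.integral_dominated_Sph[where C = "W * sqrt Kb * C"])
      fix x :: "real^'n" assume x: "x \<in> Sph"
      show "\<bar>g n x * h x\<bar> \<le> W * sqrt Kb * C" for n
        unfolding abs_mult using gb[OF x] C x W0 Kb_nonneg by (intro mult_mono) auto
      show "(\<lambda>n. g n x * h x) \<longlonglongrightarrow> f x * h x" by (intro tendsto_mult tendsto_const lim x)
    qed measurable
    have le: "(ip (g n) h)\<^sup>2 \<le> (knorm Sph K (g n))\<^sup>2 * QF h" for n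
    proof -
      obtain N a p where r: "kspan_rep Sph K (g n) N a p" using gs[of n] by (auto simp: kspan_def)
      have p: "\<And>i. i < N \<Longrightarrow> p i \<in> Sph" by (rule kspan_repD[OF r])
      have "ip (g n) h = ip (\<lambda>z. \<Sum>i<N. a i * K (p i) z) h" unfolding ip_def
      proof (rule surf.integral_cong_Sph)
        show "(\<lambda>x. (\<Sum>i<N. a i * K (p i) x) * h x) \<in> borel_measurable borel" by measurable
        show "g n x * h x = (\<Sum>i<N. a i * K (p i) x) * h x" if "x \<in> Sph" for x
          using r that by (simp add: kspan_rep_def)
      qed measurable
      also have "\<dots> = (\<Sum>i<N. ip (\<lambda>z. a i * K (p i) z) h)"
        by (rule ip_sum_left; intro sbounded_mult sbounded_const sbounded_K h p) auto
      also have "\<dots> = (\<Sum>i<N. a i * T h (p i))" unfolding ip_cmult_left unfolding ip_def T_def ..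
      finally have e: "ip (g n) h = (\<Sum>i<N. a i * T h (p i))" .
      have "(knorm Sph K (g n))\<^sup>2 = kform K N a p N a p"
        unfolding knorm_rep[OF r] by (simp add: kform_nonneg[OF p])
      then show ?thesis unfolding e using kernel_functional_bound[OF h p, where N = N and a = a] by simp
    qed
    have "(\<lambda>n. (knorm Sph K (g n))\<^sup>2 * QF h) \<longlonglongrightarrow> 1\<^sup>2 * QF h"
      by (intro tendsto_mult tendsto_power tendsto_const lim1)
    then have R: "(\<lambda>n. (knorm Sph K (g n))\<^sup>2 * QF h) \<longlonglongrightarrow> QF h" by simp
    show ?thesis by (rule LIMSEQ_le[OF tendsto_power[OF L] R]) (use le in blast)
  qed
qed

text \<open>The distance of \<open>f\<close> to the span is \<open>\<langle>f, w\<rangle> / \<parallel>w\<parallel>\<close> for the residual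
  \<open>w\<close>, which the energy on the orthogonal complement controls.\<close>

lemma kolmogorov_width_le:
  assumes g: "onf n g" and s: "s \<ge> 0"
    and Q: "\<And>h. sbounded h \<Longrightarrow> (\<And>i. i < n \<Longrightarrow> ip h (g i) = 0) \<Longrightarrow> QF h \<le> s * ip h h"
  shows "kolmogorov_width (surf :: (real^'n) measure) (rkhs_unit_sphere Sph K) n \<le> ereal (sqrt s)"
proof -
  have gs: "sbounded (g i)" if "i < n" for i using g that by (simp add: onf_def)
  have basis: "g \<in> L2_basis surf n" unfolding L2_basis_def
  proof (clarsimp, intro conjI allI impI)
    fix i assume "i < n"
    then show "L2 surf (g i)" unfolding L2_def
      using sbounded_measurable[OF gs] surf.integrable_sbounded[OF sbounded_mult[OF gs gs], of i i] by (simp add: power2_eq_square)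
  next
    fix c i assume ae: "AE x in surf. (\<Sum>i<n. c i * g i x) = 0" and i: "i < n"
    have ss: "sbounded (\<lambda>x. \<Sum>i<n. c i * g i x)" by (intro sbounded_sum sbounded_mult sbounded_const gs) simp
    have "ip (\<lambda>x. \<Sum>j<n. c j * g j x) (g i) = (\<Sum>j<n. ip (\<lambda>x. c j * g j x) (g i))"
      by (rule ip_sum_left; intro sbounded_mult sbounded_const gs i) simp
    also have "\<dots> = (\<Sum>j<n. if j = i then c i else 0)"
      unfolding ip_cmult_left using g i by (intro sum.cong refl) (auto simp: onf_def)
    also have "\<dots> = c i" using i by simp
    also have "ip (\<lambda>x. \<Sum>j<n. c j * g j x) (g i) = (\<integral>x. 0 \<partial>(surf :: (real^'n) measure))" unfolding ip_def
    proof (rule integral_cong_AE)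
      show "(\<lambda>x. (\<Sum>j<n. c j * g j x) * g i x) \<in> borel_measurable surf"
        using sbounded_measurable[OF sbounded_mult[OF ss gs[OF i]]] by simp
      show "AE x in surf. (\<Sum>j<n. c j * g j x) * g i x = 0" using ae by eventually_elim simp
    qed simp
    finally show "c i = 0" by simp
  qed
  have each: "(INF c. ereal (L2norm surf (\<lambda>x. f x - (\<Sum>i<n. c i * g i x)))) \<le> ereal (sqrt s)"
    if f: "f \<in> rkhs_unit_sphere Sph K" for f
  proof -
    have sf: "sbounded f" by (rule rkhs_unit_sphere_bound(1)[OF f])
    define w where "w = resid n g f"
    have sw: "sbounded w" unfolding w_def by (rule sbounded_resid[OF g sf])
    have "QF w \<le> s * ip w w" by (rule Q[OF sw]) (unfold w_def, rule resid_orthogonal[OF g sf])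
    moreover have "(ip f w)\<^sup>2 \<le> QF w" by (rule rkhs_unit_sphere_bound(2)[OF f sw])
    moreover have "ip f w = ip w w" unfolding w_def by (rule ip_resid_self'[OF g sf, symmetric])
    ultimately have "(ip w w)\<^sup>2 \<le> s * ip w w" by simp
    then have "ip w w \<le> s"
      using ip_self_nonneg[of w] s by (cases "ip w w = 0") (auto simp: power2_eq_square)
    then have "L2norm surf w \<le> sqrt s" unfolding L2norm_def ip_def by (simp add: power2_eq_square)
    then have "ereal (L2norm surf (\<lambda>x. f x - (\<Sum>i<n. ip f (g i) * g i x))) \<le> ereal (sqrt s)"
      unfolding w_def resid_def[abs_def] by simp
    then show ?thesis by (intro INF_lower2[of "\<lambda>i. ip f (g i)"]) auto
  qed
  show ?thesis unfolding kolmogorov_width_def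
    by (rule INF_lower2[OF basis], rule SUP_least, rule each)
qed

text \<open>Budget of dimensions: the monomials take at most \<open>2 k ^ m \<le> n / 2\<close>
  functions, the greedy extension at most \<open>n div 2\<close> more, and padding fills up to
  \<open>n\<close>. Comparing \<open>n div 2 + 1\<close> with \<open>n + 1\<close> costs the factor
  two.\<close>

lemma kolmogorov_width_of_tail:
  assumes e: "e > 0" and tail: "\<And>N. (\<Sum>i\<in>{k..N}. jb N i * tau i) \<le> e"
    and n: "4 * k ^ (CARD('n) - 1) \<le> n"
  shows "kolmogorov_width (surf :: (real^'n) measure) (rkhs_unit_sphere Sph K) n \<le> ereal (sqrt (2 * e / (real n + 1)))"
proof -
  define i0 :: 'n where "i0 = undefined"
  define d where "d = card (expos i0 k)"
  have d: "d = 2 * k ^ (CARD('n) - 1)" unfolding d_def by (rule expos(2))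
  obtain a where a: "bij_betw a {..<d} (expos i0 k)"
    using ex_bij_betw_nat_finite[OF expos(1)[of i0 k]] unfolding d_def by (auto simp: atLeast0LessThan)
  obtain r0 g0 where r0: "r0 \<le> d" and g0: "onf r0 g0"
    and perp: "\<And>h j. sbounded h \<Longrightarrow> (\<And>i. i < r0 \<Longrightarrow> ip h (g0 i) = 0) \<Longrightarrow> j < d \<Longrightarrow> ip h (monomial (a j)) = 0"
  proof (rule gram_schmidt[of d "\<lambda>j. monomial (a j)"])
    fix r g assume rg: "r \<le> d" "onf r g"
      "\<And>h j. sbounded h \<Longrightarrow> (\<And>i. i < r \<Longrightarrow> ip h (g i) = 0) \<Longrightarrow> j < d \<Longrightarrow> ip h (monomial (a j)) = 0"
    show thesis by (rule that[OF rg])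
  qed (rule sbounded_monomial)
  define D where "D = n div 2"
  obtain r g where r: "r0 \<le> r" "r \<le> r0 + D" and g: "onf r g"
    and Q: "\<And>h. sbounded h \<Longrightarrow> (\<And>i. i < r \<Longrightarrow> ip h (g i) = 0) \<Longrightarrow> QF h \<le> e / (real D + 1) * ip h h"
  proof (rule greedy[OF g0 e, of D])
    fix r g assume r: "r0 \<le> r" and g: "onf r g" and ext: "\<And>i. i < r0 \<Longrightarrow> g i = g0 i"
    show "(\<Sum>i\<in>{r0..<r}. QF (g i)) \<le> e"
    proof (rule trace_bound[OF _ _ _ _ tail])
      show "sbounded (g i)" if "i \<in> {r0..<r}" for i using g that by (simp add: onf_def)
      show "ip (g i) (g j) = (if i = j then 1 else 0)" if "i \<in> {r0..<r}" "j \<in> {r0..<r}" for i j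
        using g that by (simp add: onf_def)
      fix i j x assume i: "i \<in> {r0..<r}" and j: "j < k" and x: "x \<in> (Sph :: (real^'n) set)"
      have gi: "sbounded (g i)" using g i by (simp add: onf_def)
      have z: "ip (g i) (g0 m) = 0" if "m < r0" for m
        using g i that by (simp add: onf_def flip: ext[OF that])
      show "ip (\<lambda>z. gegenC l j (z \<bullet> x)) (g i) = 0"
      proof (rule gegen_perp[OF gi _ x j, of i0])
        fix b assume "b \<in> expos i0 k"
        then obtain m where m: "m < d" "b = a m" using a by (auto simp: bij_betw_def)
        have "ip (g i) (monomial (a m)) = 0" by (rule perp[OF gi z m(1)])
        then show "ip (monomial b) (g i) = 0" unfolding m(2) by (subst ip_commute)
      qed
    qed simp
  next
    fix r g assume rg: "r0 \<le> r" "r \<le> r0 + D" "onf r g"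
      "\<And>h. sbounded h \<Longrightarrow> (\<And>i. i < r \<Longrightarrow> ip h (g i) = 0) \<Longrightarrow> QF h \<le> e / (real D + 1) * ip h h"
    show thesis by (rule that[OF rg])
  qed
  have "r \<le> n" using r r0 n unfolding d D_def by linarith
  then obtain g' where g': "onf n g'" "\<And>i. i < r \<Longrightarrow> g' i = g i" by (rule onf_pad[OF g]) (rule that)
  have "kolmogorov_width (surf :: (real^'n) measure) (rkhs_unit_sphere Sph K) n \<le> ereal (sqrt (e / (real D + 1)))"
  proof (rule kolmogorov_width_le[OF g'(1)])
    show "0 \<le> e / (real D + 1)" using e by simp
    fix h assume h: "sbounded h" "\<And>i. i < n \<Longrightarrow> ip h (g' i) = 0"
    show "QF h \<le> e / (real D + 1) * ip h h"
    proof (rule Q[OF h(1)])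
      fix i assume "i < r"
      then show "ip h (g i) = 0" using h(2)[of i] g'(2)[of i] \<open>r \<le> n\<close> by simp
    qed
  qed
  also have "ereal (sqrt (e / (real D + 1))) \<le> ereal (sqrt (2 * e / (real n + 1)))"
  proof -
    have "n + 1 \<le> 2 * (D + 1)" unfolding D_def by presburger
    then have "real (n + 1) \<le> real (2 * (D + 1))" by (simp only: of_nat_le_iff)
    then have "real n + 1 \<le> 2 * (real D + 1)" by simp
    then have "e * (real n + 1) \<le> e * (2 * (real D + 1))" using e by (intro mult_left_mono) auto
    then have "e / (real D + 1) \<le> 2 * e / (real n + 1)" by (simp add: field_simps)
    then show ?thesis by simp
  qed
  finally show ?thesis .
qed

end

section \<open>From the given kernel to its restriction to the sphere\<close>

lemma rkhs_unit_sphere_cong: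
  assumes "\<And>x y. x \<in> D \<Longrightarrow> y \<in> D \<Longrightarrow> K x y = K' x y"
  shows "rkhs_unit_sphere D K = rkhs_unit_sphere D K'"
proof -
  have r: "kspan_rep D K = kspan_rep D K'"
    unfolding kspan_rep_def using assms by (intro ext conj_cong refl) (auto simp: fun_eq_iff intro!: sum.cong)
  have s: "kspan D K = kspan D K'" unfolding kspan_def r ..
  have "(kspan_rep D K g N a p \<and> v = (\<Sum>i<N. \<Sum>j<N. a i * a j * K (p i) (p j)))
      \<longleftrightarrow> (kspan_rep D K' g N a p \<and> v = (\<Sum>i<N. \<Sum>j<N. a i * a j * K' (p i) (p j)))" for g N a p v
    unfolding r
  proof (rule conj_cong[OF refl])
    assume "kspan_rep D K' g N a p"
    then have "p i \<in> D" if "i < N" for i using that by (simp add: kspan_rep_def)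
    then have "(\<Sum>i<N. \<Sum>j<N. a i * a j * K (p i) (p j)) = (\<Sum>i<N. \<Sum>j<N. a i * a j * K' (p i) (p j))"
      by (intro sum.cong refl) (simp add: assms)
    then show "(v = (\<Sum>i<N. \<Sum>j<N. a i * a j * K (p i) (p j))) = (v = (\<Sum>i<N. \<Sum>j<N. a i * a j * K' (p i) (p j)))" by simp
  qed
  then have n: "knorm D K = knorm D K'" unfolding knorm_def[abs_def] by simp
  have a: "kapprox D K = kapprox D K'" unfolding kapprox_def[abs_def] s n ..
  show ?thesis unfolding rkhs_unit_sphere_def rkhs_def rkhs_norm_def[abs_def] a n ..
qed

text \<open>Off the sphere \<open>K\<close> is arbitrary. If some section \<open>K x\<close> is not Borel, the convolution is the
  junk value \<open>0\<close>, and the Hoelder condition then forces \<open>K x y = 0\<close> on the sphere.\<close>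

lemma sconv_restrict:
  fixes xi :: "real^'n::finite" and mu :: "real \<Rightarrow> 'n smeasure"
  assumes card: "CARD('n) \<ge> 3" and xi: "xi \<in> Sph" and mu: "\<And>t. 0 < t \<Longrightarrow> t < pi \<Longrightarrow> mu t \<in> Mxi xi"
    and rho: "rho > 0" and B: "B \<ge> 0" and f0: "\<And>y. f0 y = (if y \<in> Sph then f y else 0)"
    and f0m: "f0 \<in> borel_measurable borel"
    and hol: "\<And>t y. 0 < t \<Longrightarrow> t < pi \<Longrightarrow> y \<in> Sph \<Longrightarrow> \<bar>sconv xi f (mu t) y - f y\<bar> \<le> B * t powr rho"
    and t: "0 < t" "t < pi" and y: "y \<in> Sph"
  shows "\<bar>sconv xi f0 (mu t) y - f0 y\<bar> \<le> B * t powr rho"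
proof (cases "f \<in> borel_measurable borel")
  case True
  interpret S: sphere_dim "(real CARD('n) - 2) / 2" xi by unfold_locales (use card xi in auto)
  interpret P: zonal_measure "(real CARD('n) - 2) / 2" xi "fst (mu t)" by (rule S.Mxi_zonal[OF mu[OF t]])
  interpret N: zonal_measure "(real CARD('n) - 2) / 2" xi "snd (mu t)" by (rule S.Mxi_zonal[OF mu[OF t]])
  define U where "U = inv (Orot xi y)"
  have Um: "U \<in> borel_measurable borel" unfolding U_def by (rule P.Orot_measurable[OF y])
  have US: "U z \<in> Sph" if "z \<in> Sph" for z using Orot_props(8)[OF card xi y, of z] that unfolding U_def by simp
  have m: "(\<lambda>z. f0 (U z)) \<in> borel_measurable borel" "(\<lambda>z. f (U z)) \<in> borel_measurable borel"
    using measurable_compose[OF Um f0m] measurable_compose[OF Um True] by auto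
  have e: "f0 (U z) = f (U z)" if "z \<in> Sph" for z using US[OF that] f0 by simp
  have "sint (mu t) (\<lambda>z. f0 (U z)) = sint (mu t) (\<lambda>z. f (U z))"
    unfolding sint_def using P.integral_cong_Sph[OF m e] N.integral_cong_Sph[OF m e] by simp
  then have "sconv xi f0 (mu t) y = sconv xi f (mu t) y" unfolding sconv_def U_def by simp
  then show ?thesis using hol[OF t y] f0[of y] y by simp
next
  case False
  have zero: "f u = 0" if u: "u \<in> Sph" for u
  proof (rule ccontr)
    assume "f u \<noteq> 0"
    then have pos: "\<bar>f u\<bar> > 0" by simp
    have "sint (mu s) (\<lambda>z. f (inv (Orot xi u) z)) = 0" if s: "0 < s" "s < pi" for s
    proof -
      define O' where "O' = Orot xi u"
      have ot: "orthogonal_transformation O'" using Orot_props(1)[OF card xi u] by (simp add: rotation_def O'_def)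
      have nm: "\<not> (\<lambda>z. f (inv O' z)) \<in> borel_measurable borel"
      proof
        assume "(\<lambda>z. f (inv O' z)) \<in> borel_measurable borel"
        from measurable_compose[OF orthogonal_transformation_borel[OF ot] this]
        have "(\<lambda>z. f (inv O' (O' z))) \<in> borel_measurable borel" .
        moreover have "inv O' (O' z) = z" for z using orthogonal_transformation_inj[OF ot] by (rule inv_f_f)
        ultimately show False using False by simp
      qed
      have ni: "\<not> integrable M (\<lambda>z. f (inv O' z))" if M: "sets M = sets borel" for M
      proof
        assume "integrable M (\<lambda>z. f (inv O' z))"
        then have "(\<lambda>z. f (inv O' z)) \<in> borel_measurable M" by (rule borel_measurable_integrable)
        then show False using nm unfolding measurable_cong_sets[OF M refl] by contradiction
      qed
      have sg: "signed_meas (mu s)" using mu[OF s] unfolding Mxi_def by simp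
      then have "sets (fst (mu s)) = sets borel" "sets (snd (mu s)) = sets borel"
        unfolding signed_meas_def by blast+
      then show ?thesis unfolding sint_def O'_def[symmetric]
        by (simp only: not_integrable_integral_eq[OF ni] diff_self)
    qed
    then have h: "\<bar>f u\<bar> \<le> B * s powr rho" if "0 < s" "s < pi" for s
      using hol[OF that u] that unfolding sconv_def by simp
    obtain s where s: "0 < s" "s \<le> 1" "B * s powr rho < \<bar>f u\<bar>"
      by (rule powr_small[OF rho pos B, of 1]) auto
    then show False using h[of s] pi_gt3 by auto
  qed
  then have "f0 = (\<lambda>_. 0)" using f0 by (auto simp: fun_eq_iff)
  then show ?thesis using B by (simp add: sconv_def sint_def)
qed

theorem theorem4p3:
  fixes xi :: "real^'n"
    and mu :: "real \<Rightarrow> 'n smeasure"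
    and c :: "nat \<Rightarrow> real" and v :: "real \<Rightarrow> real" and alpha :: "nat \<Rightarrow> nat"
    and beta gamma rho :: real
    and K :: "real^'n \<Rightarrow> real^'n \<Rightarrow> real" and B :: "real^'n \<Rightarrow> real"
  assumes dim: "CARD('n) \<ge> 3"
    and xi: "xi \<in> Sph"
    and mu_in: "\<forall>t\<in>{0<..<pi}. mu t \<in> Mxi xi"
    and mu_bdd: "\<exists>C. \<forall>t\<in>{0<..<pi}. snorm (mu t) \<le> C"
    and c_nz: "\<forall>k. c k \<noteq> 0"
    and alpha_mono: "strict_mono alpha"
    and gamma_pos: "gamma > 0"
    and beta_int: "2 * beta \<in> \<int>" and beta_ge: "2 * beta \<ge> gamma"
    and v_pos: "\<forall>t\<in>{0<..<pi}. v t > 0"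
    and v_asymp: "\<exists>cm C1 C2. C1 > 0 \<and> C2 > 0 \<and>
        (\<forall>t\<in>{0<..<pi}. C1 * t powr cm \<le> v t \<and> v t \<le> C2 * t powr cm)"
    and mult: "\<forall>t\<in>{0<..<pi}. \<forall>k. multiplier xi (mu t) k =
        c k * inverse (v t) * gegenP beta (alpha k) (cos t) * (sin t) powr gamma"
    and alpha_growth: "\<forall>l::nat. l > 0 \<longrightarrow> (\<exists>q::nat. q > 0 \<and> (\<forall>n\<ge>1. l * n \<le> alpha (q * n)))"
    and K_cont: "continuous_on (Sph \<times> Sph) (\<lambda>(x, y). K x y)"
    and K_sym: "\<forall>x\<in>Sph. \<forall>y\<in>Sph. K x y = K y x"
    and K_pd: "pos_def_kernel Sph K"
    and rho: "0 < rho" "rho \<le> 2"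
    and B_meas: "B \<in> borel_measurable (surf :: (real^'n) measure)"
    and B_ess_bdd: "\<exists>C. AE x in (surf :: (real^'n) measure). \<bar>B x\<bar> \<le> C"
    and B_nonneg: "\<forall>x. B x \<ge> 0"
    and holder: "\<forall>t\<in>{0<..<pi}. \<forall>x\<in>Sph. \<forall>y\<in>Sph.
        \<bar>sconv xi (K x) (mu t) y - K x y\<bar> \<le> B x * t powr rho"
  shows "\<exists>C. \<forall>\<^sub>F n in sequentially.
     kolmogorov_width (surf :: (real^'n) measure) (rkhs_unit_sphere Sph K) n
       \<le> ereal (C * real (n + 1) powr (- 1 / 2 - rho / (2 * (real CARD('n) - 1))))"
proof -
  define l where "l = (real CARD('n) - 2) / 2"
  \<comment> \<open>Continuity is assumed on the sphere only, while Fubini asks for joint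
    measurability on the whole space; extension by zero provides it.\<close>
  define K0 where "K0 = (\<lambda>x y. if x \<in> Sph \<and> y \<in> Sph then K x y else 0)"
  have beta: "beta > 0" using beta_ge gamma_pos by linarith
  have K0eq: "K0 x y = K x y" if "x \<in> Sph" "y \<in> Sph" for x y using that by (simp add: K0_def)
  have comp: "compact ((\<lambda>(x, y). K x y) ` (Sph \<times> Sph))"
    by (rule compact_continuous_image[OF K_cont]) (intro compact_Times compact_sphere)
  obtain Kb where Kb: "\<And>x y. x \<in> Sph \<Longrightarrow> y \<in> Sph \<Longrightarrow> \<bar>K x y\<bar> \<le> Kb"
  proof -
    obtain W where "\<forall>z \<in> (\<lambda>(x, y). K x y) ` (Sph \<times> Sph). norm z \<le> W"
      using compact_imp_bounded[OF comp] unfolding bounded_iff by blast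
    then show thesis by (intro that[of W]) auto
  qed
  have K0m: "(\<lambda>(x, y). K0 x y) \<in> borel_measurable (borel \<Otimes>\<^sub>M borel)"
  proof -
    have "closed ((Sph \<times> Sph) :: ((real^'n) \<times> (real^'n)) set)" by (intro closed_Times) auto
    then have "(\<lambda>z. indicator (Sph \<times> Sph) z *\<^sub>R (\<lambda>(x, y). K x y) z) \<in> borel_measurable borel"
      by (intro borel_measurable_continuous_on_indicator K_cont borel_closed)
    moreover have "(\<lambda>z. indicator (Sph \<times> Sph) z *\<^sub>R (\<lambda>(x, y). K x y) z) = (\<lambda>(x, y). K0 x y)"
      by (auto simp: fun_eq_iff K0_def indicator_def)
    ultimately show ?thesis by (simp add: borel_prod)
  qed
  have K0c: "continuous_on (Sph \<times> Sph) (\<lambda>(x, y). K0 x y)"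
    using K_cont by (rule continuous_on_eq) (auto simp: K0_def)
  have K0pd: "pos_def_kernel Sph K0"
    using K_pd unfolding pos_def_kernel_def by (simp add: K0_def)
  interpret sphere_kernel l xi K0 Kb
  proof unfold_locales
    show "(\<lambda>(x, y). K0 x y) \<in> borel_measurable (borel \<Otimes>\<^sub>M borel)" by (rule K0m)
  qed (use dim xi l_def K_sym K0eq Kb K0pd K0c in auto)
  have mu': "mu t \<in> Mxi xi" if "0 < t" "t < pi" for t using mu_in that by simp
  have hol0: "\<bar>sconv xi (K0 x) (mu t) y - K0 x y\<bar> \<le> B x * t powr rho"
    if t: "0 < t" "t < pi" and x: "x \<in> Sph" and y: "y \<in> Sph" for t x y
  proof (rule sconv_restrict[OF dim xi mu' rho(1) _ _ K_section_measurable _ t y])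
    show "B x \<ge> 0" using B_nonneg by simp
    show "K0 x y = (if y \<in> Sph then K x y else 0)" for y using x by (simp add: K0_def)
    show "\<bar>sconv xi (K x) (mu t) y - K x y\<bar> \<le> B x * t powr rho" if "0 < t" "t < pi" "y \<in> Sph" for t y
      using holder that x by simp
  qed
  obtain Cb where "AE x in (surf :: (real^'n) measure). \<bar>B x\<bar> \<le> Cb" using B_ess_bdd by blast
  then have Cb: "AE x in (surf :: (real^'n) measure). B x \<le> Cb" by eventually_elim simp
  have tp: "0 \<le> t powr rho" for t by simp
  \<comment> \<open>\<open>w\<close> collects the part of the multiplier that does not depend on the
    degree.\<close>
  obtain C n0 where C: "C > 0" and n0: "n0 \<ge> 1"
    and tail: "\<And>n N. n \<ge> n0 \<Longrightarrow> (\<Sum>k\<in>{n..N}. jb N k * tau k) \<le> C * real n powr (- rho)"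
  proof (rule multiplier_tail[where c = c and w = "\<lambda>t. inverse (v t) * (sin t) powr gamma" and b = jb and \<tau> = tau
        and M = "\<lambda>t k. multiplier xi (mu t) k" and ?C1.0 = "max Cb 0 * omega TYPE('n)" and ?C2.0 = "Kb * omega TYPE('n)",
        OF beta rho alpha_mono])
    show "c k \<noteq> 0" for k using c_nz by simp
    show "multiplier xi (mu t) k = c k * (inverse (v t) * (sin t) powr gamma) * gegenP beta (alpha k) (cos t)" if "0 < t" "t < pi" for t k
      using mult that by simp
    show "jb N k \<ge> 0" for N k by (rule jb_nonneg)
    show "tau k \<ge> 0" for k by (rule tau_nonneg)
    show "\<bar>\<Sum>k\<le>N. jb N k * ((multiplier xi (mu t) k - 1) * tau k)\<bar> \<le> max Cb 0 * omega TYPE('n) * t powr rho" if t: "0 < t" "t < pi" for t N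
      using hoelder_trace_JJ[OF mu'[OF t] hol0[OF t] Cb tp, of N] by (simp add: mult_ac)
    show "(\<Sum>k\<le>N. jb N k * tau k) \<le> Kb * omega TYPE('n)" for N by (rule jb_tau_bound)
    show "\<exists>D\<ge>0. \<forall>t. 0 < t \<longrightarrow> t < pi \<longrightarrow> \<bar>multiplier xi (mu t) k - 1\<bar> * tau k \<le> D * t powr rho" for k
    proof (rule hoelder_trace_single[of k])
      fix D assume D: "D \<ge> 0" and h: "\<And>mu B t Cb. mu \<in> Mxi xi
        \<Longrightarrow> (\<And>x y. x \<in> Sph \<Longrightarrow> y \<in> Sph \<Longrightarrow> \<bar>sconv xi (K0 x) mu y - K0 x y\<bar> \<le> B x * t)
        \<Longrightarrow> AE x in surf. B x \<le> Cb \<Longrightarrow> t \<ge> 0 \<Longrightarrow> \<bar>multiplier xi mu k - 1\<bar> * tau k \<le> max Cb 0 * t * D"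
      show ?thesis
      proof (intro exI[of _ "max Cb 0 * D"] conjI allI impI)
        show "0 \<le> max Cb 0 * D" using D by simp
        fix t :: real assume t: "0 < t" "t < pi"
        have "\<bar>multiplier xi (mu t) k - 1\<bar> * tau k \<le> max Cb 0 * (t powr rho) * D"
          by (rule h[OF mu'[OF t] hol0[OF t] Cb tp])
        then show "\<bar>multiplier xi (mu t) k - 1\<bar> * tau k \<le> max Cb 0 * D * t powr rho" by (simp add: mult_ac)
      qed
    qed
  next
    fix C n0 assume "C > 0" "n0 \<ge> 1" "\<And>n N. n \<ge> n0 \<Longrightarrow> (\<Sum>k\<in>{n..N}. jb N k * tau k) \<le> C * real n powr (- rho)"
    then show thesis by (rule that)
  qed
  define m where "m = real CARD('n) - 1"
  have m: "m \<ge> 2" unfolding m_def using dim by simp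
  have mnat: "m = real (CARD('n) - 1)" unfolding m_def using dim by (simp add: of_nat_diff)
  \<comment> \<open>\<open>2 C\<close> comes from the width estimate, \<open>2 powr rho\<close> from
    rounding \<open>z\<close> down to \<open>k\<close>, and \<open>8 powr (rho / m)\<close> from
    comparing \<open>n / 4\<close> with \<open>n + 1\<close>.\<close>
  define W where "W = 2 * C * (2 powr rho * 8 powr (rho / m))"
  have W: "W > 0" unfolding W_def using C by simp
  have bound: "kolmogorov_width (surf :: (real^'n) measure) (rkhs_unit_sphere Sph K0) n
       \<le> ereal (sqrt W * real (n + 1) powr (- 1 / 2 - rho / (2 * m)))"
    if n: "real n \<ge> 4 * (real n0 + 1) powr m" for n
  proof -
    \<comment> \<open>\<open>k\<close> becomes the largest integer with
      \<open>4 k ^ m \<le> n\<close>, the condition of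
      \<open>kolmogorov_width_of_tail\<close>.\<close>
    define z where "z = (real n / 4) powr (1 / m)"
    define k where "k = nat \<lfloor>z\<rfloor>"
    have "real n / 4 \<ge> (real n0 + 1) powr m" using n by simp
    then have "((real n0 + 1) powr m) powr (1 / m) \<le> z" unfolding z_def using m by (intro powr_mono2) auto
    then have z: "real n0 + 1 \<le> z" using m by (simp add: powr_powr)
    have kz: "real k \<le> z" "z < real k + 1" unfolding k_def using z by linarith+
    have k: "k \<ge> n0" "k \<ge> 1" "real k \<ge> 1" using kz z n0 by linarith+
    have n1: "real n \<ge> 1"
    proof -
      have "1 powr m \<le> (real n0 + 1) powr m" using m by (intro powr_mono2) auto
      then show ?thesis using n by simp
    qed
    have "real k ^ (CARD('n) - 1) = real k powr m" unfolding mnat by (rule powr_realpow[symmetric]) (use k in simp)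
    also have "\<dots> \<le> z powr m" using kz m k by (intro powr_mono2) auto
    also have "\<dots> = real n / 4" unfolding z_def using m n1 by (simp add: powr_powr)
    finally have "real (4 * k ^ (CARD('n) - 1)) \<le> real n" by simp
    then have kn: "4 * k ^ (CARD('n) - 1) \<le> n" by (simp only: of_nat_le_iff)
    define e where "e = C * real k powr (- rho)"
    have e: "e > 0" unfolding e_def using C k by simp
    have "kolmogorov_width (surf :: (real^'n) measure) (rkhs_unit_sphere Sph K0) n \<le> ereal (sqrt (2 * e / (real n + 1)))"
      by (rule kolmogorov_width_of_tail[OF e _ kn]) (unfold e_def, rule tail[OF k(1)])
    also have "sqrt (2 * e / (real n + 1)) \<le> sqrt (W * real (n + 1) powr (- 1 - rho / m))"
    proof (rule real_sqrt_le_mono)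
      have "z / 2 \<le> real k" using kz k by linarith
      \<comment> \<open>Uses \<open>(n + 1) / 8 \<le> n / 4\<close>, which holds from
        \<open>n = 1\<close> on.\<close>
      moreover have "((real n + 1) / 8) powr (1 / m) \<le> z"
        unfolding z_def using n1 m by (intro powr_mono2) auto
      ultimately have low: "((real n + 1) / 8) powr (1 / m) / 2 \<le> real k" by linarith
      have "real k powr (- rho) \<le> (((real n + 1) / 8) powr (1 / m) / 2) powr (- rho)"
        by (rule powr_mono2'[OF _ _ low]) (use rho n1 in auto)
      also have "\<dots> = 2 powr rho * 8 powr (rho / m) * (real n + 1) powr (- rho / m)"
      proof -
        have "(((real n + 1) / 8) powr (1 / m) / 2) powr (- rho) = (((real n + 1) / 8) powr (1 / m)) powr (- rho) / 2 powr (- rho)"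
          by (rule powr_divide)
        also have "\<dots> = ((real n + 1) / 8) powr (- rho / m) * 2 powr rho"
          by (simp add: powr_powr powr_minus_divide)
        also have "((real n + 1) / 8) powr (- rho / m) = (real n + 1) powr (- rho / m) / 8 powr (- rho / m)"
          by (rule powr_divide)
        also have "\<dots> = (real n + 1) powr (- rho / m) * 8 powr (rho / m)"
          by (simp add: powr_minus_divide)
        finally show ?thesis by simp
      qed
      finally have "2 * e \<le> W * (real n + 1) powr (- rho / m)"
        unfolding e_def W_def using C by (simp add: mult_left_mono mult.assoc)
      then have "2 * e / (real n + 1) \<le> W * (real n + 1) powr (- rho / m) / (real n + 1)"
        by (rule divide_right_mono) simp
      also have "\<dots> = W * real (n + 1) powr (- 1 - rho / m)"
        by (simp add: powr_diff powr_minus divide_inverse add.commute)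
      finally show "2 * e / (real n + 1) \<le> W * real (n + 1) powr (- 1 - rho / m)" .
    qed
    also have "sqrt (W * real (n + 1) powr (- 1 - rho / m)) = sqrt W * real (n + 1) powr (- 1 / 2 - rho / (2 * m))"
    proof -
      have "(- 1 - rho / m) * (1 / 2) = - 1 / 2 - rho / (2 * m)" using m by (simp add: field_simps)
      moreover have "sqrt (real (n + 1) powr (- 1 - rho / m)) = (real (n + 1) powr (- 1 - rho / m)) powr (1 / 2)"
        by (rule powr_half_sqrt[symmetric]) simp
      ultimately show ?thesis by (simp only: real_sqrt_mult powr_powr)
    qed
    finally show ?thesis by simp
  qed
  have sphere_eq: "rkhs_unit_sphere Sph K = rkhs_unit_sphere Sph K0"
    by (rule rkhs_unit_sphere_cong) (simp only: K0eq)
  have "\<forall>\<^sub>F n in sequentially. real n \<ge> 4 * (real n0 + 1) powr m"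
    by (rule eventually_ge_at_top[of "nat \<lceil>4 * (real n0 + 1) powr m\<rceil>", THEN eventually_mono]) linarith
  then have "\<forall>\<^sub>F n in sequentially. kolmogorov_width (surf :: (real^'n) measure) (rkhs_unit_sphere Sph K) n
       \<le> ereal (sqrt W * real (n + 1) powr (- 1 / 2 - rho / (2 * (real CARD('n) - 1))))"
    unfolding sphere_eq m_def[symmetric] by (rule eventually_mono) (rule bound)
  then show ?thesis by blast
qed

end
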